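(* Let $K$ be a compact mixing axiom A attractor of the flow $f^t$ of a smooth vector field $F$ with $F\neq 0$ on $K$, with physical measure $\rho$, and assume the decay of correlations conditions (D1), (D2) given in the context. Let $X$ be the perturbation vector field and $\Phi$ a $C^\infty$ observable. Then the shadowing contribution $SC:=\langle\!\langle S(X);d\Phi,\Phi-\rho(\Phi)\rangle\!\rangle$ equals $$SC=\int_0^\infty\rho\big(X^{sc}(\Phi_t)\big)\,dt-\int_{-\infty}^0\rho\big(X^u(\Phi_t)\big)\,dt .$$ Hence the unstable contribution $UC$, defined by the leftover part of the linear response $-UC:=\delta\rho(\Phi)-SC$, satisfies $$-UC=\int_{-\infty}^\infty\rho\big(X^u(\Phi_t)\big)\,dt .$$
   Context: Setting. $\mathcal{M}$ is a smooth Riemannian manifold; $F$ and $X$ are smooth vector fields; the flow of $F+\gamma X$ depends on a parameter $\gamma$ with base value $0$, and $f^t$ denotes the flow of $F$. $K$ is a compact hyperbolic attractor with $F\neq0$ on $K$: there is a continuous $f_*$-invariant splitting $T_K\mathcal{M}=V^s\oplus V^u\oplus V^c$, $V^c=\mathrm{span}(F)$, and constants $C>0$, $0<\lambda<1$ with $|f_*^{-t}|_{V^u}|,|f_*^t|_{V^s}|\le C\lambda^t$ for $t\ge0$; and there is an open neighborhood $U$ of $K$ with $\bigcap_{t\ge0}f^tU=K$. "Mixing axiom A attractor" has its usual meaning. $\rho$ is the physical (SRB) measure on $K$: the invariant probability such that for every $C^\infty$ $\Phi$ and Lebesgue-a.e. $x\in U$, $\frac1T\int_0^T\Phi(f^tx)dt\to\rho(\Phi):=\int\Phi\,d\rho$.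 Notation. $P^s,P^u,P^c$ are the projections of the splitting; $X^u=P^uX$, $X^{sc}=P^sX+P^cX$, $X^{cu}=P^cX+P^uX$. $\Phi_t:=\Phi\circ f^t$, and $Y(\Phi_t)$ is the derivative of $\Phi_t$ in the direction $Y$. $\mathcal{L}$ is the Lie derivative, $\nabla$ the Riemannian derivative. $C^\alpha(K)$, $\mathcal{X}^\alpha(K)$ are the Hölder continuous functions and vector fields on $K$ (exponent not fixed). Shadowing. $A(K):=\{(v,\eta):v\in\mathcal{X}^\alpha(K),\nabla_Fv\in\mathcal{X}^\alpha(K),\eta\in C^\alpha(K)\}/\sim$, where $(v_1,\eta_1)\sim(v_2,\eta_2)$ iff $\mathcal{L}_Fv_1+\eta_1F=\mathcal{L}_Fv_2+\eta_2F$. The shadowing operator $S:\mathcal{X}^\alpha(K)\to A(K)$ is $S(X)=[v,\eta]$ where $\mathcal{L}_Fv+\eta F=X$. For a Hölder covector field $\omega$ and Hölder function $\psi$ on $K$ with $F(\psi)=\omega(F)$ Hölder, $\langle\!\langle[v,\eta];\omega,\psi\rangle\!\rangle:=\rho(\omega(v))-\rho(\eta\psi)$, which does not depend on the representative. Linear response. $\delta\rho(\Phi)$ denotes the derivative of $\rho(\Phi)$ with respect to $\gamma$ at $\gamma=0$, given by the linear response formula $\delta\rho(\Phi)=\lim_{T\to\infty}\rho\left(\int_0^TX(\Phi_t)\,dt\right)$. Decay of correlations. (D1) $\int_0^\infty\rho(\Phi_t\,\mathrm{div}^{cu}_\sigma X^{cu})\,dt<\infty$, where $\mathrm{div}^{cu}_\sigma$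 is the submanifold divergence along center-unstable manifolds with respect to the conditional SRB measure $\sigma$ on them; (D2) $\lim_{T\to\infty}\rho(\eta\,\Phi_T)=\rho(\eta)\rho(\Phi)$ for any Hölder continuous $\eta$. *)

theory Defs
  imports "HOL-Probability.Probability"
begin

section \<open>Smooth maps between open subsets of normed spaces\<close>

primrec Ck_on :: "nat \<Rightarrow> 'a::real_normed_vector set \<Rightarrow> ('a \<Rightarrow> 'b::real_normed_vector) \<Rightarrow> bool" where
  "Ck_on 0 S h \<longleftrightarrow> continuous_on S h"
| "Ck_on (Suc n) S h \<longleftrightarrow> (\<forall>x\<in>S. h differentiable (at x)) \<and>
     (\<forall>v. Ck_on n S (\<lambda>x. frechet_derivative h (at x) v))"

definition smooth_on :: "'a::real_normed_vector set \<Rightarrow> ('a \<Rightarrow> 'b::real_normed_vector) \<Rightarrow> bool" where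
  "smooth_on S h \<longleftrightarrow> (\<forall>n. Ck_on n S h)"


section \<open>Smooth manifolds\<close>

text \<open>The manifold is the whole type \<open>'m\<close>, with its topology; \<open>'e\<close> is the model space. A chart
  \<open>c\<close> consists of its domain \<open>fst c\<close> and the coordinate map \<open>snd c\<close>.\<close>

type_synonym ('m, 'e) chart = "'m set \<times> ('m \<Rightarrow> 'e)"

definition cdom :: "('m, 'e) chart \<Rightarrow> 'm set" where "cdom c = fst c"

definition cmap :: "('m, 'e) chart \<Rightarrow> 'm \<Rightarrow> 'e" where "cmap c = snd c"

definition crange :: "('m, 'e) chart \<Rightarrow> 'e set" where "crange c = cmap c ` cdom c"

definition cinv :: "('m, 'e) chart \<Rightarrow> 'e \<Rightarrow> 'm" where "cinv c = inv_into (cdom c) (cmap c)"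

definition is_chart :: "('m::topological_space, 'e::euclidean_space) chart \<Rightarrow> bool" where
  "is_chart c \<longleftrightarrow> open (cdom c) \<and> open (crange c) \<and>
     homeomorphism (cdom c) (crange c) (cmap c) (cinv c)"

definition compatible :: "('m::topological_space, 'e::euclidean_space) chart \<Rightarrow> ('m, 'e) chart \<Rightarrow> bool" where
  "compatible c d \<longleftrightarrow>
     smooth_on (cmap c ` (cdom c \<inter> cdom d)) (cmap d \<circ> cinv c) \<and>
     smooth_on (cmap d ` (cdom c \<inter> cdom d)) (cmap c \<circ> cinv d)"

definition smooth_atlas :: "('m::topological_space, 'e::euclidean_space) chart set \<Rightarrow> bool" where
  "smooth_atlas A \<longleftrightarrow> (\<forall>c\<in>A. is_chart c) \<and> (\<forall>c\<in>A. \<forall>d\<in>A. compatible c d) \<and> (\<Union>c\<in>A. cdom c) = UNIV"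

definition maximal_atlas :: "('m::topological_space, 'e::euclidean_space) chart set \<Rightarrow> ('m, 'e) chart set" where
  "maximal_atlas A = {c. is_chart c \<and> (\<forall>d\<in>A. compatible c d)}"

definition smooth_fun :: "('m::topological_space, 'e::euclidean_space) chart set \<Rightarrow> ('m \<Rightarrow> real) \<Rightarrow> bool" where
  "smooth_fun A \<phi> \<longleftrightarrow> (\<forall>c\<in>A. smooth_on (crange c) (\<phi> \<circ> cinv c))"


section \<open>Tangent vectors\<close>

text \<open>A tangent vector at \<open>p\<close> is the element of \<open>'e\<close> that represents it in the chart
  \<open>chart_at A p\<close>, chosen once and for all from the atlas. Since \<open>p \<mapsto> chart_at A p\<close> is in general
  discontinuous, regularity of fields must be tested after conversion to a fixed chart
  (\<open>to_chart\<close>, \<open>from_chart\<close>).\<close>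

definition chart_at :: "('m, 'e) chart set \<Rightarrow> 'm \<Rightarrow> ('m, 'e) chart" where
  "chart_at A p = (SOME c. c \<in> A \<and> p \<in> cdom c)"

definition to_chart :: "('m, 'e::euclidean_space) chart set \<Rightarrow> ('m, 'e) chart \<Rightarrow> 'm \<Rightarrow> 'e \<Rightarrow> 'e" where
  "to_chart A c p v =
     frechet_derivative (cmap c \<circ> cinv (chart_at A p)) (at (cmap (chart_at A p) p)) v"

definition from_chart :: "('m, 'e::euclidean_space) chart set \<Rightarrow> ('m, 'e) chart \<Rightarrow> 'm \<Rightarrow> 'e \<Rightarrow> 'e" where
  "from_chart A c p u =
     frechet_derivative (cmap (chart_at A p) \<circ> cinv c) (at (cmap c p)) u"

text \<open>\<open>dderiv A p v \<phi>\<close> is the derivative of \<open>\<phi>\<close> in the direction of the tangent vector \<open>v\<close> at \<open>p\<close>,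
  that is \<open>d\<phi>(v)\<close>; \<open>push A h p v\<close> is the pushforward of \<open>v\<close> under \<open>h\<close>, a tangent vector at \<open>h p\<close>.\<close>

definition dderiv :: "('m, 'e::euclidean_space) chart set \<Rightarrow> 'm \<Rightarrow> 'e \<Rightarrow> ('m \<Rightarrow> real) \<Rightarrow> real" where
  "dderiv A p v \<phi> = frechet_derivative (\<phi> \<circ> cinv (chart_at A p)) (at (cmap (chart_at A p) p)) v"

definition push :: "('m, 'e::euclidean_space) chart set \<Rightarrow> ('m \<Rightarrow> 'm) \<Rightarrow> 'm \<Rightarrow> 'e \<Rightarrow> 'e" where
  "push A h p v = frechet_derivative (cmap (chart_at A (h p)) \<circ> h \<circ> cinv (chart_at A p))
     (at (cmap (chart_at A p) p)) v"

definition smooth_vf :: "('m::topological_space, 'e::euclidean_space) chart set \<Rightarrow> ('m \<Rightarrow> 'e) \<Rightarrow> bool" where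
  "smooth_vf A Y \<longleftrightarrow>
     (\<forall>c\<in>A. smooth_on (crange c) (\<lambda>x. to_chart A c (cinv c x) (Y (cinv c x))))"


section \<open>Riemannian metrics\<close>

definition metric_coord ::
  "('m, 'e::euclidean_space) chart set \<Rightarrow> ('m \<Rightarrow> 'e \<Rightarrow> 'e \<Rightarrow> real) \<Rightarrow> ('m, 'e) chart \<Rightarrow> 'e \<Rightarrow> 'e \<Rightarrow> 'e \<Rightarrow> real" where
  "metric_coord A g c x u w =
     g (cinv c x) (from_chart A c (cinv c x) u) (from_chart A c (cinv c x) w)"

definition riemannian_metric ::
  "('m::topological_space, 'e::euclidean_space) chart set \<Rightarrow> ('m \<Rightarrow> 'e \<Rightarrow> 'e \<Rightarrow> real) \<Rightarrow> bool" where
  "riemannian_metric A g \<longleftrightarrow>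
     (\<forall>p. bilinear (g p) \<and> (\<forall>u w. g p u w = g p w u) \<and> (\<forall>u. u \<noteq> 0 \<longrightarrow> g p u u > 0)) \<and>
     (\<forall>c\<in>A. \<forall>u w. smooth_on (crange c) (\<lambda>x. metric_coord A g c x u w))"

definition rnorm :: "('m \<Rightarrow> 'e \<Rightarrow> 'e \<Rightarrow> real) \<Rightarrow> 'm \<Rightarrow> 'e \<Rightarrow> real" where
  "rnorm g p v = sqrt (g p v v)"

definition C1_path :: "('m::topological_space, 'e::euclidean_space) chart set \<Rightarrow> (real \<Rightarrow> 'm) \<Rightarrow> bool" where
  "C1_path A \<gamma> \<longleftrightarrow> continuous_on {0..1} \<gamma> \<and>
     (\<forall>c\<in>A. \<forall>a b. 0 \<le> a \<longrightarrow> b \<le> 1 \<longrightarrow> \<gamma> ` {a..b} \<subseteq> cdom c \<longrightarrow>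
        (cmap c \<circ> \<gamma>) piecewise_C1_differentiable_on {a..b})"

definition rlength ::
  "('m, 'e::euclidean_space) chart set \<Rightarrow> ('m \<Rightarrow> 'e \<Rightarrow> 'e \<Rightarrow> real) \<Rightarrow> (real \<Rightarrow> 'm) \<Rightarrow> ennreal" where
  "rlength A g \<gamma> = (\<integral>\<^sup>+t\<in>{0..1}. ennreal
     (rnorm g (\<gamma> t) (vector_derivative (cmap (chart_at A (\<gamma> t)) \<circ> \<gamma>) (at t within {0..1}))) \<partial>lborel)"

text \<open>Riemannian distance, infinite between different components.\<close>

definition rdist ::
  "('m::topological_space, 'e::euclidean_space) chart set \<Rightarrow> ('m \<Rightarrow> 'e \<Rightarrow> 'e \<Rightarrow> real) \<Rightarrow> 'm \<Rightarrow> 'm \<Rightarrow> ennreal" where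
  "rdist A g p q = (INF \<gamma>\<in>{\<gamma>. C1_path A \<gamma> \<and> \<gamma> 0 = p \<and> \<gamma> 1 = q}. rlength A g \<gamma>)"

text \<open>Sets of Lebesgue (equivalently, Riemannian volume) measure zero.\<close>

definition mnull :: "('m, 'e::euclidean_space) chart set \<Rightarrow> 'm set \<Rightarrow> bool" where
  "mnull A N \<longleftrightarrow> (\<forall>c\<in>A. negligible (cmap c ` (N \<inter> cdom c)))"

text \<open>Christoffel symbols of the Levi-Civita connection at \<open>p\<close> in the coordinates of
  \<open>chart_at A p\<close>, as the bilinear map determined by the Koszul formula.\<close>

definition christoffel ::
  "('m, 'e::euclidean_space) chart set \<Rightarrow> ('m \<Rightarrow> 'e \<Rightarrow> 'e \<Rightarrow> real) \<Rightarrow> 'm \<Rightarrow> 'e \<Rightarrow> 'e \<Rightarrow> 'e" where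
  "christoffel A g p u w =
     (let c = chart_at A p;
          D = (\<lambda>a b b'. frechet_derivative (\<lambda>x. metric_coord A g c x b b') (at (cmap c p)) a)
      in THE z. \<forall>y. g p z y = (D u w y + D w u y - D y u w) / 2)"


section \<open>Flows, Lie and covariant derivatives along a flow\<close>

text \<open>\<open>f\<close> is the (complete, smooth) flow of the vector field \<open>Y\<close>.\<close>

definition flow_of ::
  "('m::topological_space, 'e::euclidean_space) chart set \<Rightarrow> ('m \<Rightarrow> 'e) \<Rightarrow> (real \<Rightarrow> 'm \<Rightarrow> 'm) \<Rightarrow> bool" where
  "flow_of A Y f \<longleftrightarrow>
     continuous_on UNIV (\<lambda>(t, p). f t p) \<and>
     (\<forall>c\<in>A. \<forall>d\<in>A. smooth_on {(t, x). x \<in> crange c \<and> f t (cinv c x) \<in> cdom d}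
                        (\<lambda>(t, x). cmap d (f t (cinv c x)))) \<and>
     (\<forall>p. f 0 p = p) \<and>
     (\<forall>t p. ((\<lambda>s. cmap (chart_at A (f t p)) (f s p)) has_vector_derivative Y (f t p)) (at t))"

text \<open>The Lie derivative of \<open>v\<close> along the flow: the derivative at \<open>t = 0\<close> of the curve
  \<open>(f\<^sup>-\<^sup>t)\<^sub>* (v (f\<^sup>t p))\<close> in the tangent space at \<open>p\<close>.\<close>

definition lie_deriv ::
  "('m, 'e::euclidean_space) chart set \<Rightarrow> (real \<Rightarrow> 'm \<Rightarrow> 'm) \<Rightarrow> ('m \<Rightarrow> 'e) \<Rightarrow> 'm \<Rightarrow> 'e" where
  "lie_deriv A f v p = vector_derivative (\<lambda>t. push A (f (- t)) (f t p) (v (f t p))) (at 0)"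

text \<open>The Riemannian derivative of \<open>v\<close> along the flow \<open>f\<close> of \<open>F\<close>. It only involves the values of
  \<open>v\<close> on the orbit of \<open>p\<close>.\<close>

definition orbit_coord ::
  "('m, 'e::euclidean_space) chart set \<Rightarrow> (real \<Rightarrow> 'm \<Rightarrow> 'm) \<Rightarrow> ('m \<Rightarrow> 'e) \<Rightarrow> 'm \<Rightarrow> real \<Rightarrow> 'e" where
  "orbit_coord A f v p t = to_chart A (chart_at A p) (f t p) (v (f t p))"

definition cov_deriv ::
  "('m, 'e::euclidean_space) chart set \<Rightarrow> ('m \<Rightarrow> 'e \<Rightarrow> 'e \<Rightarrow> real) \<Rightarrow> ('m \<Rightarrow> 'e) \<Rightarrow> (real \<Rightarrow> 'm \<Rightarrow> 'm)
     \<Rightarrow> ('m \<Rightarrow> 'e) \<Rightarrow> 'm \<Rightarrow> 'e" where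
  "cov_deriv A g F f v p = vector_derivative (orbit_coord A f v p) (at 0) + christoffel A g p (F p) (v p)"


section \<open>Hoelder functions and vector fields on a compact set\<close>

text \<open>\<open>h c\<close> is the expression of the object in the chart \<open>c\<close>. On a compact set \<open>K\<close> the local
  condition in charts is equivalent to the global one with respect to the Riemannian distance.\<close>

definition hoelder_local ::
  "('m::topological_space, 'e::euclidean_space) chart set \<Rightarrow> 'm set
     \<Rightarrow> (('m, 'e) chart \<Rightarrow> 'm \<Rightarrow> 'b::real_normed_vector) \<Rightarrow> bool" where
  "hoelder_local A K h \<longleftrightarrow> (\<exists>\<alpha>. 0 < \<alpha> \<and> \<alpha> \<le> 1 \<and>
     (\<forall>c\<in>A. \<forall>p\<in>K \<inter> cdom c. \<exists>N C. open N \<and> p \<in> N \<and> N \<subseteq> cdom c \<and>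
        (\<forall>x\<in>N \<inter> K. \<forall>y\<in>N \<inter> K. norm (h c x - h c y) \<le> C * norm (cmap c x - cmap c y) powr \<alpha>)))"

definition hoelder_fun ::
  "('m::topological_space, 'e::euclidean_space) chart set \<Rightarrow> 'm set \<Rightarrow> ('m \<Rightarrow> real) \<Rightarrow> bool" where
  "hoelder_fun A K \<eta> \<longleftrightarrow> hoelder_local A K (\<lambda>c. \<eta>)"

definition hoelder_vf ::
  "('m::topological_space, 'e::euclidean_space) chart set \<Rightarrow> 'm set \<Rightarrow> ('m \<Rightarrow> 'e) \<Rightarrow> bool" where
  "hoelder_vf A K v \<longleftrightarrow> hoelder_local A K (\<lambda>c x. to_chart A c x (v x))"


section \<open>Hyperbolic splittings\<close>

definition direct_sum3 :: "'e::real_vector set \<Rightarrow> 'e set \<Rightarrow> 'e set \<Rightarrow> bool" where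
  "direct_sum3 V1 V2 V3 \<longleftrightarrow> subspace V1 \<and> subspace V2 \<and> subspace V3 \<and>
     (\<forall>w. \<exists>!(a, b, c). a \<in> V1 \<and> b \<in> V2 \<and> c \<in> V3 \<and> w = a + b + c)"

text \<open>Projection to \<open>V1\<close> along \<open>V2\<close> and \<open>V3\<close>.\<close>

definition proj3 :: "'e::real_vector set \<Rightarrow> 'e set \<Rightarrow> 'e set \<Rightarrow> 'e \<Rightarrow> 'e" where
  "proj3 V1 V2 V3 w = (THE a. a \<in> V1 \<and> (\<exists>b\<in>V2. \<exists>c\<in>V3. w = a + b + c))"

definition Ps :: "('m \<Rightarrow> 'e::real_vector) \<Rightarrow> ('m \<Rightarrow> 'e set) \<Rightarrow> ('m \<Rightarrow> 'e set) \<Rightarrow> 'm \<Rightarrow> 'e \<Rightarrow> 'e" where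
  "Ps F Vs Vu p = proj3 (Vs p) (Vu p) (span {F p})"

definition Pu :: "('m \<Rightarrow> 'e::real_vector) \<Rightarrow> ('m \<Rightarrow> 'e set) \<Rightarrow> ('m \<Rightarrow> 'e set) \<Rightarrow> 'm \<Rightarrow> 'e \<Rightarrow> 'e" where
  "Pu F Vs Vu p = proj3 (Vu p) (Vs p) (span {F p})"

definition Pc :: "('m \<Rightarrow> 'e::real_vector) \<Rightarrow> ('m \<Rightarrow> 'e set) \<Rightarrow> ('m \<Rightarrow> 'e set) \<Rightarrow> 'm \<Rightarrow> 'e \<Rightarrow> 'e" where
  "Pc F Vs Vu p = proj3 (span {F p}) (Vs p) (Vu p)"

definition continuous_endo ::
  "('m::topological_space, 'e::euclidean_space) chart set \<Rightarrow> 'm set \<Rightarrow> ('m \<Rightarrow> 'e \<Rightarrow> 'e) \<Rightarrow> bool" where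
  "continuous_endo A K P \<longleftrightarrow>
     (\<forall>c\<in>A. \<forall>u. continuous_on (K \<inter> cdom c) (\<lambda>x. to_chart A c x (P x (from_chart A c x u))))"

definition hyperbolic_splitting ::
  "('m::topological_space, 'e::euclidean_space) chart set \<Rightarrow> ('m \<Rightarrow> 'e \<Rightarrow> 'e \<Rightarrow> real) \<Rightarrow> ('m \<Rightarrow> 'e)
     \<Rightarrow> (real \<Rightarrow> 'm \<Rightarrow> 'm) \<Rightarrow> 'm set \<Rightarrow> ('m \<Rightarrow> 'e set) \<Rightarrow> ('m \<Rightarrow> 'e set) \<Rightarrow> bool" where
  "hyperbolic_splitting A g F f K Vs Vu \<longleftrightarrow>
     (\<forall>p\<in>K. F p \<noteq> 0) \<and>
     (\<forall>p\<in>K. direct_sum3 (Vs p) (Vu p) (span {F p})) \<and>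
     continuous_endo A K (Ps F Vs Vu) \<and>
     continuous_endo A K (Pu F Vs Vu) \<and>
     continuous_endo A K (Pc F Vs Vu) \<and>
     (\<forall>p\<in>K. \<forall>t. push A (f t) p ` Vs p = Vs (f t p) \<and> push A (f t) p ` Vu p = Vu (f t p)) \<and>
     (\<exists>C>0. \<exists>\<theta>. 0 < \<theta> \<and> \<theta> < 1 \<and> (\<forall>p\<in>K. \<forall>t\<ge>0.
        (\<forall>v\<in>Vs p. rnorm g (f t p) (push A (f t) p v) \<le> C * \<theta> powr t * rnorm g p v) \<and>
        (\<forall>v\<in>Vu p. rnorm g (f (- t) p) (push A (f (- t)) p v) \<le> C * \<theta> powr t * rnorm g p v)))"


section \<open>Attractors and physical measures\<close>

definition attractor :: "(real \<Rightarrow> 'm \<Rightarrow> 'm) \<Rightarrow> 'm::topological_space set \<Rightarrow> 'm set \<Rightarrow> bool" where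
  "attractor f K U \<longleftrightarrow> compact K \<and> (\<forall>t. f t ` K = K) \<and> open U \<and> K \<subseteq> U \<and> (\<Inter>t\<in>{0..}. f t ` U) = K"

definition topologically_mixing :: "(real \<Rightarrow> 'm \<Rightarrow> 'm) \<Rightarrow> 'm::topological_space set \<Rightarrow> bool" where
  "topologically_mixing f K \<longleftrightarrow>
     (\<forall>B B'. openin (top_of_set K) B \<longrightarrow> openin (top_of_set K) B' \<longrightarrow> B \<noteq> {} \<longrightarrow> B' \<noteq> {} \<longrightarrow>
        (\<exists>T. \<forall>t\<ge>T. f t ` B \<inter> B' \<noteq> {}))"

text \<open>The conditions of Bowen and Ruelle for a basic hyperbolic set that is an attractor, with
  transitivity strengthened to mixing.\<close>

definition mixing_axiom_A_attractor ::
  "('m::topological_space, 'e::euclidean_space) chart set \<Rightarrow> ('m \<Rightarrow> 'e \<Rightarrow> 'e \<Rightarrow> real) \<Rightarrow> ('m \<Rightarrow> 'e)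
     \<Rightarrow> (real \<Rightarrow> 'm \<Rightarrow> 'm) \<Rightarrow> 'm set \<Rightarrow> 'm set \<Rightarrow> ('m \<Rightarrow> 'e set) \<Rightarrow> ('m \<Rightarrow> 'e set) \<Rightarrow> bool" where
  "mixing_axiom_A_attractor A g F f K U Vs Vu \<longleftrightarrow>
     attractor f K U \<and> hyperbolic_splitting A g F f K Vs Vu \<and>
     K \<subseteq> closure {p \<in> K. \<exists>T>0. f T p = p} \<and> topologically_mixing f K"

text \<open>Integration with respect to a measure carried by \<open>K\<close>, for functions that are only
  meaningful on \<open>K\<close>.\<close>

definition avg :: "'m measure \<Rightarrow> 'm set \<Rightarrow> ('m \<Rightarrow> real) \<Rightarrow> real" where
  "avg \<rho> K h = (LINT p:K|\<rho>. h p)"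

definition physical_measure ::
  "('m::topological_space, 'e::euclidean_space) chart set \<Rightarrow> (real \<Rightarrow> 'm \<Rightarrow> 'm) \<Rightarrow> 'm set \<Rightarrow> 'm set
     \<Rightarrow> 'm measure \<Rightarrow> bool" where
  "physical_measure A f K U \<rho> \<longleftrightarrow>
     sets \<rho> = sets borel \<and> prob_space \<rho> \<and> emeasure \<rho> K = 1 \<and>
     (\<forall>t. distr \<rho> borel (f t) = \<rho>) \<and>
     (\<forall>\<phi>. smooth_fun A \<phi> \<longrightarrow> (\<exists>N. mnull A N \<and>
        (\<forall>x\<in>U - N. ((\<lambda>T. integral {0..T} (\<lambda>t. \<phi> (f t x)) / T) \<longlongrightarrow> avg \<rho> K \<phi>) at_top)))"

text \<open>\<open>D\<close> is the derivative at \<open>\<gamma> = 0\<close> of the mean of \<open>\<Phi>\<close> with respect to the physical measure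
  of the attractor of \<open>F + \<gamma>X\<close> that continues \<open>K\<close>.\<close>

definition response_derivative ::
  "('m::topological_space, 'e::euclidean_space) chart set \<Rightarrow> ('m \<Rightarrow> 'e) \<Rightarrow> ('m \<Rightarrow> 'e)
     \<Rightarrow> (real \<Rightarrow> 'm \<Rightarrow> 'm) \<Rightarrow> 'm set \<Rightarrow> 'm measure \<Rightarrow> ('m \<Rightarrow> real) \<Rightarrow> real \<Rightarrow> bool" where
  "response_derivative A F X f K \<rho> \<Phi> D \<longleftrightarrow>
     (\<exists>\<epsilon>>0. \<exists>fl Kf \<mu> U'.
        (\<forall>\<gamma>. \<bar>\<gamma>\<bar> < \<epsilon> \<longrightarrow> flow_of A (\<lambda>p. F p + \<gamma> *\<^sub>R X p) (fl \<gamma>) \<and> attractor (fl \<gamma>) (Kf \<gamma>) U' \<and>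
              physical_measure A (fl \<gamma>) (Kf \<gamma>) U' (\<mu> \<gamma>)) \<and>
        fl 0 = f \<and> Kf 0 = K \<and> \<mu> 0 = \<rho> \<and>
        ((\<lambda>\<gamma>. avg (\<mu> \<gamma>) (Kf \<gamma>) \<Phi>) has_real_derivative D) (at 0))"


section \<open>Divergence along center-unstable manifolds\<close>

definition Wcu ::
  "('m::topological_space, 'e::euclidean_space) chart set \<Rightarrow> ('m \<Rightarrow> 'e \<Rightarrow> 'e \<Rightarrow> real)
     \<Rightarrow> (real \<Rightarrow> 'm \<Rightarrow> 'm) \<Rightarrow> 'm \<Rightarrow> 'm set" where
  "Wcu A g f x = (\<Union>s. {y. ((\<lambda>t. rdist A g (f (- t) (f s x)) (f (- t) y)) \<longlongrightarrow> 0) at_top})"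

text \<open>A plaque is a subset of a center-unstable manifold that is an embedded submanifold of the
  same dimension; it is then open in the center-unstable manifold.\<close>

definition cu_plaque ::
  "('m::topological_space, 'e::euclidean_space) chart set \<Rightarrow> ('m \<Rightarrow> 'e \<Rightarrow> 'e \<Rightarrow> real) \<Rightarrow> ('m \<Rightarrow> 'e)
     \<Rightarrow> (real \<Rightarrow> 'm \<Rightarrow> 'm) \<Rightarrow> 'm set \<Rightarrow> ('m \<Rightarrow> 'e set) \<Rightarrow> 'm set \<Rightarrow> bool" where
  "cu_plaque A g F f K Vu P \<longleftrightarrow> (\<exists>x\<in>K. P \<subseteq> Wcu A g f x) \<and>
     (\<forall>p\<in>P. \<exists>c\<in>maximal_atlas A. \<exists>L. p \<in> cdom c \<and> subspace L \<and>
        dim L = dim (Vu p \<union> {F p}) \<and> cmap c ` (P \<inter> cdom c) = crange c \<inter> L)"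

text \<open>A Borel set \<open>R\<close> partitioned into plaques, namely the fibres of \<open>q\<close> in \<open>R\<close>; and a system
  \<open>\<sigma>\<close> of conditional measures of \<open>\<rho>\<close> on these plaques.\<close>

definition cu_partition ::
  "('m::topological_space, 'e::euclidean_space) chart set \<Rightarrow> ('m \<Rightarrow> 'e \<Rightarrow> 'e \<Rightarrow> real) \<Rightarrow> ('m \<Rightarrow> 'e)
     \<Rightarrow> (real \<Rightarrow> 'm \<Rightarrow> 'm) \<Rightarrow> 'm set \<Rightarrow> ('m \<Rightarrow> 'e set) \<Rightarrow> 'm set \<Rightarrow> ('m \<Rightarrow> real) \<Rightarrow> bool" where
  "cu_partition A g F f K Vu R q \<longleftrightarrow> R \<in> sets borel \<and> R \<subseteq> K \<and> q \<in> borel_measurable borel \<and>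
     (\<forall>x\<in>R. cu_plaque A g F f K Vu {y\<in>R. q y = q x})"

definition conditional_measures ::
  "'m::topological_space measure \<Rightarrow> 'm set \<Rightarrow> ('m \<Rightarrow> real) \<Rightarrow> (real \<Rightarrow> 'm measure) \<Rightarrow> bool" where
  "conditional_measures \<rho> R q \<sigma> \<longleftrightarrow>
     \<sigma> \<in> measurable borel (subprob_algebra borel) \<and>
     (AE x in \<rho>. x \<in> R \<longrightarrow> emeasure (\<sigma> (q x)) {y\<in>R. q y = q x} = 1) \<and>
     (\<forall>B\<in>sets borel. emeasure \<rho> (B \<inter> R) = (\<integral>\<^sup>+x\<in>R. emeasure (\<sigma> (q x)) B \<partial>\<rho>))"

text \<open>\<open>b\<close> is the divergence of \<open>Y\<close> along center-unstable manifolds with respect to the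
  conditional measures \<open>\<sigma>\<close> of \<open>\<rho>\<close>: on plaques, the distribution \<open>\<phi> \<mapsto> - \<integral>Y(\<phi>) d\<sigma>\<close> is \<open>b \<sigma>\<close>.
  The distributional form is needed because the projections, hence \<open>X\<^sup>c\<^sup>u\<close>, are in general
  not differentiable along the plaques. Where \<open>Y\<close> is differentiable and \<open>\<sigma>\<close> has a differentiable
  density this is the Riemannian divergence of \<open>Y\<close> in the plaque plus the derivative of the
  logarithm of the density along \<open>Y\<close>. The test functions are the smooth functions whose
  restriction to the plaque has compact support.\<close>

definition cu_divergence ::
  "('m::topological_space, 'e::euclidean_space) chart set \<Rightarrow> ('m \<Rightarrow> 'e \<Rightarrow> 'e \<Rightarrow> real) \<Rightarrow> ('m \<Rightarrow> 'e)
     \<Rightarrow> (real \<Rightarrow> 'm \<Rightarrow> 'm) \<Rightarrow> 'm set \<Rightarrow> ('m \<Rightarrow> 'e set) \<Rightarrow> 'm measure \<Rightarrow> ('m \<Rightarrow> 'e) \<Rightarrow> ('m \<Rightarrow> real) \<Rightarrow> bool" where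
  "cu_divergence A g F f K Vu \<rho> Y b \<longleftrightarrow>
     set_integrable \<rho> K b \<and>
     (\<forall>R q \<sigma>. cu_partition A g F f K Vu R q \<longrightarrow> conditional_measures \<rho> R q \<sigma> \<longrightarrow>
        (AE x in \<rho>. x \<in> R \<longrightarrow> (let P = {y\<in>R. q y = q x} in
           set_integrable (\<sigma> (q x)) P b \<and>
           (\<forall>\<phi>. smooth_fun A \<phi> \<longrightarrow> (\<exists>C. compact C \<and> C \<subseteq> P \<and> (\<forall>y\<in>P - C. \<phi> y = 0)) \<longrightarrow>
              (LINT y:P|\<sigma> (q x). dderiv A y (Y y) \<phi>) = - (LINT y:P|\<sigma> (q x). \<phi> y * b y)))))"


section \<open>The shadowing operator and its pairing\<close>

definition shadow_carrier ::
  "('m::topological_space, 'e::euclidean_space) chart set \<Rightarrow> ('m \<Rightarrow> 'e \<Rightarrow> 'e \<Rightarrow> real) \<Rightarrow> ('m \<Rightarrow> 'e)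
     \<Rightarrow> (real \<Rightarrow> 'm \<Rightarrow> 'm) \<Rightarrow> 'm set \<Rightarrow> (('m \<Rightarrow> 'e) \<times> ('m \<Rightarrow> real)) set" where
  "shadow_carrier A g F f K = {(v, \<eta>). hoelder_vf A K v \<and>
     (\<forall>p\<in>K. orbit_coord A f v p differentiable (at 0)) \<and> hoelder_vf A K (cov_deriv A g F f v) \<and>
     hoelder_fun A K \<eta>}"

definition shadow_rel ::
  "('m::topological_space, 'e::euclidean_space) chart set \<Rightarrow> ('m \<Rightarrow> 'e \<Rightarrow> 'e \<Rightarrow> real) \<Rightarrow> ('m \<Rightarrow> 'e)
     \<Rightarrow> (real \<Rightarrow> 'm \<Rightarrow> 'm) \<Rightarrow> 'm set \<Rightarrow> (('m \<Rightarrow> 'e) \<times> ('m \<Rightarrow> real)) rel" where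
  "shadow_rel A g F f K = {((v1, \<eta>1), (v2, \<eta>2)).
     (v1, \<eta>1) \<in> shadow_carrier A g F f K \<and> (v2, \<eta>2) \<in> shadow_carrier A g F f K \<and>
     (\<forall>p\<in>K. lie_deriv A f v1 p + \<eta>1 p *\<^sub>R F p = lie_deriv A f v2 p + \<eta>2 p *\<^sub>R F p)}"

definition shadow_space ::
  "('m::topological_space, 'e::euclidean_space) chart set \<Rightarrow> ('m \<Rightarrow> 'e \<Rightarrow> 'e \<Rightarrow> real) \<Rightarrow> ('m \<Rightarrow> 'e)
     \<Rightarrow> (real \<Rightarrow> 'm \<Rightarrow> 'm) \<Rightarrow> 'm set \<Rightarrow> (('m \<Rightarrow> 'e) \<times> ('m \<Rightarrow> real)) set set" where
  "shadow_space A g F f K = shadow_carrier A g F f K // shadow_rel A g F f K"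

definition shadowing_op ::
  "('m::topological_space, 'e::euclidean_space) chart set \<Rightarrow> ('m \<Rightarrow> 'e \<Rightarrow> 'e \<Rightarrow> real) \<Rightarrow> ('m \<Rightarrow> 'e)
     \<Rightarrow> (real \<Rightarrow> 'm \<Rightarrow> 'm) \<Rightarrow> 'm set \<Rightarrow> ('m \<Rightarrow> 'e) \<Rightarrow> (('m \<Rightarrow> 'e) \<times> ('m \<Rightarrow> real)) set" where
  "shadowing_op A g F f K X = (THE s. s \<in> shadow_space A g F f K \<and>
     (\<forall>(v, \<eta>)\<in>s. \<forall>p\<in>K. lie_deriv A f v p + \<eta> p *\<^sub>R F p = X p))"

text \<open>The common value of \<open>\<rho>(\<omega>(v)) - \<rho>(\<eta>\<psi>)\<close> over all representatives \<open>(v, \<eta>)\<close> of the class \<open>s\<close>.\<close>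

definition pairing ::
  "'m measure \<Rightarrow> 'm set \<Rightarrow> (('m \<Rightarrow> 'e) \<times> ('m \<Rightarrow> real)) set \<Rightarrow> ('m \<Rightarrow> 'e \<Rightarrow> real) \<Rightarrow> ('m \<Rightarrow> real) \<Rightarrow> real" where
  "pairing \<rho> K s \<omega> \<psi> =
     (THE r. \<forall>(v, \<eta>)\<in>s. r = avg \<rho> K (\<lambda>p. \<omega> p (v p)) - avg \<rho> K (\<lambda>p. \<eta> p * \<psi> p))"


section \<open>Improper integrals over half-lines and the line\<close>

definition has_integral_0_inf :: "(real \<Rightarrow> real) \<Rightarrow> real \<Rightarrow> bool" where
  "has_integral_0_inf h I \<longleftrightarrow> (\<forall>T\<ge>0. h integrable_on {0..T}) \<and>
     ((\<lambda>T. integral {0..T} h) \<longlongrightarrow> I) at_top"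

definition has_integral_minf_0 :: "(real \<Rightarrow> real) \<Rightarrow> real \<Rightarrow> bool" where
  "has_integral_minf_0 h I \<longleftrightarrow> (\<forall>T\<ge>0. h integrable_on {-T..0}) \<and>
     ((\<lambda>T. integral {-T..0} h) \<longlongrightarrow> I) at_top"

definition has_integral_line :: "(real \<Rightarrow> real) \<Rightarrow> real \<Rightarrow> bool" where
  "has_integral_line h I \<longleftrightarrow>
     (\<exists>I1 I2. has_integral_minf_0 h I1 \<and> has_integral_0_inf h I2 \<and> I = I1 + I2)"

end

theory Submission
  imports Defs
begin

text \<open>The class \<open>S(X)\<close> is represented by \<open>v = v\<^sup>s - v\<^sup>u\<close> and \<open>\<eta>\<close>, where
  \<open>v\<^sup>s = \<integral>\<^sub>0\<^sup>\<infinity> f\<^sup>t\<^sub>* X\<^sup>s dt\<close>, \<open>v\<^sup>u = \<integral>\<^sub>0\<^sup>\<infinity> f\<^sup>-\<^sup>t\<^sub>* X\<^sup>u dt\<close> and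
  \<open>\<eta> F = X\<^sup>c\<close>. The integrals converge by hyperbolicity. Their Hoelder continuity, like that of the
  splitting, comes from splitting the integral at a time proportional to the logarithm of the
  distance: the tail is exponentially small and the initial part is Lipschitz with an exponentially
  large constant. Differentiating along orbits gives \<open>L\<^sub>F v = X\<^sup>s + X\<^sup>u\<close>. By Fubini and the
  invariance of \<open>\<rho>\<close>, the pairing of \<open>d\<Phi>\<close> with \<open>v\<^sup>s\<close> and \<open>v\<^sup>u\<close> gives the half-line integrals of
  \<open>\<rho>(X\<^sup>s(\<Phi>\<^sub>t))\<close> and \<open>\<rho>(X\<^sup>u(\<Phi>\<^sub>t))\<close>. Since \<open>X\<^sup>c(\<Phi>\<^sub>t) = \<eta> d\<Phi>\<^sub>t/dt\<close>, the center
  part integrates to \<open>\<rho>(\<eta> \<Phi>\<^sub>T) - \<rho>(\<eta> \<Phi>)\<close>, which tends to \<open>- \<rho>(\<eta> (\<Phi> - \<rho>(\<Phi>)))\<close> by mixing.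
  The unstable contribution is what remains of the linear response formula.\<close>

section \<open>Derivatives of smooth maps\<close>

text \<open>Tangent vectors at different points are recorded in charts chosen without any
  continuity, so neither Hoelder estimates nor comparisons between fibres can be carried out in the
  tangent spaces as given. Everything is therefore moved into one Banach space: the maps
  \<open>J p\<close> embed the tangent spaces over \<open>K\<close>, and the linearised flow becomes
  a family \<open>B t p\<close> of bounded operators. There the argument concerns an abstract
  operator cocycle and needs a distance only up to local equivalence, so \<open>dd\<close>, built
  from charts and capped at 1, replaces the Riemannian distance. Three obligations hide in the
  definition of the shadowing class. The projections are assumed continuous only, so even the
  regularity of the center coefficient is a statement about the dynamics. Membership in the carrier
  asks for a Hoelder \<open>nabla_F v\<close>; since the connection has no torsion, this is the Lie
  derivative plus \<open>nabla_v F\<close>, an operator applied pointwise to \<open>v\<close>. And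
  the pairing is a definite description over all representatives, of which only continuity,
  differentiability along orbits and the equation are used.\<close>

lemma smooth_onD:
  assumes "smooth_on S h"
  shows smooth_on_continuous: "continuous_on S h"
    and smooth_on_differentiable: "x \<in> S \<Longrightarrow> h differentiable (at x)"
    and smooth_on_partial: "smooth_on S (\<lambda>x. frechet_derivative h (at x) v)"
proof -
  have "Ck_on 0 S h" "Ck_on (Suc 0) S h" using assms unfolding smooth_on_def by blast+
  then show "continuous_on S h" "x \<in> S \<Longrightarrow> h differentiable (at x)" by auto
  have "Ck_on (Suc n) S h" for n using assms unfolding smooth_on_def by blast
  then show "smooth_on S (\<lambda>x. frechet_derivative h (at x) v)"
    unfolding smooth_on_def by simp
qed

lemma smooth_on_has_derivative:
  "smooth_on S h \<Longrightarrow> x \<in> S \<Longrightarrow> (h has_derivative frechet_derivative h (at x)) (at x)"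
  using smooth_on_differentiable frechet_derivative_works by blast

lemma smooth_on_continuous_at:
  "smooth_on S h \<Longrightarrow> open S \<Longrightarrow> x \<in> S \<Longrightarrow> isCont h x"
  using smooth_on_continuous continuous_on_eq_continuous_at by blast

lemma linear_euclidean_sum:
  fixes f :: "'a::euclidean_space \<Rightarrow> 'b::real_vector"
  assumes "linear f"
  shows "f u = (\<Sum>b\<in>Basis. (u \<bullet> b) *\<^sub>R f b)"
proof -
  have "f u = f (\<Sum>b\<in>Basis. (u \<bullet> b) *\<^sub>R b)" by (simp add: euclidean_representation)
  then show ?thesis by (simp add: linear_sum[OF assms] linear_scale[OF assms])
qed

lemma norm_linear_le_Basis:
  fixes f :: "'a::euclidean_space \<Rightarrow> 'b::real_normed_vector"
  assumes "linear f"
  shows "norm (f u) \<le> (\<Sum>b\<in>Basis. norm (f b)) * norm u"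
proof -
  have "norm (f u) \<le> (\<Sum>b\<in>Basis. norm ((u \<bullet> b) *\<^sub>R f b))"
    by (subst linear_euclidean_sum[OF assms]) (rule norm_sum)
  also have "\<dots> \<le> (\<Sum>b\<in>Basis. norm u * norm (f b))"
    by (intro sum_mono) (simp add: Basis_le_norm mult_right_mono)
  finally show ?thesis by (simp add: sum_distrib_left mult.commute)
qed

text \<open>The operator norm of the derivative is at most the sum \<open>N\<close> of the norms of
  its values on \<open>Basis\<close>. Each of these is continuous by smoothness, so \<open>N\<close>
  stays below \<open>N z + 1\<close> near \<open>z\<close>, and the mean value inequality applies on
  the convex ball.\<close>

lemma smooth_on_locally_lipschitz:
  fixes h :: "'a::euclidean_space \<Rightarrow> 'b::real_normed_vector"
  assumes h: "smooth_on S h" and S: "open S" and z: "z \<in> S"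
  shows "\<exists>r>0. \<exists>C\<ge>0. ball z r \<subseteq> S \<and> (\<forall>x\<in>ball z r. \<forall>y\<in>ball z r. norm (h x - h y) \<le> C * norm (x - y))"
proof -
  define N where "N = (\<lambda>x. \<Sum>b\<in>Basis. norm (frechet_derivative h (at x) b))"
  have "continuous_on S N"
    unfolding N_def by (intro continuous_intros smooth_on_continuous[OF smooth_on_partial[OF h]])
  then have "isCont N z" using S z continuous_on_eq_continuous_at by blast
  then have "eventually (\<lambda>x. N x < N z + 1) (at z)"
    by (intro order_tendstoD(2)[OF isContD]) auto
  then obtain r1 where r1: "r1 > 0" "\<And>x. dist x z < r1 \<Longrightarrow> N x \<le> N z + 1"
    by (metis (no_types, lifting) eventually_at less_imp_le less_add_one UNIV_I)
  obtain r2 where r2: "r2 > 0" "ball z r2 \<subseteq> S" using S z openE by blast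
  define r where "r = min r1 r2"
  have "norm (h x - h y) \<le> (N z + 1) * norm (x - y)" if "x \<in> ball z r" "y \<in> ball z r" for x y
  proof (rule differentiable_bound[where S="ball z r" and f'="\<lambda>x. frechet_derivative h (at x)"])
    fix w assume w: "w \<in> ball z r"
    then have wS: "w \<in> S" using r2 by (auto simp: r_def)
    show "(h has_derivative frechet_derivative h (at w)) (at w within ball z r)"
      using smooth_on_has_derivative[OF h wS] has_derivative_at_withinI by blast
    have lin: "linear (frechet_derivative h (at w))"
      using smooth_on_differentiable[OF h wS] linear_frechet_derivative by blast
    have "N w \<le> N z + 1" using r1(2)[of w] w by (cases "w = z") (auto simp: r_def dist_commute)
    then show "onorm (frechet_derivative h (at w)) \<le> N z + 1"
      by (intro onorm_le order_trans[OF norm_linear_le_Basis[OF lin]] mult_right_mono) (auto simp: N_def)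
  qed (use that in auto)
  moreover have "N z + 1 \<ge> 0" by (simp add: N_def add_nonneg_nonneg sum_nonneg)
  moreover have "r > 0" "ball z r \<subseteq> S" using r1 r2 by (auto simp: r_def)
  ultimately show ?thesis by blast
qed

lemma has_derivative_along_line:
  fixes k :: "'a::real_normed_vector \<Rightarrow> 'b::real_normed_vector"
  assumes "k differentiable (at (y + s *\<^sub>R u))"
  shows "((\<lambda>s. k (y + s *\<^sub>R u)) has_vector_derivative frechet_derivative k (at (y + s *\<^sub>R u)) u) (at s within T)"
proof -
  have k: "(k has_derivative frechet_derivative k (at (y + s *\<^sub>R u))) (at (y + s *\<^sub>R u))"
    using assms frechet_derivative_works by blast
  have "((\<lambda>s. k (y + s *\<^sub>R u)) has_derivative (\<lambda>t. frechet_derivative k (at (y + s *\<^sub>R u)) (t *\<^sub>R u))) (at s within T)"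
    by (rule has_derivative_compose[where f="\<lambda>s. y + s *\<^sub>R u", OF _ k]) (auto intro!: derivative_eq_intros)
  then show ?thesis
    unfolding has_vector_derivative_def
    using linear_frechet_derivative[OF assms] by (simp add: linear_scale)
qed

text \<open>The second difference of \<open>k\<close> over a small parallelogram equals \<open>\<epsilon>\<^sup>2\<close> times the iterated
  derivative at some point of it, by two applications of the mean value theorem.\<close>

lemma second_difference_mvt:
  fixes k :: "'a::real_normed_vector \<Rightarrow> real"
  assumes k: "smooth_on S k" and \<epsilon>: "\<epsilon> > 0"
    and sub: "\<And>s t. \<lbrakk>0 \<le> s; s \<le> \<epsilon>; 0 \<le> t; t \<le> \<epsilon>\<rbrakk> \<Longrightarrow> x + s *\<^sub>R u + t *\<^sub>R v \<in> S"
  shows "\<exists>s t. 0 \<le> s \<and> s \<le> \<epsilon> \<and> 0 \<le> t \<and> t \<le> \<epsilon> \<and>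
     k (x + \<epsilon> *\<^sub>R u + \<epsilon> *\<^sub>R v) - k (x + \<epsilon> *\<^sub>R u) - k (x + \<epsilon> *\<^sub>R v) + k x =
     \<epsilon>\<^sup>2 * frechet_derivative (\<lambda>y. frechet_derivative k (at y) u) (at (x + s *\<^sub>R u + t *\<^sub>R v)) v"
proof -
  let ?D = "\<lambda>y. frechet_derivative k (at y) u"
  let ?p = "\<lambda>s. k ((x + \<epsilon> *\<^sub>R v) + s *\<^sub>R u) - k (x + s *\<^sub>R u)"
  have *: "x + \<epsilon> *\<^sub>R v + s *\<^sub>R u = x + s *\<^sub>R u + \<epsilon> *\<^sub>R v" for s by simp
  have "((\<lambda>s. k ((x + \<epsilon> *\<^sub>R v) + s *\<^sub>R u)) has_vector_derivative ?D (x + s *\<^sub>R u + \<epsilon> *\<^sub>R v)) (at s)"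
    "((\<lambda>s. k (x + s *\<^sub>R u)) has_vector_derivative ?D (x + s *\<^sub>R u)) (at s)"
    if "0 \<le> s" "s \<le> \<epsilon>" for s
    using has_derivative_along_line[of k "x + \<epsilon> *\<^sub>R v" s u UNIV] has_derivative_along_line[of k x s u UNIV]
      smooth_on_differentiable[OF k] sub[OF that, of \<epsilon>] sub[OF that, of 0] \<epsilon> by (simp_all add: *)
  then have "(?p has_real_derivative (?D (x + s *\<^sub>R u + \<epsilon> *\<^sub>R v) - ?D (x + s *\<^sub>R u))) (at s)"
    if "0 \<le> s" "s \<le> \<epsilon>" for s
    using that by (intro DERIV_diff) (simp_all add: has_real_derivative_iff_has_vector_derivative)
  from MVT2[OF \<epsilon>, of ?p, OF this] obtain s where s: "0 < s" "s < \<epsilon>"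
    "?p \<epsilon> - ?p 0 = \<epsilon> * (?D (x + s *\<^sub>R u + \<epsilon> *\<^sub>R v) - ?D (x + s *\<^sub>R u))" by auto
  have "((\<lambda>t. ?D ((x + s *\<^sub>R u) + t *\<^sub>R v)) has_real_derivative
      frechet_derivative ?D (at (x + s *\<^sub>R u + t *\<^sub>R v)) v) (at t)" if "0 \<le> t" "t \<le> \<epsilon>" for t
    using has_derivative_along_line[of ?D "x + s *\<^sub>R u" t v UNIV]
      smooth_on_differentiable[OF smooth_on_partial[OF k]] sub[of s t] that s
    by (simp add: has_real_derivative_iff_has_vector_derivative)
  from MVT2[OF \<epsilon>, of "\<lambda>t. ?D ((x + s *\<^sub>R u) + t *\<^sub>R v)", OF this]
  obtain t where t: "0 < t" "t < \<epsilon>" "?D (x + s *\<^sub>R u + \<epsilon> *\<^sub>R v) - ?D (x + s *\<^sub>R u) =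
     \<epsilon> * frechet_derivative ?D (at (x + s *\<^sub>R u + t *\<^sub>R v)) v" by auto
  have "k (x + \<epsilon> *\<^sub>R u + \<epsilon> *\<^sub>R v) - k (x + \<epsilon> *\<^sub>R u) - k (x + \<epsilon> *\<^sub>R v) + k x = ?p \<epsilon> - ?p 0"
    by (simp add: algebra_simps)
  also have "\<dots> = \<epsilon>\<^sup>2 * frechet_derivative ?D (at (x + s *\<^sub>R u + t *\<^sub>R v)) v"
    using s(3) t(3) by (simp add: power2_eq_square)
  finally show ?thesis using s t by (intro exI[of _ s] exI[of _ t]) auto
qed

text \<open>The second difference over a parallelogram is unchanged when \<open>u\<close> and
  \<open>v\<close> are exchanged, so the two iterated derivatives agree at two points arbitrarily
  close to \<open>x\<close>; their continuity finishes the proof. The symmetry serves twice later: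
  to exchange time and space derivatives of the flow, and in the transformation law of the
  Christoffel symbols.\<close>

lemma second_derivative_symmetric_real:
  fixes k :: "'a::real_normed_vector \<Rightarrow> real"
  assumes k: "smooth_on S k" and S: "open S" and x: "x \<in> S"
  shows "frechet_derivative (\<lambda>y. frechet_derivative k (at y) u) (at x) v =
         frechet_derivative (\<lambda>y. frechet_derivative k (at y) v) (at x) u"
proof -
  let ?D = "\<lambda>u v y. frechet_derivative (\<lambda>y. frechet_derivative k (at y) u) (at y) v"
  have cont: "isCont (?D u v) x" for u v
    by (rule smooth_on_continuous_at[OF smooth_on_partial[OF smooth_on_partial[OF k]] S x])
  have "\<bar>?D u v x - ?D v u x\<bar> \<le> e" if "e > 0" for e
  proof -
    have "\<forall>\<^sub>F y in nhds x. \<bar>?D u v y - ?D u v x\<bar> < e/2" for u v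
    proof -
      have "((\<lambda>y. ?D u v y) \<longlongrightarrow> ?D u v x) (nhds x)"
        using cont[of u v] tendsto_at_iff_tendsto_nhds[of "?D u v" x] unfolding isCont_def by simp
      from tendstoD[OF this, of "e/2"] show ?thesis using that by (simp add: dist_real_def)
    qed
    then have "\<forall>\<^sub>F y in nhds x. \<bar>?D u v y - ?D u v x\<bar> < e/2 \<and> \<bar>?D v u y - ?D v u x\<bar> < e/2 \<and> y \<in> S"
      using S x by (intro eventually_conj eventually_nhds_in_open)
    then obtain r where r: "r > 0" "\<And>y. dist y x < r \<Longrightarrow>
       \<bar>?D u v y - ?D u v x\<bar> < e/2 \<and> \<bar>?D v u y - ?D v u x\<bar> < e/2 \<and> y \<in> S"
      unfolding eventually_nhds_metric by blast
    \<comment> \<open>The two sides of the parallelogram together have length at most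
      \<open>r / 2\<close>, which keeps it inside the ball where the derivatives are controlled; the
      summand 1 covers the case \<open>u = v = 0\<close>.\<close>
    define \<epsilon> where "\<epsilon> = r / (2 * (norm u + norm v + 1))"
    have \<epsilon>: "\<epsilon> > 0" using r(1) by (auto simp: \<epsilon>_def intro!: divide_pos_pos add_nonneg_pos)
    have pos: "norm u + norm v + 1 > 0" by (simp add: add_nonneg_pos)
    have near: "dist (x + s *\<^sub>R u + t *\<^sub>R v) x < r" if "0 \<le> s" "s \<le> \<epsilon>" "0 \<le> t" "t \<le> \<epsilon>" for s t
    proof -
      have "dist (x + s *\<^sub>R u + t *\<^sub>R v) x \<le> s * norm u + t * norm v"
        using norm_triangle_ineq[of "s *\<^sub>R u" "t *\<^sub>R v"] that by (simp add: dist_norm add.assoc)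
      also have "\<dots> \<le> \<epsilon> * norm u + \<epsilon> * norm v"
        using that by (intro add_mono mult_right_mono) auto
      also have "\<dots> \<le> \<epsilon> * (norm u + norm v + 1)" using \<epsilon> by (simp add: algebra_simps)
      also have "\<dots> = r / 2" using pos by (simp add: \<epsilon>_def field_simps)
      finally show ?thesis using r(1) by simp
    qed
    obtain s t where 1: "0 \<le> s" "s \<le> \<epsilon>" "0 \<le> t" "t \<le> \<epsilon>"
     "k (x + \<epsilon> *\<^sub>R u + \<epsilon> *\<^sub>R v) - k (x + \<epsilon> *\<^sub>R u) - k (x + \<epsilon> *\<^sub>R v) + k x = \<epsilon>\<^sup>2 * ?D u v (x + s *\<^sub>R u + t *\<^sub>R v)"
      using second_difference_mvt[OF k \<epsilon>, of x u v] near r(2) by blast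
    have near': "dist (x + s *\<^sub>R v + t *\<^sub>R u) x < r" if "0 \<le> s" "s \<le> \<epsilon>" "0 \<le> t" "t \<le> \<epsilon>" for s t
      using near[OF that(3,4,1,2)] by (simp add: add_ac)
    obtain s' t' where 2: "0 \<le> s'" "s' \<le> \<epsilon>" "0 \<le> t'" "t' \<le> \<epsilon>"
     "k (x + \<epsilon> *\<^sub>R v + \<epsilon> *\<^sub>R u) - k (x + \<epsilon> *\<^sub>R v) - k (x + \<epsilon> *\<^sub>R u) + k x = \<epsilon>\<^sup>2 * ?D v u (x + s' *\<^sub>R v + t' *\<^sub>R u)"
      using second_difference_mvt[OF k \<epsilon>, of x v u] near' r(2) by blast
    have "x + \<epsilon> *\<^sub>R v + \<epsilon> *\<^sub>R u = x + \<epsilon> *\<^sub>R u + \<epsilon> *\<^sub>R v" by simp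
    with 1(5) 2(5)[unfolded this] have "\<epsilon>\<^sup>2 * ?D u v (x + s *\<^sub>R u + t *\<^sub>R v) = \<epsilon>\<^sup>2 * ?D v u (x + s' *\<^sub>R v + t' *\<^sub>R u)" by linarith
    then have eq: "?D u v (x + s *\<^sub>R u + t *\<^sub>R v) = ?D v u (x + s' *\<^sub>R v + t' *\<^sub>R u)" using \<epsilon> by simp
    show ?thesis
      using r(2)[OF near[OF 1(1-4)]] r(2)[OF near'[OF 2(1-4)]] eq unfolding abs_le_iff abs_less_iff by linarith
  qed
  then show ?thesis using field_le_epsilon[of "\<bar>?D u v x - ?D v u x\<bar>" 0] by force
qed

lemma frechet_derivative_at_eqI:
  "(h has_derivative h') (at x) \<Longrightarrow> frechet_derivative h (at x) = h'"
  using frechet_derivative_at by metis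

lemma frechet_derivative_cong_open:
  assumes "open S" "x \<in> S" "\<And>y. y \<in> S \<Longrightarrow> h y = k y"
  shows "frechet_derivative h (at x) = frechet_derivative k (at x)"
proof -
  have "(h has_derivative D) (at x) \<longleftrightarrow> (k has_derivative D) (at x)" for D
    using has_derivative_transform_within_open[of h D x UNIV S k]
      has_derivative_transform_within_open[of k D x UNIV S h] assms by auto
  then show ?thesis unfolding frechet_derivative_def by simp
qed

text \<open>Derivatives only see the germ of a map, which is why equality on the open set
  \<open>S\<close> passes through all orders.\<close>

lemma Ck_on_cong:
  "open S \<Longrightarrow> (\<And>x. x \<in> S \<Longrightarrow> h x = k x) \<Longrightarrow> Ck_on n S h \<Longrightarrow> Ck_on n S k"
proof (induction n arbitrary: h k)
  case 0
  then show ?case using continuous_on_cong by (metis Ck_on.simps(1))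
next
  case (Suc n)
  have "k differentiable (at x)" if "x \<in> S" for x
  proof -
    have "h differentiable (at x)" using Suc.prems(3) that by simp
    then obtain D where "(h has_derivative D) (at x)" unfolding differentiable_def by blast
    from has_derivative_transform_within_open[OF this Suc.prems(1) that] Suc.prems(2)
    show ?thesis unfolding differentiable_def by blast
  qed
  moreover have "Ck_on n S (\<lambda>x. frechet_derivative k (at x) v)" for v
  proof (rule Suc.IH[OF Suc.prems(1), of "\<lambda>x. frechet_derivative h (at x) v"])
    show "frechet_derivative h (at x) v = frechet_derivative k (at x) v" if "x \<in> S" for x
      using frechet_derivative_cong_open[OF Suc.prems(1) that Suc.prems(2)] by simp
  qed (use Suc.prems(3) in simp)
  ultimately show ?case by simp
qed

lemma Ck_on_inner_left:
  fixes h :: "'a::real_normed_vector \<Rightarrow> 'b::euclidean_space"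
  shows "open S \<Longrightarrow> Ck_on n S h \<Longrightarrow> Ck_on n S (\<lambda>x. h x \<bullet> b)"
proof (induction n arbitrary: h)
  case 0
  then show ?case by (auto intro: continuous_intros)
next
  case (Suc n)
  have d: "((\<lambda>x. h x \<bullet> b) has_derivative (\<lambda>v. frechet_derivative h (at x) v \<bullet> b)) (at x)" if "x \<in> S" for x
    using Suc.prems that by (intro has_derivative_inner_left) (simp add: frechet_derivative_works)
  have "Ck_on n S (\<lambda>x. frechet_derivative (\<lambda>x. h x \<bullet> b) (at x) v)" for v
    by (rule Ck_on_cong[OF Suc.prems(1), of "\<lambda>x. frechet_derivative h (at x) v \<bullet> b"])
       (use Suc frechet_derivative_at_eqI[OF d] in auto)
  moreover have "(\<lambda>x. h x \<bullet> b) differentiable at x" if "x \<in> S" for x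
    using d[OF that] unfolding differentiable_def by blast
  ultimately show ?case by simp
qed

lemma smooth_on_inner_left:
  fixes h :: "'a::real_normed_vector \<Rightarrow> 'b::euclidean_space"
  shows "open S \<Longrightarrow> smooth_on S h \<Longrightarrow> smooth_on S (\<lambda>x. h x \<bullet> b)"
  unfolding smooth_on_def using Ck_on_inner_left by metis

text \<open>One coordinate at a time: taking the inner product with a fixed \<open>b\<close>
  commutes with differentiation and reduces the claim to real functions.\<close>

lemma second_derivative_symmetric:
  fixes k :: "'a::real_normed_vector \<Rightarrow> 'b::euclidean_space"
  assumes k: "smooth_on S k" and S: "open S" and x: "x \<in> S"
  shows "frechet_derivative (\<lambda>y. frechet_derivative k (at y) u) (at x) v =
         frechet_derivative (\<lambda>y. frechet_derivative k (at y) v) (at x) u"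
proof (rule euclidean_eqI)
  fix b :: 'b
  assume "b \<in> Basis"
  have 1: "frechet_derivative (\<lambda>x. h x \<bullet> b) (at y) w = frechet_derivative h (at y) w \<bullet> b"
    if "smooth_on S h" "y \<in> S" for h :: "'a \<Rightarrow> 'b" and y w
  proof -
    have "((\<lambda>x. h x \<bullet> b) has_derivative (\<lambda>v. frechet_derivative h (at y) v \<bullet> b)) (at y)"
      using smooth_on_has_derivative[OF that] by (intro has_derivative_inner_left)
    from frechet_derivative_at_eqI[OF this] show ?thesis by simp
  qed
  have 2: "frechet_derivative (\<lambda>y. frechet_derivative k (at y) u) (at x) v \<bullet> b =
     frechet_derivative (\<lambda>y. frechet_derivative (\<lambda>x. k x \<bullet> b) (at y) u) (at x) v" for u v
  proof -
    have "frechet_derivative (\<lambda>y. frechet_derivative k (at y) u) (at x) v \<bullet> b =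
      frechet_derivative (\<lambda>y. frechet_derivative k (at y) u \<bullet> b) (at x) v"
      using 1[OF smooth_on_partial[OF k] x] by simp
    also have "frechet_derivative (\<lambda>y. frechet_derivative k (at y) u \<bullet> b) (at x) =
      frechet_derivative (\<lambda>y. frechet_derivative (\<lambda>x. k x \<bullet> b) (at y) u) (at x)"
      by (rule frechet_derivative_cong_open[OF S x]) (simp add: 1[OF k])
    finally show ?thesis .
  qed
  show "frechet_derivative (\<lambda>y. frechet_derivative k (at y) u) (at x) v \<bullet> b =
      frechet_derivative (\<lambda>y. frechet_derivative k (at y) v) (at x) u \<bullet> b"
    unfolding 2 by (rule second_derivative_symmetric_real[OF smooth_on_inner_left[OF S k] S x])
qed

lemma has_derivative_cong_open:
  assumes "open S" "x \<in> S" "\<And>y. y \<in> S \<Longrightarrow> h y = k y"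
  shows "(h has_derivative D) (at x) \<longleftrightarrow> (k has_derivative D) (at x)"
  using has_derivative_transform_within_open[of h D x UNIV S k]
    has_derivative_transform_within_open[of k D x UNIV S h] assms by auto

section \<open>Charts and tangent vectors\<close>

text \<open>The differential of the change of coordinates from \<open>c\<close> to \<open>d\<close>
  at \<open>p\<close>. Both \<open>to_chart\<close> and \<open>from_chart\<close> are instances of
  it with \<open>chart_at A p\<close> on one side, so all conversions reduce to the law
  \<open>tcd_comp\<close>.\<close>

definition tcd :: "('m, 'e::euclidean_space) chart \<Rightarrow> ('m, 'e) chart \<Rightarrow> 'm \<Rightarrow> 'e \<Rightarrow> 'e" where
  "tcd c d p = frechet_derivative (cmap d \<circ> cinv c) (at (cmap c p))"

locale smooth_manifold =
  fixes A :: "('m::{t2_space, second_countable_topology}, 'e::euclidean_space) chart set"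
  assumes atlas: "smooth_atlas A"
begin

lemma chart_at_in: "chart_at A p \<in> A" and in_chart_at: "p \<in> cdom (chart_at A p)"
proof -
  have "\<exists>c. c \<in> A \<and> p \<in> cdom c" using atlas unfolding smooth_atlas_def by blast
  from someI_ex[OF this] show "chart_at A p \<in> A" "p \<in> cdom (chart_at A p)"
    unfolding chart_at_def by auto
qed

lemma chart:
  assumes "c \<in> A"
  shows open_cdom: "open (cdom c)" and open_crange: "open (crange c)"
    and cont_cmap: "continuous_on (cdom c) (cmap c)"
    and cont_cinv: "continuous_on (crange c) (cinv c)"
    and cinv_cmap: "p \<in> cdom c \<Longrightarrow> cinv c (cmap c p) = p"
    and cmap_cinv: "x \<in> crange c \<Longrightarrow> cmap c (cinv c x) = x"
    and cinv_in: "x \<in> crange c \<Longrightarrow> cinv c x \<in> cdom c"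
    and cmap_in: "p \<in> cdom c \<Longrightarrow> cmap c p \<in> crange c"
proof -
  have c: "is_chart c" using assms atlas unfolding smooth_atlas_def by blast
  then have h: "homeomorphism (cdom c) (crange c) (cmap c) (cinv c)" unfolding is_chart_def by blast
  show "open (cdom c)" "open (crange c)" using c unfolding is_chart_def by auto
  show "continuous_on (cdom c) (cmap c)" "continuous_on (crange c) (cinv c)"
    "p \<in> cdom c \<Longrightarrow> cinv c (cmap c p) = p" "x \<in> crange c \<Longrightarrow> cmap c (cinv c x) = x"
    "p \<in> cdom c \<Longrightarrow> cmap c p \<in> crange c"
    using h unfolding homeomorphism_def by auto
  show "x \<in> crange c \<Longrightarrow> cinv c x \<in> cdom c" using h unfolding homeomorphism_def by blast
qed

lemma open_chart_image:
  assumes "c \<in> A" "open U"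
  shows "open (cmap c ` (cdom c \<inter> U))"
proof -
  have "cmap c ` (cdom c \<inter> U) = crange c \<inter> cinv c -` U"
    using chart[OF assms(1)] by (force simp: image_iff)
  also have "open \<dots>"
    using continuous_open_preimage[OF cont_cinv open_crange] assms by blast
  finally show ?thesis .
qed

lemma open_chart_preimage:
  assumes "c \<in> A" "open V"
  shows "open (cdom c \<inter> cmap c -` V)"
  using continuous_open_preimage[OF cont_cmap open_cdom] assms by blast

lemma isCont_cmap: "c \<in> A \<Longrightarrow> p \<in> cdom c \<Longrightarrow> isCont (cmap c) p"
  using cont_cmap open_cdom continuous_on_eq_continuous_at by blast

lemma smooth_transition:
  assumes "c \<in> A" "d \<in> A"
  shows "smooth_on (cmap c ` (cdom c \<inter> cdom d)) (cmap d \<circ> cinv c)"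
  using atlas assms unfolding smooth_atlas_def compatible_def by blast

lemma open_overlap: "c \<in> A \<Longrightarrow> d \<in> A \<Longrightarrow> open (cmap c ` (cdom c \<inter> cdom d))"
  by (intro open_chart_image open_cdom)

lemma tcd_has_derivative:
  assumes "c \<in> A" "d \<in> A" "p \<in> cdom c" "p \<in> cdom d"
  shows "((cmap d \<circ> cinv c) has_derivative tcd c d p) (at (cmap c p))"
  unfolding tcd_def by (rule smooth_on_has_derivative[OF smooth_transition]) (use assms in auto)

lemma linear_tcd:
  assumes "c \<in> A" "d \<in> A" "p \<in> cdom c" "p \<in> cdom d"
  shows "linear (tcd c d p)"
  using tcd_has_derivative[OF assms] has_derivative_linear by blast

text \<open>The chain rule. The two coordinate expressions agree only on the overlap of the charts,
  but this is an open neighbourhood of the point.\<close>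

lemma derivative_change_chart:
  assumes "c \<in> A" "d \<in> A" "p \<in> cdom c" "p \<in> cdom d"
    and h: "((h \<circ> cinv d) has_derivative D) (at (cmap d p))"
  shows "((h \<circ> cinv c) has_derivative D \<circ> tcd c d p) (at (cmap c p))"
proof -
  have "(cmap d \<circ> cinv c) (cmap c p) = cmap d p" using assms by (simp add: cinv_cmap)
  with h have "((h \<circ> cinv d) has_derivative D) (at ((cmap d \<circ> cinv c) (cmap c p)))" by simp
  from diff_chain_at[OF tcd_has_derivative[OF assms(1-4)] this]
  have "((h \<circ> cinv d) \<circ> (cmap d \<circ> cinv c) has_derivative D \<circ> tcd c d p) (at (cmap c p))" .
  then show ?thesis
    by (rule has_derivative_cong_open[OF open_overlap[OF assms(1,2)], THEN iffD1, rotated 2])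
       (use assms in \<open>auto simp: cinv_cmap\<close>)
qed

lemma tcd_comp:
  assumes "c \<in> A" "d \<in> A" "e \<in> A" "p \<in> cdom c" "p \<in> cdom d" "p \<in> cdom e"
  shows "tcd d e p (tcd c d p u) = tcd c e p u"
proof -
  have "((cmap e \<circ> cinv c) has_derivative tcd d e p \<circ> tcd c d p) (at (cmap c p))"
    by (rule derivative_change_chart) (use assms tcd_has_derivative in auto)
  from has_derivative_unique[OF this tcd_has_derivative[of c e p]] show ?thesis
    using assms by (metis comp_apply)
qed

lemma tcd_self:
  assumes "c \<in> A" "p \<in> cdom c"
  shows "tcd c c p u = u"
proof -
  have "((cmap c \<circ> cinv c) has_derivative (\<lambda>u. u)) (at (cmap c p))"
    by (rule has_derivative_cong_open[OF open_crange[OF assms(1)], THEN iffD1, of _ "\<lambda>x. x"])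
       (use assms in \<open>auto simp: cmap_cinv cmap_in\<close>)
  from has_derivative_unique[OF this tcd_has_derivative[of c c p]] show ?thesis
    using assms by metis
qed

lemma to_chart_tcd: "to_chart A c p = tcd (chart_at A p) c p"
  unfolding to_chart_def tcd_def by (rule ext) simp

lemma from_chart_tcd: "from_chart A c p = tcd c (chart_at A p) p"
  unfolding from_chart_def tcd_def by (rule ext) simp

context
  fixes c :: "('m, 'e) chart" and p
  assumes c: "c \<in> A" and p: "p \<in> cdom c"
begin

lemma linear_to_chart: "linear (to_chart A c p)"
  unfolding to_chart_tcd by (intro linear_tcd c p chart_at_in in_chart_at)

lemma linear_from_chart: "linear (from_chart A c p)"
  unfolding from_chart_tcd by (intro linear_tcd c p chart_at_in in_chart_at)

lemma to_from_chart: "to_chart A c p (from_chart A c p u) = u"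
  unfolding from_chart_tcd to_chart_tcd
  by (simp add: tcd_comp[OF c chart_at_in c p in_chart_at p] tcd_self[OF c p])

lemma from_to_chart: "from_chart A c p (to_chart A c p v) = v"
  unfolding from_chart_tcd to_chart_tcd
  by (simp add: tcd_comp[OF chart_at_in c chart_at_in in_chart_at p in_chart_at] tcd_self chart_at_in in_chart_at)

lemma tcd_to_chart:
  assumes "d \<in> A" "p \<in> cdom d"
  shows "tcd c d p (to_chart A c p v) = to_chart A d p v"
  unfolding to_chart_tcd using tcd_comp[OF chart_at_in c assms(1) in_chart_at p assms(2)] .

lemma from_chart_tcd_comp:
  assumes "d \<in> A" "p \<in> cdom d"
  shows "from_chart A d p (tcd c d p u) = from_chart A c p u"
  unfolding from_chart_tcd using tcd_comp[OF c assms(1) chart_at_in p assms(2) in_chart_at] .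

end

lemma to_chart_self: "to_chart A (chart_at A p) p v = v"
  unfolding to_chart_tcd by (simp add: tcd_self chart_at_in in_chart_at)

lemma from_chart_self: "from_chart A (chart_at A p) p v = v"
  unfolding from_chart_tcd by (simp add: tcd_self chart_at_in in_chart_at)

lemma dderiv_in_chart:
  assumes "c \<in> A" "p \<in> cdom c" "((\<phi> \<circ> cinv c) has_derivative D) (at (cmap c p))"
  shows "dderiv A p v \<phi> = D (to_chart A c p v)"
proof -
  have "((\<phi> \<circ> cinv (chart_at A p)) has_derivative D \<circ> tcd (chart_at A p) c p) (at (cmap (chart_at A p) p))"
    using assms by (intro derivative_change_chart chart_at_in in_chart_at)
  from frechet_derivative_at_eqI[OF this] show ?thesis
    unfolding dderiv_def to_chart_tcd by simp
qed

text \<open>\<open>push\<close> is defined through two prescribed charts; this frees it from them.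
  Continuity of \<open>h\<close> guarantees that points near \<open>p\<close> are mapped into both
  target charts, so the coordinate expressions agree near \<open>p\<close>.\<close>

lemma push_in_chart:
  assumes c: "c \<in> A" "p \<in> cdom c" and d: "d \<in> A" "h p \<in> cdom d"
    and cont: "continuous_on UNIV h"
    and D: "((cmap d \<circ> h \<circ> cinv c) has_derivative D) (at (cmap c p))"
  shows "to_chart A d (h p) (push A h p v) = D (to_chart A c p v)"
proof -
  let ?c = "chart_at A p" and ?d = "chart_at A (h p)"
  let ?U = "h -` (cdom d \<inter> cdom ?d)"
  have U: "open ?U" using cont d chart_at_in open_cdom by (simp add: open_vimage open_Int)
  have 1: "(cmap d \<circ> h \<circ> cinv ?c has_derivative D \<circ> tcd ?c c p) (at (cmap ?c p))"
    using derivative_change_chart[of ?c c p "cmap d \<circ> h" D] c D chart_at_in in_chart_at by simp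
  have "(cmap d \<circ> h \<circ> cinv ?c) (cmap ?c p) = cmap d (h p)"
    by (simp add: cinv_cmap chart_at_in in_chart_at)
  then have "((cmap ?d \<circ> cinv d) has_derivative tcd d ?d (h p)) (at ((cmap d \<circ> h \<circ> cinv ?c) (cmap ?c p)))"
    using tcd_has_derivative[OF d(1) chart_at_in d(2) in_chart_at] by simp
  from diff_chain_at[OF 1 this]
  have "((cmap ?d \<circ> h \<circ> cinv ?c) has_derivative tcd d ?d (h p) \<circ> (D \<circ> tcd ?c c p)) (at (cmap ?c p))"
    by (rule has_derivative_cong_open[OF open_chart_image[OF chart_at_in U], THEN iffD1, rotated 2])
       (use in_chart_at[of p] in_chart_at[of "h p"] d in \<open>auto simp: cinv_cmap chart_at_in\<close>)
  from frechet_derivative_at_eqI[OF this]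
  have "push A h p v = tcd d ?d (h p) (D (to_chart A c p v))"
    unfolding push_def to_chart_tcd by simp
  then show ?thesis
    unfolding to_chart_tcd[of d] by (simp add: tcd_comp[OF d(1) chart_at_in d(1) d(2) in_chart_at d(2)] tcd_self d)
qed

end

section \<open>Smooth flows and their linearisation\<close>

text \<open>With \<open>u = |D|^2\<close> the hypothesis gives \<open>|u'| \<le> 2 C u\<close>.
  Hence \<open>exp (-2 C t) u\<close> does not increase to the right of \<open>t0\<close>,
  \<open>exp (2 C t) u\<close> does not decrease on the way to \<open>t0\<close> from the left, and
  both vanish at \<open>t0\<close>.\<close>

lemma gronwall_zero:
  fixes D :: "real \<Rightarrow> 'b::real_inner"
  assumes D: "\<And>t. t \<in> {a<..<b} \<Longrightarrow> (D has_vector_derivative D' t) (at t)"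
    and le: "\<And>t. t \<in> {a<..<b} \<Longrightarrow> norm (D' t) \<le> C * norm (D t)"
    and t0: "t0 \<in> {a<..<b}" "D t0 = 0" and t: "t \<in> {a<..<b}"
  shows "D t = 0"
proof -
  define u where "u = (\<lambda>t. D t \<bullet> D t)"
  have u: "(u has_real_derivative 2 * (D t \<bullet> D' t)) (at t)" if "t \<in> {a<..<b}" for t
    unfolding u_def has_field_derivative_def
    using has_derivative_inner[OF D[OF that, unfolded has_vector_derivative_def] D[OF that, unfolded has_vector_derivative_def]]
    by (rule has_derivative_eq_rhs) (auto simp: inner_commute algebra_simps)
  have bd: "\<bar>2 * (D t \<bullet> D' t)\<bar> \<le> 2 * C * u t" if "t \<in> {a<..<b}" for t
  proof -
    have "\<bar>D t \<bullet> D' t\<bar> \<le> norm (D t) * norm (D' t)" by (rule Cauchy_Schwarz_ineq2)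
    also have "\<dots> \<le> norm (D t) * (C * norm (D t))" using le[OF that] by (intro mult_left_mono) auto
    also have "\<dots> = C * u t" by (simp add: u_def power2_norm_eq_inner[symmetric] power2_eq_square)
    finally show ?thesis by (simp add: abs_mult)
  qed
  have e: "((\<lambda>t. exp (k * t) * u t) has_real_derivative exp (k * t) * (2 * (D t \<bullet> D' t) + k * u t)) (at t)"
    if "t \<in> {a<..<b}" for t k
    using u[OF that] by (auto intro!: derivative_eq_intros simp: algebra_simps)
  have "u t \<le> 0"
  proof (cases "t0 \<le> t")
    case True
    have "exp (- (2*C) * t) * u t \<le> exp (- (2*C) * t0) * u t0"
    proof (rule DERIV_nonpos_imp_nonincreasing[OF True])
      fix x assume "t0 \<le> x" "x \<le> t"
      then have x: "x \<in> {a<..<b}" using t0 t by auto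
      show "\<exists>y. ((\<lambda>t. exp (- (2*C) * t) * u t) has_real_derivative y) (at x) \<and> y \<le> 0"
        using e[OF x, of "- (2*C)"] bd[OF x] by (intro exI conjI) (auto intro!: mult_nonneg_nonpos)
    qed
    then show ?thesis using t0 by (simp add: u_def mult_le_0_iff not_less)
  next
    case False
    have "exp (2*C * t) * u t \<le> exp (2*C * t0) * u t0"
    proof (rule DERIV_nonneg_imp_nondecreasing[of t t0 "\<lambda>t. exp (2*C * t) * u t"])
      fix x assume "t \<le> x" "x \<le> t0"
      then have x: "x \<in> {a<..<b}" using t0 t by auto
      show "\<exists>y. ((\<lambda>t. exp (2*C * t) * u t) has_real_derivative y) (at x) \<and> y \<ge> 0"
        using e[OF x, of "2*C"] bd[OF x] by (intro exI conjI) (auto intro!: mult_nonneg_nonneg)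
    qed (use False in simp)
    then show ?thesis using t0 by (simp add: u_def mult_le_0_iff not_less)
  qed
  then show ?thesis unfolding u_def by (metis inner_ge_zero inner_eq_zero_iff order_antisym)
qed

lemma vector_chain_at:
  assumes "(h has_vector_derivative D) (at t)" "(g has_derivative G) (at (h t))"
  shows "((g \<circ> h) has_vector_derivative G D) (at t)"
proof -
  have "linear G" using assms(2) has_derivative_linear by blast
  then show ?thesis
    using diff_chain_at[OF assms(1)[unfolded has_vector_derivative_def] assms(2)]
    unfolding has_vector_derivative_def o_def by (simp add: linear_scale)
qed

lemma has_vector_derivative_cong_open:
  assumes "open S" "t \<in> S" "\<And>s. s \<in> S \<Longrightarrow> h s = k s" "(h has_vector_derivative D) (at t)"
  shows "(k has_vector_derivative D) (at t)"
  using assms has_derivative_cong_open unfolding has_vector_derivative_def by blast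

locale smooth_flow = smooth_manifold A
  for A :: "('m::{t2_space, second_countable_topology}, 'e::euclidean_space) chart set" +
  fixes F :: "'m \<Rightarrow> 'e" and f :: "real \<Rightarrow> 'm \<Rightarrow> 'm"
  assumes smooth_F: "smooth_vf A F" and flow: "flow_of A F f"
begin

definition Fc :: "('m, 'e) chart \<Rightarrow> 'e \<Rightarrow> 'e" where
  "Fc c x = to_chart A c (cinv c x) (F (cinv c x))"

definition fdom :: "('m, 'e) chart \<Rightarrow> ('m, 'e) chart \<Rightarrow> (real \<times> 'e) set" where
  "fdom c d = {(t, x). x \<in> crange c \<and> f t (cinv c x) \<in> cdom d}"

definition fc :: "('m, 'e) chart \<Rightarrow> ('m, 'e) chart \<Rightarrow> real \<times> 'e \<Rightarrow> 'e" where
  "fc c d = (\<lambda>(t, x). cmap d (f t (cinv c x)))"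

text \<open>The spatial part is taken out of the joint derivative in \<open>(t, x)\<close>, so that
  joint smoothness of the flow gives smooth dependence on time as well as on the point.\<close>

definition fD :: "('m, 'e) chart \<Rightarrow> ('m, 'e) chart \<Rightarrow> real \<Rightarrow> 'm \<Rightarrow> 'e \<Rightarrow> 'e" where
  "fD c d t p u = frechet_derivative (fc c d) (at (t, cmap c p)) (0, u)"

lemma smooth_Fc: "c \<in> A \<Longrightarrow> smooth_on (crange c) (Fc c)"
  using smooth_F unfolding smooth_vf_def Fc_def by blast

lemma Fc_cmap: "c \<in> A \<Longrightarrow> p \<in> cdom c \<Longrightarrow> Fc c (cmap c p) = to_chart A c p (F p)"
  by (simp add: Fc_def cinv_cmap)

lemma flow_cont: "continuous_on UNIV (\<lambda>(t, p). f t p)"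
  and smooth_fc: "c \<in> A \<Longrightarrow> d \<in> A \<Longrightarrow> smooth_on (fdom c d) (fc c d)"
  and flow_0: "f 0 p = p"
  and flow_ode: "((\<lambda>s. cmap (chart_at A (f t p)) (f s p)) has_vector_derivative F (f t p)) (at t)"
  using flow unfolding flow_of_def fc_def fdom_def by auto

lemma continuous_on_flow [continuous_intros]:
  "continuous_on T a \<Longrightarrow> continuous_on T b \<Longrightarrow> continuous_on T (\<lambda>x. f (a x) (b x))"
  using continuous_on_compose2[OF flow_cont, of T "\<lambda>x. (a x, b x)"] by (auto intro: continuous_intros)

lemma open_fdom:
  assumes "c \<in> A" "d \<in> A"
  shows "open (fdom c d)"
proof -
  have "continuous_on (UNIV \<times> crange c) (\<lambda>z. f (fst z) (cinv c (snd z)))"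
    by (intro continuous_intros continuous_on_compose2[OF cont_cinv[OF assms(1)]]) auto
  moreover have "open (UNIV \<times> crange c :: (real \<times> 'e) set)"
    using open_crange[OF assms(1)] by (simp add: open_Times)
  ultimately have "open (UNIV \<times> crange c \<inter> (\<lambda>z. f (fst z) (cinv c (snd z))) -` cdom d)"
    using open_cdom[OF assms(2)] continuous_open_preimage by blast
  also have "UNIV \<times> crange c \<inter> (\<lambda>z. f (fst z) (cinv c (snd z))) -` cdom d = fdom c d"
    by (auto simp: fdom_def)
  finally show ?thesis .
qed

lemma in_fdom: "c \<in> A \<Longrightarrow> p \<in> cdom c \<Longrightarrow> f t p \<in> cdom d \<Longrightarrow> (t, cmap c p) \<in> fdom c d"
  by (simp add: fdom_def cinv_cmap cmap_in)

lemma fc_has_derivative: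
  assumes "c \<in> A" "d \<in> A" "p \<in> cdom c" "f t p \<in> cdom d"
  shows "((cmap d \<circ> f t \<circ> cinv c) has_derivative fD c d t p) (at (cmap c p))"
proof -
  have 1: "(fc c d has_derivative frechet_derivative (fc c d) (at (t, cmap c p))) (at (t, cmap c p))"
    using smooth_on_has_derivative[OF smooth_fc in_fdom] assms by blast
  have "((\<lambda>x. fc c d (t, x)) has_derivative (\<lambda>u. frechet_derivative (fc c d) (at (t, cmap c p)) (0, u))) (at (cmap c p))"
    by (rule has_derivative_compose[where f="\<lambda>x. (t, x)", OF _ 1]) (auto intro!: derivative_eq_intros)
  then show ?thesis unfolding fc_def fD_def[abs_def] o_def by simp
qed

lemma linear_fD:
  assumes "c \<in> A" "d \<in> A" "p \<in> cdom c" "f t p \<in> cdom d"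
  shows "linear (fD c d t p)"
  using fc_has_derivative[OF assms] has_derivative_linear by blast

lemma continuous_on_flow_UNIV: "continuous_on UNIV (f t)"
  using continuous_on_flow[of UNIV "\<lambda>_. t" "\<lambda>p. p"] by simp

lemma push_flow:
  assumes "c \<in> A" "d \<in> A" "p \<in> cdom c" "f t p \<in> cdom d"
  shows "to_chart A d (f t p) (push A (f t) p v) = fD c d t p (to_chart A c p v)"
  by (rule push_in_chart) (use assms fc_has_derivative continuous_on_flow_UNIV in auto)

lemma linear_push: "linear (push A (f t) p)"
proof -
  let ?c = "chart_at A p" and ?d = "chart_at A (f t p)"
  have "push A (f t) p = fD ?c ?d t p"
  proof
    fix v
    have "to_chart A ?d (f t p) (push A (f t) p v) = fD ?c ?d t p (to_chart A ?c p v)"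
      by (intro push_flow chart_at_in in_chart_at)
    then show "push A (f t) p v = fD ?c ?d t p v" by (simp add: to_chart_self)
  qed
  then show ?thesis using linear_fD chart_at_in in_chart_at by simp
qed

text \<open>\<open>flow_of\<close> asks for the differential equation and for smoothness but not for
  the group law; that law is recovered from uniqueness of integral curves, the purpose of this
  notion.\<close>

definition icurve :: "(real \<Rightarrow> 'm) \<Rightarrow> bool" where
  "icurve \<gamma> \<longleftrightarrow> continuous_on UNIV \<gamma> \<and>
     (\<forall>t. ((\<lambda>s. cmap (chart_at A (\<gamma> t)) (\<gamma> s)) has_vector_derivative F (\<gamma> t)) (at t))"

lemma icurve_in_chart:
  assumes \<gamma>: "icurve \<gamma>" and c: "c \<in> A" "\<gamma> t \<in> cdom c"
  shows "((\<lambda>s. cmap c (\<gamma> s)) has_vector_derivative Fc c (cmap c (\<gamma> t))) (at t)"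
proof -
  let ?d = "chart_at A (\<gamma> t)"
  have "((cmap c \<circ> cinv ?d) has_derivative tcd ?d c (\<gamma> t)) (at (cmap ?d (\<gamma> t)))"
    using tcd_has_derivative[OF chart_at_in c(1) in_chart_at c(2)] .
  moreover have "((\<lambda>s. cmap ?d (\<gamma> s)) has_vector_derivative F (\<gamma> t)) (at t)"
    using \<gamma> unfolding icurve_def by blast
  ultimately have "(((cmap c \<circ> cinv ?d) \<circ> (\<lambda>s. cmap ?d (\<gamma> s))) has_vector_derivative tcd ?d c (\<gamma> t) (F (\<gamma> t))) (at t)"
    by (intro vector_chain_at)
  then have "((\<lambda>s. cmap c (\<gamma> s)) has_vector_derivative tcd ?d c (\<gamma> t) (F (\<gamma> t))) (at t)"
  proof (rule has_vector_derivative_cong_open[rotated 3])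
    show "open (\<gamma> -` cdom ?d)" using \<gamma> chart_at_in open_cdom unfolding icurve_def by (blast intro: open_vimage)
  qed (use in_chart_at chart_at_in cinv_cmap in auto)
  then show ?thesis by (simp add: Fc_cmap c to_chart_tcd)
qed

text \<open>The set of times at which the curves agree is closed because the manifold is Hausdorff,
  and open by the Gronwall estimate in a chart; the line is connected.\<close>

lemma icurve_unique:
  assumes \<gamma>: "icurve \<gamma>" and \<delta>: "icurve \<delta>" and eq: "\<gamma> 0 = \<delta> 0"
  shows "\<gamma> t = \<delta> t"
proof -
  let ?S = "{t. \<gamma> t = \<delta> t}"
  have cont: "continuous_on UNIV \<gamma>" "continuous_on UNIV \<delta>" using \<gamma> \<delta> unfolding icurve_def by auto
  have "closed ?S" using cont by (intro closed_Collect_eq)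
  moreover have "open ?S"
    unfolding open_contains_ball
  proof
    fix t0 assume t0: "t0 \<in> ?S"
    let ?c = "chart_at A (\<gamma> t0)"
    have cA: "?c \<in> A" "\<gamma> t0 \<in> cdom ?c" "\<delta> t0 \<in> cdom ?c" using chart_at_in in_chart_at[of "\<gamma> t0"] t0 by auto
    obtain r C where r: "r > 0" "C \<ge> 0" and
      lip: "\<And>x y. x \<in> ball (cmap ?c (\<gamma> t0)) r \<Longrightarrow> y \<in> ball (cmap ?c (\<gamma> t0)) r \<Longrightarrow> norm (Fc ?c x - Fc ?c y) \<le> C * norm (x - y)"
      using smooth_on_locally_lipschitz[OF smooth_Fc[OF cA(1)] open_crange[OF cA(1)] cmap_in[OF cA(1,2)]] by blast
    let ?V = "cdom ?c \<inter> cmap ?c -` ball (cmap ?c (\<gamma> t0)) r"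
    have V: "open ?V" by (rule open_chart_preimage[OF cA(1)]) simp
    have "open (\<gamma> -` ?V \<inter> \<delta> -` ?V)" using open_vimage[OF V] cont by blast
    moreover have "t0 \<in> \<gamma> -` ?V \<inter> \<delta> -` ?V" using cA r t0 by auto
    ultimately obtain e where e: "e > 0" "ball t0 e \<subseteq> \<gamma> -` ?V \<inter> \<delta> -` ?V" by (rule openE)
    have V': "\<gamma> t \<in> ?V" "\<delta> t \<in> ?V" if "t \<in> {t0-e<..<t0+e}" for t
      using that e by (auto simp: subset_iff dist_real_def)
    have zero: "cmap ?c (\<gamma> t) - cmap ?c (\<delta> t) = 0" if "t \<in> {t0-e<..<t0+e}" for t
    proof (rule gronwall_zero[where D'="\<lambda>t. Fc ?c (cmap ?c (\<gamma> t)) - Fc ?c (cmap ?c (\<delta> t))" and C=C and ?t0.0=t0, OF _ _ _ _ that])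
      show "((\<lambda>t. cmap ?c (\<gamma> t) - cmap ?c (\<delta> t)) has_vector_derivative Fc ?c (cmap ?c (\<gamma> t)) - Fc ?c (cmap ?c (\<delta> t))) (at t)"
        if "t \<in> {t0-e<..<t0+e}" for t
        using V'[OF that] icurve_in_chart[OF \<gamma> cA(1)] icurve_in_chart[OF \<delta> cA(1)]
        by (intro has_vector_derivative_diff) auto
      show "norm (Fc ?c (cmap ?c (\<gamma> t)) - Fc ?c (cmap ?c (\<delta> t))) \<le> C * norm (cmap ?c (\<gamma> t) - cmap ?c (\<delta> t))"
        if "t \<in> {t0-e<..<t0+e}" for t
        using V'[OF that] by (intro lip) auto
    qed (use e t0 in auto)
    then have "\<gamma> t = \<delta> t" if "t \<in> {t0-e<..<t0+e}" for t
    proof -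
      have "\<gamma> t = cinv ?c (cmap ?c (\<gamma> t))" using V'(1)[OF that] cinv_cmap[OF cA(1)] by simp
      also have "cmap ?c (\<gamma> t) = cmap ?c (\<delta> t)" using zero[OF that] by simp
      also have "cinv ?c (cmap ?c (\<delta> t)) = \<delta> t" using V'(2)[OF that] cinv_cmap[OF cA(1)] by simp
      finally show ?thesis .
    qed
    then have "t \<in> ?S" if "t \<in> ball t0 e" for t
      using that by (simp add: dist_real_def abs_less_iff)
    then have "ball t0 e \<subseteq> ?S" by blast
    then show "\<exists>e>0. ball t0 e \<subseteq> ?S" using e by blast
  qed
  ultimately have "?S = {} \<or> ?S = UNIV" using clopen[of ?S] by simp
  then show ?thesis using eq by blast
qed

lemma icurve_flow: "icurve (\<lambda>t. f (t + s) p)"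
  unfolding icurve_def
proof (intro conjI allI)
  show "continuous_on UNIV (\<lambda>t. f (t + s) p)" by (intro continuous_intros)
  fix t
  have "((\<lambda>s'. cmap (chart_at A (f (t + s) p)) (f s' p)) \<circ> (\<lambda>t. t + s) has_vector_derivative 1 *\<^sub>R F (f (t + s) p)) (at t)"
    by (intro vector_diff_chain_at flow_ode) (auto intro!: derivative_eq_intros)
  then show "((\<lambda>s'. cmap (chart_at A (f (t + s) p)) (f (s' + s) p)) has_vector_derivative F (f (t + s) p)) (at t)"
    by (simp add: o_def)
qed

text \<open>Both sides are integral curves in \<open>t\<close> that start at
  \<open>f s p\<close>.\<close>

lemma flow_add: "f (t + s) p = f t (f s p)"
  using icurve_unique[OF icurve_flow[of s p] icurve_flow[of 0 "f s p"], of t] by (simp add: flow_0)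

lemma flow_minus: "f (- t) (f t p) = p"
  using flow_add[of "-t" t p] by (simp add: flow_0)

lemma flow_in_chart:
  assumes "c \<in> A" "f t p \<in> cdom c"
  shows "((\<lambda>s. cmap c (f s p)) has_vector_derivative Fc c (cmap c (f t p))) (at t)"
  using icurve_in_chart[OF icurve_flow[of 0 p], of c t] assms by simp

lemma push_0: "push A (f 0) p v = v"
proof -
  let ?c = "chart_at A p"
  have "((cmap ?c \<circ> f 0 \<circ> cinv ?c) has_derivative (\<lambda>u. u)) (at (cmap ?c p))"
    by (rule has_derivative_cong_open[OF open_crange[OF chart_at_in], THEN iffD1, of _ p "\<lambda>x. x"])
       (auto simp: flow_0 cmap_cinv cmap_in chart_at_in in_chart_at)
  then have "to_chart A ?c (f 0 p) (push A (f 0) p v) = to_chart A ?c p v"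
    by (intro push_in_chart[OF _ _ _ _ continuous_on_flow_UNIV]) (simp_all add: chart_at_in in_chart_at flow_0)
  then show ?thesis by (simp add: flow_0 to_chart_self)
qed

lemma push_comp: "push A (f s) (f t p) (push A (f t) p v) = push A (f (s + t)) p v"
proof -
  let ?c = "chart_at A p" and ?d = "chart_at A (f t p)" and ?e = "chart_at A (f s (f t p))"
  have 1: "((cmap ?d \<circ> f t \<circ> cinv ?c) has_derivative fD ?c ?d t p) (at (cmap ?c p))"
    by (intro fc_has_derivative chart_at_in in_chart_at)
  have "(cmap ?d \<circ> f t \<circ> cinv ?c) (cmap ?c p) = cmap ?d (f t p)" by (simp add: cinv_cmap chart_at_in in_chart_at)
  then have 2: "((cmap ?e \<circ> f s \<circ> cinv ?d) has_derivative fD ?d ?e s (f t p)) (at ((cmap ?d \<circ> f t \<circ> cinv ?c) (cmap ?c p)))"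
    using fc_has_derivative[OF chart_at_in chart_at_in in_chart_at in_chart_at, of s "f t p"] by simp
  have U: "open (f t -` cdom ?d)" using continuous_on_flow_UNIV open_cdom[OF chart_at_in] open_vimage by blast
  from diff_chain_at[OF 1 2]
  have "((cmap ?e \<circ> f (s + t) \<circ> cinv ?c) has_derivative fD ?d ?e s (f t p) \<circ> fD ?c ?d t p) (at (cmap ?c p))"
    by (rule has_derivative_cong_open[OF open_chart_image[OF chart_at_in U], THEN iffD1, rotated 2])
       (use in_chart_at[of p] in_chart_at[of "f t p"] in \<open>auto simp: cinv_cmap chart_at_in flow_add\<close>)
  then have "to_chart A ?e (f (s + t) p) (push A (f (s + t)) p v) = fD ?d ?e s (f t p) (fD ?c ?d t p (to_chart A ?c p v))"
    by (subst push_in_chart) (auto simp: chart_at_in in_chart_at continuous_on_flow_UNIV flow_add o_def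
      intro: continuous_on_flow_UNIV[of "s + t", unfolded flow_add])
  also have "\<dots> = to_chart A ?e (f s (f t p)) (push A (f s) (f t p) (push A (f t) p v))"
    by (subst push_flow[of ?d]) (auto simp: chart_at_in in_chart_at push_flow[of ?c])
  finally show ?thesis by (simp add: flow_add to_chart_self)
qed

text \<open>The curve \<open>s -> f t (f s p) = f (s + t) p\<close> is differentiated at 0 in two
  ways: by the chain rule, and as an integral curve through \<open>f t p\<close>.\<close>

lemma push_F: "push A (f t) p (F p) = F (f t p)"
proof -
  let ?c = "chart_at A p" and ?d = "chart_at A (f t p)"
  have 1: "((\<lambda>s. cmap ?c (f s p)) has_vector_derivative Fc ?c (cmap ?c p)) (at 0)"
    using flow_in_chart[of ?c 0 p] by (simp add: chart_at_in in_chart_at flow_0)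
  have "(cmap ?d \<circ> f t \<circ> cinv ?c has_derivative fD ?c ?d t p) (at (cmap ?c (f 0 p)))"
    using fc_has_derivative[OF chart_at_in chart_at_in in_chart_at in_chart_at, of t p] by (simp add: flow_0)
  with 1
  have "((cmap ?d \<circ> f t \<circ> cinv ?c) \<circ> (\<lambda>s. cmap ?c (f s p)) has_vector_derivative fD ?c ?d t p (Fc ?c (cmap ?c p))) (at 0)"
    by (intro vector_chain_at)
  then have 2: "((\<lambda>s. cmap ?d (f (s + t) p)) has_vector_derivative fD ?c ?d t p (Fc ?c (cmap ?c p))) (at 0)"
  proof (rule has_vector_derivative_cong_open[rotated 3])
    have "continuous_on UNIV (\<lambda>s. f s p)" by (intro continuous_intros)
    then show "open ((\<lambda>s. f s p) -` cdom ?c)" using open_cdom[OF chart_at_in] by (blast intro: open_vimage)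
    show "0 \<in> (\<lambda>s. f s p) -` cdom ?c" by (simp add: flow_0 in_chart_at)
    show "((cmap ?d \<circ> f t \<circ> cinv ?c) \<circ> (\<lambda>s. cmap ?c (f s p))) s = cmap ?d (f (s + t) p)" if "s \<in> (\<lambda>s. f s p) -` cdom ?c" for s
      using that flow_add[of t s p] by (simp add: cinv_cmap chart_at_in add.commute)
  qed
  have 3: "((\<lambda>s. cmap ?d (f (s + t) p)) has_vector_derivative Fc ?d (cmap ?d (f t p))) (at 0)"
    using icurve_in_chart[OF icurve_flow[of t p], of ?d 0] by (simp add: chart_at_in in_chart_at)
  have "to_chart A ?d (f t p) (push A (f t) p (F p)) = fD ?c ?d t p (to_chart A ?c p (F p))"
    by (intro push_flow chart_at_in in_chart_at)
  also have "\<dots> = fD ?c ?d t p (Fc ?c (cmap ?c p))" by (simp add: Fc_cmap chart_at_in in_chart_at)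
  also have "\<dots> = Fc ?d (cmap ?d (f t p))" using 2 3 by (rule vector_derivative_unique_at)
  also have "\<dots> = to_chart A ?d (f t p) (F (f t p))" by (simp add: Fc_cmap chart_at_in in_chart_at)
  finally show ?thesis by (simp add: to_chart_self)
qed

text \<open>Time and space derivatives of the flow are interchanged here.\<close>

lemma fD_has_derivative_at_0:
  assumes c: "c \<in> A" "p \<in> cdom c"
  shows "((\<lambda>t. fD c c t p u) has_vector_derivative frechet_derivative (Fc c) (at (cmap c p)) u) (at 0)"
proof -
  let ?z = "(0, cmap c p)" and ?O = "fdom c c"
  let ?g = "\<lambda>z. frechet_derivative (fc c c) (at z) (0, u)"
  have z: "?z \<in> ?O" using in_fdom c by (simp add: flow_0)
  note sm = smooth_fc[OF c(1) c(1)] and op = open_fdom[OF c(1) c(1)]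
  have g: "(?g has_derivative frechet_derivative ?g (at ?z)) (at ?z)"
    by (rule smooth_on_has_derivative[OF smooth_on_partial[OF sm] z])
  have 1: "((\<lambda>t. ?g (t, cmap c p)) has_derivative (\<lambda>s. frechet_derivative ?g (at ?z) (s, 0))) (at 0)"
    by (rule has_derivative_compose[where f="\<lambda>t. (t, cmap c p)", OF _ g]) (auto intro!: derivative_eq_intros)
  \<comment> \<open>The identity is needed on the whole open domain and not only at time 0, because
    it is differentiated once more in space.\<close>
  have dt: "frechet_derivative (fc c c) (at y) (1, 0) = Fc c (fc c c y)" if y: "y \<in> ?O" for y
  proof -
    obtain t x where [simp]: "y = (t, x)" by fastforce
    have x: "x \<in> crange c" "f t (cinv c x) \<in> cdom c" using y by (auto simp: fdom_def)
    have D: "(fc c c has_derivative frechet_derivative (fc c c) (at y)) (at (t, x))"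
      using smooth_on_has_derivative[OF sm y] by simp
    have "((\<lambda>s. fc c c (s, x)) has_derivative (\<lambda>s. frechet_derivative (fc c c) (at y) (s, 0))) (at t)"
      by (rule has_derivative_compose[where f="\<lambda>t. (t, x)", OF _ D]) (auto intro!: derivative_eq_intros)
    moreover have "((\<lambda>s. fc c c (s, x)) has_derivative (\<lambda>s. s *\<^sub>R Fc c (fc c c y))) (at t)"
      using flow_in_chart[OF c(1) x(2)] by (simp add: fc_def has_vector_derivative_def)
    ultimately have "(\<lambda>s. frechet_derivative (fc c c) (at y) (s, 0)) = (\<lambda>s. s *\<^sub>R Fc c (fc c c y))"
      by (rule has_derivative_unique)
    from fun_cong[OF this, of 1] show ?thesis by simp
  qed
  have fz: "fc c c ?z = cmap c p" using c by (simp add: fc_def flow_0 cinv_cmap)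
  have "frechet_derivative ?g (at ?z) (1, 0)
      = frechet_derivative (\<lambda>z. frechet_derivative (fc c c) (at z) (1, 0)) (at ?z) (0, u)"
    by (rule second_derivative_symmetric[OF sm op z])
  also have "\<dots> = frechet_derivative (\<lambda>z. Fc c (fc c c z)) (at ?z) (0, u)"
    by (subst frechet_derivative_cong_open[OF op z dt]) auto
  also have "\<dots> = frechet_derivative (Fc c) (at (cmap c p)) (frechet_derivative (fc c c) (at ?z) (0, u))"
  proof -
    have "(Fc c has_derivative frechet_derivative (Fc c) (at (cmap c p))) (at (fc c c ?z))"
      unfolding fz by (intro smooth_on_has_derivative[OF smooth_Fc] c cmap_in)
    from diff_chain_at[OF smooth_on_has_derivative[OF sm z] this]
    show ?thesis using frechet_derivative_at_eqI unfolding o_def by fastforce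
  qed
  also have "frechet_derivative (fc c c) (at ?z) (0, u) = u"
  proof -
    have "fD c c 0 p (to_chart A c p (from_chart A c p u)) = to_chart A c (f 0 p) (push A (f 0) p (from_chart A c p u))"
      by (rule push_flow[symmetric]) (use c in \<open>auto simp: flow_0\<close>)
    then show ?thesis using c by (simp add: fD_def push_0 flow_0 to_from_chart)
  qed
  finally have 2: "frechet_derivative ?g (at ?z) (1, 0) = frechet_derivative (Fc c) (at (cmap c p)) u" .
  have lin: "linear (frechet_derivative ?g (at ?z))" using g has_derivative_linear by blast
  have "frechet_derivative ?g (at ?z) (s, 0) = s *\<^sub>R frechet_derivative (Fc c) (at (cmap c p)) u" for s
    using linear_scale[OF lin, of s "(1, 0)"] 2 by simp
  with 1 show ?thesis unfolding has_vector_derivative_def fD_def by simp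
qed

end

section \<open>Exponential decay and Hoelder continuity\<close>

definition improper_integral :: "(real \<Rightarrow> 'b::banach) \<Rightarrow> 'b" where
  "improper_integral g = Lim at_top (\<lambda>T. integral {0..T} g)"

lemma integral_exp_le:
  assumes "\<kappa> > 0" "(a::real) \<le> b"
  shows "(\<lambda>t. C * exp (- \<kappa> * t)) integrable_on {a..b}"
    and "C \<ge> 0 \<Longrightarrow> integral {a..b} (\<lambda>t. C * exp (- \<kappa> * t)) \<le> C / \<kappa> * exp (- \<kappa> * a)"
proof -
  have "((\<lambda>t. C * exp (- \<kappa> * t)) has_integral
     (- (C / \<kappa>) * exp (- \<kappa> * b)) - (- (C / \<kappa>) * exp (- \<kappa> * a))) {a..b}"
    using assms by (intro fundamental_theorem_of_calculus)
      (auto intro!: derivative_eq_intros simp: has_real_derivative_iff_has_vector_derivative[symmetric])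
  then show "(\<lambda>t. C * exp (- \<kappa> * t)) integrable_on {a..b}"
    "C \<ge> 0 \<Longrightarrow> integral {a..b} (\<lambda>t. C * exp (- \<kappa> * t)) \<le> C / \<kappa> * exp (- \<kappa> * a)"
  proof -
    assume h: "((\<lambda>t. C * exp (- \<kappa> * t)) has_integral
     (- (C / \<kappa>) * exp (- \<kappa> * b)) - (- (C / \<kappa>) * exp (- \<kappa> * a))) {a..b}" and "C \<ge> 0"
    then have "C / \<kappa> * exp (- \<kappa> * b) \<ge> 0" using assms by simp
    then show "integral {a..b} (\<lambda>t. C * exp (- \<kappa> * t)) \<le> C / \<kappa> * exp (- \<kappa> * a)"
      unfolding integral_unique[OF h] by linarith
  qed (auto simp: has_integral_integrable)
qed

lemma integral_exp_decay_le:
  fixes g :: "real \<Rightarrow> 'b::banach"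
  assumes "continuous_on {a..b} g" "\<kappa> > 0" "a \<le> b" "0 \<le> C"
    and "\<And>t. t \<in> {a..b} \<Longrightarrow> norm (g t) \<le> C * exp (- \<kappa> * t)"
  shows "norm (integral {a..b} g) \<le> C / \<kappa> * exp (- \<kappa> * a)"
proof -
  have "norm (integral {a..b} g) \<le> integral {a..b} (\<lambda>t. C * exp (- \<kappa> * t))"
    by (intro integral_norm_bound_integral integrable_continuous_interval assms integral_exp_le(1))
  also have "\<dots> \<le> C / \<kappa> * exp (- \<kappa> * a)" by (intro integral_exp_le assms)
  finally show ?thesis .
qed

text \<open>The bound makes the integrals over \<open>{0..n}\<close> Cauchy along the integers. The
  same bound, now against the limit, gives convergence along real times with an explicit rate, which
  the later Hoelder estimate of the integral consumes.\<close>

lemma improper_integral_exp_decay: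
  fixes g :: "real \<Rightarrow> 'b::banach"
  assumes g: "continuous_on {0..} g" and \<kappa>: "\<kappa> > 0"
    and le: "\<And>t. 0 \<le> t \<Longrightarrow> norm (g t) \<le> C * exp (- \<kappa> * t)"
  shows "((\<lambda>T. integral {0..T} g) \<longlongrightarrow> improper_integral g) at_top"
    and "0 \<le> T \<Longrightarrow> norm (improper_integral g - integral {0..T} g) \<le> C / \<kappa> * exp (- \<kappa> * T)"
proof -
  have C: "0 \<le> C" using order_trans[OF norm_ge_zero le[of 0]] by simp
  have diff: "norm (integral {0..b} g - integral {0..a} g) \<le> C / \<kappa> * exp (- \<kappa> * a)" if "0 \<le> a" "a \<le> b" for a b
  proof -
    have "g integrable_on {0..b}" using g that by (intro integrable_continuous_interval continuous_on_subset[OF g]) auto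
    from Henstock_Kurzweil_Integration.integral_combine[OF that this]
    have "integral {0..b} g - integral {0..a} g = integral {a..b} g" by (simp add: algebra_simps)
    then show ?thesis
      using integral_exp_decay_le[of a b g \<kappa> C] that \<kappa> C le continuous_on_subset[OF g, of "{a..b}"] by auto
  qed
  have lim0: "((\<lambda>a. C / \<kappa> * exp (- \<kappa> * a)) \<longlongrightarrow> 0) at_top" using \<kappa> by real_asymp
  have "convergent (\<lambda>n. integral {0..real n} g)"
  proof (rule Cauchy_convergent, rule metric_CauchyI)
    fix e :: real assume e: "e > 0"
    obtain N where N: "C / \<kappa> * exp (- \<kappa> * real N) < e/2"
      using order_tendstoD(2)[OF filterlim_compose[OF lim0 filterlim_real_sequentially], of "e/2"] e
      unfolding eventually_sequentially by auto
    have "dist (integral {0..real m} g) (integral {0..real n} g) < e" if "m \<ge> N" "n \<ge> N" for m n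
    proof (rule dist_triangle_half_r[of "integral {0..real N} g"])
      show "dist (integral {0..real N} g) (integral {0..real m} g) < e / 2"
        "dist (integral {0..real N} g) (integral {0..real n} g) < e / 2"
        using le_less_trans[OF diff[of "real N" "real m"] N] le_less_trans[OF diff[of "real N" "real n"] N] that
        by (simp_all add: dist_norm norm_minus_commute)
    qed
    then show "\<exists>M. \<forall>m\<ge>M. \<forall>n\<ge>M. dist (integral {0..real m} g) (integral {0..real n} g) < e" by blast
  qed
  then obtain I where I: "(\<lambda>n. integral {0..real n} g) \<longlonglongrightarrow> I" unfolding convergent_def by blast
  have bd: "norm (I - integral {0..T} g) \<le> C / \<kappa> * exp (- \<kappa> * T)" if "0 \<le> T" for T
  proof (rule tendsto_upperbound)
    show "(\<lambda>n. norm (integral {0..real n} g - integral {0..T} g)) \<longlonglongrightarrow> norm (I - integral {0..T} g)"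
      by (intro tendsto_intros I)
    show "\<forall>\<^sub>F n in sequentially. norm (integral {0..real n} g - integral {0..T} g) \<le> C / \<kappa> * exp (- \<kappa> * T)"
      using eventually_ge_at_top[of "nat \<lceil>T\<rceil>"] by eventually_elim (intro diff that, linarith)
  qed simp
  have "((\<lambda>T. integral {0..T} g - I) \<longlongrightarrow> 0) at_top"
    by (rule Lim_null_comparison[OF _ lim0])
       (use eventually_ge_at_top[of 0] in eventually_elim, use bd in \<open>simp add: norm_minus_commute\<close>)
  then have lim: "((\<lambda>T. integral {0..T} g) \<longlongrightarrow> I) at_top" by (simp add: LIM_zero_iff)
  then have "improper_integral g = I" unfolding improper_integral_def by (intro tendsto_Lim) simp
  with lim bd show "((\<lambda>T. integral {0..T} g) \<longlongrightarrow> improper_integral g) at_top"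
    "0 \<le> T \<Longrightarrow> norm (improper_integral g - integral {0..T} g) \<le> C / \<kappa> * exp (- \<kappa> * T)" by auto
qed

lemma improper_integralI: "((\<lambda>T. integral {0..T} g) \<longlongrightarrow> I) at_top \<Longrightarrow> improper_integral g = I"
  unfolding improper_integral_def by (intro tendsto_Lim) simp

text \<open>The shift \<open>a\<close> may have either sign. Measuring all integrals from a base
  point \<open>c\<close> to the left of both 0 and \<open>a\<close> avoids oriented
  integrals.\<close>

lemma improper_integral_shift:
  fixes g :: "real \<Rightarrow> 'b::banach"
  assumes g: "continuous_on UNIV g" and I: "((\<lambda>T. integral {0..T} g) \<longlongrightarrow> I) at_top" and c: "c \<le> 0" "c \<le> a"
  shows "improper_integral (\<lambda>t. g (t + a)) = integral {c..0} g + I - integral {c..a} g"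
proof (rule improper_integralI)
  have int: "g integrable_on {x..y}" for x y
    by (intro integrable_continuous_interval continuous_on_subset[OF g]) auto
  have eq: "integral {0..T} (\<lambda>t. g (t + a)) = integral {c..0} g + integral {0..T + a} g - integral {c..a} g"
    if T: "T \<ge> 0" "T \<ge> -a" for T
  proof -
    have "integral {0..T} (\<lambda>t. g (t + a)) = integral {a..T + a} g"
      using integral_shift_real_ivl[of a a "T + a" g] by simp
    moreover have "integral {c..a} g + integral {a..T+a} g = integral {c..T+a} g"
      by (rule Henstock_Kurzweil_Integration.integral_combine[OF _ _ int]) (use c T in auto)
    moreover have "integral {c..0} g + integral {0..T+a} g = integral {c..T+a} g"
      by (rule Henstock_Kurzweil_Integration.integral_combine[OF _ _ int]) (use c T in auto)
    ultimately show ?thesis by (simp add: algebra_simps)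
  qed
  have "((\<lambda>T. integral {0..T + a} g) \<longlongrightarrow> I) at_top"
    by (rule filterlim_compose[OF I]) real_asymp
  then have "((\<lambda>T. integral {c..0} g + integral {0..T + a} g - integral {c..a} g) \<longlongrightarrow> integral {c..0} g + I - integral {c..a} g) at_top"
    by (intro tendsto_intros)
  then show "((\<lambda>T. integral {0..T} (\<lambda>t. g (t + a))) \<longlongrightarrow> integral {c..0} g + I - integral {c..a} g) at_top"
    by (rule Lim_transform_eventually)
       (use eventually_ge_at_top[of 0] eventually_ge_at_top[of "-a"] in eventually_elim, simp add: eq)
qed

lemma improper_integral_shift_derivative:
  fixes g :: "real \<Rightarrow> 'b::banach"
  assumes g: "continuous_on UNIV g" and I: "((\<lambda>T. integral {0..T} g) \<longlongrightarrow> I) at_top"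
  shows "((\<lambda>a. improper_integral (\<lambda>t. g (t + a))) has_vector_derivative - g a) (at a)"
proof -
  \<comment> \<open>Subtracting 1 makes \<open>a\<close> an interior point of
    \<open>{c..a+1}\<close>, so that the derivative within this interval is two-sided.\<close>
  define c where "c = min a 0 - 1"
  have "((\<lambda>u. integral {c..u} g) has_vector_derivative g a) (at a within {c..a+1})"
    by (rule integral_has_vector_derivative) (auto intro: continuous_on_subset[OF g] simp: c_def)
  moreover have "at a within {c..a+1} = at a" by (rule at_within_interior) (auto simp: c_def)
  ultimately have "((\<lambda>u. integral {c..u} g) has_vector_derivative g a) (at a)" by simp
  then have "((\<lambda>u. integral {c..0} g + I - integral {c..u} g) has_vector_derivative 0 - g a) (at a)"
    by (intro has_vector_derivative_diff) auto
  then have "((\<lambda>u. integral {c..0} g + I - integral {c..u} g) has_vector_derivative - g a) (at a)" by simp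
  then show ?thesis
    by (rule has_vector_derivative_cong_open[of "{c<..}", rotated 3])
       (simp_all add: c_def improper_integral_shift[OF g I, of c, unfolded c_def])
qed

lemma improper_integral_linear:
  fixes g :: "real \<Rightarrow> 'b::banach" and L :: "'b \<Rightarrow> 'c::banach"
  assumes g: "continuous_on {0..} g" and L: "bounded_linear L"
    and lim: "((\<lambda>T. integral {0..T} g) \<longlongrightarrow> I) at_top"
  shows "((\<lambda>T. integral {0..T} (\<lambda>t. L (g t))) \<longlongrightarrow> L I) at_top"
proof -
  have "integral {0..T} (\<lambda>t. L (g t)) = L (integral {0..T} g)" for T
  proof -
    have "continuous_on {0..T} g" by (rule continuous_on_subset[OF g]) auto
    from integral_linear[OF integrable_continuous_interval[OF this] L] show ?thesis by (simp add: o_def)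
  qed
  then show ?thesis using bounded_linear.tendsto[OF L lim] by simp
qed

section \<open>Hoelder maps for a bounded distance function\<close>

definition holder_on :: "'m set \<Rightarrow> ('m \<Rightarrow> 'm \<Rightarrow> real) \<Rightarrow> ('m \<Rightarrow> 'b::real_normed_vector) \<Rightarrow> bool" where
  "holder_on K d h \<longleftrightarrow> (\<exists>\<alpha> C. 0 < \<alpha> \<and> \<alpha> \<le> 1 \<and> 0 \<le> C \<and>
     (\<forall>p\<in>K. \<forall>q\<in>K. norm (h p - h q) \<le> C * d p q powr \<alpha>))"

text \<open>The bound by 1 allows Hoelder exponents to be lowered.\<close>

locale distance_on =
  fixes K :: "'m::topological_space set" and d :: "'m \<Rightarrow> 'm \<Rightarrow> real"
  assumes d_range: "p \<in> K \<Longrightarrow> q \<in> K \<Longrightarrow> 0 \<le> d p q \<and> d p q \<le> 1"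
    and d_self: "p \<in> K \<Longrightarrow> d p p = 0"
    and d_cont: "continuous_on (K \<times> K) (\<lambda>(p, q). d p q)"
begin

lemma holder_onI:
  assumes "0 < \<alpha>" "\<And>p q. p \<in> K \<Longrightarrow> q \<in> K \<Longrightarrow> norm (h p - h q) \<le> C * d p q powr \<alpha>"
  shows "holder_on K d h"
proof -
  have "norm (h p - h q) \<le> max C 0 * d p q powr min \<alpha> 1" if "p \<in> K" "q \<in> K" for p q
  proof -
    have "d p q powr \<alpha> \<le> d p q powr min \<alpha> 1"
      using d_range[OF that] by (intro powr_mono') auto
    then have "C * d p q powr \<alpha> \<le> max C 0 * d p q powr min \<alpha> 1"
      by (intro mult_mono) auto
    then show ?thesis using assms(2)[OF that] by linarith
  qed
  then show ?thesis unfolding holder_on_def using assms(1)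
    by (intro exI[of _ "min \<alpha> 1"] exI[of _ "max C 0"]) auto
qed

lemma holder_on_lipschitz:
  assumes "\<And>p q. p \<in> K \<Longrightarrow> q \<in> K \<Longrightarrow> norm (h p - h q) \<le> C * d p q"
  shows "holder_on K d h"
  by (rule holder_onI[of 1 h C]) (use assms d_range in auto)

lemma holder_on_cong: "holder_on K d h \<Longrightarrow> (\<And>p. p \<in> K \<Longrightarrow> h p = k p) \<Longrightarrow> holder_on K d k"
  unfolding holder_on_def by auto

lemma holder_on_bounded:
  fixes h :: "'m \<Rightarrow> 'b::real_normed_vector"
  assumes "holder_on K d h"
  obtains M where "M \<ge> 0" "\<And>p. p \<in> K \<Longrightarrow> norm (h p) \<le> M"
proof (cases "K = {}")
  case False
  then obtain q where q: "q \<in> K" by blast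
  from assms obtain \<alpha> C where h: "0 < \<alpha>" "0 \<le> C" "\<And>p q. p \<in> K \<Longrightarrow> q \<in> K \<Longrightarrow> norm (h p - h q) \<le> C * d p q powr \<alpha>"
    unfolding holder_on_def by blast
  have "norm (h p) \<le> C + norm (h q)" if "p \<in> K" for p
  proof -
    have "d p q powr \<alpha> \<le> 1" using d_range[OF that q] h(1) by (intro powr_le1) auto
    then have "C * d p q powr \<alpha> \<le> C" using h(2) by (simp add: mult_left_le)
    with h(3)[OF that q] show ?thesis using norm_triangle_sub[of "h p" "h q"] by linarith
  qed
  then show ?thesis using that[of "C + norm (h q)"] h(2) by auto
qed (use that in auto)

lemma holder_on_continuous:
  assumes "holder_on K d h"
  shows "continuous_on K h"
  unfolding continuous_on_def
proof
  fix p assume p: "p \<in> K"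
  from assms obtain \<alpha> C where h: "0 < \<alpha>" "\<And>p q. p \<in> K \<Longrightarrow> q \<in> K \<Longrightarrow> norm (h p - h q) \<le> C * d p q powr \<alpha>"
    unfolding holder_on_def by blast
  have "continuous_on K (\<lambda>q. d q p)"
    using continuous_on_compose2[OF d_cont, of K "\<lambda>q. (q, p)"] p by (force intro: continuous_on_Pair continuous_on_const continuous_on_id)
  then have "((\<lambda>q. d q p) \<longlongrightarrow> d p p) (at p within K)" using p by (simp add: continuous_on_def)
  then have "((\<lambda>q. d q p) \<longlongrightarrow> 0) (at p within K)" using d_self[OF p] by simp
  moreover have inK: "\<forall>\<^sub>F q in at p within K. q \<in> K" by (simp add: eventually_at_filter)
  moreover have "\<forall>\<^sub>F q in at p within K. 0 \<le> d q p" using inK by eventually_elim (use d_range p in blast)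
  ultimately have "((\<lambda>q. C * d q p powr \<alpha>) \<longlongrightarrow> C * 0 powr \<alpha>) (at p within K)"
    using h(1) by (intro tendsto_mult_left tendsto_powr2 tendsto_const)
  then have "((\<lambda>q. C * d q p powr \<alpha>) \<longlongrightarrow> 0) (at p within K)" using h(1) by simp
  moreover have "\<forall>\<^sub>F q in at p within K. norm (h q - h p) \<le> C * d q p powr \<alpha>"
    using inK by eventually_elim (rule h(2)[OF _ p])
  ultimately have "((\<lambda>q. h q - h p) \<longlongrightarrow> 0) (at p within K)" by (rule Lim_null_comparison[rotated])
  then show "(h \<longlongrightarrow> h p) (at p within K)" by (simp add: LIM_zero_iff)
qed

lemma holder_on_bilinear:
  assumes "bounded_bilinear pr" "holder_on K d a" "holder_on K d b"
  shows "holder_on K d (\<lambda>p. pr (a p) (b p))"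
proof -
  interpret bounded_bilinear pr by fact
  from nonneg_bounded obtain N where N: "N \<ge> 0" "\<And>x y. norm (pr x y) \<le> norm x * norm y * N" by blast
  obtain \<alpha> C where a: "0 < \<alpha>" "0 \<le> C" "\<And>p q. p \<in> K \<Longrightarrow> q \<in> K \<Longrightarrow> norm (a p - a q) \<le> C * d p q powr \<alpha>"
    using assms(2) unfolding holder_on_def by blast
  obtain \<beta> D where b: "0 < \<beta>" "0 \<le> D" "\<And>p q. p \<in> K \<Longrightarrow> q \<in> K \<Longrightarrow> norm (b p - b q) \<le> D * d p q powr \<beta>"
    using assms(3) unfolding holder_on_def by blast
  obtain Ma where Ma: "Ma \<ge> 0" "\<And>p. p \<in> K \<Longrightarrow> norm (a p) \<le> Ma" using holder_on_bounded[OF assms(2)] by blast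
  obtain Mb where Mb: "Mb \<ge> 0" "\<And>p. p \<in> K \<Longrightarrow> norm (b p) \<le> Mb" using holder_on_bounded[OF assms(3)] by blast
  show ?thesis
  proof (rule holder_onI[of "min \<alpha> \<beta>"])
    fix p q assume pq: "p \<in> K" "q \<in> K"
    let ?e = "d p q powr min \<alpha> \<beta>"
    have e: "d p q powr \<alpha> \<le> ?e" "d p q powr \<beta> \<le> ?e" using d_range[OF pq] by (auto intro!: powr_mono')
    have ae: "norm (a p - a q) \<le> C * ?e" "norm (b p - b q) \<le> D * ?e"
      using a(3)[OF pq] b(3)[OF pq] mult_left_mono[OF e(1) a(2)] mult_left_mono[OF e(2) b(2)] by linarith+
    have 1: "norm (pr (a p - a q) (b p)) \<le> (C * ?e) * Mb * N"
      by (rule order_trans[OF N(2)]) (intro mult_right_mono mult_mono ae Mb pq a N mult_nonneg_nonneg; simp)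
    have 2: "norm (pr (a q) (b p - b q)) \<le> Ma * (D * ?e) * N"
      by (rule order_trans[OF N(2)]) (intro mult_right_mono mult_mono ae Ma pq b N mult_nonneg_nonneg; simp)
    have "pr (a p) (b p) - pr (a q) (b q) = pr (a p - a q) (b p) + pr (a q) (b p - b q)"
      by (simp add: diff_left diff_right)
    also have "norm \<dots> \<le> (C * ?e) * Mb * N + Ma * (D * ?e) * N"
      using norm_triangle_ineq 1 2 by (meson add_mono order_trans)
    finally show "norm (pr (a p) (b p) - pr (a q) (b q)) \<le> (C * Mb * N + Ma * D * N) * ?e"
      by (simp add: algebra_simps)
  qed (use a b in auto)
qed

lemma holder_on_linear:
  assumes "bounded_linear L" "holder_on K d a"
  shows "holder_on K d (\<lambda>p. L (a p))"
proof -
  obtain N where N: "N \<ge> 0" "\<And>x. norm (L x) \<le> norm x * N"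
    using bounded_linear.nonneg_bounded[OF assms(1)] by blast
  obtain \<alpha> C where a: "0 < \<alpha>" "0 \<le> C" "\<And>p q. p \<in> K \<Longrightarrow> q \<in> K \<Longrightarrow> norm (a p - a q) \<le> C * d p q powr \<alpha>"
    using assms(2) unfolding holder_on_def by blast
  show ?thesis
  proof (rule holder_onI[of \<alpha> _ "C * N"])
    fix p q assume "p \<in> K" "q \<in> K"
    then have "norm (a p - a q) * N \<le> C * d p q powr \<alpha> * N" using a(3) N(1) by (intro mult_right_mono) auto
    then show "norm (L (a p) - L (a q)) \<le> C * N * d p q powr \<alpha>"
      using N(2)[of "a p - a q"] by (simp add: linear_diff[OF bounded_linear.linear[OF assms(1)]] mult_ac)
  qed (use a in auto)
qed

lemma holder_on_add:
  assumes "holder_on K d a" "holder_on K d b"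
  shows "holder_on K d (\<lambda>p. a p + b p)"
proof -
  obtain \<alpha> C where a: "0 < \<alpha>" "0 \<le> C" "\<And>p q. p \<in> K \<Longrightarrow> q \<in> K \<Longrightarrow> norm (a p - a q) \<le> C * d p q powr \<alpha>"
    using assms(1) unfolding holder_on_def by blast
  obtain \<beta> D where b: "0 < \<beta>" "0 \<le> D" "\<And>p q. p \<in> K \<Longrightarrow> q \<in> K \<Longrightarrow> norm (b p - b q) \<le> D * d p q powr \<beta>"
    using assms(2) unfolding holder_on_def by blast
  show ?thesis
  proof (rule holder_onI[of "min \<alpha> \<beta>"])
    fix p q assume pq: "p \<in> K" "q \<in> K"
    let ?e = "d p q powr min \<alpha> \<beta>"
    have e: "d p q powr \<alpha> \<le> ?e" "d p q powr \<beta> \<le> ?e" using d_range[OF pq] by (auto intro!: powr_mono')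
    have "norm (a p - a q) \<le> C * ?e" "norm (b p - b q) \<le> D * ?e"
      using a(3)[OF pq] b(3)[OF pq] mult_left_mono[OF e(1) a(2)] mult_left_mono[OF e(2) b(2)] by linarith+
    moreover have "norm (a p + b p - (a q + b q)) \<le> norm (a p - a q) + norm (b p - b q)"
      by (simp add: add_diff_add norm_triangle_ineq)
    ultimately show "norm (a p + b p - (a q + b q)) \<le> (C + D) * ?e" by (simp add: algebra_simps)
  qed (use a b in auto)
qed

lemma holder_on_minus: "holder_on K d a \<Longrightarrow> holder_on K d (\<lambda>p. - a p)"
  using holder_on_linear[OF bounded_linear_minus[OF bounded_linear_ident]] .

lemma holder_on_diff: "holder_on K d a \<Longrightarrow> holder_on K d b \<Longrightarrow> holder_on K d (\<lambda>p. a p - b p)"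
  using holder_on_add[OF _ holder_on_minus, of a b] by simp

text \<open>A bound by \<open>\<theta>\<^sup>n + M\<^sup>n d\<close> for every \<open>n\<close> is a Hoelder bound: take \<open>n\<close> about
  \<open>- log\<^sub>M d / 2\<close>.\<close>

lemma geometric_tradeoff:
  fixes e C \<theta> M :: real
  assumes "0 < \<theta>" "\<theta> < 1" "1 < M" "0 \<le> C"
  shows "\<exists>\<alpha>>0. \<forall>e D. 0 \<le> e \<longrightarrow> e \<le> 1 \<longrightarrow> (\<forall>n::nat. D \<le> C * (\<theta> ^ n + M ^ n * e)) \<longrightarrow> D \<le> C * (1 / \<theta> + 1) * e powr \<alpha>"
proof -
  \<comment> \<open>For \<open>x = - ln e / (2 ln M)\<close> one has \<open>M^x e = e^(1/2)\<close>
    and \<open>\<theta>^x = e^\<beta>\<close>. The smaller of the two exponents survives.\<close>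
  define \<beta> where "\<beta> = - ln \<theta> / (2 * ln M)"
  have lM: "ln M > 0" using assms by simp
  have l\<theta>: "ln \<theta> < 0" using assms by simp
  have \<beta>: "\<beta> > 0" unfolding \<beta>_def using lM l\<theta> by (intro divide_pos_pos) auto
  define \<alpha> where "\<alpha> = min \<beta> (1/2)"
  have "D \<le> C * (1 / \<theta> + 1) * e powr \<alpha>"
    if e: "0 \<le> e" "e \<le> 1" and D: "\<And>n::nat. D \<le> C * (\<theta> ^ n + M ^ n * e)" for e D
  proof (cases "e = 0")
    case True
    have "(\<lambda>n. C * (\<theta> ^ n + M ^ n * e)) \<longlonglongrightarrow> C * (0 + 0)"
      unfolding True using assms by (intro tendsto_intros) (auto intro: LIMSEQ_power_zero)
    then have "D \<le> C * (0 + 0)" by (rule tendsto_lowerbound) (use D in \<open>auto intro: always_eventually\<close>)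
    then show ?thesis using True \<beta> by simp
  next
    case False
    then have e0: "e > 0" using e by simp
    define x where "x = - ln e / (2 * ln M)"
    have x: "x \<ge> 0" unfolding x_def using e e0 lM by (intro divide_nonneg_pos) auto
    \<comment> \<open>Rounding down keeps the growing term below its value at \<open>x\<close>; in
      the decaying term it costs at most one factor \<open>1 / \<theta>\<close>, the origin of that
      constant in the statement.\<close>
    define n where "n = nat \<lfloor>x\<rfloor>"
    have n: "real n \<le> x" "x < real n + 1" using x by (auto simp: n_def)
    have "M ^ n * e = exp (real n * ln M + ln e)" using assms e0 by (simp add: exp_add exp_of_nat_mult)
    also have "\<dots> \<le> exp (x * ln M + ln e)" using n lM by simp
    also have "x * ln M + ln e = ln e / 2" using lM by (simp add: x_def field_simps)
    also have "exp (ln e / 2) = e powr (1/2)" using e0 by (simp add: powr_def)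
    also have "\<dots> \<le> e powr \<alpha>" using e e0 by (intro powr_mono') (auto simp: \<alpha>_def)
    finally have 1: "M ^ n * e \<le> e powr \<alpha>" .
    have "\<theta> ^ n = exp (real n * ln \<theta>)" using assms by (simp add: exp_of_nat_mult)
    also have "\<dots> \<le> exp ((x - 1) * ln \<theta>)" using n l\<theta> by (simp add: mult_right_mono_neg)
    also have "(x - 1) * ln \<theta> = \<beta> * ln e - ln \<theta>" using lM by (simp add: x_def \<beta>_def field_simps)
    also have "exp (\<beta> * ln e - ln \<theta>) = e powr \<beta> / \<theta>" using e0 assms by (simp add: exp_diff powr_def)
    also have "\<dots> \<le> e powr \<alpha> / \<theta>"
      using e e0 assms by (intro divide_right_mono powr_mono') (auto simp: \<alpha>_def)
    finally have 2: "\<theta> ^ n \<le> e powr \<alpha> / \<theta>" .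
    have "D \<le> C * (\<theta> ^ n + M ^ n * e)" by (rule D)
    also have "\<dots> \<le> C * (e powr \<alpha> / \<theta> + e powr \<alpha>)" using 1 2 assms by (intro mult_left_mono add_mono) auto
    finally show ?thesis by (simp add: algebra_simps)
  qed
  moreover have "\<alpha> > 0" using \<beta> by (simp add: \<alpha>_def)
  ultimately show ?thesis by blast
qed

lemma geometric_tradeoff_bound:
  assumes "0 < \<theta>" "\<theta> < 1" "1 < M" "0 \<le> C"
    and "\<And>(n::nat) p q. p \<in> K \<Longrightarrow> q \<in> K \<Longrightarrow> D p q \<le> C * (\<theta> ^ n + M ^ n * d p q)"
  shows "\<exists>\<alpha>>0. \<forall>p\<in>K. \<forall>q\<in>K. D p q \<le> C * (1 / \<theta> + 1) * d p q powr \<alpha>"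
proof -
  obtain \<alpha> where \<alpha>: "\<alpha> > 0" "\<And>e D. 0 \<le> e \<Longrightarrow> e \<le> 1 \<Longrightarrow> (\<And>n::nat. D \<le> C * (\<theta> ^ n + M ^ n * e)) \<Longrightarrow> D \<le> C * (1 / \<theta> + 1) * e powr \<alpha>"
    using geometric_tradeoff[OF assms(1-4)] by auto
  then show ?thesis using assms(5) d_range by (intro exI[of _ \<alpha>]) auto
qed

end

section \<open>Hyperbolic cocycles\<close>

text \<open>\<open>B t p\<close> stands for the linearised flow, read in a Banach space into which all tangent spaces
  are embedded. Hence \<open>B 0 p\<close> is the projection onto the image of the tangent space at \<open>p\<close>, not
  the identity.\<close>

locale hyperbolic_cocycle = distance_on K d
  for K :: "'m::t2_space set" and d :: "'m \<Rightarrow> 'm \<Rightarrow> real" +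
  fixes f :: "real \<Rightarrow> 'm \<Rightarrow> 'm" and B :: "real \<Rightarrow> 'm \<Rightarrow> 'b::banach \<Rightarrow>\<^sub>L 'b"
    and Qs Qu Qc :: "'m \<Rightarrow> 'b \<Rightarrow>\<^sub>L 'b" and Fh :: "'m \<Rightarrow> 'b" and \<Lambda> C \<kappa> :: real
  assumes f_in: "p \<in> K \<Longrightarrow> f t p \<in> K"
    and f_add: "p \<in> K \<Longrightarrow> f (s + t) p = f s (f t p)"
    and f_0: "p \<in> K \<Longrightarrow> f 0 p = p"
    and f_cont: "continuous_on (UNIV \<times> K) (\<lambda>(t, p). f t p)"
    and B_cont: "continuous_on (UNIV \<times> K) (\<lambda>(t, p). B t p)"
    and \<Lambda>: "1 \<le> \<Lambda>" and C: "0 \<le> C" and \<kappa>: "0 < \<kappa>"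
    and d_lip: "\<lbrakk>p \<in> K; q \<in> K; \<bar>t\<bar> \<le> 1\<rbrakk> \<Longrightarrow> d (f t p) (f t q) \<le> \<Lambda> * d p q"
    and B_lip: "\<lbrakk>p \<in> K; q \<in> K; \<bar>t\<bar> \<le> 1\<rbrakk> \<Longrightarrow> norm (B t p - B t q) \<le> \<Lambda> * d p q"
    and B_le: "\<lbrakk>p \<in> K; \<bar>t\<bar> \<le> 1\<rbrakk> \<Longrightarrow> norm (B t p) \<le> \<Lambda>"
    and B_add: "p \<in> K \<Longrightarrow> B (s + t) p = B s (f t p) o\<^sub>L B t p"
    and B_Qs: "p \<in> K \<Longrightarrow> B t p o\<^sub>L Qs p = Qs (f t p) o\<^sub>L B t p"
    and B_Qu: "p \<in> K \<Longrightarrow> B t p o\<^sub>L Qu p = Qu (f t p) o\<^sub>L B t p"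
    and B_0: "p \<in> K \<Longrightarrow> B 0 p = Qs p + Qu p + Qc p"
    and Q_idem: "p \<in> K \<Longrightarrow> Qs p o\<^sub>L Qs p = Qs p" "p \<in> K \<Longrightarrow> Qu p o\<^sub>L Qu p = Qu p" "p \<in> K \<Longrightarrow> Qc p o\<^sub>L Qc p = Qc p"
    and Q_zero: "p \<in> K \<Longrightarrow> Qs p o\<^sub>L Qu p = 0" "p \<in> K \<Longrightarrow> Qs p o\<^sub>L Qc p = 0" "p \<in> K \<Longrightarrow> Qu p o\<^sub>L Qs p = 0"
      "p \<in> K \<Longrightarrow> Qu p o\<^sub>L Qc p = 0" "p \<in> K \<Longrightarrow> Qc p o\<^sub>L Qs p = 0" "p \<in> K \<Longrightarrow> Qc p o\<^sub>L Qu p = 0"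
    and Qs_decay: "p \<in> K \<Longrightarrow> 0 \<le> t \<Longrightarrow> norm (B t p o\<^sub>L Qs p) \<le> C * exp (- \<kappa> * t)"
    and Qu_decay: "p \<in> K \<Longrightarrow> 0 \<le> t \<Longrightarrow> norm (B (- t) p o\<^sub>L Qu p) \<le> C * exp (- \<kappa> * t)"
    and Qc_bound: "p \<in> K \<Longrightarrow> norm (B t p o\<^sub>L Qc p) \<le> C"
    and Qc_range: "p \<in> K \<Longrightarrow> \<exists>c. \<bar>c\<bar> \<le> C * norm w \<and> Qc p w = c *\<^sub>R Fh p"
    and Q_Fh: "p \<in> K \<Longrightarrow> Qs p (Fh p) = 0" "p \<in> K \<Longrightarrow> Qu p (Fh p) = 0"
    and Fh_lip: "\<lbrakk>p \<in> K; q \<in> K\<rbrakk> \<Longrightarrow> norm (Fh p - Fh q) \<le> \<Lambda> * d p q"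
begin

lemma f_minus: "p \<in> K \<Longrightarrow> f (- t) (f t p) = p" "p \<in> K \<Longrightarrow> f t (f (- t) p) = p"
  using f_add[of p "-t" t] f_add[of p t "-t"] by (simp_all add: f_0)

lemma blinfun_compose_add_left: "(a + b) o\<^sub>L c = (a o\<^sub>L c) + (b o\<^sub>L c)"
  and blinfun_compose_add_right: "c' o\<^sub>L (a + b) = (c' o\<^sub>L a) + (c' o\<^sub>L b)"
  and blinfun_compose_diff_left: "(a - b) o\<^sub>L c = (a o\<^sub>L c) - (b o\<^sub>L c)"
  and blinfun_compose_diff_right: "c' o\<^sub>L (a - b) = (c' o\<^sub>L a) - (c' o\<^sub>L b)"
  by (simp_all add: blinfun_eqI blinfun.bilinear_simps)

lemmas blinfun_compose_bilinear = blinfun_compose_add_left blinfun_compose_add_right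
  blinfun_compose_diff_left blinfun_compose_diff_right

lemma blinfun_compose_assoc: "(a o\<^sub>L b) o\<^sub>L c = a o\<^sub>L (b o\<^sub>L c)"
  by (simp add: blinfun_eqI)

lemma B_0_Q:
  assumes "p \<in> K"
  shows "B 0 p o\<^sub>L Qs p = Qs p" "B 0 p o\<^sub>L Qu p = Qu p" "B 0 p o\<^sub>L Qc p = Qc p"
    "Qs p o\<^sub>L B 0 p = Qs p" "Qu p o\<^sub>L B 0 p = Qu p" "Qc p o\<^sub>L B 0 p = Qc p"
  using assms by (simp_all add: B_0 blinfun_compose_bilinear Q_idem Q_zero)

lemma B_B_0: "p \<in> K \<Longrightarrow> B t p o\<^sub>L B 0 p = B t p" "p \<in> K \<Longrightarrow> B 0 (f t p) o\<^sub>L B t p = B t p"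
  using B_add[of p t 0] B_add[of p 0 t] by (simp_all add: f_0)

lemma B_Qc: "p \<in> K \<Longrightarrow> B t p o\<^sub>L Qc p = Qc (f t p) o\<^sub>L B t p"
proof -
  assume p: "p \<in> K"
  have "B t p o\<^sub>L (Qs p + Qu p + Qc p) = (Qs (f t p) + Qu (f t p) + Qc (f t p)) o\<^sub>L B t p"
    using B_B_0[OF p, of t] by (simp add: B_0 p f_in)
  then show ?thesis by (simp add: blinfun_compose_bilinear B_Qs[OF p] B_Qu[OF p])
qed

text \<open>The product rule for differences along \<open>s + t'\<close> yields two terms, each at
  most \<open>\<Lambda>^2 (2 \<Lambda>^2)^n d\<close>; the 2 in the base absorbs their sum. The norm
  bounds carry the exponent \<open>n + 1\<close> because already \<open>B 0 p\<close> is bounded by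
  \<Lambda> only, not by 1.\<close>

lemma growth:
  fixes n :: nat
  assumes "p \<in> K" "q \<in> K" "\<bar>t\<bar> \<le> real n"
  shows "d (f t p) (f t q) \<le> \<Lambda> ^ n * d p q \<and> norm (B t p) \<le> \<Lambda> ^ (n + 1) \<and> norm (B t q) \<le> \<Lambda> ^ (n + 1) \<and>
    norm (B t p - B t q) \<le> \<Lambda> * (2 * \<Lambda>\<^sup>2) ^ n * d p q"
  using assms(3)
proof (induction n arbitrary: t)
  case 0
  then show ?case using assms B_lip[of p q 0] B_le[of p 0] B_le[of q 0] f_0 by simp
next
  case (Suc n)
  \<comment> \<open>A proportional split works for either sign of \<open>t\<close>: the last piece
    has length at most 1 and the rest at most \<open>n\<close>.\<close>
  define t' s where "t' = t * n / (n + 1)" and "s = t / (n + 1)"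
  have t: "t = s + t'"
  proof -
    have "s + t' = (t + t * n) / (n + 1)" by (simp add: t'_def s_def add_divide_distrib)
    also have "t + t * n = t * (n + 1)" by (simp add: algebra_simps)
    finally show ?thesis by simp
  qed
  have s: "\<bar>s\<bar> \<le> 1" using Suc.prems by (simp add: s_def field_simps)
  have "\<bar>t'\<bar> = \<bar>t\<bar> * n / (n + 1)" by (simp add: t'_def abs_mult)
  also have "\<dots> \<le> (real n + 1) * n / (n + 1)"
    using Suc.prems by (intro divide_right_mono mult_right_mono) auto
  also have "\<dots> = n" by (simp add: add.commute)
  finally have t': "\<bar>t'\<bar> \<le> n" .
  let ?p = "f t' p" and ?q = "f t' q"
  have K: "?p \<in> K" "?q \<in> K" using assms f_in by auto
  note IH = Suc.IH[OF t']
  have \<Lambda>0: "\<Lambda> \<ge> 0" using \<Lambda> by simp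
  have d0: "d p q \<ge> 0" using d_range assms by blast
  have 1: "d (f t p) (f t q) \<le> \<Lambda> ^ Suc n * d p q"
    using d_lip[OF K s] mult_left_mono[OF conjunct1[OF IH] \<Lambda>0] by (simp add: t f_add assms mult_ac)
  have "norm (B t p) \<le> norm (B s ?p) * norm (B t' p)"
    by (simp add: t B_add assms norm_blinfun_compose)
  also have "\<dots> \<le> \<Lambda> * \<Lambda> ^ (n + 1)" using IH B_le[OF K(1) s] \<Lambda>0 by (intro mult_mono) auto
  finally have 2: "norm (B t p) \<le> \<Lambda> ^ (Suc n + 1)" by simp
  have "norm (B t q) \<le> norm (B s ?q) * norm (B t' q)"
    by (simp add: t B_add assms norm_blinfun_compose)
  also have "\<dots> \<le> \<Lambda> * \<Lambda> ^ (n + 1)" using IH B_le[OF K(2) s] \<Lambda>0 by (intro mult_mono) auto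
  finally have 3: "norm (B t q) \<le> \<Lambda> ^ (Suc n + 1)" by simp
  have "B t p - B t q = (B s ?p o\<^sub>L (B t' p - B t' q)) + ((B s ?p - B s ?q) o\<^sub>L B t' q)"
    by (simp add: t B_add assms blinfun_compose_bilinear)
  also have "norm \<dots> \<le> norm (B s ?p) * norm (B t' p - B t' q) + norm (B s ?p - B s ?q) * norm (B t' q)"
    by (intro order_trans[OF norm_triangle_ineq] add_mono norm_blinfun_compose)
  also have "\<dots> \<le> \<Lambda> * (\<Lambda> * (2 * \<Lambda>\<^sup>2) ^ n * d p q) + (\<Lambda> * (\<Lambda> ^ n * d p q)) * \<Lambda> ^ (n + 1)"
    using IH B_le[OF K(1) s] \<Lambda>0 d0 order_trans[OF B_lip[OF K s] mult_left_mono[OF conjunct1[OF IH] \<Lambda>0]]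
    by (intro add_mono mult_mono) auto
  also have "\<dots> = (\<Lambda>\<^sup>2 * (2 * \<Lambda>\<^sup>2) ^ n + \<Lambda>\<^sup>2 * (\<Lambda>\<^sup>2) ^ n) * d p q"
    by (simp add: power_mult[symmetric] power2_eq_square algebra_simps power_add[symmetric] mult_2)
  also have "\<dots> \<le> (\<Lambda>\<^sup>2 * (2 * \<Lambda>\<^sup>2) ^ n + \<Lambda>\<^sup>2 * (2 * \<Lambda>\<^sup>2) ^ n) * d p q"
    using d0 by (intro mult_right_mono add_mono mult_left_mono power_mono) auto
  also have "\<dots> = 1 * (2 * \<Lambda>\<^sup>2) ^ Suc n * d p q" by simp
  also have "\<dots> \<le> \<Lambda> * (2 * \<Lambda>\<^sup>2) ^ Suc n * d p q"
    using d0 \<Lambda> by (intro mult_right_mono) auto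
  finally show ?case using 1 2 3 by simp
qed

text \<open>Conjugating with the flow for time \<open>\<sigma> n\<close> writes \<open>Q2 p\<close>
  as \<open>B (-\<sigma> n) Q2 B (\<sigma> n)\<close>, where the first two factors together are
  bounded by hypothesis. On the image of \<open>Q1 q\<close> the last factor is compared with
  \<open>B (\<sigma> n) q\<close>, which contracts this image exponentially; the comparison costs
  \<open>d p q\<close> times an exponential in \<open>n\<close>. Balancing the two gives a Hoelder
  bound. The sign \<sigma> treats stable and unstable directions together.\<close>

lemma cross_term:
  assumes \<sigma>: "\<sigma> = 1 \<or> \<sigma> = - 1"
    and Q1: "\<And>p t. p \<in> K \<Longrightarrow> 0 \<le> t \<Longrightarrow> norm (B (\<sigma> * t) p o\<^sub>L Q1 p) \<le> C1 * exp (- \<kappa> * t)"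
    and Q1_bound: "\<And>p. p \<in> K \<Longrightarrow> norm (Q1 p) \<le> C1"
    and Q2: "\<And>p t. p \<in> K \<Longrightarrow> 0 \<le> t \<Longrightarrow> norm (B (- \<sigma> * t) p o\<^sub>L Q2 p) \<le> C2"
    and Q2_eq: "\<And>p t. p \<in> K \<Longrightarrow> B t p o\<^sub>L Q2 p = Q2 (f t p) o\<^sub>L B t p"
    and Q2_0: "\<And>p. p \<in> K \<Longrightarrow> Q2 p o\<^sub>L B 0 p = Q2 p"
  shows "\<exists>\<alpha>>0. \<exists>D. \<forall>p\<in>K. \<forall>q\<in>K. norm (Q2 p o\<^sub>L Q1 q) \<le> D * d p q powr \<alpha>"
proof (cases "K = {}")
  case False
  then have C1: "C1 \<ge> 0" and C2: "C2 \<ge> 0"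
    using Q1_bound Q2[of _ 0] by (metis all_not_in_conv norm_ge_zero order_trans order_refl)+
  have "norm (Q2 p o\<^sub>L Q1 q) \<le> C2 * C1 * \<Lambda> * (exp (- \<kappa>) ^ n + (2 * \<Lambda>\<^sup>2) ^ n * d p q)"
    if pq: "p \<in> K" "q \<in> K" for p q and n :: nat
  proof -
    let ?t = "\<sigma> * real n" and ?y = "f (\<sigma> * real n) p"
    have y: "?y \<in> K" using pq f_in by blast
    have "Q2 p = Q2 p o\<^sub>L (B (- ?t) ?y o\<^sub>L B ?t p)"
      using B_add[OF pq(1), of "- ?t" ?t] Q2_0[OF pq(1)] by simp
    also have "\<dots> = (B (- ?t) ?y o\<^sub>L Q2 ?y) o\<^sub>L B ?t p"
      using Q2_eq[OF y, of "- ?t"] by (simp add: f_minus pq blinfun_compose_assoc)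
    finally have "Q2 p o\<^sub>L Q1 q = (B (- ?t) ?y o\<^sub>L Q2 ?y) o\<^sub>L (B ?t p o\<^sub>L Q1 q)"
      by (simp add: blinfun_compose_assoc)
    also have "B ?t p o\<^sub>L Q1 q = ((B ?t p - B ?t q) o\<^sub>L Q1 q) + (B ?t q o\<^sub>L Q1 q)"
      by (simp add: blinfun_compose_bilinear)
    finally have "Q2 p o\<^sub>L Q1 q = (B (- ?t) ?y o\<^sub>L Q2 ?y) o\<^sub>L (((B ?t p - B ?t q) o\<^sub>L Q1 q) + (B ?t q o\<^sub>L Q1 q))" .
    then have "norm (Q2 p o\<^sub>L Q1 q) \<le> norm (B (- ?t) ?y o\<^sub>L Q2 ?y) * (norm (B ?t p - B ?t q) * norm (Q1 q) + norm (B ?t q o\<^sub>L Q1 q))"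
      by (smt (verit) mult_left_mono norm_blinfun_compose norm_ge_zero norm_triangle_ineq)
    also have "\<dots> \<le> C2 * ((\<Lambda> * (2 * \<Lambda>\<^sup>2) ^ n * d p q) * C1 + C1 * exp (- \<kappa> * n))"
    proof (intro mult_mono add_mono)
      show "norm (B (- ?t) ?y o\<^sub>L Q2 ?y) \<le> C2" using Q2[OF y, of n] by simp
      have "\<bar>?t\<bar> \<le> real n" using \<sigma> by auto
      then show "norm (B ?t p - B ?t q) \<le> \<Lambda> * (2 * \<Lambda>\<^sup>2) ^ n * d p q" using growth[OF pq] by blast
      show "norm (B ?t q o\<^sub>L Q1 q) \<le> C1 * exp (- \<kappa> * n)" using Q1[OF pq(2), of n] by simp
    qed (use Q1_bound pq C1 C2 \<Lambda> d_range[OF pq] in auto)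
    also have "\<dots> \<le> C2 * ((\<Lambda> * (2 * \<Lambda>\<^sup>2) ^ n * d p q) * C1 + \<Lambda> * (C1 * exp (- \<kappa> * n)))"
    proof (intro mult_left_mono add_left_mono)
      show "C1 * exp (- \<kappa> * n) \<le> \<Lambda> * (C1 * exp (- \<kappa> * n))"
        using mult_right_mono[OF \<Lambda>, of "C1 * exp (- \<kappa> * n)"] C1 by simp
    qed (rule C2)
    also have "\<dots> = C2 * C1 * \<Lambda> * (exp (- \<kappa>) ^ n + (2 * \<Lambda>\<^sup>2) ^ n * d p q)"
      by (simp add: algebra_simps exp_of_nat_mult[symmetric])
    finally show ?thesis .
  qed
  moreover have "1 \<le> \<Lambda>\<^sup>2" using \<Lambda> by simp
  then have "1 < 2 * \<Lambda>\<^sup>2" by linarith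
  ultimately show ?thesis
    using geometric_tradeoff_bound[of "exp (- \<kappa>)" "2 * \<Lambda>\<^sup>2" "C2 * C1 * \<Lambda>" "\<lambda>p q. norm (Q2 p o\<^sub>L Q1 q)"] C1 C2 \<Lambda> \<kappa>
    by auto
qed (auto intro: exI[of _ 1])

lemma holder_B_0: "holder_on K d (B 0)"
  by (rule holder_on_lipschitz[of _ \<Lambda>]) (simp add: B_lip)

lemma holder_Fh: "holder_on K d Fh"
  by (rule holder_on_lipschitz[of _ \<Lambda>]) (simp add: Fh_lip)

text \<open>Every term on the right is small for \<open>p\<close> near \<open>q\<close>: two contain
  a difference of \<open>B 0\<close>, and the others multiply projections that belong to different
  points and different bundles. The product with \<open>Q2 q\<close> has \<open>Q1 p + Q3 p\<close>
  inserted in front because it is this sum, non-growing in the suitable time direction, to which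
  \<open>cross_term\<close> applies.\<close>

lemma projection_difference:
  assumes B0: "\<And>p. p \<in> K \<Longrightarrow> B 0 p = Q1 p + Q2 p + Q3 p"
    and Qp: "\<And>p. p \<in> K \<Longrightarrow> Q1 p o\<^sub>L B 0 p = Q1 p" "\<And>p. p \<in> K \<Longrightarrow> B 0 p o\<^sub>L Q1 p = Q1 p" "\<And>p. p \<in> K \<Longrightarrow> B 0 p o\<^sub>L Q2 p = Q2 p"
    and Q12: "\<And>p. p \<in> K \<Longrightarrow> Q1 p o\<^sub>L Q2 p = 0" "\<And>p. p \<in> K \<Longrightarrow> Q1 p o\<^sub>L Q1 p = Q1 p" "\<And>p. p \<in> K \<Longrightarrow> Q1 p o\<^sub>L Q3 p = 0"
    and pq: "p \<in> K" "q \<in> K"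
  shows "Q1 p - Q1 q = (Q1 p o\<^sub>L (B 0 p - B 0 q)) + ((B 0 p - B 0 q) o\<^sub>L Q1 q)
     - ((Q2 p + Q3 p) o\<^sub>L Q1 q) + (Q1 p o\<^sub>L ((Q1 p + Q3 p) o\<^sub>L Q2 q)) + (Q1 p o\<^sub>L Q3 q)"
proof -
  have 1: "Q1 p o\<^sub>L (B 0 p - B 0 q) = Q1 p - (Q1 p o\<^sub>L Q1 q) - (Q1 p o\<^sub>L Q2 q) - (Q1 p o\<^sub>L Q3 q)"
    using Qp(1)[OF pq(1)] B0[OF pq(2)] by (simp add: blinfun_compose_bilinear)
  have 2: "(B 0 p - B 0 q) o\<^sub>L Q1 q = (Q1 p o\<^sub>L Q1 q) + ((Q2 p + Q3 p) o\<^sub>L Q1 q) - Q1 q"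
    using Qp(2)[OF pq(2)] B0[OF pq(1)] by (simp add: blinfun_compose_bilinear)
  have 3: "Q1 p o\<^sub>L ((Q1 p + Q3 p) o\<^sub>L Q2 q) = Q1 p o\<^sub>L Q2 q"
    by (simp add: blinfun_compose_bilinear blinfun_compose_assoc[symmetric] Q12 pq)
  show ?thesis unfolding 1 2 3 by simp
qed

text \<open>The sum \<open>Q2 + Qc\<close> stays bounded under the cocycle in direction
  \<open>-\<sigma>\<close>, and \<open>Q1 + Qc\<close> in direction \<sigma>, each with bound
  \<open>2 * C\<close>; so \<open>cross_term\<close> controls both mixed products of
  \<open>projection_difference\<close>. The case \<sigma> = 1 yields the stable projection, the case
  -1 the unstable one.\<close>

lemma holder_projection:
  assumes \<sigma>: "\<sigma> = 1 \<or> \<sigma> = - 1"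
    and Q1: "\<And>p t. p \<in> K \<Longrightarrow> 0 \<le> t \<Longrightarrow> norm (B (\<sigma> * t) p o\<^sub>L Q1 p) \<le> C * exp (- \<kappa> * t)"
    and Q2: "\<And>p t. p \<in> K \<Longrightarrow> 0 \<le> t \<Longrightarrow> norm (B (- \<sigma> * t) p o\<^sub>L Q2 p) \<le> C * exp (- \<kappa> * t)"
    and eq: "\<And>p t. p \<in> K \<Longrightarrow> B t p o\<^sub>L Q1 p = Q1 (f t p) o\<^sub>L B t p" "\<And>p t. p \<in> K \<Longrightarrow> B t p o\<^sub>L Q2 p = Q2 (f t p) o\<^sub>L B t p"
    and B0: "\<And>p. p \<in> K \<Longrightarrow> B 0 p = Q1 p + Q2 p + Qc p"
    and Qp: "\<And>p. p \<in> K \<Longrightarrow> Q1 p o\<^sub>L B 0 p = Q1 p" "\<And>p. p \<in> K \<Longrightarrow> B 0 p o\<^sub>L Q1 p = Q1 p"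
      "\<And>p. p \<in> K \<Longrightarrow> Q2 p o\<^sub>L B 0 p = Q2 p" "\<And>p. p \<in> K \<Longrightarrow> B 0 p o\<^sub>L Q2 p = Q2 p"
    and Q12: "\<And>p. p \<in> K \<Longrightarrow> Q1 p o\<^sub>L Q2 p = 0" "\<And>p. p \<in> K \<Longrightarrow> Q1 p o\<^sub>L Q1 p = Q1 p" "\<And>p. p \<in> K \<Longrightarrow> Q1 p o\<^sub>L Qc p = 0"
    and QF: "\<And>p. p \<in> K \<Longrightarrow> Q1 p (Fh p) = 0"
  shows "holder_on K d Q1"
proof -
  have b1: "norm (Q1 p) \<le> C" if "p \<in> K" for p using Q1[OF that, of 0] Qp(2)[OF that] by simp
  have b2: "norm (Q2 p) \<le> C" if "p \<in> K" for p using Q2[OF that, of 0] Qp(4)[OF that] by simp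
  have expC: "C * exp (- \<kappa> * t) \<le> C" if "0 \<le> t" for t
    using that \<kappa> C by (simp add: mult_left_le)
  have "\<exists>\<alpha>>0. \<exists>D. \<forall>p\<in>K. \<forall>q\<in>K. norm ((Q2 p + Qc p) o\<^sub>L Q1 q) \<le> D * d p q powr \<alpha>"
  proof (rule cross_term[OF \<sigma> Q1 b1])
    fix p t assume "p \<in> K" "0 \<le> (t::real)"
    then have "norm (B (- \<sigma> * t) p o\<^sub>L Q2 p) + norm (B (- \<sigma> * t) p o\<^sub>L Qc p) \<le> 2 * C"
      using Q2[of p t] Qc_bound[of p "- \<sigma> * t"] expC[of t] by linarith
    then show "norm (B (- \<sigma> * t) p o\<^sub>L (Q2 p + Qc p)) \<le> 2 * C"
      unfolding blinfun_compose_bilinear by (rule order_trans[OF norm_triangle_ineq])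
  qed (simp_all add: blinfun_compose_bilinear eq B_Qc Qp B_0_Q)
  then obtain \<alpha> D where \<alpha>: "\<alpha> > 0" "\<And>p q. p \<in> K \<Longrightarrow> q \<in> K \<Longrightarrow> norm ((Q2 p + Qc p) o\<^sub>L Q1 q) \<le> D * d p q powr \<alpha>" by blast
  have "\<exists>\<alpha>>0. \<exists>D. \<forall>p\<in>K. \<forall>q\<in>K. norm ((Q1 p + Qc p) o\<^sub>L Q2 q) \<le> D * d p q powr \<alpha>"
  proof (rule cross_term[of "- \<sigma>", OF _ Q2 b2])
    fix p t assume "p \<in> K" "0 \<le> (t::real)"
    then have "norm (B (- (- \<sigma>) * t) p o\<^sub>L Q1 p) + norm (B (- (- \<sigma>) * t) p o\<^sub>L Qc p) \<le> 2 * C"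
      using Q1[of p t] Qc_bound[of p "\<sigma> * t"] expC[of t] by simp
    then show "norm (B (- (- \<sigma>) * t) p o\<^sub>L (Q1 p + Qc p)) \<le> 2 * C"
      unfolding blinfun_compose_bilinear by (rule order_trans[OF norm_triangle_ineq])
  qed (use \<sigma> in \<open>auto simp: blinfun_compose_bilinear eq B_Qc Qp B_0_Q\<close>)
  then obtain \<beta> E where \<beta>: "\<beta> > 0" "\<And>p q. p \<in> K \<Longrightarrow> q \<in> K \<Longrightarrow> norm ((Q1 p + Qc p) o\<^sub>L Q2 q) \<le> E * d p q powr \<beta>" by blast
  define \<gamma> where "\<gamma> = min 1 (min \<alpha> \<beta>)"
  show ?thesis
  proof (rule holder_onI[of \<gamma> _ "C * \<Lambda> + \<Lambda> * C + \<bar>D\<bar> + C * \<bar>E\<bar> + C * C * \<Lambda>"])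
    show "0 < \<gamma>" using \<alpha> \<beta> by (simp add: \<gamma>_def)
    fix p q assume pq: "p \<in> K" "q \<in> K"
    let ?e = "d p q powr \<gamma>"
    have e: "d p q \<le> ?e" "d p q powr \<alpha> \<le> ?e" "d p q powr \<beta> \<le> ?e"
      using d_range[OF pq] powr_mono'[of \<gamma> 1 "d p q"] powr_mono'[of \<gamma> \<alpha> "d p q"] powr_mono'[of \<gamma> \<beta> "d p q"]
      by (auto simp: \<gamma>_def)
    have Bd: "norm (B 0 p - B 0 q) \<le> \<Lambda> * ?e" using B_lip[OF pq, of 0] mult_left_mono[OF e(1), of \<Lambda>] \<Lambda> by linarith
    have t1: "norm (Q1 p o\<^sub>L (B 0 p - B 0 q)) \<le> C * (\<Lambda> * ?e)"
      by (rule order_trans[OF norm_blinfun_compose]) (intro mult_mono b1 Bd pq C norm_ge_zero)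
    have t2: "norm ((B 0 p - B 0 q) o\<^sub>L Q1 q) \<le> (\<Lambda> * ?e) * C"
      by (rule order_trans[OF norm_blinfun_compose]) (use \<Lambda> in \<open>intro mult_mono b1 Bd pq C norm_ge_zero; simp\<close>)
    have t3: "norm ((Q2 p + Qc p) o\<^sub>L Q1 q) \<le> \<bar>D\<bar> * ?e"
      by (rule order_trans[OF \<alpha>(2)[OF pq]], rule mult_mono) (use e in auto)
    have "norm ((Q1 p + Qc p) o\<^sub>L Q2 q) \<le> \<bar>E\<bar> * ?e"
      by (rule order_trans[OF \<beta>(2)[OF pq]], rule mult_mono) (use e in auto)
    then have t4: "norm (Q1 p o\<^sub>L ((Q1 p + Qc p) o\<^sub>L Q2 q)) \<le> C * (\<bar>E\<bar> * ?e)"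
      by (rule order_trans[OF norm_blinfun_compose mult_mono[OF b1[OF pq(1)] _ C norm_ge_zero]])
    \<comment> \<open>No contraction is available for the center bundle. Its range is spanned by
      \<open>Fh\<close>, which is Lipschitz and annihilated by \<open>Q1 p\<close> at
      \<open>p\<close>, so only \<open>Fh q - Fh p\<close> contributes.\<close>
    have t5: "norm (Q1 p o\<^sub>L Qc q) \<le> C * C * (\<Lambda> * ?e)"
    proof (rule norm_blinfun_bound)
      fix w
      obtain c where c: "\<bar>c\<bar> \<le> C * norm w" "Qc q w = c *\<^sub>R Fh q" using Qc_range[OF pq(2)] by blast
      have "norm ((Q1 p o\<^sub>L Qc q) w) = \<bar>c\<bar> * norm (Q1 p (Fh q - Fh p))"
        by (simp add: c blinfun.bilinear_simps QF pq)
      also have "\<dots> \<le> (C * norm w) * (C * (\<Lambda> * ?e))"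
      proof (intro mult_mono c)
        have "norm (Fh q - Fh p) \<le> \<Lambda> * ?e"
          using Fh_lip[OF pq] mult_left_mono[OF e(1), of \<Lambda>] \<Lambda> unfolding norm_minus_commute[of "Fh q"] by linarith
        then show "norm (Q1 p (Fh q - Fh p)) \<le> C * (\<Lambda> * ?e)"
          by (intro order_trans[OF norm_blinfun] mult_mono b1 pq C norm_ge_zero)
      qed (use C in auto)
      finally show "norm ((Q1 p o\<^sub>L Qc q) w) \<le> C * C * (\<Lambda> * ?e) * norm w" by (simp add: mult_ac)
    qed (use C \<Lambda> in auto)
    have "norm (Q1 p - Q1 q) \<le> C * (\<Lambda> * ?e) + (\<Lambda> * ?e) * C + \<bar>D\<bar> * ?e + C * (\<bar>E\<bar> * ?e) + C * C * (\<Lambda> * ?e)"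
      by (subst projection_difference[where ?Q1.0=Q1 and ?Q2.0=Q2 and ?Q3.0=Qc, OF B0 Qp(1,2,4) Q12 pq])
        (assumption | intro order_trans[OF norm_triangle_ineq] add_mono order_trans[OF norm_triangle_ineq4] t1 t2 t3 t4 t5)+
    then show "norm (Q1 p - Q1 q) \<le> (C * \<Lambda> + \<Lambda> * C + \<bar>D\<bar> + C * \<bar>E\<bar> + C * C * \<Lambda>) * ?e"
      by (simp add: algebra_simps)
  qed
qed

lemma holder_Qs: "holder_on K d Qs"
proof -
  have "B 0 p = Qs p + Qu p + Qc p" if "p \<in> K" for p by (rule B_0[OF that])
  from holder_projection[of 1 Qs Qu, unfolded mult_1 mult_minus1, OF _ Qs_decay Qu_decay B_Qs B_Qu this
      B_0_Q(4) B_0_Q(1) B_0_Q(5) B_0_Q(2) Q_zero(1) Q_idem(1) Q_zero(2) Q_Fh(1)]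
  show ?thesis by simp
qed

lemma holder_Qu: "holder_on K d Qu"
proof -
  have "B 0 p = Qu p + Qs p + Qc p" if "p \<in> K" for p using B_0[OF that] by simp
  from holder_projection[of "-1" Qu Qs, unfolded minus_minus mult_1 mult_minus1, OF _ Qu_decay Qs_decay B_Qu B_Qs this
      B_0_Q(5) B_0_Q(2) B_0_Q(4) B_0_Q(1) Q_zero(3) Q_idem(2) Q_zero(4) Q_Fh(2)]
  show ?thesis by simp
qed

lemma holder_Qc: "holder_on K d Qc"
  by (rule holder_on_cong[OF holder_on_diff[OF holder_B_0 holder_on_add[OF holder_Qs holder_Qu]]]) (simp add: B_0)

text \<open>The push-forward of the field \<open>x\<close> by the time \<open>t\<close> map,
  evaluated at \<open>p\<close>.\<close>

definition transport :: "('m \<Rightarrow> 'b) \<Rightarrow> 'm \<Rightarrow> real \<Rightarrow> 'b" where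
  "transport x p t = B t (f (- t) p) (x (f (- t) p))"

text \<open>For \<sigma> = 1 and \<sigma> = -1 these are the fields \<open>v^s\<close> and
  \<open>v^u\<close> in embedded form.\<close>

definition transport_integral :: "real \<Rightarrow> ('m \<Rightarrow> 'b) \<Rightarrow> 'm \<Rightarrow> 'b" where
  "transport_integral \<sigma> x p = improper_integral (\<lambda>t. transport x p (\<sigma> * t))"

lemma continuous_on_f [continuous_intros]:
  "continuous_on T a \<Longrightarrow> continuous_on T b \<Longrightarrow> (\<And>s. s \<in> T \<Longrightarrow> b s \<in> K) \<Longrightarrow> continuous_on T (\<lambda>s. f (a s) (b s))"
  using continuous_on_compose2[OF f_cont continuous_on_Pair[of T a b]] by auto

lemma continuous_on_B [continuous_intros]:
  "continuous_on T a \<Longrightarrow> continuous_on T b \<Longrightarrow> (\<And>s. s \<in> T \<Longrightarrow> b s \<in> K) \<Longrightarrow> continuous_on T (\<lambda>s. B (a s) (b s))"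
  using continuous_on_compose2[OF B_cont continuous_on_Pair[of T a b]] by auto

lemma continuous_on_transport:
  assumes "continuous_on K x" "p \<in> K"
  shows "continuous_on UNIV (transport x p)"
  unfolding transport_def
  by (intro continuous_intros continuous_on_compose2[OF assms(1)]) (use assms f_in in auto)

lemma transport_decay:
  assumes "\<And>p t. p \<in> K \<Longrightarrow> 0 \<le> t \<Longrightarrow> norm (B (\<sigma> * t) p (x p)) \<le> D * exp (- \<kappa> * t)"
    and "p \<in> K" "0 \<le> t"
  shows "norm (transport x p (\<sigma> * t)) \<le> D * exp (- \<kappa> * t)"
  unfolding transport_def using assms(1)[OF f_in[OF assms(2)] assms(3)] by simp

text \<open>Pulling the push-forward field back along the orbit by time \<open>s\<close> shifts its
  time argument. Differentiation along the flow thereby becomes differentiation of a shifted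
  integral.\<close>

lemma B_transport:
  assumes "p \<in> K"
  shows "B (- s) (f s p) (transport x (f s p) t) = transport x p (t - s)"
proof -
  have 1: "f (- t) (f s p) = f (s - t) p" using f_add[OF assms, of "-t" s] by (simp add: add.commute)
  then have 2: "f t (f (s - t) p) = f s p" using f_minus(2)[OF f_in[OF assms], of t s] by simp
  have "B (- s) (f s p) o\<^sub>L B t (f (s - t) p) = B (- s + t) (f (s - t) p)"
    using B_add[OF f_in[OF assms], of "-s" t "s - t"] 2 by simp
  then show ?thesis unfolding transport_def 1
    by (metis (no_types, opaque_lifting) add.commute blinfun_apply_blinfun_compose minus_diff_eq uminus_add_conv_diff)
qed

context
  fixes \<sigma> :: real and x :: "'m \<Rightarrow> 'b" and D :: real
  assumes \<sigma>: "\<sigma> = 1 \<or> \<sigma> = - 1"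
    and x: "holder_on K d x"
    and decay: "\<And>p t. p \<in> K \<Longrightarrow> 0 \<le> t \<Longrightarrow> norm (B (\<sigma> * t) p (x p)) \<le> D * exp (- \<kappa> * t)"
begin

lemma cont_transport: "p \<in> K \<Longrightarrow> continuous_on UNIV (\<lambda>t. transport x p (\<sigma> * t))"
  by (rule continuous_on_compose2[OF continuous_on_transport[OF holder_on_continuous[OF x]]]) (auto intro: continuous_intros)

lemma transport_integral:
  assumes "p \<in> K"
  shows "((\<lambda>T. integral {0..T} (\<lambda>t. transport x p (\<sigma> * t))) \<longlongrightarrow> transport_integral \<sigma> x p) at_top"
    and "0 \<le> T \<Longrightarrow> norm (transport_integral \<sigma> x p - integral {0..T} (\<lambda>t. transport x p (\<sigma> * t))) \<le> D / \<kappa> * exp (- \<kappa> * T)"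
  unfolding transport_integral_def
  using improper_integral_exp_decay[OF continuous_on_subset[OF cont_transport[OF assms]] \<kappa> transport_decay[OF decay assms]]
  by auto

text \<open>This is the Lie derivative of the integral. Pulling back by time \<open>s\<close> shifts
  the integrand by \<open>- \<sigma> s\<close>; the shifted integral has derivative
  \<open>- g 0\<close>, and the two minus signs leave \<sigma> times the field at
  \<open>p\<close>.\<close>

lemma transport_integral_derivative:
  assumes p: "p \<in> K"
  shows "((\<lambda>s. B (- s) (f s p) (transport_integral \<sigma> x (f s p))) has_vector_derivative \<sigma> *\<^sub>R B 0 p (x p)) (at 0)"
proof -
  define g where "g = (\<lambda>t. transport x p (\<sigma> * t))"
  have g: "continuous_on UNIV g" unfolding g_def by (rule cont_transport[OF p])
  have \<sigma>\<sigma>: "\<sigma> * \<sigma> = 1" using \<sigma> by auto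
  have eq: "B (- s) (f s p) (transport_integral \<sigma> x (f s p)) = improper_integral (\<lambda>t. g (t + (- \<sigma> * s)))" for s
  proof -
    have "((\<lambda>T. integral {0..T} (\<lambda>t. B (- s) (f s p) (transport x (f s p) (\<sigma> * t)))) \<longlongrightarrow>
        B (- s) (f s p) (transport_integral \<sigma> x (f s p))) at_top"
      by (rule improper_integral_linear[OF continuous_on_subset[OF cont_transport] blinfun.bounded_linear_right transport_integral(1)])
         (use p f_in in auto)
    then have "improper_integral (\<lambda>t. B (- s) (f s p) (transport x (f s p) (\<sigma> * t))) = B (- s) (f s p) (transport_integral \<sigma> x (f s p))"
      by (rule improper_integralI)
    moreover have "B (- s) (f s p) (transport x (f s p) (\<sigma> * t)) = g (t + (- \<sigma> * s))" for t
      using \<sigma>\<sigma> by (simp add: B_transport[OF p] g_def algebra_simps mult.assoc[symmetric])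
    ultimately show ?thesis by simp
  qed
  have I: "((\<lambda>T. integral {0..T} g) \<longlongrightarrow> transport_integral \<sigma> x p) at_top"
    unfolding g_def by (rule transport_integral(1)[OF p])
  have d: "((\<lambda>a. improper_integral (\<lambda>t. g (t + a))) has_vector_derivative - g 0) (at (- \<sigma> * 0))"
    using improper_integral_shift_derivative[OF g I, of 0] by simp
  have "((\<lambda>s. - \<sigma> * s) has_vector_derivative - \<sigma>) (at 0)" by (auto intro!: derivative_eq_intros)
  from vector_diff_chain_at[OF this d]
  have "((\<lambda>a. improper_integral (\<lambda>t. g (t + a))) \<circ> (\<lambda>s. - \<sigma> * s) has_vector_derivative (- \<sigma>) *\<^sub>R (- g 0)) (at 0)" .
  then show ?thesis by (simp add: eq o_def g_def transport_def f_0 p)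
qed

text \<open>The projection \<open>B 0 p\<close> fixes every integrand and commutes with the
  integral, so the value lies in the embedded tangent space at \<open>p\<close> and is the image of
  an actual tangent vector.\<close>

lemma B_0_transport_integral:
  assumes p: "p \<in> K" shows "B 0 p (transport_integral \<sigma> x p) = transport_integral \<sigma> x p"
proof -
  have "((\<lambda>T. integral {0..T} (\<lambda>t. B 0 p (transport x p (\<sigma> * t)))) \<longlongrightarrow> B 0 p (transport_integral \<sigma> x p)) at_top"
    by (rule improper_integral_linear[OF continuous_on_subset[OF cont_transport] blinfun.bounded_linear_right transport_integral(1)])
       (use p in auto)
  moreover have "B 0 p (transport x p t) = transport x p t" for t
    using B_transport[OF p, of 0 x t] by (simp add: f_0 p)
  ultimately have "((\<lambda>T. integral {0..T} (\<lambda>t. transport x p (\<sigma> * t))) \<longlongrightarrow> B 0 p (transport_integral \<sigma> x p)) at_top" by simp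
  from tendsto_unique[OF _ this transport_integral(1)[OF p]] show ?thesis by simp
qed

lemma holder_transport_integral: "holder_on K d (transport_integral \<sigma> x)"
proof (cases "K = {}")
  case False
  then obtain p0 where "p0 \<in> K" by blast
  then have D: "D \<ge> 0" using order_trans[OF norm_ge_zero decay[of p0 0]] by simp
  obtain m where m: "m \<ge> 0" "\<And>p. p \<in> K \<Longrightarrow> norm (x p) \<le> m" using holder_on_bounded[OF x] by blast
  obtain \<alpha> H where H: "0 < \<alpha>" "\<alpha> \<le> 1" "0 \<le> H" "\<And>p q. p \<in> K \<Longrightarrow> q \<in> K \<Longrightarrow> norm (x p - x q) \<le> H * d p q powr \<alpha>"
    using x unfolding holder_on_def by blast
  \<comment> \<open>Per unit of time, \<open>2 \<Lambda>^2\<close> bounds the growth of the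
    differences of \<open>B\<close> and \<Lambda> that of the distance of the base points; the outer
    factor 2 absorbs the length of the interval, since \<open>n \<le> 2^n\<close>. In
    \<open>E\<close> the two summands stem from the difference of the operators and from the
    difference of the field.\<close>
  define M where "M = 2 * (2 * \<Lambda>\<^sup>2 * \<Lambda>)"
  define E where "E = \<Lambda> * m + \<Lambda> * H"
  have \<Lambda>0: "\<Lambda> \<ge> 0" using \<Lambda> by simp
  have \<Lambda>2: "1 \<le> \<Lambda>\<^sup>2" using \<Lambda> by simp
  have E: "E \<ge> 0" using \<Lambda>0 m H by (simp add: E_def)
  have M: "1 < M"
    using mult_mono[OF \<Lambda>2 \<Lambda>] \<Lambda> by (simp add: M_def)
  have main: "norm (transport_integral \<sigma> x p - transport_integral \<sigma> x q)
      \<le> (2 * D / \<kappa> + E) * (exp (- \<kappa>) ^ n + M ^ n * d p q powr \<alpha>)"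
    if pq: "p \<in> K" "q \<in> K" for p q and n :: nat
  proof -
    let ?e = "d p q powr \<alpha>" and ?I = "\<lambda>p. integral {0..real n} (\<lambda>t. transport x p (\<sigma> * t))"
    have d01: "0 \<le> d p q" "d p q \<le> 1" using d_range[OF pq] by auto
    have e: "d p q \<le> ?e" using powr_mono'[of \<alpha> 1 "d p q"] H d01 by simp
    have pt: "norm (transport x p (\<sigma> * t) - transport x q (\<sigma> * t)) \<le> E * (2 * \<Lambda>\<^sup>2 * \<Lambda>) ^ n * ?e"
      if t: "t \<in> {0..real n}" for t
    proof -
      let ?p = "f (- (\<sigma> * t)) p" and ?q = "f (- (\<sigma> * t)) q"
      have K: "?p \<in> K" "?q \<in> K" using pq f_in by auto
      have ab: "\<bar>\<sigma> * t\<bar> \<le> real n" "\<bar>- (\<sigma> * t)\<bar> \<le> real n" using \<sigma> t by auto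
      have dpq: "d ?p ?q \<le> \<Lambda> ^ n * d p q" using growth[OF pq ab(2)] by blast
      have "d ?p ?q powr \<alpha> \<le> (\<Lambda> ^ n * d p q) powr \<alpha>" using dpq d_range[OF K] H by (intro powr_mono2) auto
      also have "\<dots> = (\<Lambda> ^ n) powr \<alpha> * ?e" by (rule powr_mult)
      also have "\<dots> \<le> (\<Lambda> ^ n) powr 1 * ?e" using \<Lambda> H by (intro mult_right_mono powr_mono) auto
      finally have dal: "d ?p ?q powr \<alpha> \<le> \<Lambda> ^ n * ?e" using \<Lambda> by simp
      have "transport x p (\<sigma> * t) - transport x q (\<sigma> * t) =
          (B (\<sigma> * t) ?p - B (\<sigma> * t) ?q) (x ?p) + B (\<sigma> * t) ?q (x ?p - x ?q)"
        by (simp add: transport_def blinfun.bilinear_simps)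
      also have "norm \<dots> \<le> norm (B (\<sigma> * t) ?p - B (\<sigma> * t) ?q) * norm (x ?p) + norm (B (\<sigma> * t) ?q) * norm (x ?p - x ?q)"
        by (intro order_trans[OF norm_triangle_ineq] add_mono norm_blinfun)
      also have "\<dots> \<le> (\<Lambda> * (2 * \<Lambda>\<^sup>2) ^ n * (\<Lambda> ^ n * ?e)) * m + \<Lambda> ^ (n + 1) * (H * (\<Lambda> ^ n * ?e))"
      proof (intro add_mono mult_mono)
        have "norm (B (\<sigma> * t) ?p - B (\<sigma> * t) ?q) \<le> \<Lambda> * (2 * \<Lambda>\<^sup>2) ^ n * d ?p ?q" using growth[OF K ab(1)] by blast
        also have "\<dots> \<le> \<Lambda> * (2 * \<Lambda>\<^sup>2) ^ n * (\<Lambda> ^ n * ?e)"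
          using order_trans[OF dpq mult_left_mono[OF e, of "\<Lambda> ^ n"]] \<Lambda>0 by (intro mult_left_mono) auto
        finally show "norm (B (\<sigma> * t) ?p - B (\<sigma> * t) ?q) \<le> \<Lambda> * (2 * \<Lambda>\<^sup>2) ^ n * (\<Lambda> ^ n * ?e)" .
        show "norm (x ?p - x ?q) \<le> H * (\<Lambda> ^ n * ?e)"
          using H(4)[OF K] mult_left_mono[OF dal H(3)] by linarith
        show "norm (B (\<sigma> * t) ?q) \<le> \<Lambda> ^ (n + 1)" using growth[OF K(2) K(2) ab(1)] by blast
      qed (use m K \<Lambda>0 in auto)
      also have "\<dots> \<le> (\<Lambda> * (2 * \<Lambda>\<^sup>2) ^ n * (\<Lambda> ^ n * ?e)) * m + (\<Lambda> * (2 * \<Lambda>\<^sup>2) ^ n) * (H * (\<Lambda> ^ n * ?e))"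
      proof (intro add_left_mono mult_right_mono)
        have "\<Lambda> \<le> 2 * \<Lambda>\<^sup>2" using \<Lambda> mult_left_mono[OF \<Lambda> \<Lambda>0] unfolding power2_eq_square by linarith
        then have "\<Lambda> ^ n \<le> (2 * \<Lambda>\<^sup>2) ^ n" using \<Lambda>0 by (intro power_mono)
        then show "\<Lambda> ^ (n + 1) \<le> \<Lambda> * (2 * \<Lambda>\<^sup>2) ^ n" using \<Lambda>0 by (simp add: mult_left_mono)
      qed (use H \<Lambda>0 in auto)
      also have "\<dots> = E * (2 * \<Lambda>\<^sup>2 * \<Lambda>) ^ n * ?e"
        unfolding E_def power_mult_distrib by (simp add: algebra_simps)
      finally show ?thesis .
    qed
    have int: "(\<lambda>t. transport x r (\<sigma> * t)) integrable_on {0..real n}" if "r \<in> K" for r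
      by (intro integrable_continuous_interval continuous_on_subset[OF cont_transport[OF that]]) auto
    have "norm (?I p - ?I q) = norm (integral {0..real n} (\<lambda>t. transport x p (\<sigma> * t) - transport x q (\<sigma> * t)))"
      by (simp add: Henstock_Kurzweil_Integration.integral_diff int pq)
    also have "\<dots> \<le> integral {0..real n} (\<lambda>t. E * (2 * \<Lambda>\<^sup>2 * \<Lambda>) ^ n * ?e)"
      by (intro integral_norm_bound_integral integrable_diff int pq pt integrable_const_ivl)
    also have "\<dots> = E * (real n * (2 * \<Lambda>\<^sup>2 * \<Lambda>) ^ n) * ?e" by simp
    also have "\<dots> \<le> E * (2 ^ n * (2 * \<Lambda>\<^sup>2 * \<Lambda>) ^ n) * ?e"
      using E \<Lambda>0 of_nat_less_two_power[of n, where 'a=real] by (intro mult_right_mono mult_left_mono) auto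
    also have "\<dots> = E * (M ^ n * ?e)" unfolding M_def power_mult_distrib[of 2 "2 * \<Lambda>\<^sup>2 * \<Lambda>"] by simp
    finally have 1: "norm (?I p - ?I q) \<le> E * (M ^ n * ?e)" .
    have tail: "norm (transport_integral \<sigma> x r - ?I r) \<le> D / \<kappa> * exp (- \<kappa>) ^ n" if "r \<in> K" for r
      using transport_integral(2)[OF that, of "real n"] by (simp add: exp_of_nat_mult[symmetric] mult.commute)
    have "norm (transport_integral \<sigma> x p - transport_integral \<sigma> x q)
       \<le> norm (transport_integral \<sigma> x p - ?I p) + norm (?I p - ?I q) + norm (transport_integral \<sigma> x q - ?I q)"
      using norm_triangle_ineq[of "transport_integral \<sigma> x p - ?I p" "?I p - transport_integral \<sigma> x q"]
        norm_triangle_ineq4[of "?I p - ?I q" "transport_integral \<sigma> x q - ?I q"] by simp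
    also have "\<dots> \<le> 2 * D / \<kappa> * exp (- \<kappa>) ^ n + E * (M ^ n * ?e)"
      using tail[OF pq(1)] tail[OF pq(2)] 1 by simp
    also have "\<dots> \<le> (2 * D / \<kappa> + E) * (exp (- \<kappa>) ^ n + M ^ n * ?e)"
    proof -
      have "0 \<le> E * exp (- \<kappa>) ^ n" "0 \<le> 2 * D / \<kappa> * (M ^ n * ?e)" using E D M \<kappa> by auto
      then show ?thesis by (simp add: algebra_simps)
    qed
    finally show ?thesis .
  qed
  \<comment> \<open>The trade-off is applied to \<open>d p q powr \<alpha>\<close> instead of
    \<open>d p q\<close>, whence the final exponent \<open>\<alpha> * \<beta>\<close>.\<close>
  obtain \<beta> where \<beta>: "\<beta> > 0" "\<And>e D'. 0 \<le> e \<Longrightarrow> e \<le> 1 \<Longrightarrow> (\<And>n::nat. D' \<le> (2 * D / \<kappa> + E) * (exp (- \<kappa>) ^ n + M ^ n * e)) \<Longrightarrow>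
      D' \<le> (2 * D / \<kappa> + E) * (1 / exp (- \<kappa>) + 1) * e powr \<beta>"
    using geometric_tradeoff[of "exp (- \<kappa>)" M "2 * D / \<kappa> + E"] M \<kappa> D E by auto
  show ?thesis
  proof (rule holder_onI[of "\<alpha> * \<beta>"])
    fix p q assume pq: "p \<in> K" "q \<in> K"
    have "d p q powr \<alpha> \<le> 1" using d_range[OF pq] H by (intro powr_le1) auto
    from \<beta>(2)[OF _ this main[OF pq]]
    show "norm (transport_integral \<sigma> x p - transport_integral \<sigma> x q) \<le> (2 * D / \<kappa> + E) * (1 / exp (- \<kappa>) + 1) * d p q powr (\<alpha> * \<beta>)"
      by (simp add: powr_powr)
  qed (use H \<beta> in auto)
qed (auto simp: holder_on_def intro: exI[of _ 1])

end

end

section \<open>Averages over an invariant measure\<close>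

locale invariant_measure =
  fixes K :: "'m::{t2_space, second_countable_topology} set" and f :: "real \<Rightarrow> 'm \<Rightarrow> 'm" and \<rho> :: "'m measure"
  assumes compact_K: "compact K" and sets_\<rho>: "sets \<rho> = sets borel" and prob: "prob_space \<rho>"
    and \<rho>_K: "emeasure \<rho> K = 1"
    and cont_f: "continuous_on UNIV (f t)" and f_iff: "f t p \<in> K \<longleftrightarrow> p \<in> K"
    and inv: "distr \<rho> borel (f t) = \<rho>"
begin

sublocale prob_space \<rho> by (rule prob)

lemma K_borel: "K \<in> sets borel"
  using compact_K compact_imp_closed borel_closed by blast

lemma K_sets: "K \<in> sets \<rho>"
  using K_borel sets_\<rho> by simp

lemma avg_integrable:
  fixes h :: "'m \<Rightarrow> real"
  assumes "continuous_on K h"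
  shows "set_integrable \<rho> K h"
proof -
  obtain M where M: "\<And>p. p \<in> K \<Longrightarrow> norm (h p) \<le> M"
    using compact_imp_bounded[OF compact_continuous_image[OF assms compact_K]] unfolding bounded_iff by auto
  have "(\<lambda>p. indicator K p *\<^sub>R h p) \<in> borel_measurable \<rho>"
    using borel_measurable_continuous_on_indicator[OF K_borel assms] measurable_cong_sets[OF sets_\<rho> refl] by blast
  then show ?thesis unfolding set_integrable_def
  proof (rule integrable_const_bound[where B="\<bar>M\<bar>", rotated])
    show "AE p in \<rho>. norm (indicator K p *\<^sub>R h p) \<le> \<bar>M\<bar>"
      using M by (intro AE_I2) (fastforce simp: indicator_def)
  qed
qed

lemma avg_add: "continuous_on K h \<Longrightarrow> continuous_on K k \<Longrightarrow> avg \<rho> K (\<lambda>p. h p + k p) = avg \<rho> K h + avg \<rho> K k"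
  unfolding avg_def by (rule set_integral_add) (rule avg_integrable, assumption)+

lemma avg_diff: "continuous_on K h \<Longrightarrow> continuous_on K k \<Longrightarrow> avg \<rho> K (\<lambda>p. h p - k p) = avg \<rho> K h - avg \<rho> K k"
  unfolding avg_def by (rule set_integral_diff) (rule avg_integrable, assumption)+

lemma avg_cmult: "avg \<rho> K (\<lambda>p. c * h p) = c * avg \<rho> K h"
  unfolding avg_def by simp

lemma avg_cong: "(\<And>p. p \<in> K \<Longrightarrow> h p = k p) \<Longrightarrow> avg \<rho> K h = avg \<rho> K k"
  unfolding avg_def by (rule set_lebesgue_integral_cong[OF K_sets]) auto

lemma avg_bound:
  assumes "continuous_on K h" "\<And>p. p \<in> K \<Longrightarrow> \<bar>h p\<bar> \<le> c" "0 \<le> c"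
  shows "\<bar>avg \<rho> K h\<bar> \<le> c"
proof -
  have "\<bar>avg \<rho> K h\<bar> = norm (integral\<^sup>L \<rho> (\<lambda>p. indicator K p *\<^sub>R h p))"
    by (simp add: avg_def set_lebesgue_integral_def)
  also have "\<dots> \<le> (\<integral>p. norm (indicator K p *\<^sub>R h p) \<partial>\<rho>)" by (rule integral_norm_bound)
  also have "\<dots> \<le> (\<integral>p. c \<partial>\<rho>)"
    using avg_integrable[OF assms(1)] assms(2,3)
    by (intro integral_mono) (auto simp: set_integrable_def indicator_def)
  also have "\<dots> = c" by (simp add: prob_space)
  finally show ?thesis .
qed

text \<open>Since \<open>f_iff\<close> makes the indicator of \<open>K\<close> invariant, a function
  that is meaningful only on \<open>K\<close> may be moved by the flow although \<rho> is a measure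
  on the whole manifold.\<close>

lemma avg_invariant:
  assumes "continuous_on K h"
  shows "avg \<rho> K (\<lambda>p. h (f t p)) = avg \<rho> K h"
proof -
  have m: "f t \<in> measurable \<rho> borel"
    using borel_measurable_continuous_onI[OF cont_f] measurable_cong_sets[OF sets_\<rho> refl] by blast
  have h: "(\<lambda>p. indicator K p *\<^sub>R h p) \<in> borel_measurable borel"
    using borel_measurable_continuous_on_indicator[OF K_borel assms] .
  have "avg \<rho> K h = integral\<^sup>L (distr \<rho> borel (f t)) (\<lambda>p. indicator K p *\<^sub>R h p)"
    by (simp add: inv avg_def set_lebesgue_integral_def)
  also have "\<dots> = integral\<^sup>L \<rho> (\<lambda>p. indicator K (f t p) *\<^sub>R h (f t p))"
    by (rule integral_distr[OF m h])
  also have "\<dots> = avg \<rho> K (\<lambda>p. h (f t p))"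
    by (simp add: avg_def set_lebesgue_integral_def indicator_def f_iff)
  finally show ?thesis by simp
qed

text \<open>Continuity on a compact product gives boundedness, and the extension by zero is then
  integrable for the product measure. Second countability of the manifold makes Borel sets of the
  product measurable for the product of the Borel sigma-algebras.\<close>

lemma avg_fubini:
  fixes h :: "real \<Rightarrow> 'm \<Rightarrow> real"
  assumes h: "continuous_on ({0..T} \<times> K) (\<lambda>(t, p). h t p)"
  shows "(\<lambda>t. avg \<rho> K (h t)) integrable_on {0..T}"
    and "avg \<rho> K (\<lambda>p. integral {0..T} (\<lambda>t. h t p)) = integral {0..T} (\<lambda>t. avg \<rho> K (h t))"
proof -
  define k where "k = (\<lambda>(p, t). indicator ({0..T} \<times> K) (t, p) *\<^sub>R h t p)"
  interpret P: pair_sigma_finite \<rho> lborel ..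
  obtain M where M: "\<And>z. z \<in> {0..T} \<times> K \<Longrightarrow> norm ((\<lambda>(t, p). h t p) z) \<le> M"
    using compact_imp_bounded[OF compact_continuous_image[OF h compact_Times[OF compact_Icc compact_K]]]
    unfolding bounded_iff by auto
  have TK: "{0..T} \<times> K \<in> sets (borel :: (real \<times> 'm) measure)"
    using K_borel by (simp add: borel_prod[symmetric])
  have meas: "(\<lambda>z. indicator ({0..T} \<times> K) z *\<^sub>R (\<lambda>(t, p). h t p) z) \<in> borel_measurable (borel \<Otimes>\<^sub>M borel)"
    using borel_measurable_continuous_on_indicator[OF TK h] by (simp add: borel_prod)
  have "(\<lambda>z. indicator ({0..T} \<times> K) (snd z, fst z) *\<^sub>R h (snd z) (fst z)) \<in> borel_measurable (borel \<Otimes>\<^sub>M borel)"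
    using measurable_compose[OF _ meas, of "\<lambda>z. (snd z, fst z)" "borel \<Otimes>\<^sub>M borel"] by (simp add: split_beta)
  then have meas': "case_prod (\<lambda>p t. k (p, t)) \<in> borel_measurable (\<rho> \<Otimes>\<^sub>M lborel)"
    by (subst measurable_cong_sets[OF sets_pair_measure_cong[OF sets_\<rho> sets_lborel] refl])
       (simp add: k_def split_beta')
  have int: "integrable (\<rho> \<Otimes>\<^sub>M lborel) (case_prod (\<lambda>p t. k (p, t)))"
  proof (rule Bochner_Integration.integrable_bound)
    have "emeasure (\<rho> \<Otimes>\<^sub>M lborel) (space \<rho> \<times> {0..T}) < \<infinity>"
      by (subst lborel.emeasure_pair_measure_Times) (auto simp: emeasure_space_1 emeasure_lborel_Icc_eq)
    then show "integrable (\<rho> \<Otimes>\<^sub>M lborel) (\<lambda>z. indicator (space \<rho> \<times> {0..T}) z *\<^sub>R \<bar>M\<bar>)"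
      by (intro integrable_scaleR_left integrable_real_indicator) auto
    show "AE z in \<rho> \<Otimes>\<^sub>M (lborel :: real measure). norm (case_prod (\<lambda>p t. k (p, t)) z) \<le> norm (indicator (space \<rho> \<times> {0..T}) z *\<^sub>R \<bar>M\<bar>)"
    proof (rule AE_I2)
      fix z assume "z \<in> space (\<rho> \<Otimes>\<^sub>M (lborel :: real measure))"
      then show "norm (case_prod (\<lambda>p t. k (p, t)) z) \<le> norm (indicator (space \<rho> \<times> {0..T}) z *\<^sub>R \<bar>M\<bar>)"
        using M[of "(snd z, fst z)"] by (auto simp: k_def space_pair_measure indicator_def)
    qed
  qed (rule meas')
  have s1: "(\<integral>p. k (p, t) \<partial>\<rho>) = indicator {0..T} t *\<^sub>R avg \<rho> K (h t)" for t
    by (cases "t \<in> {0..T}") (simp_all add: k_def avg_def set_lebesgue_integral_def indicator_times)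
  have s2: "(\<integral>t. k (p, t) \<partial>lborel) = indicator K p *\<^sub>R integral {0..T} (\<lambda>t. h t p)" for p
  proof (cases "p \<in> K")
    case True
    have "continuous_on {0..T} (\<lambda>t. h t p)"
    proof -
      have "continuous_on {0..T} (\<lambda>t. (t, p))" by (intro continuous_on_Pair continuous_on_const continuous_on_id)
      from continuous_on_compose2[OF h this] True show ?thesis by auto
    qed
    then have "set_integrable lborel {0..T} (\<lambda>t. h t p)" using borel_integrable_atLeastAtMost' by blast
    then have "(LINT t:{0..T}|lborel. h t p) = integral {0..T} (\<lambda>t. h t p)" by (rule set_borel_integral_eq_integral(2))
    then show ?thesis using True by (simp add: k_def set_lebesgue_integral_def indicator_times)
  qed (simp add: k_def indicator_times)
  have "integrable lborel (\<lambda>t. \<integral>p. k (p, t) \<partial>\<rho>)" using P.integrable_snd[OF int] by simp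
  then have si: "set_integrable lborel {0..T} (\<lambda>t. avg \<rho> K (h t))" unfolding s1 set_integrable_def .
  then show "(\<lambda>t. avg \<rho> K (h t)) integrable_on {0..T}" by (rule set_borel_integral_eq_integral(1))
  have "(\<integral>t. (\<integral>p. k (p, t) \<partial>\<rho>) \<partial>lborel) = (\<integral>p. (\<integral>t. k (p, t) \<partial>lborel) \<partial>\<rho>)" using P.Fubini_integral[OF int] .
  then show "avg \<rho> K (\<lambda>p. integral {0..T} (\<lambda>t. h t p)) = integral {0..T} (\<lambda>t. avg \<rho> K (h t))"
    unfolding s1 s2 using set_borel_integral_eq_integral(2)[OF si]
    by (simp add: avg_def set_lebesgue_integral_def)
qed

end

text \<open>Here \<omega> plays the role of the differential of \<Phi> and \<open>Fh\<close> that of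
  the vector field, both in the embedding; \<open>\<Phi>_deriv\<close> is the only link between
  \<omega> and \<Phi>.\<close>

locale measured_cocycle =
  hyperbolic_cocycle K d f B Qs Qu Qc Fh \<Lambda> C \<kappa> + invariant_measure K f \<rho>
  for K :: "'m::{t2_space, second_countable_topology} set" and d f and B :: "real \<Rightarrow> 'm \<Rightarrow> 'b::banach \<Rightarrow>\<^sub>L 'b"
    and Qs Qu Qc Fh \<Lambda> C \<kappa> \<rho> +
  fixes \<omega> :: "'m \<Rightarrow> 'b \<Rightarrow>\<^sub>L real" and \<Phi> :: "'m \<Rightarrow> real"
  assumes \<omega>_cont: "continuous_on K \<omega>" and \<Phi>_cont: "continuous_on K \<Phi>"
    and \<Phi>_deriv: "p \<in> K \<Longrightarrow> ((\<lambda>t. \<Phi> (f t p)) has_real_derivative \<omega> (f t p) (Fh (f t p))) (at t)"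
    and B_Fh: "p \<in> K \<Longrightarrow> B t p (Fh p) = Fh (f t p)"
    and Fh_nonzero: "p \<in> K \<Longrightarrow> Fh p \<noteq> 0"
begin

lemma Fh_cont: "continuous_on K Fh"
  by (rule holder_on_continuous[OF holder_Fh])

lemma Fh_lower_bound: obtains m where "m > 0" "\<And>p. p \<in> K \<Longrightarrow> m \<le> norm (Fh p)"
proof (cases "K = {}")
  case False
  then obtain q where "q \<in> K" "\<forall>p\<in>K. norm (Fh q) \<le> norm (Fh p)"
    using continuous_attains_inf[OF compact_K False, of "\<lambda>p. norm (Fh p)"] Fh_cont by (auto intro: continuous_intros)
  then show ?thesis using that[of "norm (Fh q)"] Fh_nonzero by auto
qed (use that[of 1] in auto)

text \<open>From \<open>(a p - a q) Fh p = (w p - w q) - a q (Fh p - Fh q)\<close>. It lets the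
  coefficient of a multiple of the nowhere zero \<open>Fh\<close> inherit continuity or a Hoelder
  bound.\<close>

lemma coefficient_estimate:
  assumes "m \<le> norm (Fh p)" "w p = a p *\<^sub>R Fh p" "w q = a q *\<^sub>R Fh q"
  shows "m * \<bar>a p - a q\<bar> \<le> norm (w p - w q) + \<bar>a q\<bar> * norm (Fh p - Fh q)"
proof -
  have "m * \<bar>a p - a q\<bar> \<le> norm (Fh p) * \<bar>a p - a q\<bar>" using assms(1) by (intro mult_right_mono) auto
  also have "\<dots> = norm ((w p - w q) - a q *\<^sub>R (Fh p - Fh q))"
  proof -
    have "(w p - w q) - a q *\<^sub>R (Fh p - Fh q) = (a p - a q) *\<^sub>R Fh p"
      by (simp add: assms(2,3) algebra_simps)
    then show ?thesis by simp
  qed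
  also have "\<dots> \<le> norm (w p - w q) + \<bar>a q\<bar> * norm (Fh p - Fh q)"
    using norm_triangle_ineq4[of "w p - w q" "a q *\<^sub>R (Fh p - Fh q)"] by simp
  finally show ?thesis .
qed

lemma holder_coefficient:
  assumes w: "holder_on K d w" and a: "\<And>p. p \<in> K \<Longrightarrow> w p = a p *\<^sub>R Fh p"
  shows "holder_on K d a"
proof -
  obtain m where m: "m > 0" "\<And>p. p \<in> K \<Longrightarrow> m \<le> norm (Fh p)" using Fh_lower_bound by blast
  obtain N where N: "N \<ge> 0" "\<And>p. p \<in> K \<Longrightarrow> norm (w p) \<le> N" using holder_on_bounded[OF w] by blast
  have ab: "\<bar>a p\<bar> \<le> N / m" if "p \<in> K" for p
  proof -
    have "\<bar>a p\<bar> * m \<le> \<bar>a p\<bar> * norm (Fh p)" using m(2)[OF that] by (intro mult_left_mono) auto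
    also have "\<dots> \<le> N" using N(2)[OF that] a[OF that] by simp
    finally show ?thesis using m(1) by (simp add: field_simps)
  qed
  obtain \<alpha> H where H: "0 < \<alpha>" "\<alpha> \<le> 1" "\<And>p q. p \<in> K \<Longrightarrow> q \<in> K \<Longrightarrow> norm (w p - w q) \<le> H * d p q powr \<alpha>"
    using w unfolding holder_on_def by blast
  show ?thesis
  proof (rule holder_onI[OF H(1)])
    fix p q assume pq: "p \<in> K" "q \<in> K"
    have e: "d p q \<le> d p q powr \<alpha>" using powr_mono'[of \<alpha> 1 "d p q"] H d_range[OF pq] by simp
    have "m * \<bar>a p - a q\<bar> \<le> norm (w p - w q) + \<bar>a q\<bar> * norm (Fh p - Fh q)"
      by (rule coefficient_estimate[where w = w, OF m(2)[OF pq(1)] a[OF pq(1)] a[OF pq(2)]])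
    also have "\<dots> \<le> H * d p q powr \<alpha> + N / m * (\<Lambda> * d p q powr \<alpha>)"
      using \<Lambda> e ab[OF pq(2)] N m by (intro add_mono H pq mult_mono order_trans[OF Fh_lip[OF pq]] mult_left_mono) auto
    finally show "norm (a p - a q) \<le> ((H + N / m * \<Lambda>) / m) * d p q powr \<alpha>"
      using m(1) by (simp add: field_simps)
  qed
qed

text \<open>A separate version for fields of which only continuity is known, such as the difference
  of two representatives of a shadowing class.\<close>

lemma continuous_coefficient:
  assumes w: "continuous_on K w" and a: "\<And>p. p \<in> K \<Longrightarrow> w p = a p *\<^sub>R Fh p"
  shows "continuous_on K a"
  unfolding continuous_on_def
proof
  fix q assume q: "q \<in> K"
  obtain m where m: "m > 0" "\<And>p. p \<in> K \<Longrightarrow> m \<le> norm (Fh p)" using Fh_lower_bound by blast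
  have "((\<lambda>p. (norm (w p - w q) + \<bar>a q\<bar> * norm (Fh p - Fh q)) / m) \<longlongrightarrow> (norm (w q - w q) + \<bar>a q\<bar> * norm (Fh q - Fh q)) / m) (at q within K)"
    using w Fh_cont q m(1) unfolding continuous_on_def by (intro tendsto_intros) auto
  then have lim: "((\<lambda>p. (norm (w p - w q) + \<bar>a q\<bar> * norm (Fh p - Fh q)) / m) \<longlongrightarrow> 0) (at q within K)" by simp
  have inK: "\<forall>\<^sub>F p in at q within K. p \<in> K" by (simp add: eventually_at_filter)
  have "\<forall>\<^sub>F p in at q within K. norm (a p - a q) \<le> (norm (w p - w q) + \<bar>a q\<bar> * norm (Fh p - Fh q)) / m"
    using inK
  proof eventually_elim
    case (elim p)
    show ?case using coefficient_estimate[where w = w, OF m(2)[OF elim] a[OF elim] a[OF q]] m(1) by (simp add: field_simps)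
  qed
  from Lim_null_comparison[OF this lim] show "(a \<longlongrightarrow> a q) (at q within K)" by (simp add: LIM_zero_iff)
qed

text \<open>In the embedding this is \<open>Y(\<Phi>_t)\<close> at \<open>p\<close>, in the form of
  the differential of \<Phi> at \<open>f t p\<close> applied to the push-forward of the vector at
  \<open>p\<close>.\<close>

definition response_rate :: "('m \<Rightarrow> 'b) \<Rightarrow> real \<Rightarrow> 'm \<Rightarrow> real" where
  "response_rate y t p = \<omega> (f t p) (B t p (y p))"

lemma continuous_on_\<omega> [continuous_intros]:
  "continuous_on T b \<Longrightarrow> (\<And>s. s \<in> T \<Longrightarrow> b s \<in> K) \<Longrightarrow> continuous_on T (\<lambda>s. \<omega> (b s))"
  using continuous_on_compose2[OF \<omega>_cont] by blast

lemma continuous_on_response_rate: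
  assumes "continuous_on K y"
  shows "continuous_on (T \<times> K) (\<lambda>(t, p). response_rate y t p)"
proof -
  have "continuous_on (T \<times> K) (\<lambda>z. y (snd z))"
    by (rule continuous_on_compose2[OF assms]) (auto intro: continuous_intros)
  then show ?thesis unfolding response_rate_def split_beta
    by (intro continuous_intros) (auto intro: f_in)
qed

lemma continuous_on_response_rate_K:
  assumes "continuous_on K y"
  shows "continuous_on K (response_rate y t)"
proof -
  have "continuous_on K (\<lambda>p. (t, p))" by (intro continuous_on_Pair continuous_on_const continuous_on_id)
  from continuous_on_compose2[OF continuous_on_response_rate[OF assms, of UNIV] this] show ?thesis by auto
qed

lemma continuous_on_response_rate_scaled:
  "continuous_on K y \<Longrightarrow> continuous_on (T \<times> K) (\<lambda>(t, p). response_rate y (\<sigma> * t) p)"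
  using continuous_on_compose2[OF continuous_on_response_rate[of y UNIV], of "T \<times> K" "\<lambda>z. (\<sigma> * fst z, snd z)"]
  by (force intro: continuous_intros simp: split_beta)

text \<open>Invariance of the measure moves the base point along the orbit and so turns the response
  rate into \<omega> of a push-forward field. The tail bound for the integral of that field is
  uniform in \<open>p\<close> and therefore survives averaging.\<close>

lemma hyperbolic_response:
  assumes \<sigma>: "\<sigma> = 1 \<or> \<sigma> = - 1" and y: "holder_on K d y"
    and decay: "\<And>p t. p \<in> K \<Longrightarrow> 0 \<le> t \<Longrightarrow> norm (B (\<sigma> * t) p (y p)) \<le> D * exp (- \<kappa> * t)"
  shows "(\<lambda>t. avg \<rho> K (response_rate y (\<sigma> * t))) integrable_on {0..T}"
    and "((\<lambda>T. integral {0..T} (\<lambda>t. avg \<rho> K (response_rate y (\<sigma> * t)))) \<longlongrightarrow>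
       avg \<rho> K (\<lambda>p. \<omega> p (transport_integral \<sigma> y p))) at_top"
proof -
  have yc: "continuous_on K y" by (rule holder_on_continuous[OF y])
  show "(\<lambda>t. avg \<rho> K (response_rate y (\<sigma> * t))) integrable_on {0..T}"
    by (rule avg_fubini(1)[OF continuous_on_response_rate_scaled[OF yc]])
  let ?V = "transport_integral \<sigma> y"
  have Vc: "continuous_on K ?V" by (rule holder_on_continuous[OF holder_transport_integral[OF \<sigma> y decay]])
  have cont_tr: "continuous_on (T \<times> K) (\<lambda>(t, p). \<omega> p (transport y p (\<sigma> * t)))" for T
  proof -
    have "continuous_on (T \<times> K) (\<lambda>z. y (f (- (\<sigma> * fst z)) (snd z)))"
      by (rule continuous_on_compose2[OF yc]) (auto intro!: continuous_intros f_in)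
    then show ?thesis unfolding transport_def split_beta
      by (intro continuous_intros) (auto intro: f_in)
  qed
  have shift: "avg \<rho> K (response_rate y t) = avg \<rho> K (\<lambda>p. \<omega> p (transport y p t))" for t
  proof -
    have "avg \<rho> K (response_rate y t) = avg \<rho> K (\<lambda>p. response_rate y t (f (- t) p))"
      by (rule avg_invariant[OF continuous_on_response_rate_K[OF yc], symmetric])
    also have "\<dots> = avg \<rho> K (\<lambda>p. \<omega> p (transport y p t))"
      by (rule avg_cong) (simp add: response_rate_def transport_def f_minus)
    finally show ?thesis .
  qed
  obtain N where N: "\<And>p. p \<in> K \<Longrightarrow> norm (\<omega> p) \<le> N"
    using compact_imp_bounded[OF compact_continuous_image[OF \<omega>_cont compact_K]] unfolding bounded_iff by auto
  have I: "integral {0..T} (\<lambda>t. avg \<rho> K (response_rate y (\<sigma> * t))) =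
      avg \<rho> K (\<lambda>p. \<omega> p (integral {0..T} (\<lambda>t. transport y p (\<sigma> * t))))" for T
  proof -
    have "integral {0..T} (\<lambda>t. avg \<rho> K (response_rate y (\<sigma> * t))) =
       integral {0..T} (\<lambda>t. avg \<rho> K (\<lambda>p. \<omega> p (transport y p (\<sigma> * t))))" by (simp add: shift)
    also have "\<dots> = avg \<rho> K (\<lambda>p. integral {0..T} (\<lambda>t. \<omega> p (transport y p (\<sigma> * t))))"
      by (rule avg_fubini(2)[OF cont_tr, symmetric])
    also have "\<dots> = avg \<rho> K (\<lambda>p. \<omega> p (integral {0..T} (\<lambda>t. transport y p (\<sigma> * t))))"
    proof (rule avg_cong)
      fix p assume p: "p \<in> K"
      have "(\<lambda>t. transport y p (\<sigma> * t)) integrable_on {0..T}"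
        by (intro integrable_continuous_interval continuous_on_subset[OF cont_transport[OF \<sigma> y decay p]]) auto
      from integral_linear[OF this blinfun.bounded_linear_right[of "\<omega> p"]]
      show "integral {0..T} (\<lambda>t. \<omega> p (transport y p (\<sigma> * t))) = \<omega> p (integral {0..T} (\<lambda>t. transport y p (\<sigma> * t)))"
        by (simp add: o_def)
    qed
    finally show ?thesis .
  qed
  have Ic: "continuous_on K (\<lambda>p. \<omega> p (integral {0..T} (\<lambda>t. transport y p (\<sigma> * t))))" for T
  proof -
    have "continuous_on (K \<times> {0..T}) (\<lambda>z. y (f (- (\<sigma> * snd z)) (fst z)))"
      by (rule continuous_on_compose2[OF yc]) (auto intro!: continuous_intros f_in)
    then have "continuous_on (K \<times> cbox 0 T) (\<lambda>(p, t). transport y p (\<sigma> * t))"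
      unfolding transport_def split_beta cbox_interval by (intro continuous_intros) (auto intro: f_in)
    from integral_continuous_on_param[OF this] show ?thesis
      by (intro continuous_intros) (auto simp: cbox_interval)
  qed
  have bd: "\<bar>integral {0..T} (\<lambda>t. avg \<rho> K (response_rate y (\<sigma> * t))) - avg \<rho> K (\<lambda>p. \<omega> p (?V p))\<bar>
      \<le> \<bar>N\<bar> * \<bar>D\<bar> / \<kappa> * exp (- \<kappa> * T)" if "T \<ge> 0" for T
  proof -
    have "integral {0..T} (\<lambda>t. avg \<rho> K (response_rate y (\<sigma> * t))) - avg \<rho> K (\<lambda>p. \<omega> p (?V p)) =
      avg \<rho> K (\<lambda>p. \<omega> p (integral {0..T} (\<lambda>t. transport y p (\<sigma> * t))) - \<omega> p (?V p))"
      unfolding I by (rule avg_diff[OF Ic, symmetric]) (intro continuous_intros Vc, auto)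
    also have "\<bar>\<dots>\<bar> \<le> \<bar>N\<bar> * (\<bar>D\<bar> / \<kappa> * exp (- \<kappa> * T))"
    proof (rule avg_bound)
      show "continuous_on K (\<lambda>p. \<omega> p (integral {0..T} (\<lambda>t. transport y p (\<sigma> * t))) - \<omega> p (?V p))"
        by (intro continuous_on_diff Ic continuous_intros Vc) auto
      fix p assume p: "p \<in> K"
      have 1: "norm (integral {0..T} (\<lambda>t. transport y p (\<sigma> * t)) - ?V p) \<le> \<bar>D\<bar> / \<kappa> * exp (- \<kappa> * T)"
      proof -
        have "norm (?V p - integral {0..T} (\<lambda>t. transport y p (\<sigma> * t))) \<le> D / \<kappa> * exp (- \<kappa> * T)"
          by (rule transport_integral(2)[OF \<sigma> y _ p that]) (rule decay)
        also have "\<dots> \<le> \<bar>D\<bar> / \<kappa> * exp (- \<kappa> * T)"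
          using \<kappa> by (intro mult_right_mono divide_right_mono) auto
        finally show ?thesis by (simp add: norm_minus_commute)
      qed
      have "\<bar>\<omega> p (integral {0..T} (\<lambda>t. transport y p (\<sigma> * t))) - \<omega> p (?V p)\<bar>
        = norm (\<omega> p (integral {0..T} (\<lambda>t. transport y p (\<sigma> * t)) - ?V p))" by (simp add: blinfun.bilinear_simps)
      also have "\<dots> \<le> \<bar>N\<bar> * (\<bar>D\<bar> / \<kappa> * exp (- \<kappa> * T))"
        using N[OF p] 1 by (intro order_trans[OF norm_blinfun] mult_mono) auto
      finally show "\<bar>\<omega> p (integral {0..T} (\<lambda>t. transport y p (\<sigma> * t))) - \<omega> p (?V p)\<bar> \<le> \<bar>N\<bar> * (\<bar>D\<bar> / \<kappa> * exp (- \<kappa> * T))" .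
    qed (use \<kappa> in auto)
    finally show ?thesis by simp
  qed
  have lim0: "((\<lambda>T. \<bar>N\<bar> * \<bar>D\<bar> / \<kappa> * exp (- \<kappa> * T)) \<longlongrightarrow> 0) at_top" using \<kappa> by real_asymp
  have "((\<lambda>T. integral {0..T} (\<lambda>t. avg \<rho> K (response_rate y (\<sigma> * t))) - avg \<rho> K (\<lambda>p. \<omega> p (?V p))) \<longlongrightarrow> 0) at_top"
    by (rule Lim_null_comparison[OF _ lim0])
       (use eventually_ge_at_top[of 0] in eventually_elim, use bd in simp)
  then show "((\<lambda>T. integral {0..T} (\<lambda>t. avg \<rho> K (response_rate y (\<sigma> * t)))) \<longlongrightarrow> avg \<rho> K (\<lambda>p. \<omega> p (?V p))) at_top"
    by (simp add: LIM_zero_iff)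
qed

text \<open>Along one orbit the factor \<open>\<eta> p\<close> is a constant, taken at the starting
  point: \<open>B\<close> carries \<open>Fh p\<close> to \<open>Fh (f t p)\<close>, so the rate is
  exactly the time derivative of \<open>\<eta> p * \<Phi> (f t p)\<close>.\<close>

lemma center_response:
  assumes \<eta>: "continuous_on K \<eta>"
    and mix: "((\<lambda>T. avg \<rho> K (\<lambda>p. \<eta> p * \<Phi> (f T p))) \<longlongrightarrow> avg \<rho> K \<eta> * avg \<rho> K \<Phi>) at_top"
  shows "((\<lambda>T. integral {0..T} (\<lambda>t. avg \<rho> K (response_rate (\<lambda>p. \<eta> p *\<^sub>R Fh p) t))) \<longlongrightarrow>
     - avg \<rho> K (\<lambda>p. \<eta> p * (\<Phi> p - avg \<rho> K \<Phi>))) at_top"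
proof -
  let ?y = "\<lambda>p. \<eta> p *\<^sub>R Fh p"
  have yc: "continuous_on K ?y" by (intro continuous_intros \<eta> Fh_cont)
  have \<Phi>f: "continuous_on K (\<lambda>p. \<Phi> (f T p))" for T
    by (rule continuous_on_compose2[OF \<Phi>_cont]) (auto intro!: continuous_intros f_in)
  have eq: "integral {0..T} (\<lambda>t. avg \<rho> K (response_rate ?y t)) =
     avg \<rho> K (\<lambda>p. \<eta> p * \<Phi> (f T p)) - avg \<rho> K (\<lambda>p. \<eta> p * \<Phi> p)" if "T \<ge> 0" for T
  proof -
    have "integral {0..T} (\<lambda>t. avg \<rho> K (response_rate ?y t)) = avg \<rho> K (\<lambda>p. integral {0..T} (\<lambda>t. response_rate ?y t p))"
      by (rule avg_fubini(2)[OF continuous_on_response_rate[OF yc], symmetric])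
    also have "\<dots> = avg \<rho> K (\<lambda>p. \<eta> p * \<Phi> (f T p) - \<eta> p * \<Phi> p)"
    proof (rule avg_cong)
      fix p assume p: "p \<in> K"
      have "((\<lambda>t. response_rate ?y t p) has_integral (\<eta> p * \<Phi> (f T p) - \<eta> p * \<Phi> (f 0 p))) {0..T}"
      proof (rule fundamental_theorem_of_calculus[OF that])
        fix t assume "t \<in> {0..T}"
        have "((\<lambda>t. \<eta> p * \<Phi> (f t p)) has_real_derivative \<eta> p * \<omega> (f t p) (Fh (f t p))) (at t within {0..T})"
          by (rule DERIV_cmult[OF has_field_derivative_at_within[OF \<Phi>_deriv[OF p]]])
        moreover have "response_rate ?y t p = \<eta> p * \<omega> (f t p) (Fh (f t p))"
          by (simp add: response_rate_def blinfun.bilinear_simps B_Fh[OF p])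
        ultimately show "((\<lambda>t. \<eta> p * \<Phi> (f t p)) has_vector_derivative response_rate ?y t p) (at t within {0..T})"
          by (simp add: has_real_derivative_iff_has_vector_derivative)
      qed
      then show "integral {0..T} (\<lambda>t. response_rate ?y t p) = \<eta> p * \<Phi> (f T p) - \<eta> p * \<Phi> p"
        by (simp add: integral_unique f_0 p)
    qed
    also have "\<dots> = avg \<rho> K (\<lambda>p. \<eta> p * \<Phi> (f T p)) - avg \<rho> K (\<lambda>p. \<eta> p * \<Phi> p)"
      by (intro avg_diff continuous_intros \<eta> \<Phi>f \<Phi>_cont)
    finally show ?thesis .
  qed
  have "avg \<rho> K (\<lambda>p. \<eta> p * (\<Phi> p - avg \<rho> K \<Phi>)) = avg \<rho> K (\<lambda>p. \<eta> p * \<Phi> p - avg \<rho> K \<Phi> * \<eta> p)"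
    by (rule avg_cong) (simp add: algebra_simps)
  also have "\<dots> = avg \<rho> K (\<lambda>p. \<eta> p * \<Phi> p) - avg \<rho> K \<Phi> * avg \<rho> K \<eta>"
    by (subst avg_diff) (auto intro!: continuous_intros \<eta> \<Phi>_cont simp: avg_cmult)
  finally have "- avg \<rho> K (\<lambda>p. \<eta> p * (\<Phi> p - avg \<rho> K \<Phi>)) = avg \<rho> K \<eta> * avg \<rho> K \<Phi> - avg \<rho> K (\<lambda>p. \<eta> p * \<Phi> p)"
    by simp
  then have "((\<lambda>T. avg \<rho> K (\<lambda>p. \<eta> p * \<Phi> (f T p)) - avg \<rho> K (\<lambda>p. \<eta> p * \<Phi> p)) \<longlongrightarrow>
     - avg \<rho> K (\<lambda>p. \<eta> p * (\<Phi> p - avg \<rho> K \<Phi>))) at_top"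
    using tendsto_diff[OF mix tendsto_const[of "avg \<rho> K (\<lambda>p. \<eta> p * \<Phi> p)"]] by metis
  then show ?thesis
    by (rule Lim_transform_eventually) (use eventually_ge_at_top[of 0] in eventually_elim, simp add: eq)
qed

text \<open>A continuous field \<open>w\<close> whose Lie derivative is \<open>- \<zeta> F\<close> has no stable and unstable
  component, so \<open>w = a F\<close>, and \<open>\<omega>(w) - \<zeta> \<psi>\<close> is the derivative of \<open>a \<psi>\<close> along the flow.\<close>

lemma pairing_difference:
  assumes w: "continuous_on K w" and w0: "\<And>p. p \<in> K \<Longrightarrow> B 0 p (w p) = w p"
    and \<zeta>: "continuous_on K \<zeta>"
    and lie: "\<And>p. p \<in> K \<Longrightarrow> ((\<lambda>t. B (- t) (f t p) (w (f t p))) has_vector_derivative - \<zeta> p *\<^sub>R Fh p) (at 0)"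
  shows "avg \<rho> K (\<lambda>p. \<omega> p (w p)) = avg \<rho> K (\<lambda>p. \<zeta> p * (\<Phi> p - c))"
proof -
  \<comment> \<open>These are the values of \<open>w\<close> along the orbit, all pulled back to the
    tangent space at \<open>p\<close>. The hypothesis gives the derivative at time 0 for every base
    point; the cocycle law transfers it to time \<open>t\<close>.\<close>
  define W where "W = (\<lambda>p t. B (- t) (f t p) (w (f t p)))"
  have W': "(W p has_vector_derivative - \<zeta> (f t p) *\<^sub>R Fh p) (at t)" if p: "p \<in> K" for p t
  proof -
    let ?q = "f t p"
    have q: "?q \<in> K" using f_in[OF p] .
    have eq: "W p s = B (- t) ?q (W ?q (s - t))" for s
    proof -
      have s: "f s p = f (s - t) ?q" using f_add[OF p, of "s - t" t] by simp
      have "B (- s) (f s p) = B (- t + - (s - t)) (f s p)" by simp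
      also have "\<dots> = B (- t) (f (- (s - t)) (f s p)) o\<^sub>L B (- (s - t)) (f s p)"
        by (rule B_add[OF f_in[OF p]])
      also have "f (- (s - t)) (f s p) = ?q" unfolding s by (rule f_minus(1)[OF q])
      finally show ?thesis by (simp add: W_def flip: s)
    qed
    have "((\<lambda>h. W ?q h) has_vector_derivative - \<zeta> ?q *\<^sub>R Fh ?q) (at (t - t))"
      using lie[OF q] by (simp add: W_def)
    moreover have "((\<lambda>s. s - t) has_vector_derivative 1) (at t)" by (auto intro!: derivative_eq_intros)
    ultimately have "(W ?q \<circ> (\<lambda>s. s - t) has_vector_derivative 1 *\<^sub>R (- \<zeta> ?q *\<^sub>R Fh ?q)) (at t)"
      by (intro vector_diff_chain_at) simp_all
    then have "((\<lambda>s. W ?q (s - t)) has_vector_derivative - \<zeta> ?q *\<^sub>R Fh ?q) (at t)"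
      by (simp add: o_def)
    from bounded_linear.has_vector_derivative[OF blinfun.bounded_linear_right this, of "B (- t) ?q"]
    have "((\<lambda>s. B (- t) ?q (W ?q (s - t))) has_vector_derivative B (- t) ?q (- \<zeta> ?q *\<^sub>R Fh ?q)) (at t)" .
    moreover have "B (- t) ?q (- \<zeta> ?q *\<^sub>R Fh ?q) = - \<zeta> ?q *\<^sub>R Fh p"
      by (simp add: blinfun.bilinear_simps B_Fh[OF q] f_minus p)
    ultimately show ?thesis by (simp add: eq[abs_def])
  qed
  obtain N where N: "\<And>p. p \<in> K \<Longrightarrow> norm (w p) \<le> N"
    using compact_imp_bounded[OF compact_continuous_image[OF w compact_K]] unfolding bounded_iff by auto
  \<comment> \<open>\<open>Q p\<close> kills \<open>Fh p\<close>, so \<open>Q p (W p t)\<close> is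
    constant in \<open>t\<close>; it also decays, because vectors in the range of \<open>Q\<close>
    are contracted when carried back to \<open>p\<close> from far along the orbit. For the stable
    projection they have to come from the past, hence the sign -1 below.\<close>
  have zero: "Q p (w p) = 0"
    if p: "p \<in> K" and QF: "Q p (Fh p) = 0" and Q0: "Q p (B 0 p (w p)) = Q p (w p)"
      and comm: "\<And>t. Q p o\<^sub>L B (- t) (f t p) = B (- t) (f t p) o\<^sub>L Q (f t p)"
      and dec: "\<And>t. t \<ge> 0 \<Longrightarrow> norm (B (- (\<sigma> * t)) (f (\<sigma> * t) p) o\<^sub>L Q (f (\<sigma> * t) p)) \<le> C * exp (- \<kappa> * t)"
    for Q :: "'m \<Rightarrow> 'b \<Rightarrow>\<^sub>L 'b" and \<sigma> :: real and p
  proof -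
    have "((\<lambda>t. Q p (W p t)) has_derivative (\<lambda>h. 0)) (at t)" for t
    proof -
      from bounded_linear.has_vector_derivative[OF blinfun.bounded_linear_right W'[OF p], of "Q p" t]
      show ?thesis by (simp add: blinfun.bilinear_simps QF has_vector_derivative_def)
    qed
    then have "Q p (W p t) = Q p (W p 0)" for t
      using has_derivative_zero_unique[of UNIV "\<lambda>t. Q p (W p t)" 0 t] by (metis UNIV_I convex_UNIV has_derivative_at_withinI)
    then have const: "Q p (W p t) = Q p (w p)" for t using Q0 by (simp add: W_def f_0 p)
    have le: "norm (Q p (w p)) \<le> C * exp (- \<kappa> * t) * N" if "t \<ge> 0" for t
    proof -
      let ?q = "f (\<sigma> * t) p"
      have "Q p (w p) = (B (- (\<sigma> * t)) ?q o\<^sub>L Q ?q) (w ?q)"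
        unfolding comm[symmetric] const[of "\<sigma> * t", symmetric] by (simp add: W_def)
      also have "norm \<dots> \<le> C * exp (- \<kappa> * t) * N"
        using dec[OF that] N[OF f_in[OF p]] C by (intro order_trans[OF norm_blinfun] mult_mono) auto
      finally show ?thesis .
    qed
    have "((\<lambda>t. C * exp (- \<kappa> * t) * N) \<longlongrightarrow> 0) at_top" using \<kappa> by real_asymp
    from tendsto_lowerbound[OF this, of "norm (Q p (w p))"] show ?thesis
      using le eventually_mono[OF eventually_ge_at_top[of "0::real"]] by auto
  qed
  have ws: "Qs p (w p) = 0" if p: "p \<in> K" for p
  proof (rule zero[of p Qs "-1", OF p Q_Fh(1)[OF p]])
    show "Qs p (B 0 p (w p)) = Qs p (w p)" using w0[OF p] by simp
    show "Qs p o\<^sub>L B (- t) (f t p) = B (- t) (f t p) o\<^sub>L Qs (f t p)" for t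
      using B_Qs[OF f_in[OF p], of "-t" t] by (simp add: f_minus p)
  qed (use Qs_decay f_in p in simp)
  have wu: "Qu p (w p) = 0" if p: "p \<in> K" for p
  proof (rule zero[of p Qu 1, OF p Q_Fh(2)[OF p]])
    show "Qu p (B 0 p (w p)) = Qu p (w p)" using w0[OF p] by simp
    show "Qu p o\<^sub>L B (- t) (f t p) = B (- t) (f t p) o\<^sub>L Qu (f t p)" for t
      using B_Qu[OF f_in[OF p], of "-t" t] by (simp add: f_minus p)
  qed (use Qu_decay f_in p in simp)
  have "\<exists>a. w p = a *\<^sub>R Fh p" if p: "p \<in> K" for p
  proof -
    have "w p = Qc p (w p)" using w0[OF p] ws[OF p] wu[OF p] by (simp add: B_0 p blinfun.bilinear_simps)
    then show ?thesis using Qc_range[OF p] by metis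
  qed
  then obtain a where a: "\<And>p. p \<in> K \<Longrightarrow> w p = a p *\<^sub>R Fh p" by metis
  have ac: "continuous_on K a" by (rule continuous_coefficient[OF w a])
  let ?\<psi> = "\<lambda>p. \<Phi> p - c" and ?k = "\<lambda>p. \<omega> p (w p) - \<zeta> p * (\<Phi> p - c)"
  have kc: "continuous_on K ?k" by (intro continuous_intros w \<zeta> \<Phi>_cont) auto
  have kfc: "continuous_on (T \<times> K) (\<lambda>(t, p). ?k (f t p))" for T
    unfolding split_beta by (rule continuous_on_compose2[OF kc]) (auto intro!: continuous_intros f_in)
  have Wa: "W p t = a (f t p) *\<^sub>R Fh p" if p: "p \<in> K" for p t
    using a[OF f_in[OF p]] B_Fh[OF f_in[OF p], of "-t" t] by (simp add: W_def blinfun.bilinear_simps f_minus p)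
  \<comment> \<open>The coefficient \<open>a\<close> is only known to be continuous, so the vector
    \<open>\<psi> W\<close>, which equals \<open>a \<psi> Fh p\<close>, is differentiated in place
    of the number \<open>a \<psi>\<close>, and the nonzero vector \<open>Fh p\<close> is cancelled
    at the end.\<close>
  have ftc: "integral {0..1} (\<lambda>t. ?k (f t p)) = a (f 1 p) * ?\<psi> (f 1 p) - a p * ?\<psi> p" if p: "p \<in> K" for p
  proof -
    have "((\<lambda>t. ?k (f t p) *\<^sub>R Fh p) has_integral (?\<psi> (f 1 p) *\<^sub>R W p 1 - ?\<psi> (f 0 p) *\<^sub>R W p 0)) {0..1}"
    proof (rule fundamental_theorem_of_calculus)
      fix t :: real assume "t \<in> {0..1}"
      have "((\<lambda>t. ?\<psi> (f t p)) has_real_derivative \<omega> (f t p) (Fh (f t p))) (at t)"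
        using \<Phi>_deriv[OF p, of t] by (auto intro!: derivative_eq_intros)
      from has_vector_derivative_scaleR[OF this W'[OF p, of t]]
      have "((\<lambda>t. ?\<psi> (f t p) *\<^sub>R W p t) has_vector_derivative
          ?\<psi> (f t p) *\<^sub>R (- \<zeta> (f t p) *\<^sub>R Fh p) + \<omega> (f t p) (Fh (f t p)) *\<^sub>R W p t) (at t)" .
      moreover have "?\<psi> (f t p) *\<^sub>R (- \<zeta> (f t p) *\<^sub>R Fh p) + \<omega> (f t p) (Fh (f t p)) *\<^sub>R W p t = ?k (f t p) *\<^sub>R Fh p"
        by (simp add: Wa[OF p] a[OF f_in[OF p]] blinfun.bilinear_simps algebra_simps flip: scaleR_add_left)
      ultimately show "((\<lambda>t. ?\<psi> (f t p) *\<^sub>R W p t) has_vector_derivative ?k (f t p) *\<^sub>R Fh p) (at t within {0..1})"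
        using has_vector_derivative_at_within by metis
    qed simp
    moreover have "((\<lambda>t. ?k (f t p) *\<^sub>R Fh p) has_integral integral {0..1} (\<lambda>t. ?k (f t p)) *\<^sub>R Fh p) {0..1}"
    proof (rule has_integral_scaleR_left, rule integrable_integral, rule integrable_continuous_interval)
      show "continuous_on {0..1} (\<lambda>t. ?k (f t p))"
        by (rule continuous_on_compose2[OF kc]) (auto intro!: continuous_intros f_in p)
    qed
    ultimately have "integral {0..1} (\<lambda>t. ?k (f t p)) *\<^sub>R Fh p = ?\<psi> (f 1 p) *\<^sub>R W p 1 - ?\<psi> (f 0 p) *\<^sub>R W p 0"
      by (rule has_integral_unique[rotated])
    also have "\<dots> = (a (f 1 p) * ?\<psi> (f 1 p) - a p * ?\<psi> p) *\<^sub>R Fh p"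
      by (simp add: Wa[OF p] f_0 p algebra_simps)
    finally show ?thesis using Fh_nonzero[OF p] by simp
  qed
  \<comment> \<open>By invariance the average of \<open>k\<close> is its average over orbit segments
    of length 1; there the integral is the difference of \<open>a \<psi>\<close> at the two ends,
    and the averages of these agree, again by invariance.\<close>
  have "avg \<rho> K ?k = integral {0..1} (\<lambda>t. avg \<rho> K (\<lambda>p. ?k (f t p)))"
    by (simp add: avg_invariant[OF kc])
  also have "\<dots> = avg \<rho> K (\<lambda>p. integral {0..1} (\<lambda>t. ?k (f t p)))" by (rule avg_fubini(2)[OF kfc, symmetric])
  also have "\<dots> = avg \<rho> K (\<lambda>p. a (f 1 p) * ?\<psi> (f 1 p) - a p * ?\<psi> p)" by (rule avg_cong) (rule ftc)
  also have "\<dots> = avg \<rho> K (\<lambda>p. a (f 1 p) * ?\<psi> (f 1 p)) - avg \<rho> K (\<lambda>p. a p * ?\<psi> p)"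
  proof (rule avg_diff)
    have apc: "continuous_on K (\<lambda>p. a p * ?\<psi> p)" by (intro continuous_intros ac \<Phi>_cont)
    then show "continuous_on K (\<lambda>p. a p * ?\<psi> p)" .
    show "continuous_on K (\<lambda>p. a (f 1 p) * ?\<psi> (f 1 p))"
      by (rule continuous_on_compose2[OF apc]) (auto intro!: continuous_intros f_in)
  qed
  also have "\<dots> = 0"
    using avg_invariant[of "\<lambda>p. a p * ?\<psi> p" 1] by (simp add: continuous_intros ac \<Phi>_cont)
  finally have "avg \<rho> K ?k = 0" .
  moreover have "avg \<rho> K ?k = avg \<rho> K (\<lambda>p. \<omega> p (w p)) - avg \<rho> K (\<lambda>p. \<zeta> p * (\<Phi> p - c))"
    by (rule avg_diff) (intro continuous_intros w \<zeta> \<Phi>_cont; simp)+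
  ultimately show ?thesis by simp
qed

end

section \<open>Local Lipschitz estimates on a manifold\<close>

text \<open>A finite subcover yields finitely many constants, and monotonicity allows the sum of
  their absolute values to replace each of them.\<close>

lemma compact_local_const:
  fixes P :: "'a::topological_space \<Rightarrow> real \<Rightarrow> bool"
  assumes S: "compact S" and loc: "\<And>z. z \<in> S \<Longrightarrow> \<exists>C. \<forall>\<^sub>F w in nhds z. w \<in> S \<longrightarrow> P w C"
    and mono: "\<And>w C D. w \<in> S \<Longrightarrow> P w C \<Longrightarrow> C \<le> D \<Longrightarrow> P w D"
  shows "\<exists>C\<ge>0. \<forall>w\<in>S. P w C"
proof -
  define \<U> where "\<U> = {U. open U \<and> (\<exists>C. \<forall>w\<in>U. w \<in> S \<longrightarrow> P w C)}"
  have "S \<subseteq> \<Union>\<U>"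
  proof
    fix z assume z: "z \<in> S"
    obtain C where "\<forall>\<^sub>F w in nhds z. w \<in> S \<longrightarrow> P w C" using loc[OF z] by (rule exE)
    then obtain U where "open U" "z \<in> U" "\<forall>w\<in>U. w \<in> S \<longrightarrow> P w C"
      unfolding eventually_nhds by (elim exE conjE)
    then have "U \<in> \<U>" unfolding \<U>_def by (intro CollectI conjI exI[of _ C])
    with \<open>z \<in> U\<close> show "z \<in> \<Union>\<U>" by (rule UnionI[rotated])
  qed
  moreover have "open U" if "U \<in> \<U>" for U using that unfolding \<U>_def by simp
  ultimately obtain T where T: "T \<subseteq> \<U>" "finite T" "S \<subseteq> \<Union>T" using compactE[OF S] by metis
  have "\<forall>U\<in>T. \<exists>C. \<forall>w\<in>U. w \<in> S \<longrightarrow> P w C"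
  proof
    fix U assume "U \<in> T"
    then have "U \<in> \<U>" using T(1) by (rule subsetD[rotated])
    then show "\<exists>C. \<forall>w\<in>U. w \<in> S \<longrightarrow> P w C" unfolding \<U>_def by simp
  qed
  from bchoice[OF this] obtain C where C: "\<forall>U\<in>T. \<forall>w\<in>U. w \<in> S \<longrightarrow> P w (C U)" by (rule exE)
  define M where "M = (\<Sum>z\<in>T. \<bar>C z\<bar>)"
  have "P w M" if w: "w \<in> S" for w
  proof -
    obtain z where z: "z \<in> T" "w \<in> z" using T(3) w by (auto dest: subsetD)
    then have "P w (C z)" using C w by simp
    moreover have "C z \<le> M" using member_le_sum[of z T "\<lambda>z. \<bar>C z\<bar>"] z T by (simp add: M_def)
    ultimately show ?thesis by (rule mono[OF w])
  qed
  moreover have "M \<ge> 0" by (simp add: M_def sum_nonneg)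
  ultimately show ?thesis by (intro exI[of _ M]) simp
qed

lemma compact_local_bound:
  fixes \<phi> \<psi> :: "'a::topological_space \<Rightarrow> real"
  assumes S: "compact S" and loc: "\<And>z. z \<in> S \<Longrightarrow> \<exists>C. \<forall>\<^sub>F w in nhds z. w \<in> S \<longrightarrow> \<phi> w \<le> C * \<psi> w"
    and pos: "\<And>z. z \<in> S \<Longrightarrow> 0 \<le> \<psi> z"
  shows "\<exists>C\<ge>0. \<forall>w\<in>S. \<phi> w \<le> C * \<psi> w"
  by (rule compact_local_const[OF S loc]) (use pos in \<open>auto intro: order_trans mult_right_mono\<close>)

lemma tendsto_eventually_bounded:
  fixes h :: "'a \<Rightarrow> 'b::real_normed_vector"
  assumes "(h \<longlongrightarrow> l) F"
  shows "\<forall>\<^sub>F x in F. norm (h x) \<le> norm l + 1"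
  using order_tendstoD(2)[OF tendsto_norm[OF assms], of "norm l + 1"] by (auto elim: eventually_mono)

lemma continuous_nhds_compose:
  fixes g :: "'a::t2_space \<Rightarrow> 'b::topological_space"
  assumes "open U" "z \<in> U" "continuous_on U g" "filterlim h (nhds z) F"
  shows "filterlim (\<lambda>x. g (h x)) (nhds (g z)) F"
proof -
  have "isCont g z" using assms continuous_on_eq_continuous_at by blast
  then show ?thesis using isCont_tendsto_compose[OF _ assms(4)] by blast
qed

definition Bl :: "('a::euclidean_space \<Rightarrow> 'b::real_normed_vector) \<Rightarrow> 'a \<Rightarrow>\<^sub>L 'b" where
  "Bl = Blinfun"

lemma Bl_apply: "linear h \<Longrightarrow> Bl h x = h x"
  by (simp add: Bl_def bounded_linear_Blinfun_apply linear_conv_bounded_linear)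

text \<open>These rank-one operators assemble a linear map from its values on \<open>Basis\<close>,
  so regularity of an operator-valued function reduces to that of finitely many vector-valued
  ones.\<close>

definition coord_map :: "'a::euclidean_space \<Rightarrow> 'b::real_normed_vector \<Rightarrow> 'a \<Rightarrow>\<^sub>L 'b" where
  "coord_map b y = Bl (\<lambda>u. (u \<bullet> b) *\<^sub>R y)"

lemma linear_inner_scale: "linear (\<lambda>u. (u \<bullet> b) *\<^sub>R y)"
  by (simp add: linear_iff inner_add_left scaleR_add_left)

lemma coord_map_apply: "coord_map b y u = (u \<bullet> b) *\<^sub>R y"
  unfolding coord_map_def by (simp add: Bl_apply linear_inner_scale)

lemma bounded_linear_coord_map:
  fixes b :: "'a::euclidean_space"
  shows "bounded_linear (coord_map b :: 'b::real_normed_vector \<Rightarrow> _)"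
proof (rule bounded_linear_intro[where K="norm b"])
  show "coord_map b (x + y) = coord_map b x + coord_map b y" for x y :: 'b
    by (rule blinfun_eqI) (simp add: coord_map_apply blinfun.bilinear_simps scaleR_add_right)
  show "coord_map b (r *\<^sub>R x) = r *\<^sub>R coord_map b x" for r and x :: 'b
    by (rule blinfun_eqI) (simp add: coord_map_apply blinfun.bilinear_simps)
  show "norm (coord_map b x) \<le> norm x * norm b" for x :: 'b
  proof (rule norm_blinfun_bound)
    fix u
    have "\<bar>u \<bullet> b\<bar> * norm x \<le> (norm u * norm b) * norm x"
      by (intro mult_right_mono Cauchy_Schwarz_ineq2) simp
    then show "norm (coord_map b x u) \<le> norm x * norm b * norm u" by (simp add: coord_map_apply mult_ac)
  qed simp
qed

lemma Bl_Basis: "linear h \<Longrightarrow> Bl h = (\<Sum>b\<in>Basis. coord_map b (h b))"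
  by (rule blinfun_eqI) (simp add: Bl_apply blinfun.sum_left coord_map_apply flip: linear_euclidean_sum)

section \<open>Locally Lipschitz families depending on time and a point\<close>

context smooth_flow
begin

text \<open>The estimate compares two points at the same time, uniformly for times near
  \<open>t0\<close> and points near the diagonal, while continuity is joint in both arguments.
  Quantifying over all charts frees the notion from the choice \<open>chart_at\<close>; one chart
  suffices to establish it, since transition maps are locally Lipschitz.\<close>

definition locally_lipschitz :: "real \<Rightarrow> 'm \<Rightarrow> (real \<Rightarrow> 'm \<Rightarrow> 'b::real_normed_vector) \<Rightarrow> bool" where
  "locally_lipschitz t0 p H \<longleftrightarrow> ((\<lambda>(t, x). H t x) \<longlongrightarrow> H t0 p) (nhds (t0, p)) \<and>
     (\<forall>c\<in>A. p \<in> cdom c \<longrightarrow> (\<exists>C. \<forall>\<^sub>F (t, x, y) in nhds (t0, p, p).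
        norm (H t x - H t y) \<le> C * norm (cmap c x - cmap c y)))"

lemma tendsto_fst_nhds: "(fst \<longlongrightarrow> a) (nhds (a, b))" and tendsto_snd_nhds: "(snd \<longlongrightarrow> b) (nhds (a, b))"
  using tendsto_fst[OF filterlim_ident, of "(a, b)"] tendsto_snd[OF filterlim_ident, of "(a, b)"] by simp_all

lemma filterlim_left: "filterlim (\<lambda>(t, x, y). (t, x)) (nhds (t0, p)) (nhds (t0, p, q))"
  and filterlim_right: "filterlim (\<lambda>(t, x, y). (t, y)) (nhds (t0, q)) (nhds (t0, p, q))"
  unfolding split_beta'
  by (rule tendsto_Pair[OF tendsto_fst_nhds filterlim_compose[OF tendsto_fst_nhds tendsto_snd_nhds]],
      rule tendsto_Pair[OF tendsto_fst_nhds filterlim_compose[OF tendsto_snd_nhds tendsto_snd_nhds]])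

lemma eventually_left:
  assumes "\<forall>\<^sub>F (t, x) in nhds (t0, p). P t x"
  shows "\<forall>\<^sub>F (t, x, y) in nhds (t0, p, q). P t x" "\<forall>\<^sub>F (t, x, y) in nhds (t0, q, p). P t y"
  using eventually_compose_filterlim[OF assms filterlim_left] eventually_compose_filterlim[OF assms filterlim_right]
  by (simp_all add: split_beta')

lemma cmap_tendsto:
  "c \<in> A \<Longrightarrow> p \<in> cdom c \<Longrightarrow> ((\<lambda>(t, x). (t, cmap c x)) \<longlongrightarrow> (t0, cmap c p)) (nhds (t0, p))"
  unfolding split_beta'
  by (intro tendsto_Pair tendsto_fst_nhds continuous_nhds_compose[OF open_cdom _ cont_cmap tendsto_snd_nhds])

lemma eventually_snd_in: "open N \<Longrightarrow> p \<in> N \<Longrightarrow> \<forall>\<^sub>F (t, x) in nhds (t0, p). x \<in> N"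
  unfolding eventually_nhds by (rule exI[of _ "UNIV \<times> N"]) (auto intro: open_Times)

lemma locally_lipschitz_in_chart:
  fixes h :: "real \<times> 'e \<Rightarrow> 'b::real_normed_vector"
  assumes r: "r > 0" "C \<ge> 0"
      "\<And>x y. x \<in> ball (t0, cmap c p) r \<Longrightarrow> y \<in> ball (t0, cmap c p) r \<Longrightarrow> norm (h x - h y) \<le> C * norm (x - y)"
    and c: "c \<in> A" "p \<in> cdom c"
  shows "locally_lipschitz t0 p (\<lambda>t x. h (t, cmap c x))"
  unfolding locally_lipschitz_def
proof (intro conjI ballI impI)
  have "continuous_on (ball (t0, cmap c p) r) h"
    by (rule lipschitz_on_continuous_on[of C], rule lipschitz_onI) (use r in \<open>auto simp: dist_norm\<close>)
  then have "((\<lambda>z. h ((\<lambda>(t, x). (t, cmap c x)) z)) \<longlongrightarrow> h (t0, cmap c p)) (nhds (t0, p))"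
    by (intro continuous_nhds_compose[OF open_ball _ _ cmap_tendsto[OF c]]) (use r in auto)
  then show "((\<lambda>(t, x). h (t, cmap c x)) \<longlongrightarrow> h (t0, cmap c p)) (nhds (t0, p))" by (simp add: split_beta')
  fix d assume d: "d \<in> A" "p \<in> cdom d"
  have "cmap d p \<in> cmap d ` (cdom d \<inter> cdom c)" using c d by blast
  from smooth_on_locally_lipschitz[OF smooth_transition[OF d(1) c(1)] open_overlap[OF d(1) c(1)] this]
  obtain s D where s: "s > 0" "D \<ge> 0" "\<And>x y. x \<in> ball (cmap d p) s \<Longrightarrow> y \<in> ball (cmap d p) s \<Longrightarrow>
     norm ((cmap c \<circ> cinv d) x - (cmap c \<circ> cinv d) y) \<le> D * norm (x - y)" by blast
  have "\<forall>\<^sub>F z in nhds (t0, p). (case z of (t, x) \<Rightarrow> (t, cmap c x)) \<in> ball (t0, cmap c p) r"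
    by (rule topological_tendstoD[OF cmap_tendsto[OF c]]) (use r in auto)
  moreover have "\<forall>\<^sub>F z in nhds (t0, p). (case z of (t, x) \<Rightarrow> (t, cmap d x)) \<in> UNIV \<times> ball (cmap d p) s"
    by (rule topological_tendstoD[OF cmap_tendsto[OF d]]) (use s in \<open>auto intro: open_Times\<close>)
  moreover have "\<forall>\<^sub>F (t, x) in nhds (t0, p). x \<in> cdom d" by (intro eventually_snd_in open_cdom d)
  ultimately have near: "\<forall>\<^sub>F (t, x) in nhds (t0, p). (t, cmap c x) \<in> ball (t0, cmap c p) r \<and> cmap d x \<in> ball (cmap d p) s \<and> x \<in> cdom d"
    by eventually_elim auto
  show "\<exists>C. \<forall>\<^sub>F (t, x, y) in nhds (t0, p, p). norm (h (t, cmap c x) - h (t, cmap c y)) \<le> C * norm (cmap d x - cmap d y)"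
  proof (rule exI[of _ "C * D"])
    show "\<forall>\<^sub>F (t, x, y) in nhds (t0, p, p). norm (h (t, cmap c x) - h (t, cmap c y)) \<le> C * D * norm (cmap d x - cmap d y)"
      using eventually_left(1)[OF near] eventually_left(2)[OF near]
    proof eventually_elim
      case (elim z)
      obtain t x y where [simp]: "z = (t, x, y)" by (cases z) auto
      have "norm (h (t, cmap c x) - h (t, cmap c y)) \<le> C * norm (cmap c x - cmap c y)"
        using r(3)[of "(t, cmap c x)" "(t, cmap c y)"] elim by (simp add: norm_Pair)
      also have "norm (cmap c x - cmap c y) \<le> D * norm (cmap d x - cmap d y)"
        using s(3)[of "cmap d x" "cmap d y"] elim cinv_cmap[OF d(1)] by simp
      finally show ?case using r(2) by (simp add: mult.assoc mult_left_mono)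
    qed
  qed
qed

lemma locally_lipschitz_smooth:
  fixes h :: "real \<times> 'e \<Rightarrow> 'b::real_normed_vector"
  assumes h: "smooth_on S h" "open S" and c: "c \<in> A" "p \<in> cdom c" and z: "(t0, cmap c p) \<in> S"
  shows "locally_lipschitz t0 p (\<lambda>t x. h (t, cmap c x))"
proof -
  obtain r C where "r > 0" "C \<ge> 0"
      "\<And>x y. x \<in> ball (t0, cmap c p) r \<Longrightarrow> y \<in> ball (t0, cmap c p) r \<Longrightarrow> norm (h x - h y) \<le> C * norm (x - y)"
    using smooth_on_locally_lipschitz[OF h z] by blast
  then show ?thesis by (rule locally_lipschitz_in_chart[OF _ _ _ c])
qed

lemma locally_lipschitz_smooth_static:
  fixes h :: "'e \<Rightarrow> 'b::real_normed_vector"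
  assumes h: "smooth_on S h" "open S" and c: "c \<in> A" "p \<in> cdom c" and z: "cmap c p \<in> S"
  shows "locally_lipschitz t0 p (\<lambda>t x. h (cmap c x))"
proof -
  obtain r C where r: "r > 0" "C \<ge> 0"
      "\<And>x y. x \<in> ball (cmap c p) r \<Longrightarrow> y \<in> ball (cmap c p) r \<Longrightarrow> norm (h x - h y) \<le> C * norm (x - y)"
    using smooth_on_locally_lipschitz[OF h z] by blast
  have "locally_lipschitz t0 p (\<lambda>t x. (h \<circ> snd) (t, cmap c x))"
  proof (rule locally_lipschitz_in_chart[OF r(1,2) _ c])
    fix x y assume "x \<in> ball (t0, cmap c p) r" "y \<in> ball (t0, cmap c p) r"
    then have "snd x \<in> ball (cmap c p) r" "snd y \<in> ball (cmap c p) r"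
      using dist_snd_le[of "(t0, cmap c p)" x] dist_snd_le[of "(t0, cmap c p)" y] by auto
    from r(3)[OF this] have "norm ((h \<circ> snd) x - (h \<circ> snd) y) \<le> C * dist (snd x) (snd y)" by (simp add: dist_norm)
    also have "\<dots> \<le> C * norm (x - y)" using r(2) dist_snd_le[of x y] by (intro mult_left_mono) (simp_all only: dist_norm)
    finally show "norm ((h \<circ> snd) x - (h \<circ> snd) y) \<le> C * norm (x - y)" .
  qed
  then show ?thesis by simp
qed

lemma locally_lipschitz_tendsto:
  "locally_lipschitz t0 p H \<Longrightarrow> ((\<lambda>(t, x). H t x) \<longlongrightarrow> H t0 p) (nhds (t0, p))"
  unfolding locally_lipschitz_def by blast

lemma locally_lipschitz_estimate:
  assumes "locally_lipschitz t0 p H" "c \<in> A" "p \<in> cdom c"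
  obtains C where "C \<ge> 0" "\<forall>\<^sub>F (t, x, y) in nhds (t0, p, p). norm (H t x - H t y) \<le> C * norm (cmap c x - cmap c y)"
proof -
  obtain C where C: "\<forall>\<^sub>F (t, x, y) in nhds (t0, p, p). norm (H t x - H t y) \<le> C * norm (cmap c x - cmap c y)"
    using assms unfolding locally_lipschitz_def by blast
  have "\<forall>\<^sub>F (t, x, y) in nhds (t0, p, p). norm (H t x - H t y) \<le> \<bar>C\<bar> * norm (cmap c x - cmap c y)"
    using C by eventually_elim (auto intro: order_trans[OF _ mult_right_mono])
  then show ?thesis using that[of "\<bar>C\<bar>"] by simp
qed

lemma locally_lipschitz_const: "locally_lipschitz t0 p (\<lambda>t x. k)"
  unfolding locally_lipschitz_def split_beta' by (auto intro!: exI[of _ 0])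

lemma locally_lipschitz_bilinear:
  assumes "bounded_bilinear pr" "locally_lipschitz t0 p H" "locally_lipschitz t0 p J"
  shows "locally_lipschitz t0 p (\<lambda>t x. pr (H t x) (J t x))"
proof -
  interpret bounded_bilinear pr by fact
  note H = locally_lipschitz_tendsto[OF assms(2)] and J = locally_lipschitz_tendsto[OF assms(3)]
  obtain N where N: "N \<ge> 0" "\<And>x y. norm (pr x y) \<le> norm x * norm y * N" using nonneg_bounded by blast
  show ?thesis
    unfolding locally_lipschitz_def
  proof (intro conjI ballI impI)
    show "((\<lambda>(t, x). pr (H t x) (J t x)) \<longlongrightarrow> pr (H t0 p) (J t0 p)) (nhds (t0, p))"
      using tendsto[OF H J] by (simp add: split_beta')
    fix c assume c: "c \<in> A" "p \<in> cdom c"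
    obtain C where C: "C \<ge> 0" "\<forall>\<^sub>F (t, x, y) in nhds (t0, p, p). norm (H t x - H t y) \<le> C * norm (cmap c x - cmap c y)"
      using locally_lipschitz_estimate[OF assms(2) c] .
    obtain D where D: "D \<ge> 0" "\<forall>\<^sub>F (t, x, y) in nhds (t0, p, p). norm (J t x - J t y) \<le> D * norm (cmap c x - cmap c y)"
      using locally_lipschitz_estimate[OF assms(3) c] .
    define a b where "a = norm (H t0 p) + 1" and "b = norm (J t0 p) + 1"
    have ab: "a \<ge> 0" "b \<ge> 0" by (simp_all add: a_def b_def)
    have "\<forall>\<^sub>F (t, x) in nhds (t0, p). norm (H t x) \<le> a"
      using tendsto_eventually_bounded[OF H] by eventually_elim (auto simp: a_def)
    from eventually_left(2)[OF this] have Ha: "\<forall>\<^sub>F (t, x, y) in nhds (t0, p, p). norm (H t y) \<le> a" .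
    have "\<forall>\<^sub>F (t, x) in nhds (t0, p). norm (J t x) \<le> b"
      using tendsto_eventually_bounded[OF J] by eventually_elim (auto simp: b_def)
    from eventually_left(1)[OF this] have Jb: "\<forall>\<^sub>F (t, x, y) in nhds (t0, p, p). norm (J t x) \<le> b" .
    have "\<forall>\<^sub>F (t, x, y) in nhds (t0, p, p). norm (pr (H t x) (J t x) - pr (H t y) (J t y)) \<le> (C * b * N + a * D * N) * norm (cmap c x - cmap c y)"
      using C(2) D(2) Ha Jb
    proof eventually_elim
      case (elim z)
      obtain t x y where [simp]: "z = (t, x, y)" by (cases z) auto
      let ?e = "norm (cmap c x - cmap c y)"
      have "pr (H t x) (J t x) - pr (H t y) (J t y) = pr (H t x - H t y) (J t x) + pr (H t y) (J t x - J t y)"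
        by (simp add: diff_left diff_right)
      also have "norm \<dots> \<le> norm (H t x - H t y) * norm (J t x) * N + norm (H t y) * norm (J t x - J t y) * N"
        by (intro order_trans[OF norm_triangle_ineq] add_mono N(2))
      also have "\<dots> \<le> (C * ?e) * b * N + a * (D * ?e) * N"
        using elim ab C(1) D(1) N(1) by (intro add_mono mult_right_mono mult_mono) auto
      finally show ?case by (simp add: algebra_simps)
    qed
    then show "\<exists>C. \<forall>\<^sub>F (t, x, y) in nhds (t0, p, p). norm (pr (H t x) (J t x) - pr (H t y) (J t y)) \<le> C * norm (cmap c x - cmap c y)" ..
  qed
qed

lemma locally_lipschitz_linear:
  assumes L: "bounded_linear L" and H: "locally_lipschitz t0 p H"
  shows "locally_lipschitz t0 p (\<lambda>t x. L (H t x))"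
proof -
  interpret bounded_linear L by fact
  have bb: "bounded_bilinear (\<lambda>(r::real) x. r *\<^sub>R L x)"
    using bounded_bilinear.comp[of scaleR "\<lambda>x. x" L] bounded_bilinear_scaleR L by auto
  from locally_lipschitz_bilinear[OF bb locally_lipschitz_const[of _ _ 1] H] show ?thesis by simp
qed

lemma locally_lipschitz_add:
  assumes "locally_lipschitz t0 p H" "locally_lipschitz t0 p J"
  shows "locally_lipschitz t0 p (\<lambda>t x. H t x + J t x)"
  unfolding locally_lipschitz_def
proof (intro conjI ballI impI)
  show "((\<lambda>(t, x). H t x + J t x) \<longlongrightarrow> H t0 p + J t0 p) (nhds (t0, p))"
    using tendsto_add[OF locally_lipschitz_tendsto[OF assms(1)] locally_lipschitz_tendsto[OF assms(2)]]
    by (simp add: split_beta')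
  fix c assume c: "c \<in> A" "p \<in> cdom c"
  obtain C where C: "\<forall>\<^sub>F (t, x, y) in nhds (t0, p, p). norm (H t x - H t y) \<le> C * norm (cmap c x - cmap c y)"
    using locally_lipschitz_estimate[OF assms(1) c] .
  obtain D where D: "\<forall>\<^sub>F (t, x, y) in nhds (t0, p, p). norm (J t x - J t y) \<le> D * norm (cmap c x - cmap c y)"
    using locally_lipschitz_estimate[OF assms(2) c] .
  have "\<forall>\<^sub>F (t, x, y) in nhds (t0, p, p). norm (H t x + J t x - (H t y + J t y)) \<le> (C + D) * norm (cmap c x - cmap c y)"
    using C D
  proof eventually_elim
    case (elim z)
    obtain t x y where [simp]: "z = (t, x, y)" by (cases z) auto
    have "norm (H t x + J t x - (H t y + J t y)) \<le> norm (H t x - H t y) + norm (J t x - J t y)"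
      unfolding add_diff_add by (rule norm_triangle_ineq)
    with elim show ?case by (simp add: distrib_right)
  qed
  then show "\<exists>C. \<forall>\<^sub>F (t, x, y) in nhds (t0, p, p). norm (H t x + J t x - (H t y + J t y)) \<le> C * norm (cmap c x - cmap c y)" ..
qed

lemma locally_lipschitz_sum:
  "(\<And>i. i \<in> I \<Longrightarrow> locally_lipschitz t0 p (H i)) \<Longrightarrow> locally_lipschitz t0 p (\<lambda>t x. \<Sum>i\<in>I. H i t x)"
  by (induction I rule: infinite_finite_induct) (simp_all add: locally_lipschitz_const locally_lipschitz_add)

lemma locally_lipschitz_cong:
  assumes H: "locally_lipschitz t0 p H" and eq: "\<forall>\<^sub>F (t, x) in nhds (t0, p). H t x = J t x"
  shows "locally_lipschitz t0 p J"
proof -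
  have eq0: "H t0 p = J t0 p" using eventually_nhds_x_imp_x[OF eq] by simp
  show ?thesis
    unfolding locally_lipschitz_def
  proof (intro conjI ballI impI)
    have "\<forall>\<^sub>F z in nhds (t0, p). (case z of (t, x) \<Rightarrow> H t x) = (case z of (t, x) \<Rightarrow> J t x)"
      using eq by eventually_elim auto
    from Lim_transform_eventually[OF locally_lipschitz_tendsto[OF H] this]
    show "((\<lambda>(t, x). J t x) \<longlongrightarrow> J t0 p) (nhds (t0, p))" by (simp add: eq0)
    fix c assume c: "c \<in> A" "p \<in> cdom c"
    obtain C where C: "\<forall>\<^sub>F (t, x, y) in nhds (t0, p, p). norm (H t x - H t y) \<le> C * norm (cmap c x - cmap c y)"
      using locally_lipschitz_estimate[OF H c] .
    have "\<forall>\<^sub>F (t, x, y) in nhds (t0, p, p). norm (J t x - J t y) \<le> C * norm (cmap c x - cmap c y)"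
      using C eventually_left(1)[OF eq] eventually_left(2)[OF eq] by eventually_elim auto
    then show "\<exists>C. \<forall>\<^sub>F (t, x, y) in nhds (t0, p, p). norm (J t x - J t y) \<le> C * norm (cmap c x - cmap c y)" ..
  qed
qed

lemma flow_tendsto: "((\<lambda>(t, x). f t x) \<longlongrightarrow> f t0 p) (nhds (t0, p))"
  using continuous_nhds_compose[OF open_UNIV UNIV_I flow_cont filterlim_ident, of "(t0, p)"] by (simp add: split_beta')

text \<open>\<open>h\<close> does not depend on time, so \<open>s\<close> is a dummy; the dependence
  on \<open>t\<close> enters through the flow, whose expression in charts is smooth.\<close>

lemma locally_lipschitz_flow:
  assumes h: "locally_lipschitz s (f t0 p) (\<lambda>t. h)"
  shows "locally_lipschitz t0 p (\<lambda>t x. h (f t x))"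
  unfolding locally_lipschitz_def
proof (intro conjI ballI impI)
  have lim: "filterlim (\<lambda>(t, x). (s, f t x)) (nhds (s, f t0 p)) (nhds (t0, p))"
    using tendsto_Pair[OF tendsto_const flow_tendsto, of s t0 p] by (simp add: split_beta')
  from filterlim_compose[OF locally_lipschitz_tendsto[OF h] this]
  show "((\<lambda>(t, x). h (f t x)) \<longlongrightarrow> h (f t0 p)) (nhds (t0, p))" by (simp add: split_beta')
  fix c assume c: "c \<in> A" "p \<in> cdom c"
  let ?d = "chart_at A (f t0 p)"
  note d = chart_at_in[of "f t0 p"] in_chart_at[of "f t0 p"]
  obtain C where C: "C \<ge> 0" "\<forall>\<^sub>F (t, x, y) in nhds (s, f t0 p, f t0 p). norm (h x - h y) \<le> C * norm (cmap ?d x - cmap ?d y)"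
    using locally_lipschitz_estimate[OF h d] .
  have lim2: "filterlim (\<lambda>(t, x, y). (s, f t x, f t y)) (nhds (s, f t0 p, f t0 p)) (nhds (t0, p, p))"
    using tendsto_Pair[OF tendsto_const tendsto_Pair[OF filterlim_compose[OF flow_tendsto filterlim_left] filterlim_compose[OF flow_tendsto filterlim_right]]]
    by (simp add: split_beta')
  have C': "\<forall>\<^sub>F (t, x, y) in nhds (t0, p, p). norm (h (f t x) - h (f t y)) \<le> C * norm (cmap ?d (f t x) - cmap ?d (f t y))"
    using eventually_compose_filterlim[OF C(2) lim2] by (simp add: split_beta')
  have "locally_lipschitz t0 p (\<lambda>t x. fc c ?d (t, cmap c x))"
    by (rule locally_lipschitz_smooth[OF smooth_fc[OF c(1) d(1)] open_fdom[OF c(1) d(1)] c in_fdom[OF c d(2)]])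
  from locally_lipschitz_estimate[OF this c] obtain D where D: "D \<ge> 0"
    "\<forall>\<^sub>F (t, x, y) in nhds (t0, p, p). norm (fc c ?d (t, cmap c x) - fc c ?d (t, cmap c y)) \<le> D * norm (cmap c x - cmap c y)" .
  have cd: "\<forall>\<^sub>F (t, x) in nhds (t0, p). x \<in> cdom c" by (rule eventually_snd_in[OF open_cdom[OF c(1)] c(2)])
  have "\<forall>\<^sub>F (t, x, y) in nhds (t0, p, p). norm (h (f t x) - h (f t y)) \<le> (C * D) * norm (cmap c x - cmap c y)"
    using C' D(2) eventually_left(1)[OF cd] eventually_left(2)[OF cd]
  proof eventually_elim
    case (elim z)
    obtain t x y where [simp]: "z = (t, x, y)" by (cases z) auto
    have "norm (h (f t x) - h (f t y)) \<le> C * norm (cmap ?d (f t x) - cmap ?d (f t y))" using elim by simp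
    also have "\<dots> \<le> C * (D * norm (cmap c x - cmap c y))"
      using elim C(1) by (intro mult_left_mono) (auto simp: fc_def cinv_cmap c(1))
    finally show ?case by (simp add: mult.assoc)
  qed
  then show "\<exists>C. \<forall>\<^sub>F (t, x, y) in nhds (t0, p, p). norm (h (f t x) - h (f t y)) \<le> C * norm (cmap c x - cmap c y)" ..
qed

lemma locally_lipschitz_static_continuous:
  assumes "locally_lipschitz s p (\<lambda>t. h)"
  shows "isCont h p"
proof -
  have "((\<lambda>z. h (snd z)) \<longlongrightarrow> h p) (nhds (s, p))"
    using locally_lipschitz_tendsto[OF assms] by (simp add: split_beta')
  moreover have "((\<lambda>x. (s, x)) \<longlongrightarrow> (s, p)) (nhds p)"
    by (rule tendsto_Pair[OF tendsto_const filterlim_ident])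
  ultimately have "((\<lambda>x. h (snd (s, x))) \<longlongrightarrow> h p) (nhds p)" by (rule filterlim_compose)
  then show ?thesis unfolding isCont_def using tendsto_at_iff_tendsto_nhds[of h p] by simp
qed

lemma locally_lipschitz_Bl:
  assumes lin: "\<forall>\<^sub>F (t, x) in nhds (t0, p). linear (H t x)"
    and H: "\<And>b. b \<in> Basis \<Longrightarrow> locally_lipschitz t0 p (\<lambda>t x. H t x b)"
  shows "locally_lipschitz t0 p (\<lambda>t x. Bl (H t x))"
proof (rule locally_lipschitz_cong)
  show "locally_lipschitz t0 p (\<lambda>t x. \<Sum>b\<in>Basis. coord_map b (H t x b))"
    by (rule locally_lipschitz_sum) (rule locally_lipschitz_linear[OF bounded_linear_coord_map H])
  show "\<forall>\<^sub>F (t, x) in nhds (t0, p). (\<Sum>b\<in>Basis. coord_map b (H t x b)) = Bl (H t x)"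
    using lin by eventually_elim (auto simp: Bl_Basis)
qed

lemma locally_lipschitz_tcd:
  assumes c: "c \<in> A" "p \<in> cdom c" and d: "d \<in> A" "p \<in> cdom d"
  shows "locally_lipschitz t0 p (\<lambda>t x. Bl (tcd c d x))"
proof (rule locally_lipschitz_Bl)
  have "\<forall>\<^sub>F (t, x) in nhds (t0, p). x \<in> cdom c \<inter> cdom d"
    using c d by (intro eventually_snd_in open_Int open_cdom) auto
  then show "\<forall>\<^sub>F (t, x) in nhds (t0, p). linear (tcd c d x)"
    by eventually_elim (auto intro: linear_tcd c d)
  show "locally_lipschitz t0 p (\<lambda>t x. tcd c d x b)" for b
    unfolding tcd_def
    by (rule locally_lipschitz_smooth_static[OF smooth_on_partial[OF smooth_transition[OF c(1) d(1)]] open_overlap[OF c(1) d(1)] c])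
       (use c d in auto)
qed

lemma locally_lipschitz_fD:
  assumes c: "c \<in> A" "p \<in> cdom c" and d: "d \<in> A" "f t0 p \<in> cdom d"
  shows "locally_lipschitz t0 p (\<lambda>t x. Bl (fD c d t x))"
proof (rule locally_lipschitz_Bl)
  have "\<forall>\<^sub>F z in nhds (t0, p). (case z of (t, x) \<Rightarrow> f t x) \<in> cdom d"
    by (rule topological_tendstoD[OF flow_tendsto]) (use d open_cdom in auto)
  moreover have "\<forall>\<^sub>F (t, x) in nhds (t0, p). x \<in> cdom c" by (rule eventually_snd_in[OF open_cdom[OF c(1)] c(2)])
  ultimately show "\<forall>\<^sub>F (t, x) in nhds (t0, p). linear (fD c d t x)"
    by eventually_elim (auto intro: linear_fD c d)
  show "locally_lipschitz t0 p (\<lambda>t x. fD c d t x b)" for b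
    unfolding fD_def
    by (rule locally_lipschitz_smooth[OF smooth_on_partial[OF smooth_fc[OF c(1) d(1)]] open_fdom[OF c(1) d(1)] c in_fdom[OF c d(2)]])
qed

end

section \<open>Embedding the tangent bundle over a compact set\<close>

text \<open>Finite families of vectors, as a Banach space: the \<open>i\<close>-th component is the value at \<open>i\<close>, and
  \<open>ins i u\<close> is a hat function around \<open>i\<close>. Bounded continuous functions on the
  reals are used because the library proves them complete on a metric space only, and the type
  \<open>nat\<close> is not an instance of that class.\<close>

type_synonym 'e seqs = "real \<Rightarrow>\<^sub>C 'e"

instance bcontfun :: (metric_space, banach) banach ..

definition ins :: "nat \<Rightarrow> 'e::real_normed_vector \<Rightarrow> 'e seqs" where
  "ins i u = Bcontfun (\<lambda>r. max 0 (1 - \<bar>r - real i\<bar>) *\<^sub>R u)"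

lemma apply_ins: "apply_bcontfun (ins i u) r = max 0 (1 - \<bar>r - real i\<bar>) *\<^sub>R u"
proof -
  have "(\<lambda>r. max 0 (1 - \<bar>r - real i\<bar>) *\<^sub>R u) \<in> bcontfun"
  proof (rule bcontfun_normI)
    show "continuous_on UNIV (\<lambda>r. max 0 (1 - \<bar>r - real i\<bar>) *\<^sub>R u)" by (intro continuous_intros)
    show "norm (max 0 (1 - \<bar>r - real i\<bar>) *\<^sub>R u) \<le> norm u" for r
      by (simp add: mult_left_le_one_le)
  qed
  then show ?thesis unfolding ins_def by (simp add: Bcontfun_inverse)
qed

lemma linear_ins: "linear (ins i)"
  by (rule linearI) (auto intro!: bcontfun_eqI simp: apply_ins scaleR_add_right)

definition ev :: "nat \<Rightarrow> 'e seqs \<Rightarrow>\<^sub>L 'e::real_normed_vector" where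
  "ev i = Blinfun (\<lambda>w. apply_bcontfun w (real i))"

lemma ev_apply: "ev i w = apply_bcontfun w (real i)"
proof -
  have "bounded_linear (\<lambda>w :: 'a seqs. apply_bcontfun w (real i))"
    by (rule bounded_linear_intro[where K=1]) (auto intro: norm_bounded)
  then show ?thesis unfolding ev_def by (simp add: bounded_linear_Blinfun_apply)
qed

text \<open>Distinct integers are at distance at least 1, so the hat around one of them vanishes at
  the others.\<close>

lemma ev_ins: "ev i (ins j u) = (if i = j then u else 0)"
proof -
  have "max 0 (1 - \<bar>real i - real j\<bar>) = 0" if "i \<noteq> j"
    using that by linarith
  then show ?thesis by (simp add: ev_apply apply_ins)
qed

context smooth_flow
begin

lemma locally_lipschitz_compose:
  fixes H :: "real \<Rightarrow> 'm \<Rightarrow> 'b::real_normed_vector \<Rightarrow>\<^sub>L 'c::real_normed_vector" and J :: "real \<Rightarrow> 'm \<Rightarrow> 'd::real_normed_vector \<Rightarrow>\<^sub>L 'b"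
  shows "locally_lipschitz t0 p H \<Longrightarrow> locally_lipschitz t0 p J \<Longrightarrow> locally_lipschitz t0 p (\<lambda>t x. H t x o\<^sub>L J t x)"
  by (rule locally_lipschitz_bilinear[OF bounded_bilinear_blinfun_compose])

lemma locally_lipschitz_apply:
  fixes H :: "real \<Rightarrow> 'm \<Rightarrow> 'b::real_normed_vector \<Rightarrow>\<^sub>L 'c::real_normed_vector"
  shows "locally_lipschitz t0 p H \<Longrightarrow> locally_lipschitz t0 p J \<Longrightarrow> locally_lipschitz t0 p (\<lambda>t x. H t x (J t x))"
  by (rule locally_lipschitz_bilinear[OF bounded_bilinear_blinfun_apply])

lemma locally_lipschitz_scaleR:
  "locally_lipschitz t0 p H \<Longrightarrow> locally_lipschitz t0 p J \<Longrightarrow> locally_lipschitz t0 p (\<lambda>t x. H t x *\<^sub>R J t x)"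
  by (rule locally_lipschitz_bilinear[OF bounded_bilinear_scaleR])

lemma locally_lipschitz_continuous_on:
  assumes "\<And>t p. p \<in> K \<Longrightarrow> locally_lipschitz t p H"
  shows "continuous_on (UNIV \<times> K) (\<lambda>(t, p). H t p)"
proof -
  have "isCont (\<lambda>(t, p). H t p) z" if "z \<in> UNIV \<times> K" for z
  proof -
    obtain t p where z: "z = (t, p)" "p \<in> K" using \<open>z \<in> UNIV \<times> K\<close> by auto
    have "((\<lambda>z. (\<lambda>(t, p). H t p) z) \<longlongrightarrow> (\<lambda>(t, p). H t p) (t, p)) (nhds (t, p))"
      using locally_lipschitz_tendsto[OF assms[OF z(2)]] by simp
    then show ?thesis unfolding isCont_def z(1) tendsto_at_iff_tendsto_nhds .
  qed
  then show ?thesis by (simp add: continuous_at_imp_continuous_on)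
qed

lemma locally_lipschitz_inverse:
  fixes H :: "real \<Rightarrow> 'm \<Rightarrow> real"
  assumes H: "locally_lipschitz t0 p H" and nz: "H t0 p > 0"
  shows "locally_lipschitz t0 p (\<lambda>t x. inverse (H t x))"
  unfolding locally_lipschitz_def
proof (intro conjI ballI impI)
  note lim = locally_lipschitz_tendsto[OF H]
  show "((\<lambda>(t, x). inverse (H t x)) \<longlongrightarrow> inverse (H t0 p)) (nhds (t0, p))"
    using tendsto_inverse[OF lim] nz by (simp add: split_beta')
  fix c assume c: "c \<in> A" "p \<in> cdom c"
  obtain C where C: "C \<ge> 0" "\<forall>\<^sub>F (t, x, y) in nhds (t0, p, p). norm (H t x - H t y) \<le> C * norm (cmap c x - cmap c y)"
    using locally_lipschitz_estimate[OF H c] .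
  define h where "h = H t0 p / 2"
  have h: "h > 0" using nz by (simp add: h_def)
  have "\<forall>\<^sub>F (t, x) in nhds (t0, p). h \<le> H t x"
    using order_tendstoD(1)[OF lim, of h] nz by (auto simp: h_def split_beta' elim: eventually_mono)
  note near = eventually_left(1)[OF this] eventually_left(2)[OF this]
  have "\<forall>\<^sub>F (t, x, y) in nhds (t0, p, p). norm (inverse (H t x) - inverse (H t y)) \<le> (C / (h * h)) * norm (cmap c x - cmap c y)"
    using C(2) near
  proof eventually_elim
    case (elim z)
    obtain t x y where [simp]: "z = (t, x, y)" by (cases z) auto
    have pos: "H t x > 0" "H t y > 0" using elim h by auto
    have "norm (inverse (H t x) - inverse (H t y)) = \<bar>H t y - H t x\<bar> / (H t x * H t y)"
      using pos by (simp add: field_simps abs_divide)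
    also have "\<dots> \<le> (C * norm (cmap c x - cmap c y)) / (h * h)"
      using elim h C(1) pos by (intro frac_le mult_mono) (auto simp: abs_minus_commute)
    finally show ?case by simp
  qed
  then show "\<exists>C. \<forall>\<^sub>F (t, x, y) in nhds (t0, p, p). norm (inverse (H t x) - inverse (H t y)) \<le> C * norm (cmap c x - cmap c y)" ..
qed

lemma locally_lipschitz_cmap:
  assumes "c \<in> A" "p \<in> cdom c"
  shows "locally_lipschitz t0 p (\<lambda>t. cmap c)"
proof -
  have "locally_lipschitz t0 p (\<lambda>t x. snd (t, cmap c x))"
    by (rule locally_lipschitz_in_chart[of 1 1, OF _ _ _ assms]) (use dist_snd_le in \<open>auto simp: dist_norm[symmetric]\<close>)
  then show ?thesis by simp
qed

end

text \<open>Finitely many open coordinate balls cover \<open>K\<close>. The closed balls still lie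
  in the chart ranges, so their preimages are compact, which allows hat functions on them to be
  extended by zero.\<close>

locale chart_cover = smooth_flow A F f
  for A :: "('m::{t2_space, second_countable_topology}, 'e::euclidean_space) chart set" and F f +
  fixes K :: "'m set" and n :: nat and ch :: "nat \<Rightarrow> ('m, 'e) chart" and ctr :: "nat \<Rightarrow> 'e" and rad :: "nat \<Rightarrow> real"
  assumes compact_K: "compact K" and f_iff: "f t p \<in> K \<longleftrightarrow> p \<in> K"
    and ch: "i < n \<Longrightarrow> ch i \<in> A" and rad: "i < n \<Longrightarrow> rad i > 0"
    and ball_in: "i < n \<Longrightarrow> cball (ctr i) (rad i) \<subseteq> crange (ch i)"
    and cover: "p \<in> K \<Longrightarrow> \<exists>i<n. p \<in> cdom (ch i) \<and> norm (cmap (ch i) p - ctr i) < rad i"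
begin

text \<open>A hat function is enough, since no more than Lipschitz regularity is asked of the cover
  later, and its explicit form keeps the estimates elementary.\<close>

definition bump :: "nat \<Rightarrow> 'm \<Rightarrow> real" where
  "bump i x = (if x \<in> cdom (ch i) then max 0 (rad i - norm (cmap (ch i) x - ctr i)) else 0)"

lemma bump_nonneg: "bump i x \<ge> 0"
  by (simp add: bump_def)

lemma bump_in: "bump i x \<noteq> 0 \<Longrightarrow> x \<in> cdom (ch i)"
  by (auto simp: bump_def split: if_splits)

lemma bump_pos: "p \<in> K \<Longrightarrow> \<exists>i<n. bump i p > 0"
  using cover unfolding bump_def by fastforce

text \<open>The function is zero off the preimage of a closed ball. That preimage is compact, hence
  closed in the Hausdorff manifold, and a point outside the chart has a neighbourhood that misses
  it.\<close>

lemma bump_vanishes: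
  assumes i: "i < n" and p: "p \<notin> cdom (ch i)"
  shows "\<forall>\<^sub>F x in nhds p. bump i x = 0"
proof -
  let ?S = "cinv (ch i) ` cball (ctr i) (rad i)"
  have "compact ?S"
    by (intro compact_continuous_image continuous_on_subset[OF cont_cinv[OF ch[OF i]] ball_in[OF i]] compact_cball)
  then have "open (- ?S)" using compact_imp_closed by blast
  moreover have "p \<in> - ?S" using p cinv_in[OF ch[OF i]] ball_in[OF i] by auto
  moreover have "bump i x = 0" if "x \<in> - ?S" for x
  proof (rule ccontr)
    assume "bump i x \<noteq> 0"
    then have x: "x \<in> cdom (ch i)" and "norm (cmap (ch i) x - ctr i) < rad i"
      by (auto simp: bump_def max_def split: if_splits)
    then have "cmap (ch i) x \<in> cball (ctr i) (rad i)" by (simp add: dist_norm norm_minus_commute)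
    then have "x \<in> ?S" using cinv_cmap[OF ch[OF i] x] by force
    then show False using that by simp
  qed
  ultimately show ?thesis unfolding eventually_nhds by blast
qed

lemma eventually_snd:
  assumes "\<forall>\<^sub>F x in nhds p. P x" shows "\<forall>\<^sub>F (t, x) in nhds (t0, p). P x"
  using eventually_compose_filterlim[OF assms tendsto_snd_nhds] by (simp add: split_beta')

lemma lip_bump: 
  assumes i: "i < n"
  shows "locally_lipschitz t0 p (\<lambda>t. bump i)"
proof (cases "p \<in> cdom (ch i)")
  case True
  have "locally_lipschitz t0 p (\<lambda>t x. (\<lambda>z. max 0 (rad i - norm (snd z - ctr i))) (t, cmap (ch i) x))"
  proof (rule locally_lipschitz_in_chart[of 1 1, OF _ _ _ ch[OF i] True])
    fix x y :: "real \<times> 'e"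
    have "\<bar>norm (snd y - ctr i) - norm (snd x - ctr i)\<bar> \<le> norm (snd y - snd x)"
      using norm_triangle_ineq3[of "snd y - ctr i" "snd x - ctr i"] by simp
    also have "\<dots> \<le> norm (y - x)" using dist_snd_le[of y x] by (simp only: dist_norm)
    finally have 1: "\<bar>norm (snd y - ctr i) - norm (snd x - ctr i)\<bar> \<le> norm (x - y)"
      unfolding norm_minus_commute[of x y] .
    have "\<bar>max 0 (rad i - a) - max 0 (rad i - b)\<bar> \<le> \<bar>b - a\<bar>" for a b by linarith
    from order_trans[OF this 1]
    show "norm (max 0 (rad i - norm (snd x - ctr i)) - max 0 (rad i - norm (snd y - ctr i))) \<le> 1 * norm (x - y)"
      by simp
  qed auto
  then show ?thesis
    by (rule locally_lipschitz_cong) (use eventually_snd_in[OF open_cdom[OF ch[OF i]] True] in eventually_elim, auto simp: bump_def)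
next
  case False
  show ?thesis
    by (rule locally_lipschitz_cong[OF locally_lipschitz_const[of _ _ 0]])
       (use eventually_snd[OF bump_vanishes[OF i False]] in eventually_elim, auto)
qed

lemma lip_bump_scale:
  assumes i: "i < n" and H: "p \<in> cdom (ch i) \<Longrightarrow> locally_lipschitz t0 p H"
  shows "locally_lipschitz t0 p (\<lambda>t x. bump i x *\<^sub>R H t x)"
proof (cases "p \<in> cdom (ch i)")
  case True
  show ?thesis by (rule locally_lipschitz_scaleR[OF lip_bump[OF i] H[OF True]])
next
  case False
  show ?thesis
    by (rule locally_lipschitz_cong[OF locally_lipschitz_const[of _ _ 0]])
       (use eventually_snd[OF bump_vanishes[OF i False]] in eventually_elim, auto)
qed

definition theta :: "nat \<Rightarrow> 'm \<Rightarrow> 'e" where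
  "theta i x = bump i x *\<^sub>R cmap (ch i) x"

lemma lip_theta: "i < n \<Longrightarrow> locally_lipschitz t0 p (\<lambda>t. theta i)"
  unfolding theta_def by (rule lip_bump_scale) (auto intro: locally_lipschitz_cmap ch)

text \<open>The distance of the images under the classical embedding into a Euclidean space by bump
  functions and bump-weighted coordinates.\<close>

definition gap :: "'m \<Rightarrow> 'm \<Rightarrow> real" where
  "gap x y = (\<Sum>i<n. \<bar>bump i x - bump i y\<bar> + norm (theta i x - theta i y))"

text \<open>Near the diagonal of \<open>K\<close> this is comparable with the distance in any chart, so Hoelder
  continuity in charts becomes Hoelder continuity with respect to \<open>dd\<close>.\<close>

definition dd :: "'m \<Rightarrow> 'm \<Rightarrow> real" where
  "dd x y = min 1 (gap x y)"

lemma cont_bump: "i < n \<Longrightarrow> continuous_on T (bump i)" and cont_theta: "i < n \<Longrightarrow> continuous_on T (theta i)"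
  using locally_lipschitz_static_continuous[OF lip_bump] locally_lipschitz_static_continuous[OF lip_theta]
  by (auto intro: continuous_at_imp_continuous_on)

lemma cont_dd: "continuous_on T (\<lambda>(x, y). dd x y)"
  unfolding dd_def gap_def split_beta'
  by (intro continuous_intros continuous_on_compose2[OF cont_bump[of _ UNIV]] continuous_on_compose2[OF cont_theta[of _ UNIV]]) auto

lemma gap_nonneg: "gap x y \<ge> 0"
  unfolding gap_def by (intro sum_nonneg) auto

lemma gap_pos:
  assumes "x \<in> K" "x \<noteq> y"
  shows "gap x y > 0"
proof (rule ccontr)
  assume "\<not> gap x y > 0"
  then have "gap x y = 0" using gap_nonneg[of x y] by simp
  then have z: "\<bar>bump i x - bump i y\<bar> + norm (theta i x - theta i y) = 0" if "i < n" for i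
    unfolding gap_def using that by (subst (asm) sum_nonneg_eq_0_iff) auto
  obtain i where i: "i < n" "bump i x > 0" using bump_pos[OF assms(1)] by blast
  have eq: "bump i x = bump i y" "theta i x = theta i y"
    using z[OF i(1)] by (simp_all add: add_nonneg_eq_0_iff)
  then have "cmap (ch i) x = cmap (ch i) y" using i by (simp add: theta_def)
  moreover have "x \<in> cdom (ch i)" "y \<in> cdom (ch i)" using i eq bump_in by auto
  ultimately have "x = y" using cinv_cmap[OF ch[OF i(1)]] by metis
  with assms(2) show False by simp
qed

lemma component_le_gap:
  assumes "i < n" shows "\<bar>bump i x - bump i y\<bar> + norm (theta i x - theta i y) \<le> gap x y"
  unfolding gap_def using assms by (intro member_le_sum) auto

text \<open>Coordinates are recovered from \<open>theta\<close> by division by the bump function,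
  which is at least \<open>b\<close> near \<open>p\<close>; this gives the factor
  \<open>(1 + M) / b\<close>. The summand \<open>2 * M\<close> covers points where the cap at 1 is
  active.\<close>

lemma chart_le_dd:
  fixes t0 :: real
  assumes p: "p \<in> K"
  shows "\<exists>i<n. p \<in> cdom (ch i) \<and> (\<exists>C\<ge>0. \<forall>\<^sub>F (t, x, y) in nhds (t0, p, p).
     norm (cmap (ch i) x - cmap (ch i) y) \<le> C * dd x y)"
proof -
  obtain i where i: "i < n" "bump i p > 0" using bump_pos[OF p] by blast
  define b where "b = bump i p / 2"
  have b: "b > 0" using i by (simp add: b_def)
  have pc: "p \<in> cdom (ch i)" using i bump_in by auto
  define M where "M = norm (cmap (ch i) p) + 1"
  have M: "M \<ge> 0" by (simp add: M_def)
  have lb: "((\<lambda>(t, x). bump i x) \<longlongrightarrow> bump i p) (nhds (t0, p))"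
    by (rule locally_lipschitz_tendsto[OF lip_bump[OF i(1)]])
  have "\<forall>\<^sub>F (t, x) in nhds (t0, p). b \<le> bump i x"
    using order_tendstoD(1)[OF lb, of b] i by (auto simp: b_def split_beta' elim: eventually_mono)
  moreover have "\<forall>\<^sub>F (t, x) in nhds (t0, p). norm (cmap (ch i) x) \<le> M"
    using tendsto_eventually_bounded[OF locally_lipschitz_tendsto[OF locally_lipschitz_cmap[OF ch[OF i(1)] pc], of t0]]
    by (auto simp: M_def split_beta' elim: eventually_mono)
  ultimately have near: "\<forall>\<^sub>F (t, x) in nhds (t0, p). b \<le> bump i x \<and> norm (cmap (ch i) x) \<le> M"
    by eventually_elim auto
  have "\<forall>\<^sub>F (t, x, y) in nhds (t0, p, p). norm (cmap (ch i) x - cmap (ch i) y) \<le> ((1 + M) / b + 2 * M) * dd x y"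
    using eventually_left(1)[OF near] eventually_left(2)[OF near]
  proof eventually_elim
    case (elim z)
    obtain t x y where [simp]: "z = (t, x, y)" by (cases z) auto
    let ?\<phi> = "cmap (ch i)"
    have bx: "b \<le> bump i x" and My: "norm (?\<phi> x) \<le> M" "norm (?\<phi> y) \<le> M" using elim by auto
    have "b * norm (?\<phi> x - ?\<phi> y) \<le> bump i x * norm (?\<phi> x - ?\<phi> y)" using bx by (intro mult_right_mono) auto
    also have "\<dots> = norm (theta i x - theta i y - (bump i x - bump i y) *\<^sub>R ?\<phi> y)"
    proof -
      have "theta i x - theta i y - (bump i x - bump i y) *\<^sub>R ?\<phi> y = bump i x *\<^sub>R (?\<phi> x - ?\<phi> y)"
        by (simp add: theta_def algebra_simps)
      then show ?thesis using bump_nonneg[of i x] by simp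
    qed
    also have "\<dots> \<le> norm (theta i x - theta i y) + \<bar>bump i x - bump i y\<bar> * norm (?\<phi> y)"
      by (rule order_trans[OF norm_triangle_ineq4]) simp
    also have "\<dots> \<le> gap x y + gap x y * M"
      using component_le_gap[OF i(1), of x y] My gap_nonneg[of x y] abs_ge_zero[of "bump i x - bump i y"] norm_ge_zero[of "theta i x - theta i y"] norm_ge_zero[of "?\<phi> y"]
      by (intro add_mono mult_mono) linarith+
    finally have g: "norm (?\<phi> x - ?\<phi> y) \<le> (1 + M) / b * gap x y" using b by (simp add: field_simps)
    show ?case
    proof (cases "gap x y \<le> 1")
      case True
      have "(1 + M) / b * gap x y \<le> ((1 + M) / b + 2 * M) * gap x y" using M gap_nonneg by (intro mult_right_mono) auto
      then show ?thesis using g True by (simp add: dd_def)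
    next
      case False
      have "norm (?\<phi> x - ?\<phi> y) \<le> 2 * M" using norm_triangle_ineq4[of "?\<phi> x" "?\<phi> y"] My by linarith
      moreover have "(1 + M) / b \<ge> 0" using M b by simp
      ultimately show ?thesis using False by (simp add: dd_def)
    qed
  qed
  moreover have "(1 + M) / b + 2 * M \<ge> 0" using M b by simp
  ultimately show ?thesis using i(1) pc by blast
qed

text \<open>Near the diagonal the local estimate applies through \<open>chart_le_dd\<close>; away
  from it \<open>dd\<close> is bounded below while \<open>H\<close> is locally bounded. Compactness
  of the time interval and of \<open>K\<close> makes the constant uniform.\<close>

lemma lipschitz_global:
  assumes H: "\<And>t p. p \<in> K \<Longrightarrow> locally_lipschitz t p H"
  shows "\<exists>\<Lambda>\<ge>0. \<forall>t\<in>{-1..1}. \<forall>p\<in>K. \<forall>q\<in>K. norm (H t p - H t q) \<le> \<Lambda> * dd p q"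
proof -
  have "compact ({-1..1::real} \<times> K \<times> K)" using compact_K by (intro compact_Times) auto
  moreover have "\<exists>C. \<forall>\<^sub>F w in nhds z. w \<in> {-1..1} \<times> K \<times> K \<longrightarrow> (\<lambda>(t, x, y). norm (H t x - H t y)) w \<le> C * (\<lambda>(t, x, y). dd x y) w"
    if z: "z \<in> {-1..1::real} \<times> K \<times> K" for z
  proof -
    obtain t p q where [simp]: "z = (t, p, q)" and pq: "p \<in> K" "q \<in> K" using z by auto
    have "\<exists>C. \<forall>\<^sub>F (t, x, y) in nhds (t, p, q). norm (H t x - H t y) \<le> C * dd x y"
    proof (cases "p = q")
      case True
      obtain i C where i: "i < n" "p \<in> cdom (ch i)" and C: "C \<ge> 0"
        "\<forall>\<^sub>F (t, x, y) in nhds (t, p, p). norm (cmap (ch i) x - cmap (ch i) y) \<le> C * dd x y"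
        using chart_le_dd[OF pq(1), of t] by blast
      obtain D where D: "D \<ge> 0" "\<forall>\<^sub>F (t, x, y) in nhds (t, p, p). norm (H t x - H t y) \<le> D * norm (cmap (ch i) x - cmap (ch i) y)"
        using locally_lipschitz_estimate[OF H[OF pq(1)] ch[OF i(1)] i(2)] by blast
      have "\<forall>\<^sub>F (t, x, y) in nhds (t, p, p). norm (H t x - H t y) \<le> (D * C) * dd x y"
        using C(2) D(2)
      proof eventually_elim
        case (elim w)
        obtain t x y where [simp]: "w = (t, x, y)" by (cases w) auto
        have "norm (H t x - H t y) \<le> D * norm (cmap (ch i) x - cmap (ch i) y)" using elim by simp
        also have "\<dots> \<le> D * (C * dd x y)" using elim D(1) by (intro mult_left_mono) auto
        finally show ?case by (simp add: mult.assoc)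
      qed
      then show ?thesis using True by auto
    next
      case False
      define e where "e = dd p q / 2"
      have e: "e > 0" using gap_pos[OF pq(1) False] by (simp add: e_def dd_def)
      have "isCont (\<lambda>(x, y). dd x y) (p, q)" using cont_dd[of UNIV] continuous_on_eq_continuous_at[OF open_UNIV] by blast
      then have "((\<lambda>(x, y). dd x y) \<longlongrightarrow> dd p q) (nhds (p, q))"
        unfolding isCont_def using tendsto_at_iff_tendsto_nhds[of "\<lambda>(x, y). dd x y" "(p, q)"] by simp
      from filterlim_compose[OF this tendsto_snd_nhds[of "(p, q)" t]]
      have lim: "((\<lambda>(t, x, y). dd x y) \<longlongrightarrow> dd p q) (nhds (t, p, q))" by (simp add: split_beta')
      have de: "\<forall>\<^sub>F (t, x, y) in nhds (t, p, q). e \<le> dd x y"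
        using order_tendstoD(1)[OF lim, of e] e by (auto simp: e_def split_beta' elim: eventually_mono)
      define N where "N = norm (H t p) + norm (H t q) + 2"
      have N: "N \<ge> 0" by (simp add: N_def)
      have Hb: "\<forall>\<^sub>F (t', x) in nhds (t, r). norm (H t' x) \<le> norm (H t r) + 1" if "r \<in> K" for r
      proof -
        have "\<forall>\<^sub>F z in nhds (t, r). norm (case z of (t', x) \<Rightarrow> H t' x) \<le> norm (H t r) + 1"
          by (rule tendsto_eventually_bounded[OF locally_lipschitz_tendsto[OF H[OF that]]])
        then show ?thesis by eventually_elim auto
      qed
      have "\<forall>\<^sub>F (t', x, y) in nhds (t, p, q). norm (H t' x - H t' y) \<le> (N / e) * dd x y"
        using de eventually_left(1)[OF Hb[OF pq(1)]] eventually_left(2)[OF Hb[OF pq(2)]]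
      proof eventually_elim
        case (elim w)
        obtain t' x y where [simp]: "w = (t', x, y)" by (cases w) auto
        have "norm (H t' x - H t' y) \<le> norm (H t' x) + norm (H t' y)" by (rule norm_triangle_ineq4)
        also have "\<dots> \<le> N" using elim by (simp add: N_def)
        also have "N = (N / e) * e" using e by simp
        also have "\<dots> \<le> (N / e) * dd x y" using elim N e by (intro mult_left_mono) auto
        finally show ?case by simp
      qed
      then show ?thesis by (rule exI)
    qed
    then obtain C where "\<forall>\<^sub>F (t, x, y) in nhds z. norm (H t x - H t y) \<le> C * dd x y" by auto
    then show ?thesis by (intro exI[of _ C]) (auto elim: eventually_mono)
  qed
  moreover have "0 \<le> (\<lambda>(t, x, y). dd x y) z" for z :: "real \<times> 'm \<times> 'm"
    using gap_nonneg by (auto simp: dd_def split_beta')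
  ultimately have "\<exists>C\<ge>0. \<forall>w\<in>{-1..1} \<times> K \<times> K. (\<lambda>(t, x, y). norm (H t x - H t y)) w \<le> C * (\<lambda>(t, x, y). dd x y) w"
    by (rule compact_local_bound)
  then obtain C where "C \<ge> 0" "\<forall>w\<in>{-1..1} \<times> K \<times> K. (\<lambda>(t, x, y). norm (H t x - H t y)) w \<le> C * (\<lambda>(t, x, y). dd x y) w"
    by (elim exE conjE)
  then show ?thesis by (intro exI[of _ C]) auto
qed

lemma bounded_global:
  assumes H: "\<And>t p. p \<in> K \<Longrightarrow> locally_lipschitz t p H"
  shows "\<exists>\<Lambda>\<ge>0. \<forall>t\<in>{-1..1}. \<forall>p\<in>K. norm (H t p) \<le> \<Lambda>"
proof -
  have "continuous_on ({-1..1} \<times> K) (\<lambda>(t, p). H t p)"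
    by (rule continuous_on_subset[OF locally_lipschitz_continuous_on[of K H, OF H]]) auto
  moreover have "compact ({-1..1::real} \<times> K)" using compact_K by (intro compact_Times) auto
  ultimately have "bounded ((\<lambda>(t, p). H t p) ` ({-1..1} \<times> K))"
    using compact_continuous_image compact_imp_bounded by blast
  then obtain N where "\<forall>x\<in>(\<lambda>(t, p). H t p) ` ({-1..1} \<times> K). norm x \<le> N" unfolding bounded_iff ..
  then have "norm (H t p) \<le> \<bar>N\<bar>" if "t \<in> {-1..1}" "p \<in> K" for t p
    using that by (force intro: order_trans[OF _ abs_ge_self])
  then show ?thesis by (intro exI[of _ "\<bar>N\<bar>"]) simp
qed

lemma dd_flow_lipschitz: "\<exists>\<Lambda>\<ge>0. \<forall>t\<in>{-1..1}. \<forall>p\<in>K. \<forall>q\<in>K. dd (f t p) (f t q) \<le> \<Lambda> * dd p q"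
proof -
  have "\<forall>i\<in>{..<n}. \<exists>\<Lambda>. \<Lambda> \<ge> 0 \<and> (\<forall>t\<in>{-1..1}. \<forall>p\<in>K. \<forall>q\<in>K. norm (bump i (f t p) - bump i (f t q)) \<le> \<Lambda> * dd p q)"
    using lipschitz_global[OF locally_lipschitz_flow[OF lip_bump]] by blast
  from bchoice[OF this] obtain a where a: "\<And>i t p q. i < n \<Longrightarrow> t \<in> {-1..1} \<Longrightarrow> p \<in> K \<Longrightarrow> q \<in> K \<Longrightarrow>
    norm (bump i (f t p) - bump i (f t q)) \<le> a i * dd p q" "\<And>i. i < n \<Longrightarrow> a i \<ge> 0" by (metis lessThan_iff)
  have "\<forall>i\<in>{..<n}. \<exists>\<Lambda>. \<Lambda> \<ge> 0 \<and> (\<forall>t\<in>{-1..1}. \<forall>p\<in>K. \<forall>q\<in>K. norm (theta i (f t p) - theta i (f t q)) \<le> \<Lambda> * dd p q)"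
    using lipschitz_global[OF locally_lipschitz_flow[OF lip_theta]] by blast
  from bchoice[OF this] obtain b where b: "\<And>i t p q. i < n \<Longrightarrow> t \<in> {-1..1} \<Longrightarrow> p \<in> K \<Longrightarrow> q \<in> K \<Longrightarrow>
    norm (theta i (f t p) - theta i (f t q)) \<le> b i * dd p q" "\<And>i. i < n \<Longrightarrow> b i \<ge> 0" by (metis lessThan_iff)
  have "dd (f t p) (f t q) \<le> (\<Sum>i<n. a i + b i) * dd p q" if "t \<in> {-1..1}" "p \<in> K" "q \<in> K" for t p q
  proof -
    have "dd (f t p) (f t q) \<le> gap (f t p) (f t q)" by (simp add: dd_def)
    also have "\<dots> \<le> (\<Sum>i<n. a i * dd p q + b i * dd p q)"
      unfolding gap_def using a(1) b(1) that by (intro sum_mono add_mono) auto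
    also have "\<dots> = (\<Sum>i<n. a i + b i) * dd p q" by (simp add: sum_distrib_right distrib_right)
    finally show ?thesis .
  qed
  moreover have "(\<Sum>i<n. a i + b i) \<ge> 0" using a b by (intro sum_nonneg add_nonneg_nonneg) auto
  ultimately show ?thesis by blast
qed

text \<open>\<open>J p\<close> embeds the tangent space at \<open>p\<close>: it collects the representatives of a vector in all
  charts of the cover, each multiplied by its bump function. \<open>L p\<close> is a left inverse.\<close>

definition Jc :: "('m, 'e) chart \<Rightarrow> 'm \<Rightarrow> 'e \<Rightarrow>\<^sub>L 'e seqs" where
  "Jc c x = (\<Sum>i<n. bump i x *\<^sub>R (Bl (ins i) o\<^sub>L Bl (tcd c (ch i) x)))"

text \<open>Both \<open>Jc\<close> and \<open>Lc\<close> multiply by the bump functions, so the left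
  inverse is normalised by the sum of their squares.\<close>

definition weight :: "'m \<Rightarrow> real" where
  "weight x = (\<Sum>i<n. bump i x * bump i x)"

definition Lc :: "('m, 'e) chart \<Rightarrow> 'm \<Rightarrow> 'e seqs \<Rightarrow>\<^sub>L 'e" where
  "Lc c x = inverse (weight x) *\<^sub>R (\<Sum>i<n. bump i x *\<^sub>R (Bl (tcd (ch i) c x) o\<^sub>L ev i))"

definition J :: "'m \<Rightarrow> 'e \<Rightarrow>\<^sub>L 'e seqs" where "J x = Jc (chart_at A x) x"

definition L :: "'m \<Rightarrow> 'e seqs \<Rightarrow>\<^sub>L 'e" where "L x = Lc (chart_at A x) x"

lemma weight_pos: "p \<in> K \<Longrightarrow> weight p > 0"
  using bump_pos[of p] unfolding weight_def by (auto intro!: sum_pos2)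

lemma lip_Jc:
  assumes "c \<in> A" "p \<in> cdom c"
  shows "locally_lipschitz t0 p (\<lambda>t. Jc c)"
  unfolding Jc_def
  by (intro locally_lipschitz_sum lip_bump_scale locally_lipschitz_compose locally_lipschitz_const locally_lipschitz_tcd)
     (use assms ch in auto)

lemma lip_Lc:
  assumes "c \<in> A" "p \<in> cdom c" "p \<in> K"
  shows "locally_lipschitz t0 p (\<lambda>t. Lc c)"
proof -
  have "locally_lipschitz t0 p (\<lambda>t x. bump i x * bump i x)" if "i < n" for i
    using locally_lipschitz_scaleR[OF lip_bump[OF that] lip_bump[OF that]] by simp
  then have "locally_lipschitz t0 p (\<lambda>t. weight)"
    unfolding weight_def by (intro locally_lipschitz_sum) auto
  then have "locally_lipschitz t0 p (\<lambda>t x. inverse (weight x))"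
    by (rule locally_lipschitz_inverse) (rule weight_pos[OF assms(3)])
  moreover have "locally_lipschitz t0 p (\<lambda>t x. \<Sum>i<n. bump i x *\<^sub>R (Bl (tcd (ch i) c x) o\<^sub>L ev i))"
    by (intro locally_lipschitz_sum lip_bump_scale locally_lipschitz_compose locally_lipschitz_const locally_lipschitz_tcd)
       (use assms ch in auto)
  ultimately show ?thesis unfolding Lc_def by (rule locally_lipschitz_scaleR)
qed

lemma Jc_apply:
  assumes "c \<in> A" "x \<in> cdom c"
  shows "Jc c x u = (\<Sum>i<n. bump i x *\<^sub>R ins i (tcd c (ch i) x u))"
  unfolding Jc_def blinfun.sum_left
proof (rule sum.cong)
  fix i assume "i \<in> {..<n}"
  then have i: "i < n" by simp
  show "(bump i x *\<^sub>R (Bl (ins i) o\<^sub>L Bl (tcd c (ch i) x))) u = bump i x *\<^sub>R ins i (tcd c (ch i) x u)"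
  proof (cases "bump i x = 0")
    case False
    then show ?thesis using linear_tcd[OF assms(1) ch[OF i] assms(2) bump_in]
      by (simp add: blinfun.bilinear_simps Bl_apply linear_ins)
  qed (simp add: blinfun.bilinear_simps)
qed simp

lemma Lc_apply:
  assumes "c \<in> A" "x \<in> cdom c"
  shows "Lc c x w = inverse (weight x) *\<^sub>R (\<Sum>i<n. bump i x *\<^sub>R tcd (ch i) c x (ev i w))"
proof -
  have "(bump i x *\<^sub>R (Bl (tcd (ch i) c x) o\<^sub>L ev i)) w = bump i x *\<^sub>R tcd (ch i) c x (ev i w)" if i: "i < n" for i
  proof (cases "bump i x = 0")
    case False
    then show ?thesis using linear_tcd[OF ch[OF i] assms(1) bump_in assms(2)]
      by (simp add: blinfun.bilinear_simps Bl_apply)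
  qed (simp add: blinfun.bilinear_simps)
  then have "(\<Sum>i<n. (bump i x *\<^sub>R (Bl (tcd (ch i) c x) o\<^sub>L ev i)) w) = (\<Sum>i<n. bump i x *\<^sub>R tcd (ch i) c x (ev i w))"
    by (intro sum.cong) auto
  then show ?thesis unfolding Lc_def blinfun.scaleR_left blinfun.sum_left by simp
qed

text \<open>\<open>J\<close> is built with the discontinuous choice \<open>chart_at\<close>, yet its
  values near a point can be computed in one fixed chart. Together with \<open>L_chart\<close> this
  is how regularity in the embedding is proved.\<close>

lemma J_chart:
  assumes c: "c \<in> A" "x \<in> cdom c"
  shows "J x v = Jc c x (to_chart A c x v)"
  unfolding J_def Jc_apply[OF chart_at_in in_chart_at] Jc_apply[OF c]
proof (rule sum.cong)
  fix i assume "i \<in> {..<n}"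
  then have i: "i < n" by simp
  show "bump i x *\<^sub>R ins i (tcd (chart_at A x) (ch i) x v) = bump i x *\<^sub>R ins i (tcd c (ch i) x (to_chart A c x v))"
  proof (cases "bump i x = 0")
    case False
    then show ?thesis
      using tcd_to_chart[OF c ch[OF i] bump_in] by (simp add: to_chart_tcd)
  qed simp
qed simp

lemma L_chart:
  assumes c: "c \<in> A" "x \<in> cdom c"
  shows "to_chart A c x (L x w) = Lc c x w"
proof -
  have lin: "linear (to_chart A c x)" by (rule linear_to_chart[OF c])
  have "bump i x *\<^sub>R to_chart A c x (tcd (ch i) (chart_at A x) x (ev i w)) = bump i x *\<^sub>R tcd (ch i) c x (ev i w)" if i: "i < n" for i
  proof (cases "bump i x = 0")
    case False
    then show ?thesis
      unfolding to_chart_tcd using tcd_comp[OF ch[OF i] chart_at_in c(1) bump_in in_chart_at c(2)] by simp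
  qed simp
  then have "(\<Sum>i<n. bump i x *\<^sub>R to_chart A c x (tcd (ch i) (chart_at A x) x (ev i w))) = (\<Sum>i<n. bump i x *\<^sub>R tcd (ch i) c x (ev i w))"
    by (intro sum.cong) auto
  then show ?thesis
    unfolding L_def Lc_apply[OF chart_at_in in_chart_at] Lc_apply[OF c]
    by (simp add: linear_scale[OF lin] linear_sum[OF lin])
qed

lemma L_J:
  assumes p: "p \<in> K" shows "L p (J p v) = v"
proof -
  let ?c = "chart_at A p"
  have ev: "ev i (J p v) = bump i p *\<^sub>R tcd ?c (ch i) p v" if i: "i < n" for i
  proof -
    have "ev i (J p v) = (\<Sum>j<n. if i = j then bump j p *\<^sub>R tcd ?c (ch j) p v else 0)"
      unfolding J_def Jc_apply[OF chart_at_in in_chart_at] blinfun.sum_right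
      by (rule sum.cong) (auto simp: blinfun.scaleR_right ev_ins)
    then show ?thesis using i by simp
  qed
  have "bump i p *\<^sub>R tcd (ch i) ?c p (ev i (J p v)) = (bump i p * bump i p) *\<^sub>R v" if i: "i < n" for i
  proof (cases "bump i p = 0")
    case False
    note b = bump_in[OF False]
    have "tcd (ch i) ?c p (ev i (J p v)) = bump i p *\<^sub>R tcd (ch i) ?c p (tcd ?c (ch i) p v)"
      unfolding ev[OF i] by (rule linear_scale[OF linear_tcd[OF ch[OF i] chart_at_in b in_chart_at]])
    also have "tcd (ch i) ?c p (tcd ?c (ch i) p v) = v"
      using tcd_comp[OF chart_at_in ch[OF i] chart_at_in in_chart_at b in_chart_at] tcd_self[OF chart_at_in in_chart_at] by simp
    finally show ?thesis by simp
  qed simp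
  then have "L p (J p v) = inverse (weight p) *\<^sub>R (\<Sum>i<n. (bump i p * bump i p) *\<^sub>R v)"
    unfolding L_def Lc_apply[OF chart_at_in in_chart_at] by simp
  also have "\<dots> = v" using weight_pos[OF p] by (simp add: weight_def flip: scaleR_sum_left)
  finally show ?thesis .
qed

definition B :: "real \<Rightarrow> 'm \<Rightarrow> 'e seqs \<Rightarrow>\<^sub>L 'e seqs" where
  "B t x = J (f t x) o\<^sub>L Bl (push A (f t) x) o\<^sub>L L x"

lemma B_apply: "B t x w = J (f t x) (push A (f t) x (L x w))"
  unfolding B_def by (simp add: Bl_apply linear_push)

text \<open>Near \<open>(t0, p)\<close> two fixed charts serve, one around \<open>p\<close> and one
  around \<open>f t0 p\<close>; in them \<open>B\<close> is a product of three locally Lipschitz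
  factors.\<close>

lemma lip_B:
  assumes p: "p \<in> K"
  shows "locally_lipschitz t0 p B"
proof -
  let ?c = "chart_at A p" and ?d = "chart_at A (f t0 p)"
  note c = chart_at_in[of p] in_chart_at[of p] and d = chart_at_in[of "f t0 p"] in_chart_at[of "f t0 p"]
  show ?thesis
  proof (rule locally_lipschitz_cong)
    show "locally_lipschitz t0 p (\<lambda>t x. Jc ?d (f t x) o\<^sub>L Bl (fD ?c ?d t x) o\<^sub>L Lc ?c x)"
      by (intro locally_lipschitz_compose locally_lipschitz_fD lip_Lc c d p
          locally_lipschitz_flow[of 0, OF lip_Jc[OF d]])
    have "\<forall>\<^sub>F z in nhds (t0, p). (case z of (t, x) \<Rightarrow> f t x) \<in> cdom ?d"
      by (rule topological_tendstoD[OF flow_tendsto]) (use d open_cdom in auto)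
    moreover have "\<forall>\<^sub>F (t, x) in nhds (t0, p). x \<in> cdom ?c" by (rule eventually_snd_in[OF open_cdom[OF c(1)] c(2)])
    ultimately show "\<forall>\<^sub>F (t, x) in nhds (t0, p). Jc ?d (f t x) o\<^sub>L Bl (fD ?c ?d t x) o\<^sub>L Lc ?c x = B t x"
    proof eventually_elim
      case (elim z)
      obtain t x where [simp]: "z = (t, x)" by (cases z) auto
      have x: "x \<in> cdom ?c" "f t x \<in> cdom ?d" using elim by auto
      have "(Jc ?d (f t x) o\<^sub>L Bl (fD ?c ?d t x) o\<^sub>L Lc ?c x) w = B t x w" for w
        unfolding B_apply J_chart[OF d(1) x(2)] push_flow[OF c(1) d(1) x] L_chart[OF c(1) x(1)]
        using linear_fD[OF c(1) d(1) x] by (simp add: Bl_apply)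
      then show ?case by (simp add: blinfun_eqI)
    qed
  qed
qed

lemma lip_vector_field:
  assumes Y: "smooth_vf A Y"
  shows "locally_lipschitz t0 p (\<lambda>t x. J x (Y x))"
proof -
  let ?c = "chart_at A p"
  note c = chart_at_in[of p] in_chart_at[of p]
  have Ys: "smooth_on (crange ?c) (\<lambda>x. to_chart A ?c (cinv ?c x) (Y (cinv ?c x)))"
    using Y c unfolding smooth_vf_def by blast
  show ?thesis
  proof (rule locally_lipschitz_cong)
    show "locally_lipschitz t0 p (\<lambda>t x. Jc ?c x (to_chart A ?c (cinv ?c (cmap ?c x)) (Y (cinv ?c (cmap ?c x)))))"
      by (rule locally_lipschitz_apply[OF lip_Jc[OF c] locally_lipschitz_smooth_static[OF Ys open_crange[OF c(1)] c cmap_in[OF c]]])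
    show "\<forall>\<^sub>F (t, x) in nhds (t0, p). Jc ?c x (to_chart A ?c (cinv ?c (cmap ?c x)) (Y (cinv ?c (cmap ?c x)))) = J x (Y x)"
      using eventually_snd_in[OF open_cdom[OF c(1)] c(2), of t0]
      by eventually_elim (auto simp: cinv_cmap c(1) J_chart[OF c(1)])
  qed
qed

end

section \<open>The hyperbolic splitting\<close>

text \<open>\<open>Ps\<close>, \<open>Pu\<close> and \<open>Pc\<close> list the three subspaces in
  different orders, hence the three variants.\<close>

lemma direct_sum3_proj:
  assumes "direct_sum3 V1 V2 V3" "a \<in> V1" "b \<in> V2" "c \<in> V3" "w = a + b + c"
  shows "proj3 V1 V2 V3 w = a" "proj3 V2 V1 V3 w = b" "proj3 V3 V1 V2 w = c"
proof -
  have u: "a' = a \<and> b' = b \<and> c' = c" if "a' \<in> V1" "b' \<in> V2" "c' \<in> V3" "w = a' + b' + c'" for a' b' c'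
  proof -
    have "\<exists>!(a, b, c). a \<in> V1 \<and> b \<in> V2 \<and> c \<in> V3 \<and> w = a + b + c"
      using assms(1) unfolding direct_sum3_def by blast
    then have "(a', b', c') = (a, b, c)"
      by (rule ex1E) (use that assms(2-5) in \<open>metis (mono_tags, lifting) case_prodI\<close>)
    then show ?thesis by simp
  qed
  show "proj3 V1 V2 V3 w = a"
    unfolding proj3_def by (rule the_equality) (use assms u in blast)+
  show "proj3 V2 V1 V3 w = b"
    unfolding proj3_def
  proof (rule the_equality)
    show "b \<in> V2 \<and> (\<exists>ba\<in>V1. \<exists>c\<in>V3. w = b + ba + c)"
      using assms by (intro conjI bexI[of _ a] bexI[of _ c]) (auto simp: add_ac)
    fix b' assume "b' \<in> V2 \<and> (\<exists>ba\<in>V1. \<exists>c\<in>V3. w = b' + ba + c)"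
    then obtain a' c' where "b' \<in> V2" "a' \<in> V1" "c' \<in> V3" "w = b' + a' + c'" by blast
    then show "b' = b" using u[of a' b' c'] by (simp add: add.commute)
  qed
  show "proj3 V3 V1 V2 w = c"
    unfolding proj3_def
  proof (rule the_equality)
    show "c \<in> V3 \<and> (\<exists>b\<in>V1. \<exists>ca\<in>V2. w = c + b + ca)"
      using assms by (intro conjI bexI[of _ a] bexI[of _ b]) (auto simp: add_ac)
    fix c' assume "c' \<in> V3 \<and> (\<exists>b\<in>V1. \<exists>ca\<in>V2. w = c' + b + ca)"
    then obtain a' b' where "c' \<in> V3" "a' \<in> V1" "b' \<in> V2" "w = c' + a' + b'" by blast
    then show "c' = c" using u[of a' b' c'] by (simp add: add_ac)
  qed
qed

lemma direct_sum3_decomp: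
  assumes "direct_sum3 V1 V2 V3"
  shows "proj3 V1 V2 V3 w \<in> V1" "proj3 V2 V1 V3 w \<in> V2" "proj3 V3 V1 V2 w \<in> V3"
    "w = proj3 V1 V2 V3 w + proj3 V2 V1 V3 w + proj3 V3 V1 V2 w"
proof -
  obtain a b c where abc: "a \<in> V1" "b \<in> V2" "c \<in> V3" "w = a + b + c"
    using assms unfolding direct_sum3_def by blast
  from direct_sum3_proj[OF assms this] abc
  show "proj3 V1 V2 V3 w \<in> V1" "proj3 V2 V1 V3 w \<in> V2" "proj3 V3 V1 V2 w \<in> V3"
    "w = proj3 V1 V2 V3 w + proj3 V2 V1 V3 w + proj3 V3 V1 V2 w" by simp_all
qed

lemma direct_sum3_linear:
  assumes V: "direct_sum3 V1 V2 V3"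
  shows "linear (proj3 V1 V2 V3)" "linear (proj3 V2 V1 V3)" "linear (proj3 V3 V1 V2)"
proof -
  note sub = V[unfolded direct_sum3_def, THEN conjunct1] V[unfolded direct_sum3_def, THEN conjunct2, THEN conjunct1]
    V[unfolded direct_sum3_def, THEN conjunct2, THEN conjunct2, THEN conjunct1]
  note D = direct_sum3_decomp[OF V]
  have add: "proj3 V1 V2 V3 (x + y) = proj3 V1 V2 V3 x + proj3 V1 V2 V3 y \<and>
     proj3 V2 V1 V3 (x + y) = proj3 V2 V1 V3 x + proj3 V2 V1 V3 y \<and>
     proj3 V3 V1 V2 (x + y) = proj3 V3 V1 V2 x + proj3 V3 V1 V2 y" for x y
  proof -
    have "x + y = (proj3 V1 V2 V3 x + proj3 V1 V2 V3 y) + (proj3 V2 V1 V3 x + proj3 V2 V1 V3 y) + (proj3 V3 V1 V2 x + proj3 V3 V1 V2 y)"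
      using D(4)[of x] D(4)[of y] by (metis add.assoc add.left_commute)
    from direct_sum3_proj[OF V subspace_add[OF sub(1) D(1) D(1)] subspace_add[OF sub(2) D(2) D(2)] subspace_add[OF sub(3) D(3) D(3)] this]
    show ?thesis by blast
  qed
  have scale: "proj3 V1 V2 V3 (r *\<^sub>R x) = r *\<^sub>R proj3 V1 V2 V3 x \<and>
     proj3 V2 V1 V3 (r *\<^sub>R x) = r *\<^sub>R proj3 V2 V1 V3 x \<and>
     proj3 V3 V1 V2 (r *\<^sub>R x) = r *\<^sub>R proj3 V3 V1 V2 x" for r x
  proof -
    have "r *\<^sub>R x = r *\<^sub>R proj3 V1 V2 V3 x + r *\<^sub>R proj3 V2 V1 V3 x + r *\<^sub>R proj3 V3 V1 V2 x"
      using D(4)[of x] by (metis scaleR_add_right)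
    from direct_sum3_proj[OF V subspace_scale[OF sub(1) D(1)] subspace_scale[OF sub(2) D(2)] subspace_scale[OF sub(3) D(3)] this]
    show ?thesis by blast
  qed
  show "linear (proj3 V1 V2 V3)" "linear (proj3 V2 V1 V3)" "linear (proj3 V3 V1 V2)"
    by (rule linearI; use add scale in blast)+
qed

lemma bilinear_quadratic_sum:
  fixes h :: "'e::euclidean_space \<Rightarrow> 'e \<Rightarrow> real"
  assumes "bilinear h"
  shows "h u w = (\<Sum>b\<in>Basis. \<Sum>b'\<in>Basis. (u \<bullet> b) * (w \<bullet> b') * h b b')"
proof -
  have 1: "linear (\<lambda>u. h u w)" and 2: "linear (h b)" for b using assms unfolding bilinear_def by auto
  have "h u w = (\<Sum>b\<in>Basis. (u \<bullet> b) *\<^sub>R h b w)" by (rule linear_euclidean_sum[OF 1])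
  also have "\<dots> = (\<Sum>b\<in>Basis. (u \<bullet> b) *\<^sub>R (\<Sum>b'\<in>Basis. (w \<bullet> b') *\<^sub>R h b b'))"
    by (subst linear_euclidean_sum[OF 2]) simp
  finally show ?thesis by (simp add: sum_distrib_left mult.assoc)
qed

lemma bilinear_Basis_bound:
  fixes h :: "'e::euclidean_space \<Rightarrow> 'e \<Rightarrow> real"
  assumes "bilinear h"
  shows "\<bar>h u w\<bar> \<le> (\<Sum>b\<in>Basis. \<Sum>b'\<in>Basis. \<bar>h b b'\<bar>) * (norm u * norm w)"
proof -
  have "\<bar>h u w\<bar> \<le> (\<Sum>b\<in>Basis. \<bar>\<Sum>b'\<in>Basis. (u \<bullet> b) * (w \<bullet> b') * h b b'\<bar>)"
    unfolding bilinear_quadratic_sum[OF assms, of u w] by (rule sum_abs)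
  also have "\<dots> \<le> (\<Sum>b\<in>Basis. \<Sum>b'\<in>Basis. \<bar>(u \<bullet> b) * (w \<bullet> b') * h b b'\<bar>)" by (intro sum_mono sum_abs)
  also have "\<dots> \<le> (\<Sum>b\<in>Basis. \<Sum>b'\<in>Basis. (norm u * norm w) * \<bar>h b b'\<bar>)"
    by (intro sum_mono) (auto simp: abs_mult intro!: mult_right_mono mult_mono Basis_le_norm)
  finally show ?thesis by (simp add: sum_distrib_left mult.commute)
qed

lemma bilinear_diff:
  fixes h k :: "'e::real_vector \<Rightarrow> 'e \<Rightarrow> real"
  shows "bilinear h \<Longrightarrow> bilinear k \<Longrightarrow> bilinear (\<lambda>u w. h u w - k u w)"
  unfolding bilinear_def by (auto intro: linear_compose_sub)

text \<open>The constant is the minimum over the unit sphere; homogeneity extends the bound to all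
  vectors.\<close>

lemma positive_definite_bound:
  fixes h :: "'e::euclidean_space \<Rightarrow> 'e \<Rightarrow> real"
  assumes h: "bilinear h" and pos: "\<And>u. u \<noteq> 0 \<Longrightarrow> h u u > 0"
  obtains m where "m > 0" "\<And>u. m * (norm u)\<^sup>2 \<le> h u u"
proof -
  have cont: "continuous_on (sphere 0 1) (\<lambda>u. h u u)"
    by (subst bilinear_quadratic_sum[OF h]) (intro continuous_intros)
  have ne: "sphere (0::'e) 1 \<noteq> {}" by (simp add: sphere_eq_empty)
  obtain v where v: "v \<in> sphere 0 1" "\<And>u. u \<in> sphere 0 1 \<Longrightarrow> h v v \<le> h u u"
    using continuous_attains_inf[OF compact_sphere ne cont] by blast
  have "h v v * (norm u)\<^sup>2 \<le> h u u" for u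
  proof (cases "u = 0")
    case True
    have "h 0 0 = 0" using bilinear_lzero[OF h] by simp
    then show ?thesis using True by simp
  next
    case False
    let ?s = "u /\<^sub>R norm u"
    have "h v v \<le> h ?s ?s" using False by (intro v(2)) simp
    also have "h ?s ?s = h u u / (norm u)\<^sup>2"
      by (simp add: bilinear_lmul[OF h] bilinear_rmul[OF h] power2_eq_square field_simps)
    finally show ?thesis using False by (simp add: field_simps)
  qed
  moreover have "h v v > 0" using v(1) by (intro pos) auto
  ultimately show ?thesis using that by blast
qed

section \<open>Comparison of the Riemannian metric with coordinate norms\<close>

locale riemannian_flow = smooth_flow A F f
  for A :: "('m::{t2_space, second_countable_topology}, 'e::euclidean_space) chart set" and F f +
  fixes g :: "'m \<Rightarrow> 'e \<Rightarrow> 'e \<Rightarrow> real"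
  assumes riem: "riemannian_metric A g"
begin

lemma bilinear_g: "bilinear (g p)" and g_sym: "g p u w = g p w u" and g_pos: "u \<noteq> 0 \<Longrightarrow> g p u u > 0"
  and smooth_metric: "c \<in> A \<Longrightarrow> smooth_on (crange c) (\<lambda>x. metric_coord A g c x u w)"
  using riem unfolding riemannian_metric_def by blast+

lemma bilinear_metric_coord:
  assumes "c \<in> A" "x \<in> crange c"
  shows "bilinear (metric_coord A g c x)"
proof -
  have l: "linear (from_chart A c (cinv c x))" using assms by (intro linear_from_chart cinv_in)
  have "linear (\<lambda>u. g (cinv c x) (from_chart A c (cinv c x) u) w)" "linear (\<lambda>u. g (cinv c x) w (from_chart A c (cinv c x) u))" for w
    using bilinear_g[of "cinv c x"] linear_compose[OF l] unfolding bilinear_def o_def by auto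
  then show ?thesis unfolding bilinear_def metric_coord_def by simp
qed

lemma metric_coord_pos:
  assumes "c \<in> A" "x \<in> crange c" "u \<noteq> 0"
  shows "metric_coord A g c x u u > 0"
proof -
  have "from_chart A c (cinv c x) u \<noteq> 0"
    using to_from_chart[OF assms(1) cinv_in[OF assms(1,2)]] assms(3)
      linear_0[OF linear_to_chart[OF assms(1) cinv_in[OF assms(1,2)]]] by metis
  then show ?thesis unfolding metric_coord_def by (rule g_pos)
qed

lemma metric_coord_sym: "metric_coord A g c x u w = metric_coord A g c x w u"
  unfolding metric_coord_def by (rule g_sym)

lemma metric_coord_cmap:
  assumes "c \<in> A" "p \<in> cdom c"
  shows "metric_coord A g c (cmap c p) (to_chart A c p v) (to_chart A c p w) = g p v w"
  unfolding metric_coord_def using assms by (simp add: cinv_cmap from_to_chart)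

text \<open>The quadratic form at \<open>x\<close> differs from that at \<open>x0\<close> by at most
  \<open>S x |u|^2\<close>, and \<open>S x < m / 2\<close> near \<open>x0\<close>, so half of the
  lower bound at \<open>x0\<close> survives.\<close>

lemma metric_local_bounds:
  assumes c: "c \<in> A" and x0: "x0 \<in> crange c"
  shows "\<exists>m>0. \<exists>M\<ge>0. \<forall>\<^sub>F x in nhds x0. x \<in> crange c \<and>
    (\<forall>u. m * (norm u)\<^sup>2 \<le> metric_coord A g c x u u \<and> metric_coord A g c x u u \<le> M * (norm u)\<^sup>2)"
proof -
  let ?G = "metric_coord A g c"
  define S where "S = (\<lambda>x. \<Sum>b\<in>Basis. \<Sum>b'\<in>Basis. \<bar>?G x b b' - ?G x0 b b'\<bar>)"
  obtain m where m: "m > 0" "\<And>u. m * (norm u)\<^sup>2 \<le> ?G x0 u u"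
    using positive_definite_bound[OF bilinear_metric_coord[OF c x0] metric_coord_pos[OF c x0]] by blast
  define M where "M = (\<Sum>b\<in>Basis. \<Sum>b'\<in>Basis. \<bar>?G x0 b b'\<bar>) + m"
  have M: "M \<ge> 0" using m by (simp add: M_def sum_nonneg add_nonneg_nonneg)
  have "continuous_on (crange c) S"
    unfolding S_def by (intro continuous_intros smooth_on_continuous[OF smooth_metric[OF c]])
  then have "(S \<longlongrightarrow> S x0) (nhds x0)"
    using continuous_nhds_compose[OF open_crange[OF c] x0 _ filterlim_ident] by blast
  moreover have "S x0 = 0" by (simp add: S_def)
  ultimately have "\<forall>\<^sub>F x in nhds x0. S x < m / 2" using m by (intro order_tendstoD(2)) auto
  moreover have "\<forall>\<^sub>F x in nhds x0. x \<in> crange c" using open_crange[OF c] x0 by (rule eventually_nhds_in_open)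
  ultimately have "\<forall>\<^sub>F x in nhds x0. x \<in> crange c \<and> (\<forall>u. m / 2 * (norm u)\<^sup>2 \<le> ?G x u u \<and> ?G x u u \<le> M * (norm u)\<^sup>2)"
  proof eventually_elim
    case (elim x)
    have "m / 2 * (norm u)\<^sup>2 \<le> ?G x u u \<and> ?G x u u \<le> M * (norm u)\<^sup>2" for u
    proof -
      have "\<bar>?G x u u - ?G x0 u u\<bar> \<le> S x * (norm u * norm u)"
        unfolding S_def
        by (rule bilinear_Basis_bound[OF bilinear_diff[OF bilinear_metric_coord[OF c elim(2)] bilinear_metric_coord[OF c x0]]])
      also have "\<dots> \<le> (m / 2) * (norm u)\<^sup>2"
        unfolding power2_eq_square using elim(1) by (intro mult_right_mono) auto
      finally have d: "\<bar>?G x u u - ?G x0 u u\<bar> \<le> (m / 2) * (norm u)\<^sup>2" .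
      have "\<bar>?G x0 u u\<bar> \<le> (M - m) * (norm u)\<^sup>2"
        using bilinear_Basis_bound[OF bilinear_metric_coord[OF c x0], of u u] by (simp add: M_def power2_eq_square)
      then have "?G x u u \<le> (M - m) * (norm u)\<^sup>2 + (m / 2) * (norm u)\<^sup>2" using d by linarith
      also have "\<dots> \<le> M * (norm u)\<^sup>2" using m by (simp add: algebra_simps)
      finally have "?G x u u \<le> M * (norm u)\<^sup>2" .
      moreover have "m / 2 * (norm u)\<^sup>2 \<le> ?G x u u" using d m(2)[of u] by (simp add: abs_le_iff) argo
      ultimately show ?thesis by blast
    qed
    then show ?case using elim by blast
  qed
  then show ?thesis using m M by (intro exI[of _ "m / 2"] conjI exI[of _ M]) auto
qed

end

section \<open>The splitting and the linearised flow in the embedding\<close>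

locale hyperbolic_cover = chart_cover A F f K n ch ctr rad + riemannian_flow A F f g
  for A :: "('m::{t2_space, second_countable_topology}, 'e::euclidean_space) chart set"
    and F f K n ch ctr rad g +
  fixes Vs Vu :: "'m \<Rightarrow> 'e set"
  assumes hyp: "hyperbolic_splitting A g F f K Vs Vu"
begin

abbreviation "PS \<equiv> Ps F Vs Vu"
abbreviation "PU \<equiv> Pu F Vs Vu"
abbreviation "PC \<equiv> Pc F Vs Vu"

lemma F_nonzero: "p \<in> K \<Longrightarrow> F p \<noteq> 0"
  and ds: "p \<in> K \<Longrightarrow> direct_sum3 (Vs p) (Vu p) (span {F p})"
  and cont_P: "continuous_endo A K PS" "continuous_endo A K PU" "continuous_endo A K PC"
  and push_V: "p \<in> K \<Longrightarrow> push A (f t) p ` Vs p = Vs (f t p)" "p \<in> K \<Longrightarrow> push A (f t) p ` Vu p = Vu (f t p)"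
  using hyp unfolding hyperbolic_splitting_def by blast+

lemma P_in: "p \<in> K \<Longrightarrow> PS p w \<in> Vs p" "p \<in> K \<Longrightarrow> PU p w \<in> Vu p" "p \<in> K \<Longrightarrow> PC p w \<in> span {F p}"
  and P_sum: "p \<in> K \<Longrightarrow> PS p w + PU p w + PC p w = w"
  using direct_sum3_decomp[OF ds] unfolding Ps_def Pu_def Pc_def by auto

lemma P_unique:
  assumes "p \<in> K" "a \<in> Vs p" "b \<in> Vu p" "c \<in> span {F p}"
  shows "PS p (a + b + c) = a" "PU p (a + b + c) = b" "PC p (a + b + c) = c"
  unfolding Ps_def Pu_def Pc_def using direct_sum3_proj[OF ds[OF assms(1)] assms(2-4) refl] by auto

lemma linear_P: "p \<in> K \<Longrightarrow> linear (PS p)" "p \<in> K \<Longrightarrow> linear (PU p)" "p \<in> K \<Longrightarrow> linear (PC p)"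
  using direct_sum3_linear[OF ds] unfolding Ps_def[abs_def] Pu_def[abs_def] Pc_def[abs_def] by auto

lemma V_0: "p \<in> K \<Longrightarrow> 0 \<in> Vs p" "p \<in> K \<Longrightarrow> 0 \<in> Vu p" "0 \<in> span {F p}"
  using ds unfolding direct_sum3_def by (auto simp: subspace_0 span_0)

lemma P_P:
  assumes "p \<in> K"
  shows "PS p (PS p w) = PS p w" "PS p (PU p w) = 0" "PS p (PC p w) = 0"
    "PU p (PS p w) = 0" "PU p (PU p w) = PU p w" "PU p (PC p w) = 0"
    "PC p (PS p w) = 0" "PC p (PU p w) = 0" "PC p (PC p w) = PC p w"
  using P_unique[OF assms P_in(1)[OF assms, of w] V_0(2)[OF assms] V_0(3)]
    P_unique[OF assms V_0(1)[OF assms] P_in(2)[OF assms, of w] V_0(3)]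
    P_unique[OF assms V_0(1)[OF assms] V_0(2)[OF assms] P_in(3)[OF assms, of w]]
  by simp_all

text \<open>The images of the three components lie in the three bundles at \<open>f t p\<close>, so
  uniqueness of the decomposition there identifies them as the components of the image.\<close>

lemma push_P:
  assumes p: "p \<in> K"
  shows "PS (f t p) (push A (f t) p w) = push A (f t) p (PS p w)"
    "PU (f t p) (push A (f t) p w) = push A (f t) p (PU p w)"
    "PC (f t p) (push A (f t) p w) = push A (f t) p (PC p w)"
proof -
  have fp: "f t p \<in> K" using p f_iff by simp
  have lin: "linear (push A (f t) p)" by (rule linear_push)
  obtain k where k: "PC p w = k *\<^sub>R F p" using P_in(3)[OF p, of w] unfolding span_singleton by auto
  have "push A (f t) p (PC p w) = k *\<^sub>R F (f t p)" unfolding k linear_scale[OF lin] push_F ..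
  then have c: "push A (f t) p (PC p w) \<in> span {F (f t p)}" unfolding span_singleton by auto
  have s: "push A (f t) p (PS p w) \<in> Vs (f t p)" using push_V(1)[OF p] P_in(1)[OF p] by blast
  have u: "push A (f t) p (PU p w) \<in> Vu (f t p)" using push_V(2)[OF p] P_in(2)[OF p] by blast
  have "push A (f t) p w = push A (f t) p (PS p w + PU p w + PC p w)" by (simp add: P_sum[OF p])
  also have "\<dots> = push A (f t) p (PS p w) + push A (f t) p (PU p w) + push A (f t) p (PC p w)"
    by (simp add: linear_add[OF lin])
  finally have "push A (f t) p w = push A (f t) p (PS p w) + push A (f t) p (PU p w) + push A (f t) p (PC p w)" .
  with P_unique[OF fp s u c]
  show "PS (f t p) (push A (f t) p w) = push A (f t) p (PS p w)"
    "PU (f t p) (push A (f t) p w) = push A (f t) p (PU p w)"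
    "PC (f t p) (push A (f t) p w) = push A (f t) p (PC p w)" by simp_all
qed

lemma PS_F: "p \<in> K \<Longrightarrow> PS p (F p) = 0" and PU_F: "p \<in> K \<Longrightarrow> PU p (F p) = 0"
  using P_unique[OF _ V_0(1) V_0(2), of p "F p"] span_base[of "F p" "{F p}"] by simp_all

definition Q :: "('m \<Rightarrow> 'e \<Rightarrow> 'e) \<Rightarrow> 'm \<Rightarrow> 'e seqs \<Rightarrow>\<^sub>L 'e seqs" where
  "Q P p = J p o\<^sub>L Bl (P p) o\<^sub>L L p"

lemma Q_apply: "linear (P p) \<Longrightarrow> Q P p w = J p (P p (L p w))"
  by (simp add: Q_def Bl_apply)

text \<open>What is drawn from this is boundedness over the compact set \<open>K\<close>; the
  Hoelder regularity of these operators comes from the cocycle afterwards.\<close>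

lemma continuous_Q:
  assumes P: "continuous_endo A K P" and lin: "\<And>p. p \<in> K \<Longrightarrow> linear (P p)"
  shows "continuous_on K (Q P)"
  unfolding continuous_on_def
proof
  fix p assume p: "p \<in> K"
  let ?c = "chart_at A p"
  note c = chart_at_in[of p] in_chart_at[of p]
  have "\<forall>\<^sub>F x in at p within K. x \<in> cdom ?c" 
    using eventually_nhds_in_open[OF open_cdom[OF c(1)] c(2)] by (auto simp: eventually_at_filter elim: eventually_mono)
  moreover have "\<forall>\<^sub>F x in at p within K. x \<in> K" by (simp add: eventually_at_filter)
  ultimately have near: "\<forall>\<^sub>F x in at p within K. x \<in> K \<inter> cdom ?c" by eventually_elim simp
  let ?M = "\<lambda>x. \<Sum>b\<in>Basis. coord_map b (to_chart A ?c x (P x (from_chart A ?c x b)))"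
  have eq: "Q P x = Jc ?c x o\<^sub>L ?M x o\<^sub>L Lc ?c x" if x: "x \<in> K \<inter> cdom ?c" for x
  proof (rule blinfun_eqI)
    fix w
    have xc: "x \<in> cdom ?c" and xK: "x \<in> K" using x by auto
    have lM: "linear (\<lambda>u. to_chart A ?c x (P x (from_chart A ?c x u)))"
      using linear_compose[OF linear_compose[OF linear_from_chart[OF c(1) xc] lin[OF xK]] linear_to_chart[OF c(1) xc]]
      by (simp add: o_def)
    have "Q P x w = Jc ?c x (to_chart A ?c x (P x (from_chart A ?c x (Lc ?c x w))))"
      unfolding Q_apply[of P x, OF lin[OF xK]] J_chart[OF c(1) xc] L_chart[OF c(1) xc, symmetric] from_to_chart[OF c(1) xc] ..
    then show "Q P x w = (Jc ?c x o\<^sub>L ?M x o\<^sub>L Lc ?c x) w"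
      using Bl_Basis[OF lM] Bl_apply[OF lM] by simp
  qed
  have cJ: "(Jc ?c \<longlongrightarrow> Jc ?c p) (at p within K)"
    using locally_lipschitz_static_continuous[OF lip_Jc[OF c]] isCont_def tendsto_within_subset[OF _ subset_UNIV] by blast
  have cL: "(Lc ?c \<longlongrightarrow> Lc ?c p) (at p within K)"
    using locally_lipschitz_static_continuous[OF lip_Lc[OF c p]] isCont_def tendsto_within_subset[OF _ subset_UNIV] by blast
  have cM: "(?M \<longlongrightarrow> ?M p) (at p within K)"
  proof (intro tendsto_sum bounded_linear.tendsto[OF bounded_linear_coord_map])
    fix b
    have "continuous_on (K \<inter> cdom ?c) (\<lambda>x. to_chart A ?c x (P x (from_chart A ?c x b)))"
      using P c unfolding continuous_endo_def by blast
    then have "((\<lambda>x. to_chart A ?c x (P x (from_chart A ?c x b))) \<longlongrightarrow> to_chart A ?c p (P p (from_chart A ?c p b))) (at p within K \<inter> cdom ?c)"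
      using p c unfolding continuous_on_def by blast
    moreover have "at p within K \<inter> cdom ?c = at p within K"
      by (rule at_within_nhd[OF c(2) open_cdom[OF c(1)]]) auto
    ultimately show "((\<lambda>x. to_chart A ?c x (P x (from_chart A ?c x b))) \<longlongrightarrow> to_chart A ?c p (P p (from_chart A ?c p b))) (at p within K)" by simp
  qed
  have "((\<lambda>x. Jc ?c x o\<^sub>L ?M x o\<^sub>L Lc ?c x) \<longlongrightarrow> Jc ?c p o\<^sub>L ?M p o\<^sub>L Lc ?c p) (at p within K)"
    by (intro bounded_bilinear.tendsto[OF bounded_bilinear_blinfun_compose] cJ cL cM)
  moreover have "\<forall>\<^sub>F x in at p within K. Jc ?c x o\<^sub>L ?M x o\<^sub>L Lc ?c x = Q P x"
    using near by eventually_elim (rule eq[symmetric])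
  ultimately have "(Q P \<longlongrightarrow> Jc ?c p o\<^sub>L ?M p o\<^sub>L Lc ?c p) (at p within K)" by (rule Lim_transform_eventually)
  then show "(Q P \<longlongrightarrow> Q P p) (at p within K)" using eq[of p] p c by simp
qed

lemma eventually_cmap:
  assumes "c \<in> A" "p \<in> cdom c" "\<forall>\<^sub>F x in nhds (cmap c p). P x"
  shows "\<forall>\<^sub>F q in nhds p. P (cmap c q)"
  using eventually_compose_filterlim[OF assms(3) continuous_nhds_compose[OF open_cdom[OF assms(1)] assms(2) cont_cmap[OF assms(1)] filterlim_ident]] .

lemma static_bounded:
  assumes "locally_lipschitz t p (\<lambda>t. h)"
  shows "\<forall>\<^sub>F x in nhds p. norm (h x) \<le> norm (h p) + 1"
proof (rule tendsto_eventually_bounded)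
  show "(h \<longlongrightarrow> h p) (nhds p)"
    using locally_lipschitz_static_continuous[OF assms] tendsto_at_iff_tendsto_nhds[of h p] unfolding isCont_def by simp
qed

text \<open>Hyperbolicity is stated in the Riemannian norm, the cocycle in the norm of the
  embedding. Locally both are equivalent to the coordinate norm, \<open>Jc\<close> and
  \<open>Lc\<close> supplying the two directions, and compactness of \<open>K\<close> makes the
  constant uniform.\<close>

lemma rnorm_J: "\<exists>C\<ge>0. \<forall>p\<in>K. \<forall>v. norm (J p v) \<le> C * rnorm g p v"
  and J_rnorm: "\<exists>C\<ge>0. \<forall>p\<in>K. \<forall>v. rnorm g p v \<le> C * norm (J p v)"
proof -
  have loc: "\<exists>C. \<forall>\<^sub>F q in nhds p. q \<in> K \<longrightarrow> (\<forall>v. norm (J q v) \<le> C * rnorm g q v \<and> rnorm g q v \<le> C * norm (J q v))"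
    if p: "p \<in> K" for p
  proof -
    let ?c = "chart_at A p"
    note c = chart_at_in[of p] in_chart_at[of p]
    obtain m M where m: "m > 0" "M \<ge> 0" and ev: "\<forall>\<^sub>F x in nhds (cmap ?c p). x \<in> crange ?c \<and>
       (\<forall>u. m * (norm u)\<^sup>2 \<le> metric_coord A g ?c x u u \<and> metric_coord A g ?c x u u \<le> M * (norm u)\<^sup>2)"
      using metric_local_bounds[OF c(1) cmap_in[OF c]] by blast
    define a b where "a = norm (Jc ?c p) + 1" and "b = norm (Lc ?c p) + 1"
    have ab: "a \<ge> 0" "b \<ge> 0" by (simp_all add: a_def b_def)
    define C where "C = a / sqrt m + sqrt M * b"
    have "\<forall>\<^sub>F q in nhds p. q \<in> K \<longrightarrow> (\<forall>v. norm (J q v) \<le> C * rnorm g q v \<and> rnorm g q v \<le> C * norm (J q v))"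
      using eventually_cmap[OF c ev] static_bounded[OF lip_Jc[OF c]] static_bounded[OF lip_Lc[OF c p]]
        eventually_nhds_in_open[OF open_cdom[OF c(1)] c(2)]
    proof eventually_elim
      case (elim q)
      show ?case
      proof (intro impI allI)
        fix v assume q: "q \<in> K"
        have qc: "q \<in> cdom ?c" using elim by simp
        let ?u = "to_chart A ?c q v"
        have G: "metric_coord A g ?c (cmap ?c q) ?u ?u = g q v v" by (rule metric_coord_cmap[OF c(1) qc])
        have rn: "rnorm g q v \<ge> 0" by (cases "v = 0") (auto simp: rnorm_def g_pos less_imp_le bilinear_lzero[OF bilinear_g])
        have "m * (norm ?u)\<^sup>2 \<le> g q v v" using elim(1) G by metis
        then have "sqrt (m * (norm ?u)\<^sup>2) \<le> sqrt (g q v v)" by (rule real_sqrt_le_mono)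
        then have 1: "norm ?u \<le> rnorm g q v / sqrt m"
          using m by (simp add: rnorm_def real_sqrt_mult field_simps)
        have "g q v v \<le> M * (norm ?u)\<^sup>2" using elim(1) G by metis
        then have "sqrt (g q v v) \<le> sqrt (M * (norm ?u)\<^sup>2)" by (rule real_sqrt_le_mono)
        then have 2: "rnorm g q v \<le> sqrt M * norm ?u" by (simp add: rnorm_def real_sqrt_mult)
        have "norm (J q v) \<le> a * norm ?u"
          unfolding J_chart[OF c(1) qc] using elim(2) by (intro order_trans[OF norm_blinfun] mult_right_mono) (auto simp: a_def)
        also have "\<dots> \<le> a * (rnorm g q v / sqrt m)" using 1 ab by (intro mult_left_mono)
        also have "\<dots> \<le> C * rnorm g q v"
          using rn m ab by (simp add: C_def distrib_right)
        finally have A: "norm (J q v) \<le> C * rnorm g q v" .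
        have "norm ?u = norm (Lc ?c q (J q v))" using L_chart[OF c(1) qc, of "J q v"] L_J[OF q] by simp
        also have "\<dots> \<le> b * norm (J q v)" using elim(3) by (intro order_trans[OF norm_blinfun] mult_right_mono) (auto simp: b_def)
        finally have "sqrt M * norm ?u \<le> sqrt M * (b * norm (J q v))" using m by (intro mult_left_mono) auto
        also have "\<dots> \<le> C * norm (J q v)" using m ab by (simp add: C_def distrib_right)
        finally show "norm (J q v) \<le> C * rnorm g q v \<and> rnorm g q v \<le> C * norm (J q v)" using A 2 by linarith
      qed
    qed
    then show ?thesis by (rule exI)
  qed
  have rn: "rnorm g q v \<ge> 0" for q v by (cases "v = 0") (auto simp: rnorm_def g_pos less_imp_le bilinear_lzero[OF bilinear_g])
  have "\<exists>C\<ge>0. \<forall>p\<in>K. \<forall>v. norm (J p v) \<le> C * rnorm g p v \<and> rnorm g p v \<le> C * norm (J p v)"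
  proof (rule compact_local_const[OF compact_K loc])
    fix w and C D :: real assume H: "\<forall>v. norm (J w v) \<le> C * rnorm g w v \<and> rnorm g w v \<le> C * norm (J w v)" and "C \<le> D"
    then have "C * rnorm g w v \<le> D * rnorm g w v" "C * norm (J w v) \<le> D * norm (J w v)" for v
      using rn by (auto intro: mult_right_mono)
    with H show "\<forall>v. norm (J w v) \<le> D * rnorm g w v \<and> rnorm g w v \<le> D * norm (J w v)"
      by (meson order_trans)
  qed
  then show "\<exists>C\<ge>0. \<forall>p\<in>K. \<forall>v. norm (J p v) \<le> C * rnorm g p v"
    "\<exists>C\<ge>0. \<forall>p\<in>K. \<forall>v. rnorm g p v \<le> C * norm (J p v)" by meson+
qed

definition Fh :: "'m \<Rightarrow> 'e seqs" where "Fh p = J p (F p)"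

lemma K_bound:
  fixes h :: "'m \<Rightarrow> 'b::real_normed_vector"
  assumes "continuous_on K h"
  shows "\<exists>M\<ge>0. \<forall>p\<in>K. norm (h p) \<le> M"
proof -
  obtain M where "\<And>p. p \<in> K \<Longrightarrow> norm (h p) \<le> M"
    using compact_imp_bounded[OF compact_continuous_image[OF assms compact_K]] unfolding bounded_iff by auto
  then have "\<forall>p\<in>K. norm (h p) \<le> max M 0" by (simp add: le_max_iff_disj)
  then show ?thesis by (intro exI[of _ "max M 0"]) simp
qed

lemma K_lower_bound:
  fixes h :: "'m \<Rightarrow> 'b::real_normed_vector"
  assumes "continuous_on K h" "\<And>p. p \<in> K \<Longrightarrow> h p \<noteq> 0"
  shows "\<exists>m>0. \<forall>p\<in>K. m \<le> norm (h p)"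
proof (cases "K = {}")
  case False
  have "continuous_on K (\<lambda>p. norm (h p))" using assms(1) by (intro continuous_intros)
  from continuous_attains_inf[OF compact_K False this] obtain q where q: "q \<in> K" "\<forall>p\<in>K. norm (h q) \<le> norm (h p)" by blast
  then show ?thesis using assms(2)[OF q(1)] by (intro exI[of _ "norm (h q)"]) simp
qed (auto intro: exI[of _ 1])

lemma J_inj: "p \<in> K \<Longrightarrow> J p v = 0 \<Longrightarrow> v = 0"
  using L_J[of p v] by (simp add: blinfun.zero_right)

lemma cont_Fh: "continuous_on K Fh"
  unfolding Fh_def[abs_def]
  using locally_lipschitz_static_continuous[OF lip_vector_field[OF smooth_F]]
  by (auto intro: continuous_at_imp_continuous_on)

lemma Fh_nonzero: "p \<in> K \<Longrightarrow> Fh p \<noteq> 0"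
  unfolding Fh_def using J_inj F_nonzero by blast

lemma B_J: "p \<in> K \<Longrightarrow> B t p (J p v) = J (f t p) (push A (f t) p v)"
  by (simp add: B_apply L_J)

lemma B_Fh: "p \<in> K \<Longrightarrow> B t p (Fh p) = Fh (f t p)"
  by (simp add: Fh_def B_J push_F)

lemma B_Q:
  assumes "p \<in> K" "linear (P p)" "linear (P (f t p))"
    and "\<And>w. P (f t p) (push A (f t) p w) = push A (f t) p (P p w)"
  shows "B t p o\<^sub>L Q P p = Q P (f t p) o\<^sub>L B t p"
  using assms f_iff by (intro blinfun_eqI) (simp add: Q_apply B_apply L_J)

lemma B_cocycle: "p \<in> K \<Longrightarrow> B (s + t) p = B s (f t p) o\<^sub>L B t p"
  using f_iff by (intro blinfun_eqI) (simp add: B_apply L_J push_comp flow_add)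

text \<open>The bridge from the geometry to the abstract cocycle. It combines Lipschitz bounds for
  times in \<open>[-1, 1]\<close>, the equivalence of the two norms, and bounds for the embedded
  projections over \<open>K\<close>.\<close>

lemma cocycle_exists: "\<exists>\<Lambda> C \<kappa>. hyperbolic_cocycle K dd f B (Q PS) (Q PU) (Q PC) Fh \<Lambda> C \<kappa>"
proof -
  have fK: "f t p \<in> K" if "p \<in> K" for t p using that f_iff by simp
  obtain l1 where l1: "l1 \<ge> 0" "\<forall>t\<in>{-1..1}. \<forall>p\<in>K. \<forall>q\<in>K. dd (f t p) (f t q) \<le> l1 * dd p q"
    using dd_flow_lipschitz by (elim exE conjE)
  have "\<exists>\<Lambda>\<ge>0. \<forall>t\<in>{-1..1}. \<forall>p\<in>K. \<forall>q\<in>K. norm (B t p - B t q) \<le> \<Lambda> * dd p q"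
    by (rule lipschitz_global[OF lip_B])
  then obtain l2 where l2: "l2 \<ge> 0" "\<forall>t\<in>{-1..1}. \<forall>p\<in>K. \<forall>q\<in>K. norm (B t p - B t q) \<le> l2 * dd p q"
    by (elim exE conjE)
  have "\<exists>\<Lambda>\<ge>0. \<forall>t\<in>{-1..1}. \<forall>p\<in>K. norm (B t p) \<le> \<Lambda>" by (rule bounded_global[OF lip_B])
  then obtain l3 where l3: "l3 \<ge> 0" "\<forall>t\<in>{-1..1}. \<forall>p\<in>K. norm (B t p) \<le> l3"
    by (elim exE conjE)
  obtain l4 where l4: "l4 \<ge> 0" "\<forall>t\<in>{-1..1::real}. \<forall>p\<in>K. \<forall>q\<in>K. norm (J p (F p) - J q (F q)) \<le> l4 * dd p q"
    using lipschitz_global[OF lip_vector_field[OF smooth_F]] by (elim exE conjE)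
  define \<Lambda> where "\<Lambda> = 1 + l1 + l2 + l3 + l4"
  have \<Lambda>: "1 \<le> \<Lambda>" "l1 \<le> \<Lambda>" "l2 \<le> \<Lambda>" "l3 \<le> \<Lambda>" "l4 \<le> \<Lambda>" using l1 l2 l3 l4 by (auto simp: \<Lambda>_def)
  have dd: "0 \<le> dd p q" for p q using gap_nonneg by (simp add: dd_def)
  have scale: "l * dd p q \<le> \<Lambda> * dd p q" if "l \<le> \<Lambda>" for l p q using that dd by (rule mult_right_mono)
  have "\<exists>C>0. \<exists>\<theta>. 0 < \<theta> \<and> \<theta> < 1 \<and> (\<forall>p\<in>K. \<forall>t\<ge>0.
        (\<forall>v\<in>Vs p. rnorm g (f t p) (push A (f t) p v) \<le> C * \<theta> powr t * rnorm g p v) \<and>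
        (\<forall>v\<in>Vu p. rnorm g (f (- t) p) (push A (f (- t)) p v) \<le> C * \<theta> powr t * rnorm g p v))"
    using hyp unfolding hyperbolic_splitting_def by (elim conjE)
  then obtain C0 \<theta> where C0: "C0 > 0" "0 < \<theta>" "\<theta> < 1"
    and dec: "\<forall>p\<in>K. \<forall>t\<ge>0.
        (\<forall>v\<in>Vs p. rnorm g (f t p) (push A (f t) p v) \<le> C0 * \<theta> powr t * rnorm g p v) \<and>
        (\<forall>v\<in>Vu p. rnorm g (f (- t) p) (push A (f (- t)) p v) \<le> C0 * \<theta> powr t * rnorm g p v)"
    by (elim exE conjE)
  have dec_s: "rnorm g (f t p) (push A (f t) p v) \<le> C0 * \<theta> powr t * rnorm g p v" if "p \<in> K" "0 \<le> t" "v \<in> Vs p" for p t v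
    using dec that by simp
  have dec_u: "rnorm g (f (- t) p) (push A (f (- t)) p v) \<le> C0 * \<theta> powr t * rnorm g p v" if "p \<in> K" "0 \<le> t" "v \<in> Vu p" for p t v
    using dec that by simp
  define \<kappa> where "\<kappa> = - ln \<theta>"
  have \<kappa>: "\<kappa> > 0" using C0 by (simp add: \<kappa>_def)
  have pw: "\<theta> powr t = exp (- \<kappa> * t)" for t using C0 by (simp add: powr_def \<kappa>_def mult.commute)
  obtain cJ where cJ: "cJ \<ge> 0" "\<forall>p\<in>K. \<forall>v. norm (J p v) \<le> cJ * rnorm g p v" using rnorm_J by (elim exE conjE)
  obtain cR where cR: "cR \<ge> 0" "\<forall>p\<in>K. \<forall>v. rnorm g p v \<le> cR * norm (J p v)" using J_rnorm by (elim exE conjE)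
  have "\<exists>M\<ge>0. \<forall>p\<in>K. norm (Q PS p) \<le> M" by (rule K_bound[OF continuous_Q[OF cont_P(1) linear_P(1)]])
  then obtain Ms where Ms: "Ms \<ge> 0" "\<forall>p\<in>K. norm (Q PS p) \<le> Ms"
    by (elim exE conjE)
  have "\<exists>M\<ge>0. \<forall>p\<in>K. norm (Q PU p) \<le> M" by (rule K_bound[OF continuous_Q[OF cont_P(2) linear_P(2)]])
  then obtain Mu where Mu: "Mu \<ge> 0" "\<forall>p\<in>K. norm (Q PU p) \<le> Mu"
    by (elim exE conjE)
  have "\<exists>M\<ge>0. \<forall>p\<in>K. norm (Q PC p) \<le> M" by (rule K_bound[OF continuous_Q[OF cont_P(3) linear_P(3)]])
  then obtain Mc where Mc: "Mc \<ge> 0" "\<forall>p\<in>K. norm (Q PC p) \<le> Mc"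
    by (elim exE conjE)
  obtain MF where MF: "MF \<ge> 0" "\<forall>p\<in>K. norm (Fh p) \<le> MF" using K_bound[OF cont_Fh] by (elim exE conjE)
  have "\<exists>m>0. \<forall>p\<in>K. m \<le> norm (Fh p)" by (rule K_lower_bound[OF cont_Fh Fh_nonzero])
  then obtain mF where mF: "mF > 0" "\<forall>p\<in>K. mF \<le> norm (Fh p)" by (elim exE conjE)
  \<comment> \<open>The first two summands bound the decay after passing from the embedded to the
    Riemannian norm and back. The third bounds the coefficient of \<open>Fh\<close> in the center
    component, the fourth that component for all times, because the flow carries \<open>Fh\<close>
    to \<open>Fh\<close>.\<close>
  define C where "C = cJ * C0 * cR * Ms + cJ * C0 * cR * Mu + Mc / mF + Mc / mF * MF"
  have nn: "0 \<le> cJ * C0 * cR * Ms" "0 \<le> cJ * C0 * cR * Mu" "0 \<le> Mc / mF" "0 \<le> Mc / mF * MF"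
    using cJ cR Ms Mu Mc MF mF C0 by auto
  have C: "0 \<le> C" "cJ * C0 * cR * Ms \<le> C" "cJ * C0 * cR * Mu \<le> C" "Mc / mF \<le> C" "Mc / mF * MF \<le> C"
    using nn by (auto simp: C_def)
  have decay: "norm (B s p o\<^sub>L Q P p) \<le> C * exp (- \<kappa> * t)"
    if p: "p \<in> K" and M: "\<forall>p\<in>K. norm (Q P p) \<le> M" "M \<ge> 0" "cJ * C0 * cR * M \<le> C" and lin: "linear (P p)"
      and le: "\<And>w. rnorm g (f s p) (push A (f s) p (P p w)) \<le> C0 * \<theta> powr t * rnorm g p (P p w)" for P M s t p
  proof (rule norm_blinfun_bound)
    fix w
    let ?v = "P p (L p w)"
    have "norm ((B s p o\<^sub>L Q P p) w) = norm (J (f s p) (push A (f s) p ?v))" by (simp add: Q_apply lin B_J p)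
    also have "\<dots> \<le> cJ * rnorm g (f s p) (push A (f s) p ?v)" using cJ fK[OF p] by blast
    also have "\<dots> \<le> cJ * (C0 * exp (- \<kappa> * t) * rnorm g p ?v)" using le cJ(1) unfolding pw by (intro mult_left_mono)
    also have "\<dots> \<le> cJ * (C0 * exp (- \<kappa> * t) * (cR * (M * norm w)))"
    proof (intro mult_left_mono)
      have "norm (J p ?v) = norm (Q P p w)" by (simp add: Q_apply lin)
      also have "\<dots> \<le> M * norm w" using M(1) p by (intro order_trans[OF norm_blinfun] mult_right_mono) auto
      finally have "cR * norm (J p ?v) \<le> cR * (M * norm w)" using cR(1) by (rule mult_left_mono)
      moreover have "rnorm g p ?v \<le> cR * norm (J p ?v)" using cR(2) p by blast
      ultimately show "rnorm g p ?v \<le> cR * (M * norm w)" by linarith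
    qed (use C0 cJ in auto)
    also have "\<dots> = (cJ * C0 * cR * M) * (exp (- \<kappa> * t) * norm w)" by (simp add: mult_ac)
    also have "\<dots> \<le> C * (exp (- \<kappa> * t) * norm w)" using M(3) by (intro mult_right_mono) auto
    finally show "norm ((B s p o\<^sub>L Q P p) w) \<le> C * exp (- \<kappa> * t) * norm w" by (simp add: mult_ac)
  qed (use C in auto)
  have center: "\<exists>k. \<bar>k\<bar> \<le> Mc / mF * norm w \<and> Q PC p w = k *\<^sub>R Fh p" if p: "p \<in> K" for p w
  proof -
    obtain k where k: "PC p (L p w) = k *\<^sub>R F p" using P_in(3)[OF p, of "L p w"] unfolding span_singleton by auto
    have Qw: "Q PC p w = k *\<^sub>R Fh p" by (simp add: Q_apply linear_P p k Fh_def blinfun.scaleR_right)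
    have "\<bar>k\<bar> * mF \<le> \<bar>k\<bar> * norm (Fh p)" using mF p by (intro mult_left_mono) auto
    also have "\<dots> = norm (Q PC p w)" by (simp add: Qw)
    also have "\<dots> \<le> Mc * norm w" using Mc p by (intro order_trans[OF norm_blinfun] mult_right_mono) auto
    finally have "\<bar>k\<bar> \<le> Mc / mF * norm w" using mF(1) by (simp add: field_simps)
    with Qw show ?thesis by blast
  qed
  have "hyperbolic_cocycle K dd f B (Q PS) (Q PU) (Q PC) Fh \<Lambda> C \<kappa>"
  proof
    show "0 \<le> dd p q \<and> dd p q \<le> 1" for p q using dd by (simp add: dd_def)
    show "dd p p = 0" for p by (simp add: dd_def gap_def)
    show "continuous_on (K \<times> K) (\<lambda>(p, q). dd p q)" by (rule cont_dd)
    show "f t p \<in> K" if "p \<in> K" for p t by (rule fK[OF that])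
    show "f (s + t) p = f s (f t p)" for p s t by (rule flow_add)
    show "f 0 p = p" for p by (rule flow_0)
    show "continuous_on (UNIV \<times> K) (\<lambda>(t, p). f t p)" by (rule continuous_on_subset[OF flow_cont]) auto
    show "continuous_on (UNIV \<times> K) (\<lambda>(t, p). B t p)" by (rule locally_lipschitz_continuous_on[OF lip_B])
    show "1 \<le> \<Lambda>" "0 \<le> C" "0 < \<kappa>" by (rule \<Lambda> C \<kappa>)+
    fix p assume p: "p \<in> K"
    show "norm (B t p) \<le> \<Lambda>" if "\<bar>t\<bar> \<le> 1" for t
    proof -
      have "norm (B t p) \<le> l3" using l3 p that by (auto simp: abs_le_iff)
      then show ?thesis using \<Lambda> by linarith
    qed
    show "B (s + t) p = B s (f t p) o\<^sub>L B t p" for s t by (rule B_cocycle[OF p])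
    show "B t p o\<^sub>L Q PS p = Q PS (f t p) o\<^sub>L B t p" "B t p o\<^sub>L Q PU p = Q PU (f t p) o\<^sub>L B t p" for t
      by (intro B_Q p linear_P fK push_P)+
    show "B 0 p = Q PS p + Q PU p + Q PC p"
    proof (rule blinfun_eqI)
      fix w
      have "(Q PS p + Q PU p + Q PC p) w = J p (PS p (L p w) + PU p (L p w) + PC p (L p w))"
        by (simp add: blinfun.bilinear_simps Q_apply linear_P p)
      also have "\<dots> = J p (L p w)" by (simp only: P_sum[OF p])
      finally show "B 0 p w = (Q PS p + Q PU p + Q PC p) w" by (simp add: B_apply push_0 flow_0)
    qed
    show "Q PS p o\<^sub>L Q PS p = Q PS p" "Q PU p o\<^sub>L Q PU p = Q PU p" "Q PC p o\<^sub>L Q PC p = Q PC p"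
      "Q PS p o\<^sub>L Q PU p = 0" "Q PS p o\<^sub>L Q PC p = 0" "Q PU p o\<^sub>L Q PS p = 0"
      "Q PU p o\<^sub>L Q PC p = 0" "Q PC p o\<^sub>L Q PS p = 0" "Q PC p o\<^sub>L Q PU p = 0"
      by (intro blinfun_eqI; simp add: Q_apply linear_P p L_J P_P blinfun.zero_right)+
    show "norm (B t p o\<^sub>L Q PS p) \<le> C * exp (- \<kappa> * t)" if "0 \<le> t" for t
      by (rule decay[OF p Ms(2,1) C(2) linear_P(1)[OF p] dec_s[OF p that P_in(1)[OF p]]])
    show "norm (B (- t) p o\<^sub>L Q PU p) \<le> C * exp (- \<kappa> * t)" if "0 \<le> t" for t
      by (rule decay[OF p Mu(2,1) C(3) linear_P(2)[OF p] dec_u[OF p that P_in(2)[OF p]]])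
    show "norm (B t p o\<^sub>L Q PC p) \<le> C" for t
    proof (rule norm_blinfun_bound)
      fix w
      obtain k where k: "\<bar>k\<bar> \<le> Mc / mF * norm w" "Q PC p w = k *\<^sub>R Fh p" using center[OF p] by blast
      have "norm ((B t p o\<^sub>L Q PC p) w) = \<bar>k\<bar> * norm (Fh (f t p))" by (simp add: k B_Fh p blinfun.scaleR_right)
      also have "\<dots> \<le> (Mc / mF * norm w) * MF" using k MF fK[OF p] nn by (intro mult_mono) auto
      also have "\<dots> = (Mc / mF * MF) * norm w" by simp
      also have "\<dots> \<le> C * norm w" using C(5) by (rule mult_right_mono) simp
      finally show "norm ((B t p o\<^sub>L Q PC p) w) \<le> C * norm w" .
    qed (rule C)
    show "\<exists>c. \<bar>c\<bar> \<le> C * norm w \<and> Q PC p w = c *\<^sub>R Fh p" for w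
    proof -
      obtain k where k: "\<bar>k\<bar> \<le> Mc / mF * norm w" "Q PC p w = k *\<^sub>R Fh p" using center[OF p] by blast
      then show ?thesis using mult_right_mono[OF C(4), of "norm w"] by (intro exI[of _ k]) auto
    qed
    show "Q PS p (Fh p) = 0" "Q PU p (Fh p) = 0"
      by (simp_all add: Q_apply linear_P p Fh_def L_J PS_F PU_F blinfun.zero_right)
    fix q assume q: "q \<in> K"
    show "dd (f t p) (f t q) \<le> \<Lambda> * dd p q" if "\<bar>t\<bar> \<le> 1" for t
    proof -
      have "dd (f t p) (f t q) \<le> l1 * dd p q" using l1 p q that by (auto simp: abs_le_iff)
      then show ?thesis using scale[OF \<Lambda>(2)] by (rule order_trans)
    qed
    show "norm (B t p - B t q) \<le> \<Lambda> * dd p q" if "\<bar>t\<bar> \<le> 1" for t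
    proof -
      have "norm (B t p - B t q) \<le> l2 * dd p q" using l2 p q that by (auto simp: abs_le_iff)
      then show ?thesis using scale[OF \<Lambda>(3)] by (rule order_trans)
    qed
    show "norm (Fh p - Fh q) \<le> \<Lambda> * dd p q"
    proof -
      have "norm (Fh p - Fh q) \<le> l4 * dd p q" using l4(2)[rule_format, of 0 p q] p q by (simp add: Fh_def)
      then show ?thesis using scale[OF \<Lambda>(5)] by (rule order_trans)
    qed
  qed
  then show ?thesis by (intro exI)
qed

end

section \<open>The Riemannian derivative of the flow field\<close>

lemma second_derivative_linear:
  fixes \<tau> :: "'a::euclidean_space \<Rightarrow> 'b::real_normed_vector"
  assumes \<tau>: "smooth_on S \<tau>" and S: "open S" and x: "x \<in> S"
  shows "frechet_derivative (\<lambda>z. frechet_derivative \<tau> (at z) w) (at x) u =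
    (\<Sum>b\<in>Basis. (w \<bullet> b) *\<^sub>R frechet_derivative (\<lambda>z. frechet_derivative \<tau> (at z) b) (at x) u)"
proof -
  have "((\<lambda>z. \<Sum>b\<in>Basis. (w \<bullet> b) *\<^sub>R frechet_derivative \<tau> (at z) b) has_derivative
      (\<lambda>u. \<Sum>b\<in>Basis. (w \<bullet> b) *\<^sub>R frechet_derivative (\<lambda>z. frechet_derivative \<tau> (at z) b) (at x) u)) (at x)"
    by (intro has_derivative_sum has_derivative_scaleR_right smooth_on_has_derivative[OF smooth_on_partial[OF \<tau>] x])
  then have "((\<lambda>z. frechet_derivative \<tau> (at z) w) has_derivative
      (\<lambda>u. \<Sum>b\<in>Basis. (w \<bullet> b) *\<^sub>R frechet_derivative (\<lambda>z. frechet_derivative \<tau> (at z) b) (at x) u)) (at x)"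
  proof (rule has_derivative_cong_open[OF S x, THEN iffD1, rotated])
    fix z assume "z \<in> S"
    then have "linear (frechet_derivative \<tau> (at z))"
      using smooth_on_differentiable[OF \<tau>] linear_frechet_derivative by blast
    then show "(\<Sum>b\<in>Basis. (w \<bullet> b) *\<^sub>R frechet_derivative \<tau> (at z) b) = frechet_derivative \<tau> (at z) w"
      by (rule linear_euclidean_sum[symmetric])
  qed
  from frechet_derivative_at_eqI[OF this] show ?thesis by simp
qed

text \<open>Both the linear map and its argument vary with \<open>z\<close>; expanding the argument
  over \<open>Basis\<close> leaves an ordinary product rule with two terms.\<close>

lemma derivative_apply_field:
  fixes \<tau> :: "'a::euclidean_space \<Rightarrow> 'b::real_normed_vector"
  assumes \<tau>: "smooth_on S \<tau>" and S: "open S" and x: "x \<in> S"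
    and P: "(P has_derivative P') (at x)"
  shows "((\<lambda>z. frechet_derivative \<tau> (at z) (P z)) has_derivative
     (\<lambda>u. frechet_derivative (\<lambda>z. frechet_derivative \<tau> (at z) (P x)) (at x) u + frechet_derivative \<tau> (at x) (P' u))) (at x)"
proof -
  have lin: "linear (frechet_derivative \<tau> (at z))" if "z \<in> S" for z
    using smooth_on_differentiable[OF \<tau> that] linear_frechet_derivative by blast
  let ?D = "\<lambda>b u. frechet_derivative (\<lambda>z. frechet_derivative \<tau> (at z) b) (at x) u"
  have "((\<lambda>z. \<Sum>b\<in>Basis. (P z \<bullet> b) *\<^sub>R frechet_derivative \<tau> (at z) b) has_derivative
      (\<lambda>u. \<Sum>b\<in>Basis. (P x \<bullet> b) *\<^sub>R ?D b u + (P' u \<bullet> b) *\<^sub>R frechet_derivative \<tau> (at x) b)) (at x)"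
    by (intro has_derivative_sum has_derivative_scaleR smooth_on_has_derivative[OF smooth_on_partial[OF \<tau>] x] has_derivative_inner_left P)
  moreover have "(\<Sum>b\<in>Basis. (P x \<bullet> b) *\<^sub>R ?D b u + (P' u \<bullet> b) *\<^sub>R frechet_derivative \<tau> (at x) b) =
      ?D (P x) u + frechet_derivative \<tau> (at x) (P' u)" for u
    unfolding sum.distrib second_derivative_linear[OF \<tau> S x, of "P x" u] linear_euclidean_sum[OF lin[OF x], of "P' u"] ..
  ultimately have "((\<lambda>z. \<Sum>b\<in>Basis. (P z \<bullet> b) *\<^sub>R frechet_derivative \<tau> (at z) b) has_derivative
      (\<lambda>u. ?D (P x) u + frechet_derivative \<tau> (at x) (P' u))) (at x)" by simp
  then show ?thesis
    by (rule has_derivative_cong_open[OF S x, THEN iffD1, rotated]) (rule linear_euclidean_sum[OF lin, symmetric])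
qed

text \<open>The base point and both arguments vary, hence three terms. Expanding the form over
  \<open>Basis\<close> reduces the claim to products of scalars; it is applied to the metric under a
  change of chart.\<close>

lemma derivative_bilinear_family:
  fixes G :: "'a::euclidean_space \<Rightarrow> 'e::euclidean_space \<Rightarrow> 'e \<Rightarrow> real" and \<sigma> :: "'c::real_normed_vector \<Rightarrow> 'a"
  assumes G: "\<And>u w. smooth_on S (\<lambda>y. G y u w)" and S: "open S" and bil: "\<And>y. y \<in> S \<Longrightarrow> bilinear (G y)"
    and \<sigma>: "(\<sigma> has_derivative \<sigma>') (at x)" and x: "\<sigma> x \<in> S" and nbhd: "open O'" "x \<in> O'" "\<And>z. z \<in> O' \<Longrightarrow> \<sigma> z \<in> S"
    and P: "(P has_derivative P') (at x)" and R: "(R has_derivative R') (at x)"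
  shows "((\<lambda>z. G (\<sigma> z) (P z) (R z)) has_derivative
     (\<lambda>u. frechet_derivative (\<lambda>y. G y (P x) (R x)) (at (\<sigma> x)) (\<sigma>' u) + G (\<sigma> x) (P' u) (R x) + G (\<sigma> x) (P x) (R' u))) (at x)"
proof -
  let ?D = "\<lambda>a b v. frechet_derivative (\<lambda>y. G y a b) (at (\<sigma> x)) v"
  have Gd: "((\<lambda>y. G y a b) has_derivative ?D a b) (at (\<sigma> x))" for a b
    by (rule smooth_on_has_derivative[OF G x])
  have D: "?D p r v = (\<Sum>i\<in>Basis. \<Sum>j\<in>Basis. (p \<bullet> i) * (r \<bullet> j) * ?D i j v)" for p r v
  proof -
    have "((\<lambda>y. \<Sum>i\<in>Basis. \<Sum>j\<in>Basis. ((p \<bullet> i) * (r \<bullet> j)) * G y i j) has_derivative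
       (\<lambda>v. \<Sum>i\<in>Basis. \<Sum>j\<in>Basis. ((p \<bullet> i) * (r \<bullet> j)) * ?D i j v)) (at (\<sigma> x))"
      by (intro has_derivative_sum has_derivative_mult_right Gd)
    then have "((\<lambda>y. G y p r) has_derivative (\<lambda>v. \<Sum>i\<in>Basis. \<Sum>j\<in>Basis. ((p \<bullet> i) * (r \<bullet> j)) * ?D i j v)) (at (\<sigma> x))"
      by (rule has_derivative_cong_open[OF S x, THEN iffD1, rotated]) (rule bilinear_quadratic_sum[OF bil, symmetric])
    from frechet_derivative_at_eqI[OF this] show ?thesis by simp
  qed
  have Gs: "((\<lambda>z. G (\<sigma> z) i j) has_derivative (\<lambda>u. ?D i j (\<sigma>' u))) (at x)" for i j
    using has_derivative_compose[OF \<sigma> Gd] .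
  have "((\<lambda>z. \<Sum>i\<in>Basis. \<Sum>j\<in>Basis. (P z \<bullet> i) * (R z \<bullet> j) * G (\<sigma> z) i j) has_derivative
     (\<lambda>u. \<Sum>i\<in>Basis. \<Sum>j\<in>Basis. ((P x \<bullet> i) * (R x \<bullet> j)) * ?D i j (\<sigma>' u) + ((P x \<bullet> i) * (R' u \<bullet> j) + (P' u \<bullet> i) * (R x \<bullet> j)) * G (\<sigma> x) i j)) (at x)"
    by (intro has_derivative_sum has_derivative_mult Gs has_derivative_inner_left P R)
  moreover have "(\<Sum>i\<in>Basis. \<Sum>j\<in>Basis. ((P x \<bullet> i) * (R x \<bullet> j)) * ?D i j (\<sigma>' u) + ((P x \<bullet> i) * (R' u \<bullet> j) + (P' u \<bullet> i) * (R x \<bullet> j)) * G (\<sigma> x) i j)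
     = ?D (P x) (R x) (\<sigma>' u) + G (\<sigma> x) (P' u) (R x) + G (\<sigma> x) (P x) (R' u)" for u
    unfolding D[of "P x" "R x"] bilinear_quadratic_sum[OF bil[OF x], of "P' u"] bilinear_quadratic_sum[OF bil[OF x], of "P x"]
    by (simp add: sum.distrib distrib_right)
  ultimately have "((\<lambda>z. \<Sum>i\<in>Basis. \<Sum>j\<in>Basis. (P z \<bullet> i) * (R z \<bullet> j) * G (\<sigma> z) i j) has_derivative
     (\<lambda>u. ?D (P x) (R x) (\<sigma>' u) + G (\<sigma> x) (P' u) (R x) + G (\<sigma> x) (P x) (R' u))) (at x)" by simp
  then show ?thesis
    by (rule has_derivative_cong_open[OF nbhd(1,2), THEN iffD1, rotated]) (rule bilinear_quadratic_sum[OF bil[OF nbhd(3)], symmetric])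
qed

text \<open>The vector that represents the functional \<open>h z\<close> in the Euclidean inner
  product, in other words the lowering of an index by \<open>h\<close>.\<close>

definition gram :: "('e::euclidean_space \<Rightarrow> 'e \<Rightarrow> real) \<Rightarrow> 'e \<Rightarrow> 'e" where
  "gram h z = (\<Sum>b\<in>Basis. h z b *\<^sub>R b)"

lemma linear_gram: "bilinear h \<Longrightarrow> linear (gram h)"
proof (rule linearI)
  assume h: "bilinear h"
  show "gram h (x + y) = gram h x + gram h y" for x y
    by (simp add: gram_def bilinear_ladd[OF h] scaleR_add_left sum.distrib)
  show "gram h (r *\<^sub>R x) = r *\<^sub>R gram h x" for r x
    by (simp add: gram_def bilinear_lmul[OF h] scaleR_sum_right)
qed

lemma gram_inner: "bilinear h \<Longrightarrow> gram h z \<bullet> y = h z y"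
proof -
  assume h: "bilinear h"
  then have "linear (h z)" unfolding bilinear_def by blast
  then show ?thesis
    unfolding gram_def inner_sum_left by (subst linear_euclidean_sum[of "h z" y]) (simp_all add: inner_commute mult.commute)
qed

text \<open>Positivity makes \<open>gram h\<close> injective, hence bijective in finite dimension.
  This justifies the definite description in the Koszul formula.\<close>

lemma riesz_unique:
  fixes h :: "'e::euclidean_space \<Rightarrow> 'e \<Rightarrow> real"
  assumes h: "bilinear h" and pos: "\<And>u. u \<noteq> 0 \<Longrightarrow> h u u > 0" and k: "linear k"
  shows "\<exists>!z. \<forall>y. h z y = k y"
proof -
  have inj: "inj (gram h)"
  proof (rule linear_injective_0[OF linear_gram[OF h], THEN iffD2], intro allI impI)
    fix x assume "gram h x = 0"
    then have "h x x = 0" using gram_inner[OF h, of x x] by simp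
    then show "x = 0" using pos[of x] by (cases "x = 0") auto
  qed
  then have "surj (gram h)" by (rule linear_inj_imp_surj[OF linear_gram[OF h]])
  then obtain z where z: "gram h z = (\<Sum>b\<in>Basis. k b *\<^sub>R b)" by (metis surjD)
  have "h z y = k y" for y
  proof -
    have "h z y = (\<Sum>b\<in>Basis. k b *\<^sub>R b) \<bullet> y" unfolding gram_inner[OF h, symmetric] z ..
    also have "\<dots> = k y"
      unfolding inner_sum_left by (subst linear_euclidean_sum[OF k, of y]) (simp add: inner_commute mult.commute)
    finally show ?thesis .
  qed
  moreover have "z' = z" if "\<forall>y. h z' y = k y" for z'
  proof -
    have "gram h z' = gram h z" unfolding gram_def using that calculation by simp
    then show ?thesis using inj by (rule injD[rotated])
  qed
  ultimately show ?thesis by (intro ex1I[of _ z]) auto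
qed

section \<open>Lipschitz dependence of solutions of linear equations\<close>

context smooth_flow
begin

lemma locally_lipschitzI:
  assumes c: "c \<in> A" "p \<in> cdom c"
    and est: "\<forall>\<^sub>F (t, x, y) in nhds (t0, p, p). norm (H x - H y) \<le> C * norm (cmap c x - cmap c y)"
  shows "locally_lipschitz t0 p (\<lambda>t. H)"
  unfolding locally_lipschitz_def
proof (intro conjI ballI impI)
  have "filterlim (\<lambda>(t, x). (t, x, p)) (nhds (t0, p, p)) (nhds (t0, p))"
    unfolding split_beta' by (intro tendsto_Pair tendsto_fst_nhds tendsto_snd_nhds tendsto_const)
  from eventually_compose_filterlim[OF est this]
  have 1: "\<forall>\<^sub>F (t, x) in nhds (t0, p). norm (H x - H p) \<le> C * norm (cmap c x - cmap c p)" by (simp add: split_beta')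
  have "((\<lambda>(t, x). cmap c x) \<longlongrightarrow> cmap c p) (nhds (t0, p))"
    unfolding split_beta' by (rule continuous_nhds_compose[OF open_cdom[OF c(1)] c(2) cont_cmap[OF c(1)] tendsto_snd_nhds])
  then have "((\<lambda>(t, x). C * norm (cmap c x - cmap c p)) \<longlongrightarrow> C * norm (cmap c p - cmap c p)) (nhds (t0, p))"
    unfolding split_beta' by (intro tendsto_intros)
  then have 2: "((\<lambda>(t, x). C * norm (cmap c x - cmap c p)) \<longlongrightarrow> 0) (nhds (t0, p))" by simp
  have "((\<lambda>(t, x). H x - H p) \<longlongrightarrow> 0) (nhds (t0, p))"
    by (rule Lim_null_comparison[OF _ 2]) (use 1 in eventually_elim, auto)
  then show "((\<lambda>(t, x). H x) \<longlongrightarrow> H p) (nhds (t0, p))" unfolding split_beta' by (rule LIM_zero_cancel)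
  fix d assume d: "d \<in> A" "p \<in> cdom d"
  obtain D where D: "D \<ge> 0" "\<forall>\<^sub>F (t, x, y) in nhds (t0, p, p). norm (cmap c x - cmap c y) \<le> D * norm (cmap d x - cmap d y)"
  proof -
    have cong: "locally_lipschitz t0 p (\<lambda>t x. (cmap c \<circ> cinv d) (cmap d x))"
      by (rule locally_lipschitz_smooth_static[OF smooth_transition[OF d(1) c(1)] open_overlap[OF d(1) c(1)] d]) (use c d in auto)
    have "locally_lipschitz t0 p (\<lambda>t. cmap c)"
      by (rule locally_lipschitz_cong[OF cong])
         (use eventually_snd_in[OF open_cdom[OF d(1)] d(2)] in eventually_elim, auto simp: cinv_cmap d(1))
    from locally_lipschitz_estimate[OF this d] show ?thesis using that by blast
  qed
  have "\<forall>\<^sub>F (t, x, y) in nhds (t0, p, p). norm (H x - H y) \<le> (\<bar>C\<bar> * D) * norm (cmap d x - cmap d y)"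
    using est D(2)
  proof eventually_elim
    case (elim z)
    obtain t x y where [simp]: "z = (t, x, y)" by (cases z) auto
    have "norm (H x - H y) \<le> C * norm (cmap c x - cmap c y)" using elim by simp
    also have "\<dots> \<le> \<bar>C\<bar> * norm (cmap c x - cmap c y)" by (intro mult_right_mono) auto
    also have "\<dots> \<le> \<bar>C\<bar> * (D * norm (cmap d x - cmap d y))" using elim by (intro mult_left_mono) auto
    finally show ?case by (simp add: mult.assoc)
  qed
  then show "\<exists>C. \<forall>\<^sub>F (t, x, y) in nhds (t0, p, p). norm (H x - H y) \<le> C * norm (cmap d x - cmap d y)" by (rule exI)
qed

text \<open>From \<open>M x (z x - z y) = (k x - k y) - (M x - M y) (z y)\<close> and the lower
  bound \<open>m\<close> on \<open>M x\<close>; no inverse operator has to be formed. The same lower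
  bound controls \<open>norm (z y)\<close> by \<open>a / m\<close>.\<close>

lemma locally_lipschitz_solution:
  fixes M :: "'m \<Rightarrow> 'b::real_normed_vector \<Rightarrow>\<^sub>L 'c::real_normed_vector" and z :: "'m \<Rightarrow> 'b" and k :: "'m \<Rightarrow> 'c"
  assumes M: "locally_lipschitz t0 p (\<lambda>t. M)" and k: "locally_lipschitz t0 p (\<lambda>t. k)"
    and m: "m > 0" and inv: "\<forall>\<^sub>F (t, x) in nhds (t0, p). M x (z x) = k x \<and> (\<forall>u. m * norm u \<le> norm (M x u))"
  shows "locally_lipschitz t0 p (\<lambda>t. z)"
proof -
  let ?c = "chart_at A p"
  note c = chart_at_in[of p] in_chart_at[of p]
  obtain C where C: "C \<ge> 0" "\<forall>\<^sub>F (t, x, y) in nhds (t0, p, p). norm (M x - M y) \<le> C * norm (cmap ?c x - cmap ?c y)"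
    using locally_lipschitz_estimate[OF M c] by blast
  obtain D where D: "D \<ge> 0" "\<forall>\<^sub>F (t, x, y) in nhds (t0, p, p). norm (k x - k y) \<le> D * norm (cmap ?c x - cmap ?c y)"
    using locally_lipschitz_estimate[OF k c] by blast
  define a where "a = norm (k p) + 1"
  have a: "a \<ge> 0" by (simp add: a_def)
  have "\<forall>\<^sub>F (t, x) in nhds (t0, p). norm (k x) \<le> a"
    using tendsto_eventually_bounded[OF locally_lipschitz_tendsto[OF k]] by eventually_elim (auto simp: a_def)
  note ka = eventually_left(2)[OF this]
  have "\<forall>\<^sub>F (t, x, y) in nhds (t0, p, p). norm (z x - z y) \<le> ((D + C * (a / m)) / m) * norm (cmap ?c x - cmap ?c y)"
    using C(2) D(2) ka eventually_left(1)[OF inv] eventually_left(2)[OF inv]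
  proof eventually_elim
    case (elim w)
    obtain t x y where [simp]: "w = (t, x, y)" by (cases w) auto
    let ?e = "norm (cmap ?c x - cmap ?c y)"
    have M: "\<forall>u. m * norm u \<le> norm (M x u)" "\<forall>u. m * norm u \<le> norm (M y u)" using elim by simp_all
    have E: "M x (z x) = k x" "M y (z y) = k y" "m * norm (z x - z y) \<le> norm (M x (z x - z y))"
      using elim M(1)[rule_format, of "z x - z y"] by simp_all
    have "m * norm (z y) \<le> a" using M(2)[rule_format, of "z y"] E(2) elim by simp
    then have zy: "norm (z y) \<le> a / m" using m by (simp add: field_simps)
    have "M x (z x - z y) = (k x - k y) - (M x - M y) (z y)" by (simp add: E blinfun.bilinear_simps)
    also have "norm \<dots> \<le> norm (k x - k y) + norm (M x - M y) * norm (z y)"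
      by (intro order_trans[OF norm_triangle_ineq4] add_left_mono norm_blinfun)
    also have "\<dots> \<le> D * ?e + (C * ?e) * (a / m)"
      using elim zy C(1) by (intro add_mono mult_mono) auto
    finally have "m * norm (z x - z y) \<le> D * ?e + (C * ?e) * (a / m)" using E(3) by linarith
    then show ?case using m by (simp add: field_simps)
  qed
  then show ?thesis by (rule locally_lipschitzI[OF c])
qed

end

section \<open>Christoffel symbols in any chart and the operator
  \<open>v -> nabla_v F\<close>\<close>

context riemannian_flow
begin

text \<open>Twice the Christoffel symbol of the first kind in the chart \<open>c\<close>.\<close>

definition koszul :: "('m, 'e) chart \<Rightarrow> 'e \<Rightarrow> 'e \<Rightarrow> 'e \<Rightarrow> 'e \<Rightarrow> real" where
  "koszul c x u w y =
     frechet_derivative (\<lambda>z. metric_coord A g c z w y) (at x) u +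
     frechet_derivative (\<lambda>z. metric_coord A g c z u y) (at x) w -
     frechet_derivative (\<lambda>z. metric_coord A g c z u w) (at x) y"

text \<open>The symbols are needed in a fixed chart around each point, since
  \<open>christoffel\<close> uses the chart chosen at the point and so need not vary
  continuously.\<close>

definition gamma :: "('m, 'e) chart \<Rightarrow> 'e \<Rightarrow> 'e \<Rightarrow> 'e \<Rightarrow> 'e" where
  "gamma c x u w = (THE z. \<forall>y. metric_coord A g c x z y = koszul c x u w y / 2)"

lemma christoffel_gamma: "christoffel A g p u w = gamma (chart_at A p) (cmap (chart_at A p) p) u w"
proof -
  have "metric_coord A g (chart_at A p) (cmap (chart_at A p) p) z y = g p z y" for z y
    unfolding metric_coord_def by (simp add: cinv_cmap chart_at_in in_chart_at from_chart_self)
  then show ?thesis unfolding christoffel_def gamma_def koszul_def Let_def by simp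
qed

lemma D_metric_sum:
  assumes c: "c \<in> A" and x: "x \<in> crange c"
  shows "frechet_derivative (\<lambda>z. metric_coord A g c z p r) (at x) v =
    (\<Sum>i\<in>Basis. \<Sum>j\<in>Basis. (p \<bullet> i) * (r \<bullet> j) * frechet_derivative (\<lambda>z. metric_coord A g c z i j) (at x) v)"
proof -
  have "((\<lambda>y. \<Sum>i\<in>Basis. \<Sum>j\<in>Basis. ((p \<bullet> i) * (r \<bullet> j)) * metric_coord A g c y i j) has_derivative
     (\<lambda>v. \<Sum>i\<in>Basis. \<Sum>j\<in>Basis. ((p \<bullet> i) * (r \<bullet> j)) * frechet_derivative (\<lambda>z. metric_coord A g c z i j) (at x) v)) (at x)"
    by (intro has_derivative_sum has_derivative_mult_right smooth_on_has_derivative[OF smooth_metric[OF c] x])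
  then have "((\<lambda>y. metric_coord A g c y p r) has_derivative
     (\<lambda>v. \<Sum>i\<in>Basis. \<Sum>j\<in>Basis. ((p \<bullet> i) * (r \<bullet> j)) * frechet_derivative (\<lambda>z. metric_coord A g c z i j) (at x) v)) (at x)"
    by (rule has_derivative_cong_open[OF open_crange[OF c] x, THEN iffD1, rotated])
       (rule bilinear_quadratic_sum[OF bilinear_metric_coord[OF c], symmetric])
  from frechet_derivative_at_eqI[OF this] show ?thesis by simp
qed

lemma linear_D_metric:
  assumes c: "c \<in> A" and x: "x \<in> crange c"
  shows "linear (\<lambda>p. frechet_derivative (\<lambda>z. metric_coord A g c z p r) (at x) v)"
    "linear (\<lambda>r. frechet_derivative (\<lambda>z. metric_coord A g c z p r) (at x) v)"
    "linear (\<lambda>v. frechet_derivative (\<lambda>z. metric_coord A g c z p r) (at x) v)"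
proof -
  show "linear (\<lambda>p. frechet_derivative (\<lambda>z. metric_coord A g c z p r) (at x) v)"
    "linear (\<lambda>r. frechet_derivative (\<lambda>z. metric_coord A g c z p r) (at x) v)"
    by (subst D_metric_sum[OF c x], rule linearI;
        simp add: inner_add_left algebra_simps sum.distrib sum_distrib_left)+
  show "linear (\<lambda>v. frechet_derivative (\<lambda>z. metric_coord A g c z p r) (at x) v)"
    using smooth_on_has_derivative[OF smooth_metric[OF c] x] has_derivative_linear by blast
qed

lemma linear_koszul:
  assumes "c \<in> A" "x \<in> crange c"
  shows "linear (koszul c x u w)" "linear (\<lambda>w. koszul c x u w y)"
  unfolding koszul_def[abs_def]
  by (intro linear_compose_add linear_compose_sub linear_D_metric[OF assms])+

lemma gamma:
  assumes c: "c \<in> A" "x \<in> crange c"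
  shows "metric_coord A g c x (gamma c x u w) y = koszul c x u w y / 2"
    and gamma_unique: "(\<And>y. metric_coord A g c x z y = koszul c x u w y / 2) \<Longrightarrow> gamma c x u w = z"
proof -
  have "linear (\<lambda>y. koszul c x u w y / 2)"
    using linear_compose_scale_right[OF linear_koszul(1)[OF c], of "1/2"] by simp
  from riesz_unique[OF bilinear_metric_coord[OF c] metric_coord_pos[OF c] this]
  have ex1: "\<exists>!z. \<forall>y. metric_coord A g c x z y = koszul c x u w y / 2" .
  from theI'[OF this] show "metric_coord A g c x (gamma c x u w) y = koszul c x u w y / 2"
    unfolding gamma_def by blast
  show "gamma c x u w = z" if "\<And>y. metric_coord A g c x z y = koszul c x u w y / 2"
    unfolding gamma_def by (rule the1_equality[OF ex1]) (use that in blast)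
qed

lemma linear_gamma:
  assumes c: "c \<in> A" "x \<in> crange c"
  shows "linear (gamma c x u)"
proof (rule linearI)
  note b = bilinear_metric_coord[OF c] and k = linear_koszul(2)[OF c]
  show "gamma c x u (w + w') = gamma c x u w + gamma c x u w'" for w w'
    by (rule gamma_unique[OF c]) (simp add: bilinear_ladd[OF b] gamma[OF c] linear_add[OF k] add_divide_distrib)
  show "gamma c x u (r *\<^sub>R w) = r *\<^sub>R gamma c x u w" for r w
    by (rule gamma_unique[OF c]) (simp add: bilinear_lmul[OF b] gamma[OF c] linear_scale[OF k])
qed

text \<open>The covariant derivative of \<open>F\<close> in direction \<open>v\<close>, in
  coordinates. It is tensorial in \<open>v\<close> and so yields an operator on each tangent space,
  in contrast to the derivative of \<open>v\<close> along \<open>F\<close>.\<close>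

definition nabla :: "('m, 'e) chart \<Rightarrow> 'e \<Rightarrow> 'e \<Rightarrow> 'e" where
  "nabla c x v = frechet_derivative (Fc c) (at x) v + gamma c x (Fc c x) v"

lemma linear_nabla:
  assumes c: "c \<in> A" "x \<in> crange c"
  shows "linear (nabla c x)"
  unfolding nabla_def[abs_def]
  by (intro linear_compose_add linear_gamma[OF c] linear_frechet_derivative smooth_on_differentiable[OF smooth_Fc[OF c(1)] c(2)])

text \<open>The derivative of \<open>F\<close> picks up the second derivative of the transition map
  at the pair of \<open>v\<close> and \<open>F\<close>, and the Christoffel symbol picks up minus
  that term with the arguments exchanged; symmetry of second derivatives cancels them.\<close>

lemma nabla_change_chart:
  assumes c: "c \<in> A" "p \<in> cdom c" and d: "d \<in> A" "p \<in> cdom d"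
  shows "nabla d (cmap d p) (tcd c d p v) = tcd c d p (nabla c (cmap c p) v)"
proof -
  let ?\<tau> = "cmap d \<circ> cinv c" and ?S = "cmap c ` (cdom c \<inter> cdom d)" and ?x = "cmap c p" and ?y = "cmap d p"
  let ?T = "tcd c d p"
  let ?D2 = "\<lambda>a b. frechet_derivative (\<lambda>z. frechet_derivative ?\<tau> (at z) b) (at ?x) a"
  have S: "open ?S" by (rule open_overlap[OF c(1) d(1)])
  have x: "?x \<in> ?S" using c d by blast
  have \<tau>: "smooth_on ?S ?\<tau>" by (rule smooth_transition[OF c(1) d(1)])
  have \<tau>x: "?\<tau> ?x = ?y" using c by (simp add: cinv_cmap)
  have T: "frechet_derivative ?\<tau> (at ?x) = ?T" by (simp add: tcd_def)
  have \<tau>d: "(?\<tau> has_derivative ?T) (at ?x)" by (rule tcd_has_derivative[OF c(1) d(1) c(2) d(2)])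
  have xc: "?x \<in> crange c" and yd: "?y \<in> crange d" using c d by (auto simp: cmap_in)
  have in_S: "\<exists>q. q \<in> cdom c \<and> q \<in> cdom d \<and> z = cmap c q" if "z \<in> ?S" for z using that by blast
  have linT: "linear ?T" by (rule linear_tcd[OF c(1) d(1) c(2) d(2)])
  have F_eq: "Fc d (?\<tau> z) = frechet_derivative ?\<tau> (at z) (Fc c z)" if z: "z \<in> ?S" for z
  proof -
    obtain q where q: "q \<in> cdom c" "q \<in> cdom d" "z = cmap c q" using in_S[OF z] by (elim exE conjE)
    show ?thesis using tcd_to_chart[OF c(1) q(1) d(1) q(2), of "F q"]
      by (simp add: q Fc_cmap c d cinv_cmap tcd_def)
  qed
  have FT: "Fc d ?y = ?T (Fc c ?x)" using F_eq[OF x] \<tau>x T by simp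
  \<comment> \<open>Both sides of \<open>F_eq\<close> are differentiated, and uniqueness of the
    derivative equates the results.\<close>
  have DF: "frechet_derivative (Fc d) (at ?y) (?T a) = ?D2 a (Fc c ?x) + ?T (frechet_derivative (Fc c) (at ?x) a)" for a
  proof -
    have "(Fc d has_derivative frechet_derivative (Fc d) (at ?y)) (at (?\<tau> ?x))"
      unfolding \<tau>x by (rule smooth_on_has_derivative[OF smooth_Fc[OF d(1)] yd])
    from diff_chain_at[OF \<tau>d this]
    have "((\<lambda>z. Fc d (?\<tau> z)) has_derivative (\<lambda>a. frechet_derivative (Fc d) (at ?y) (?T a))) (at ?x)"
      unfolding o_def .
    note 1 = this
    have "((\<lambda>z. frechet_derivative ?\<tau> (at z) (Fc c z)) has_derivative
        (\<lambda>a. ?D2 a (Fc c ?x) + frechet_derivative ?\<tau> (at ?x) (frechet_derivative (Fc c) (at ?x) a))) (at ?x)"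
      by (rule derivative_apply_field[OF \<tau> S x smooth_on_has_derivative[OF smooth_Fc[OF c(1)] xc]])
    then have 2: "((\<lambda>z. Fc d (?\<tau> z)) has_derivative
        (\<lambda>a. ?D2 a (Fc c ?x) + frechet_derivative ?\<tau> (at ?x) (frechet_derivative (Fc c) (at ?x) a))) (at ?x)"
      by (rule has_derivative_cong_open[OF S x, THEN iffD1, rotated]) (rule F_eq[symmetric])
    from fun_cong[OF has_derivative_unique[OF 1 2], of a] show ?thesis unfolding T .
  qed
  have G_eq: "metric_coord A g c z u w = metric_coord A g d (?\<tau> z) (frechet_derivative ?\<tau> (at z) u) (frechet_derivative ?\<tau> (at z) w)"
    if z: "z \<in> ?S" for z u w
  proof -
    obtain q where q: "q \<in> cdom c" "q \<in> cdom d" "z = cmap c q" using in_S[OF z] by (elim exE conjE)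
    have "from_chart A d q (frechet_derivative ?\<tau> (at z) u) = from_chart A c q u" for u
      using from_chart_tcd_comp[OF c(1) q(1) d(1) q(2), of u] by (simp add: q tcd_def)
    then show ?thesis unfolding metric_coord_def by (simp add: q cinv_cmap c d)
  qed
  have GT: "metric_coord A g c ?x u w = metric_coord A g d ?y (?T u) (?T w)" for u w
    using G_eq[OF x] \<tau>x T by simp
  have \<tau>S: "?\<tau> z \<in> crange d" if "z \<in> ?S" for z
    using in_S[OF that] c d by (auto simp: cinv_cmap cmap_in)
  have DG: "frechet_derivative (\<lambda>z. metric_coord A g c z b b') (at ?x) a =
      frechet_derivative (\<lambda>z. metric_coord A g d z (?T b) (?T b')) (at ?y) (?T a)
      + metric_coord A g d ?y (?D2 a b) (?T b') + metric_coord A g d ?y (?T b) (?D2 a b')" for a b b'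
  proof -
    have P: "((\<lambda>z. frechet_derivative ?\<tau> (at z) b) has_derivative (\<lambda>a. ?D2 a b)) (at ?x)" for b
      by (rule smooth_on_has_derivative[OF smooth_on_partial[OF \<tau>] x])
    have "((\<lambda>z. metric_coord A g d (?\<tau> z) (frechet_derivative ?\<tau> (at z) b) (frechet_derivative ?\<tau> (at z) b')) has_derivative
      (\<lambda>u. frechet_derivative (\<lambda>y. metric_coord A g d y (frechet_derivative ?\<tau> (at ?x) b) (frechet_derivative ?\<tau> (at ?x) b')) (at (?\<tau> ?x)) (?T u)
        + metric_coord A g d (?\<tau> ?x) (?D2 u b) (frechet_derivative ?\<tau> (at ?x) b') + metric_coord A g d (?\<tau> ?x) (frechet_derivative ?\<tau> (at ?x) b) (?D2 u b'))) (at ?x)"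
      by (rule derivative_bilinear_family[OF smooth_metric[OF d(1)] open_crange[OF d(1)] bilinear_metric_coord[OF d(1)] \<tau>d _ S x \<tau>S P P])
         (use \<tau>S[OF x] in simp_all)
    then have "((\<lambda>z. metric_coord A g c z b b') has_derivative
      (\<lambda>u. frechet_derivative (\<lambda>y. metric_coord A g d y (?T b) (?T b')) (at ?y) (?T u)
        + metric_coord A g d ?y (?D2 u b) (?T b') + metric_coord A g d ?y (?T b) (?D2 u b'))) (at ?x)"
      unfolding \<tau>x T by (rule has_derivative_cong_open[OF S x, THEN iffD1, rotated]) (rule G_eq[symmetric])
    from frechet_derivative_at_eqI[OF this] show ?thesis by simp
  qed
  have D2_sym: "?D2 a b = ?D2 b a" for a b by (rule second_derivative_symmetric[OF \<tau> S x])
  \<comment> \<open>Of the six second-order terms four cancel in pairs by symmetry; the two that are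
    paired with the image of \<open>y\<close> add up, hence the factor 2.\<close>
  have K: "koszul c ?x u w y = koszul d ?y (?T u) (?T w) (?T y) + 2 * metric_coord A g d ?y (?D2 u w) (?T y)" for u w y
    unfolding koszul_def DG
    using D2_sym[of y u] D2_sym[of y w] D2_sym[of w u]
      metric_coord_sym[of d ?y "?T w" "?D2 u y"] metric_coord_sym[of d ?y "?T u" "?D2 w y"] by simp
  have \<Gamma>: "gamma d ?y (?T u) (?T w) = ?T (gamma c ?x u w) - ?D2 u w" for u w
  proof (rule gamma_unique[OF d(1) yd])
    fix y'
    have "tcd d c p y' = tcd d c p y'" ..
    define y where "y = tcd d c p y'"
    have y': "y' = ?T y" unfolding y_def using tcd_comp[OF d(1) c(1) d(1) d(2) c(2) d(2)] tcd_self[OF d] by simp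
    have "metric_coord A g d ?y (?T (gamma c ?x u w) - ?D2 u w) y' =
       metric_coord A g c ?x (gamma c ?x u w) y - metric_coord A g d ?y (?D2 u w) (?T y)"
      unfolding y' GT by (rule bilinear_lsub[OF bilinear_metric_coord[OF d(1) yd]])
    also have "\<dots> = koszul d ?y (?T u) (?T w) y' / 2"
    proof -
      have "(a + 2 * b) / 2 - b = a / 2" for a b :: real by (simp add: add_divide_distrib)
      then show ?thesis unfolding gamma[OF c(1) xc] K y' .
    qed
    finally show "metric_coord A g d ?y (?T (gamma c ?x u w) - ?D2 u w) y' = koszul d ?y (?T u) (?T w) y' / 2" .
  qed
  show ?thesis
    unfolding nabla_def FT DF \<Gamma> linear_add[OF linT] using D2_sym[of v "Fc c ?x"] by simp
qed

definition nablaF :: "'m \<Rightarrow> 'e \<Rightarrow> 'e" where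
  "nablaF p v = nabla (chart_at A p) (cmap (chart_at A p) p) v"

lemma nablaF_christoffel:
  "nablaF p v = frechet_derivative (Fc (chart_at A p)) (at (cmap (chart_at A p) p)) v + christoffel A g p (F p) v"
  unfolding nablaF_def nabla_def christoffel_gamma by (simp add: Fc_cmap chart_at_in in_chart_at to_chart_self)

lemma nablaF_chart:
  assumes "c \<in> A" "p \<in> cdom c"
  shows "to_chart A c p (nablaF p v) = nabla c (cmap c p) (to_chart A c p v)"
  unfolding nablaF_def to_chart_tcd using nabla_change_chart[OF chart_at_in in_chart_at assms] by simp

lemma linear_nablaF: "linear (nablaF p)"
  unfolding nablaF_def[abs_def] by (intro linear_nabla chart_at_in cmap_in in_chart_at)

lemma lip_metric:
  assumes c: "c \<in> A" "p \<in> cdom c"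
  shows "locally_lipschitz t0 p (\<lambda>t q. metric_coord A g c (cmap c q) i j)"
    "locally_lipschitz t0 p (\<lambda>t q. frechet_derivative (\<lambda>z. metric_coord A g c z i j) (at (cmap c q)) a)"
  by (rule locally_lipschitz_smooth_static[OF _ open_crange[OF c(1)] c cmap_in[OF c]],
      intro smooth_on_partial smooth_metric c)+

lemma lip_Fc_component:
  assumes c: "c \<in> A" "p \<in> cdom c"
  shows "locally_lipschitz t0 p (\<lambda>t q. Fc c (cmap c q) \<bullet> i)"
  by (rule locally_lipschitz_smooth_static[OF _ open_crange[OF c(1)] c cmap_in[OF c]])
     (intro smooth_on_inner_left smooth_Fc open_crange c)

lemma locally_lipschitz_mult:
  fixes H J :: "real \<Rightarrow> 'm \<Rightarrow> real"
  shows "locally_lipschitz t0 p H \<Longrightarrow> locally_lipschitz t0 p J \<Longrightarrow> locally_lipschitz t0 p (\<lambda>t x. H t x * J t x)"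
  by (rule locally_lipschitz_bilinear[OF bounded_bilinear_mult])

lemma locally_lipschitz_uminus_real:
  "locally_lipschitz t0 p H \<Longrightarrow> locally_lipschitz t0 p (\<lambda>t x. - (H t x :: real))"
  using locally_lipschitz_mult[OF locally_lipschitz_const[of t0 p "-1"], of H] by simp

text \<open>The direction \<open>Fc\<close> varies with the point, so derivatives of the metric in
  that direction, and values on it, are expanded over \<open>Basis\<close> into terms with fixed
  vectors.\<close>

lemma lip_koszul:
  assumes c: "c \<in> A" "p \<in> cdom c"
  shows "locally_lipschitz t0 p (\<lambda>t q. koszul c (cmap c q) (Fc c (cmap c q)) b y)"
proof -
  let ?D = "\<lambda>q i j a. frechet_derivative (\<lambda>z. metric_coord A g c z i j) (at (cmap c q)) a"
  let ?F = "\<lambda>q. Fc c (cmap c q)"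
  show ?thesis
  proof (rule locally_lipschitz_cong)
    show "locally_lipschitz t0 p (\<lambda>t q. ((\<Sum>i\<in>Basis. (?F q \<bullet> i) * ?D q b y i) + (\<Sum>i\<in>Basis. (?F q \<bullet> i) * ?D q i y b))
        + - (\<Sum>i\<in>Basis. (?F q \<bullet> i) * ?D q i b y))"
      by (rule locally_lipschitz_add, rule locally_lipschitz_add,
          (rule locally_lipschitz_sum, rule locally_lipschitz_mult[OF lip_Fc_component[OF c] lip_metric(2)[OF c]])+,
          rule locally_lipschitz_uminus_real, rule locally_lipschitz_sum,
          rule locally_lipschitz_mult[OF lip_Fc_component[OF c] lip_metric(2)[OF c]])
    show "\<forall>\<^sub>F (t, q) in nhds (t0, p). ((\<Sum>i\<in>Basis. (?F q \<bullet> i) * ?D q b y i) + (\<Sum>i\<in>Basis. (?F q \<bullet> i) * ?D q i y b))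
        + - (\<Sum>i\<in>Basis. (?F q \<bullet> i) * ?D q i b y) = koszul c (cmap c q) (?F q) b y"
      using eventually_snd_in[OF open_cdom[OF c(1)] c(2), of t0]
    proof eventually_elim
      case (elim w)
      obtain t q where [simp]: "w = (t, q)" by (cases w) auto
      have q: "cmap c q \<in> crange c" using elim by (simp add: cmap_in c(1))
      note L = linear_D_metric[OF c(1) q]
      show ?case
        using linear_euclidean_sum[OF L(3)[of b y], of "?F q"] linear_euclidean_sum[OF L(1)[of y b], of "?F q"]
          linear_euclidean_sum[OF L(1)[of b y], of "?F q"]
        by (simp add: koszul_def)
    qed
  qed
qed

text \<open>The defining equation of \<open>gamma\<close> is a linear system with operator
  \<open>gram\<close> of the metric; positivity and the Cauchy-Schwarz inequality give the lower
  bound that \<open>locally_lipschitz_solution\<close> asks for.\<close>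

lemma lip_gamma:
  assumes c: "c \<in> A" "p \<in> cdom c"
  shows "locally_lipschitz t0 p (\<lambda>t q. gamma c (cmap c q) (Fc c (cmap c q)) b)"
proof -
  let ?G = "\<lambda>q. metric_coord A g c (cmap c q)"
  obtain m M where m: "m > 0" and ev: "\<forall>\<^sub>F x in nhds (cmap c p). x \<in> crange c \<and>
     (\<forall>u. m * (norm u)\<^sup>2 \<le> metric_coord A g c x u u \<and> metric_coord A g c x u u \<le> M * (norm u)\<^sup>2)"
    using metric_local_bounds[OF c(1) cmap_in[OF c]] by blast
  have lim: "((\<lambda>(t, q). cmap c q) \<longlongrightarrow> cmap c p) (nhds (t0, p))"
    unfolding split_beta' by (rule continuous_nhds_compose[OF open_cdom[OF c(1)] c(2) cont_cmap[OF c(1)] tendsto_snd_nhds])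
  have ev': "\<forall>\<^sub>F (t, q) in nhds (t0, p). cmap c q \<in> crange c \<and> (\<forall>u. m * (norm u)\<^sup>2 \<le> ?G q u u)"
    using eventually_compose_filterlim[OF ev lim] by eventually_elim auto
  have lin: "\<forall>\<^sub>F (t, q) in nhds (t0, p). linear (gram (?G q))"
    using ev' by eventually_elim (auto intro: linear_gram bilinear_metric_coord c)
  show ?thesis
  proof (rule locally_lipschitz_solution[OF _ _ m])
    show "locally_lipschitz t0 p (\<lambda>t q. Bl (gram (?G q)))"
    proof (rule locally_lipschitz_Bl[OF lin])
      show "locally_lipschitz t0 p (\<lambda>t q. gram (?G q) i)" for i
        unfolding gram_def
        by (rule locally_lipschitz_sum, rule locally_lipschitz_scaleR[OF lip_metric(1)[OF c] locally_lipschitz_const])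
    qed
    show "locally_lipschitz t0 p (\<lambda>t q. \<Sum>j\<in>Basis. (koszul c (cmap c q) (Fc c (cmap c q)) b j * (1/2)) *\<^sub>R j)"
      by (rule locally_lipschitz_sum, rule locally_lipschitz_scaleR[OF locally_lipschitz_mult[OF lip_koszul[OF c] locally_lipschitz_const] locally_lipschitz_const])
    show "\<forall>\<^sub>F (t, q) in nhds (t0, p). Bl (gram (?G q)) (gamma c (cmap c q) (Fc c (cmap c q)) b) =
       (\<Sum>j\<in>Basis. (koszul c (cmap c q) (Fc c (cmap c q)) b j * (1/2)) *\<^sub>R j) \<and> (\<forall>u. m * norm u \<le> norm (Bl (gram (?G q)) u))"
      using ev'
    proof eventually_elim
      case (elim w)
      obtain t q where [simp]: "w = (t, q)" by (cases w) auto
      have q: "cmap c q \<in> crange c" and pd: "\<And>u. m * (norm u)\<^sup>2 \<le> ?G q u u" using elim by auto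
      note bil = bilinear_metric_coord[OF c(1) q]
      have "m * norm u \<le> norm (gram (?G q) u)" for u
      proof (cases "u = 0")
        case False
        have "m * norm u * norm u \<le> gram (?G q) u \<bullet> u" using pd[of u] by (simp add: gram_inner[OF bil] power2_eq_square)
        also have "\<dots> \<le> norm (gram (?G q) u) * norm u" by (rule norm_cauchy_schwarz)
        finally show ?thesis using False by simp
      qed simp
      then show ?case by (simp add: Bl_apply linear_gram[OF bil]) (simp add: gram_def gamma[OF c(1) q])
    qed
  qed
qed

lemma lip_nabla:
  assumes c: "c \<in> A" "p \<in> cdom c"
  shows "locally_lipschitz t0 p (\<lambda>t q. Bl (nabla c (cmap c q)))"
proof (rule locally_lipschitz_Bl)
  show "\<forall>\<^sub>F (t, q) in nhds (t0, p). linear (nabla c (cmap c q))"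
    using eventually_snd_in[OF open_cdom[OF c(1)] c(2), of t0] by eventually_elim (auto intro: linear_nabla cmap_in c)
  show "locally_lipschitz t0 p (\<lambda>t q. nabla c (cmap c q) b)" for b
    unfolding nabla_def
    by (rule locally_lipschitz_add[OF locally_lipschitz_smooth_static[OF smooth_on_partial[OF smooth_Fc[OF c(1)]] open_crange[OF c(1)] c cmap_in[OF c]] lip_gamma[OF c]])
qed

end

context hyperbolic_cover
begin

lemma lip_nabla_operator:
  assumes p: "p \<in> K"
  shows "locally_lipschitz t0 p (\<lambda>t q. J q o\<^sub>L Bl (nablaF q) o\<^sub>L L q)"
proof -
  let ?c = "chart_at A p"
  note c = chart_at_in[of p] in_chart_at[of p]
  show ?thesis
  proof (rule locally_lipschitz_cong)
    show "locally_lipschitz t0 p (\<lambda>t q. Jc ?c q o\<^sub>L Bl (nabla ?c (cmap ?c q)) o\<^sub>L Lc ?c q)"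
      by (rule locally_lipschitz_compose[OF locally_lipschitz_compose[OF lip_Jc[OF c] lip_nabla[OF c]] lip_Lc[OF c p]])
    show "\<forall>\<^sub>F (t, q) in nhds (t0, p). Jc ?c q o\<^sub>L Bl (nabla ?c (cmap ?c q)) o\<^sub>L Lc ?c q = J q o\<^sub>L Bl (nablaF q) o\<^sub>L L q"
      using eventually_snd_in[OF open_cdom[OF c(1)] c(2), of t0]
    proof eventually_elim
      case (elim w)
      obtain t q where [simp]: "w = (t, q)" by (cases w) auto
      have q: "q \<in> cdom ?c" using elim by simp
      show ?case
        using J_chart[OF c(1) q] L_chart[OF c(1) q] nablaF_chart[OF c(1) q] linear_nabla[OF c(1) cmap_in[OF c(1) q]]
        by (auto intro!: blinfun_eqI simp: Bl_apply linear_nablaF)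
    qed
  qed
qed

text \<open>Tensoriality in \<open>v\<close> pays off here: a Lipschitz family of operators over
  \<open>K\<close> is applied to a Hoelder section.\<close>

lemma holder_nabla:
  assumes v: "holder_on K dd (\<lambda>p. J p (v p))" and dist: "distance_on K dd"
  shows "holder_on K dd (\<lambda>p. J p (nablaF p (v p)))"
proof -
  interpret distance_on K dd by fact
  let ?N = "\<lambda>q. J q o\<^sub>L Bl (nablaF q) o\<^sub>L L q"
  have "\<exists>\<Lambda>\<ge>0. \<forall>t\<in>{-1..1::real}. \<forall>p\<in>K. \<forall>q\<in>K. norm (?N p - ?N q) \<le> \<Lambda> * dd p q"
    by (rule lipschitz_global[OF lip_nabla_operator])
  then obtain l where l: "\<forall>t\<in>{-1..1::real}. \<forall>p\<in>K. \<forall>q\<in>K. norm (?N p - ?N q) \<le> l * dd p q" by (elim exE conjE)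
  have "holder_on K dd ?N"
    by (rule holder_on_lipschitz[of _ l]) (use l[rule_format, of 0] in simp)
  from holder_on_bilinear[OF bounded_bilinear_blinfun_apply this v]
  show ?thesis by (rule holder_on_cong) (simp add: Bl_apply linear_nablaF L_J)
qed

end

section \<open>Hoelder vector fields and derivatives along the flow\<close>

text \<open>Neighbourhoods of a triple contain products; freezing the time leaves one neighbourhood
  of \<open>p\<close> for both points, the form in which \<open>hoelder_local\<close> is
  stated.\<close>

lemma eventually_nhds_square:
  fixes t0 :: "'t::topological_space" and p :: "'a::topological_space"
  assumes "\<forall>\<^sub>F (t, x, y) in nhds (t0, p, p). P t x y"
  shows "\<exists>N. open N \<and> p \<in> N \<and> (\<forall>x\<in>N. \<forall>y\<in>N. P t0 x y)"
proof -
  obtain S where S: "open S" "(t0, p, p) \<in> S" "\<forall>z\<in>S. case z of (t, x, y) \<Rightarrow> P t x y"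
    using assms unfolding eventually_nhds by (elim exE conjE)
  from open_prod_elim[OF S(1,2)] obtain T1 T2 where T: "open T2" "(t0, p, p) \<in> T1 \<times> T2" "T1 \<times> T2 \<subseteq> S" by metis
  have "(p, p) \<in> T2" using T(2) by simp
  from open_prod_elim[OF T(1) this] obtain N1 N2 where N: "open N1" "open N2" "(p, p) \<in> N1 \<times> N2" "N1 \<times> N2 \<subseteq> T2" by metis
  have "P t0 x y" if "x \<in> N1 \<inter> N2" "y \<in> N1 \<inter> N2" for x y
  proof -
    have "(x, y) \<in> T2" using that N(4) by auto
    then have "(t0, x, y) \<in> S" using T(2,3) by auto
    from S(3)[rule_format, OF this] show ?thesis by simp
  qed
  then show ?thesis using N by (intro exI[of _ "N1 \<inter> N2"]) auto
qed

context chart_cover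
begin

text \<open>The converse of \<open>chart_le_dd\<close>: each summand of \<open>gap\<close> is
  locally Lipschitz in the chart. It translates Hoelder bounds for \<open>dd\<close> into Hoelder
  bounds in charts.\<close>

lemma dd_le_chart:
  assumes c: "c \<in> A" "p \<in> cdom c"
  shows "\<exists>C\<ge>0. \<forall>\<^sub>F (t, x, y) in nhds (t0::real, p, p). dd x y \<le> C * norm (cmap c x - cmap c y)"
proof -
  have "\<forall>i\<in>{..<n}. \<exists>C. C \<ge> 0 \<and> (\<forall>\<^sub>F (t, x, y) in nhds (t0, p, p).
      \<bar>bump i x - bump i y\<bar> + norm (theta i x - theta i y) \<le> C * norm (cmap c x - cmap c y))"
  proof
    fix i assume "i \<in> {..<n}"
    then have i: "i < n" by simp
    obtain C where C: "C \<ge> 0" "\<forall>\<^sub>F (t, x, y) in nhds (t0, p, p). norm (bump i x - bump i y) \<le> C * norm (cmap c x - cmap c y)"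
      using locally_lipschitz_estimate[OF lip_bump[OF i] c] by blast
    obtain D where D: "D \<ge> 0" "\<forall>\<^sub>F (t, x, y) in nhds (t0, p, p). norm (theta i x - theta i y) \<le> D * norm (cmap c x - cmap c y)"
      using locally_lipschitz_estimate[OF lip_theta[OF i] c] by blast
    have "\<forall>\<^sub>F (t, x, y) in nhds (t0, p, p). \<bar>bump i x - bump i y\<bar> + norm (theta i x - theta i y) \<le> (C + D) * norm (cmap c x - cmap c y)"
      using C(2) D(2) by eventually_elim (auto simp: distrib_right)
    then show "\<exists>C. C \<ge> 0 \<and> (\<forall>\<^sub>F (t, x, y) in nhds (t0, p, p).
      \<bar>bump i x - bump i y\<bar> + norm (theta i x - theta i y) \<le> C * norm (cmap c x - cmap c y))"
      using C D by (intro exI[of _ "C + D"]) auto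
  qed
  from bchoice[OF this] obtain C where C: "\<forall>i\<in>{..<n}. C i \<ge> 0 \<and> (\<forall>\<^sub>F (t, x, y) in nhds (t0, p, p).
      \<bar>bump i x - bump i y\<bar> + norm (theta i x - theta i y) \<le> C i * norm (cmap c x - cmap c y))" by (rule exE)
  then have "\<forall>\<^sub>F z in nhds (t0, p, p). \<forall>i\<in>{..<n}. case z of (t, x, y) \<Rightarrow>
      \<bar>bump i x - bump i y\<bar> + norm (theta i x - theta i y) \<le> C i * norm (cmap c x - cmap c y)"
    by (intro eventually_ball_finite) auto
  then have "\<forall>\<^sub>F (t, x, y) in nhds (t0, p, p). dd x y \<le> (\<Sum>i<n. C i) * norm (cmap c x - cmap c y)"
  proof eventually_elim
    case (elim z)
    obtain t x y where [simp]: "z = (t, x, y)" by (cases z) auto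
    have "gap x y \<le> (\<Sum>i<n. C i * norm (cmap c x - cmap c y))"
      unfolding gap_def by (rule sum_mono) (use elim in simp)
    then show ?case by (simp add: dd_def sum_distrib_right min_le_iff_disj)
  qed
  moreover have "(\<Sum>i<n. C i) \<ge> 0" using C by (intro sum_nonneg) auto
  ultimately show ?thesis by blast
qed

text \<open>The operators \<open>M c\<close> read an embedded object in the chart \<open>c\<close>:
  they are \<open>Lc c\<close> for vector fields and the identity for functions. The exponent of
  \<open>h\<close> is kept, one for all charts, as the definition demands.\<close>

lemma hoelder_localI:
  fixes h :: "'m \<Rightarrow> 'b::real_normed_vector" and M :: "('m, 'e) chart \<Rightarrow> 'm \<Rightarrow> 'b \<Rightarrow>\<^sub>L 'c::real_normed_vector"
  assumes dist: "distance_on K dd" and h: "holder_on K dd h"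
    and M: "\<And>c p. c \<in> A \<Longrightarrow> p \<in> K \<inter> cdom c \<Longrightarrow> locally_lipschitz 0 p (\<lambda>t. M c)"
    and k: "\<And>c x. c \<in> A \<Longrightarrow> x \<in> K \<inter> cdom c \<Longrightarrow> k c x = M c x (h x)"
  shows "hoelder_local A K k"
proof -
  interpret distance_on K dd by fact
  obtain \<alpha> H where H: "0 < \<alpha>" "\<alpha> \<le> 1" "0 \<le> H" "\<And>p q. p \<in> K \<Longrightarrow> q \<in> K \<Longrightarrow> norm (h p - h q) \<le> H * dd p q powr \<alpha>"
    using h unfolding holder_on_def by blast
  obtain Mh where Mh: "Mh \<ge> 0" "\<And>p. p \<in> K \<Longrightarrow> norm (h p) \<le> Mh" using holder_on_bounded[OF h] by blast
  have "\<exists>N C. open N \<and> p \<in> N \<and> N \<subseteq> cdom c \<and>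
      (\<forall>x\<in>N \<inter> K. \<forall>y\<in>N \<inter> K. norm (k c x - k c y) \<le> C * norm (cmap c x - cmap c y) powr \<alpha>)"
    if c: "c \<in> A" and p: "p \<in> K \<inter> cdom c" for c p
  proof -
    have pc: "p \<in> cdom c" using p by simp
    note lM = M[OF c p]
    obtain C where C: "C \<ge> 0" "\<forall>\<^sub>F (t, x, y) in nhds (0::real, p, p). dd x y \<le> C * norm (cmap c x - cmap c y)"
      using dd_le_chart[OF c pc] by blast
    obtain D where D: "D \<ge> 0" "\<forall>\<^sub>F (t, x, y) in nhds (0::real, p, p). norm (M c x - M c y) \<le> D * norm (cmap c x - cmap c y)"
      using locally_lipschitz_estimate[OF lM c pc] by blast
    define m where "m = norm (M c p) + 1"
    have m: "m \<ge> 0" by (simp add: m_def)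
    have "\<forall>\<^sub>F (t, x) in nhds (0::real, p). norm (M c x) \<le> m"
      using tendsto_eventually_bounded[OF locally_lipschitz_tendsto[OF lM]] by eventually_elim (auto simp: m_def)
    note Mm = eventually_left(2)[OF this]
    have "((\<lambda>(t, x). cmap c x) \<longlongrightarrow> cmap c p) (nhds (0::real, p))"
      unfolding split_beta' by (rule continuous_nhds_compose[OF open_cdom[OF c] pc cont_cmap[OF c] tendsto_snd_nhds])
    then have "\<forall>\<^sub>F z in nhds (0::real, p). dist (case z of (t, x) \<Rightarrow> cmap c x) (cmap c p) < 1/2" by (rule tendstoD) simp
    \<comment> \<open>The radius 1/2 keeps the coordinate distance of two such points at most 1, so
      that it is bounded by its \<alpha>-th power.\<close>
    then have near: "\<forall>\<^sub>F (t, x) in nhds (0::real, p). dist (cmap c x) (cmap c p) < 1/2" by eventually_elim auto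
    have in_c: "\<forall>\<^sub>F (t, x) in nhds (0::real, p). x \<in> cdom c" by (rule eventually_snd_in[OF open_cdom[OF c] pc])
    have "\<forall>\<^sub>F (t, x, y) in nhds (0::real, p, p). x \<in> cdom c \<and> (x \<in> K \<longrightarrow> y \<in> K \<longrightarrow> y \<in> cdom c \<longrightarrow>
        norm (M c x (h x) - M c y (h y)) \<le> (D * Mh + m * (H * C powr \<alpha>)) * norm (cmap c x - cmap c y) powr \<alpha>)"
      using C(2) D(2) Mm eventually_left(1)[OF near] eventually_left(2)[OF near] eventually_left(1)[OF in_c]
    proof eventually_elim
      case (elim z)
      obtain t x y where [simp]: "z = (t, x, y)" by (cases z) auto
      let ?e = "norm (cmap c x - cmap c y)"
      have "?e \<le> dist (cmap c x) (cmap c p) + dist (cmap c y) (cmap c p)"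
        unfolding dist_norm[symmetric] by (rule dist_triangle2)
      also have "\<dots> \<le> 1" using elim by simp
      finally have e: "?e \<le> ?e powr \<alpha>" using powr_mono'[of \<alpha> 1 ?e] H by simp
      have "norm (M c x (h x) - M c y (h y)) \<le> (D * Mh + m * (H * C powr \<alpha>)) * ?e powr \<alpha>" if "x \<in> K" "y \<in> K"
      proof -
        have dxy: "dd x y powr \<alpha> \<le> C powr \<alpha> * ?e powr \<alpha>"
          unfolding powr_mult[symmetric] using elim H d_range[OF that] by (intro powr_mono2) auto
        have "M c x (h x) - M c y (h y) = (M c x - M c y) (h x) + M c y (h x - h y)" by (simp add: blinfun.bilinear_simps)
        also have "norm \<dots> \<le> norm (M c x - M c y) * norm (h x) + norm (M c y) * norm (h x - h y)"
          by (intro order_trans[OF norm_triangle_ineq] add_mono norm_blinfun)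
        also have "\<dots> \<le> (D * ?e powr \<alpha>) * Mh + m * (H * (C powr \<alpha> * ?e powr \<alpha>))"
        proof (intro add_mono mult_mono)
          show "norm (M c x - M c y) \<le> D * ?e powr \<alpha>" using elim mult_left_mono[OF e D(1)] by simp
          show "norm (h x - h y) \<le> H * (C powr \<alpha> * ?e powr \<alpha>)" using H(4)[OF that] mult_left_mono[OF dxy H(3)] by linarith
        qed (use elim Mh that D m in auto)
        finally show ?thesis by (simp add: algebra_simps)
      qed
      then show ?case using elim by simp
    qed
    from eventually_nhds_square[OF this] obtain N where N: "open N" "p \<in> N"
      "\<forall>x\<in>N. \<forall>y\<in>N. x \<in> cdom c \<and> (x \<in> K \<longrightarrow> y \<in> K \<longrightarrow> y \<in> cdom c \<longrightarrow>
        norm (M c x (h x) - M c y (h y)) \<le> (D * Mh + m * (H * C powr \<alpha>)) * norm (cmap c x - cmap c y) powr \<alpha>)"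
      by (elim exE conjE)
    have "N \<subseteq> cdom c" using N by blast
    moreover have "norm (k c x - k c y) \<le> (D * Mh + m * (H * C powr \<alpha>)) * norm (cmap c x - cmap c y) powr \<alpha>"
      if "x \<in> N \<inter> K" "y \<in> N \<inter> K" for x y
    proof -
      have xy: "x \<in> K \<inter> cdom c" "y \<in> K \<inter> cdom c" using that N(3) by auto
      then show ?thesis unfolding k[OF c xy(1)] k[OF c xy(2)] using that N(3) by simp
    qed
    ultimately show ?thesis using N by (intro exI[of _ N] exI[of _ "D * Mh + m * (H * C powr \<alpha>)"]) simp
  qed
  then show ?thesis unfolding hoelder_local_def using H by (intro exI[of _ \<alpha>]) simp
qed

lemma hoelder_funI:
  assumes dist: "distance_on K dd" and h: "holder_on K dd (h :: 'm \<Rightarrow> real)"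
  shows "hoelder_fun A K h"
  unfolding hoelder_fun_def
  by (rule hoelder_localI[OF dist h, where M="\<lambda>c x. id_blinfun"]) (auto simp: locally_lipschitz_const)

lemma hoelder_vfI:
  assumes dist: "distance_on K dd" and h: "holder_on K dd (\<lambda>p. J p (v p))"
  shows "hoelder_vf A K v"
  unfolding hoelder_vf_def
proof (rule hoelder_localI[OF dist h])
  show "locally_lipschitz 0 p (\<lambda>t. Lc c)" if "c \<in> A" "p \<in> K \<inter> cdom c" for c p using that by (intro lip_Lc) auto
  show "to_chart A c x (v x) = Lc c x (J x (v x))" if "c \<in> A" "x \<in> K \<inter> cdom c" for c x
    using L_chart[OF that(1), of x "J x (v x)"] L_J[of x "v x"] that by simp
qed

text \<open>For the other members of a shadowing class only chartwise Hoelder bounds are given;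
  continuity of their embedded form is all that the comparison of representatives needs.\<close>

lemma hoelder_local_tendsto:
  assumes k: "hoelder_local A K k" and c: "c \<in> A" and p: "p \<in> K" "p \<in> cdom c"
  shows "(k c \<longlongrightarrow> k c p) (at p within K)"
proof -
  obtain \<alpha> where \<alpha>: "0 < \<alpha>" and loc: "\<forall>c\<in>A. \<forall>p\<in>K \<inter> cdom c. \<exists>N C. open N \<and> p \<in> N \<and> N \<subseteq> cdom c \<and>
        (\<forall>x\<in>N \<inter> K. \<forall>y\<in>N \<inter> K. norm (k c x - k c y) \<le> C * norm (cmap c x - cmap c y) powr \<alpha>)"
    using k unfolding hoelder_local_def by (elim exE conjE)
  from loc[rule_format, OF c, of p] p obtain N C where N: "open N" "p \<in> N"
     "\<forall>x\<in>N \<inter> K. \<forall>y\<in>N \<inter> K. norm (k c x - k c y) \<le> C * norm (cmap c x - cmap c y) powr \<alpha>" by auto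
  have "(cmap c \<longlongrightarrow> cmap c p) (at p within K)"
    using isCont_cmap[OF c p(2)] unfolding isCont_def by (rule tendsto_within_subset) simp
  then have "((\<lambda>x. C * norm (cmap c x - cmap c p) powr \<alpha>) \<longlongrightarrow> C * norm (cmap c p - cmap c p) powr \<alpha>) (at p within K)"
    using \<alpha> by (intro tendsto_intros tendsto_powr2) auto
  then have lim: "((\<lambda>x. C * norm (cmap c x - cmap c p) powr \<alpha>) \<longlongrightarrow> 0) (at p within K)" using \<alpha> by simp
  have "\<forall>\<^sub>F x in at p within K. x \<in> N"
    using eventually_nhds_in_open[OF N(1,2)] by (auto simp: eventually_at_filter elim: eventually_mono)
  moreover have "\<forall>\<^sub>F x in at p within K. x \<in> K" by (simp add: eventually_at_filter)
  ultimately have "\<forall>\<^sub>F x in at p within K. norm (k c x - k c p) \<le> C * norm (cmap c x - cmap c p) powr \<alpha>"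
    by eventually_elim (use N p in simp)
  from Lim_null_comparison[OF this lim] show ?thesis by (simp add: LIM_zero_iff)
qed

lemma hoelder_fun_continuous:
  assumes "hoelder_fun A K h" shows "continuous_on K h"
  unfolding continuous_on_def
  using hoelder_local_tendsto[OF assms[unfolded hoelder_fun_def] chart_at_in _ in_chart_at] by blast

lemma hoelder_vf_continuous:
  assumes "hoelder_vf A K v" shows "continuous_on K (\<lambda>p. J p (v p))"
  unfolding continuous_on_def
proof
  fix p assume p: "p \<in> K"
  let ?c = "chart_at A p"
  note c = chart_at_in[of p] in_chart_at[of p]
  have 1: "((\<lambda>x. to_chart A ?c x (v x)) \<longlongrightarrow> to_chart A ?c p (v p)) (at p within K)"
    using hoelder_local_tendsto[OF assms[unfolded hoelder_vf_def] c(1) p c(2)] .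
  have 2: "(Jc ?c \<longlongrightarrow> Jc ?c p) (at p within K)"
    using locally_lipschitz_static_continuous[OF lip_Jc[OF c]] unfolding isCont_def by (rule tendsto_within_subset) simp
  have "((\<lambda>x. Jc ?c x (to_chart A ?c x (v x))) \<longlongrightarrow> Jc ?c p (to_chart A ?c p (v p))) (at p within K)"
    by (rule bounded_bilinear.tendsto[OF bounded_bilinear_blinfun_apply 2 1])
  moreover have "\<forall>\<^sub>F x in at p within K. x \<in> cdom ?c"
    using eventually_nhds_in_open[OF open_cdom[OF c(1)] c(2)] by (auto simp: eventually_at_filter elim: eventually_mono)
  then have "\<forall>\<^sub>F x in at p within K. Jc ?c x (to_chart A ?c x (v x)) = J x (v x)"
    by eventually_elim (simp add: J_chart[OF c(1)])
  ultimately have "((\<lambda>x. J x (v x)) \<longlongrightarrow> Jc ?c p (to_chart A ?c p (v p))) (at p within K)" by (rule Lim_transform_eventually)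
  then show "((\<lambda>x. J x (v x)) \<longlongrightarrow> J p (v p)) (at p within K)" by (simp add: J_chart[OF c])
qed

end

section \<open>Lie derivatives in coordinates and derivatives of observables along the flow\<close>

context smooth_flow
begin

text \<open>The curve in the fixed tangent space at \<open>p\<close> whose velocity at time 0 is the
  Lie derivative.\<close>

definition pulled :: "('m \<Rightarrow> 'e) \<Rightarrow> 'm \<Rightarrow> real \<Rightarrow> 'e" where
  "pulled v p t = push A (f (- t)) (f t p) (v (f t p))"

lemma lie_deriv_pulled: "lie_deriv A f v p = vector_derivative (pulled v p) (at 0)"
  unfolding lie_deriv_def pulled_def[abs_def] ..

lemma pulled_0: "pulled v p 0 = v p"
  unfolding pulled_def by (simp add: push_0 flow_0)

lemma push_pulled: "push A (f t) p (pulled v p t) = v (f t p)"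
proof -
  have "push A (f t) (f (- t) (f t p)) (push A (f (- t)) (f t p) (v (f t p))) = push A (f (t + - t)) (f t p) (v (f t p))"
    by (rule push_comp)
  then show ?thesis unfolding pulled_def by (simp add: flow_minus push_0)
qed

lemma fD_0: 
  assumes "c \<in> A" "p \<in> cdom c"
  shows "fD c c 0 p u = u"
  using push_flow[OF assms(1,1,2), of 0 "from_chart A c p u"] assms by (simp add: flow_0 push_0 to_from_chart)

lemma orbit_open: "c \<in> A \<Longrightarrow> open ((\<lambda>t. f t p) -` cdom c)"
proof -
  assume "c \<in> A"
  have "continuous_on UNIV (\<lambda>t. f t p)" by (intro continuous_intros)
  then show ?thesis using open_cdom[OF \<open>c \<in> A\<close>] by (blast intro: open_vimage)
qed

text \<open>In the chart at \<open>p\<close> the field along the orbit is the linearised flow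
  applied to \<open>pulled\<close>. The product rule adds to the Lie derivative the time derivative
  of the linearised flow, which at time 0 is the derivative of \<open>F\<close>.\<close>

lemma orbit_coord_derivative:
  assumes W: "(pulled v p has_vector_derivative W') (at 0)"
  shows "(orbit_coord A f v p has_vector_derivative
     W' + frechet_derivative (Fc (chart_at A p)) (at (cmap (chart_at A p) p)) (v p)) (at 0)"
proof -
  let ?c = "chart_at A p"
  note c = chart_at_in[of p] in_chart_at[of p]
  let ?DF = "frechet_derivative (Fc ?c) (at (cmap ?c p))"
  have lin: "linear ?DF"
    using smooth_on_differentiable[OF smooth_Fc[OF c(1)] cmap_in[OF c]] linear_frechet_derivative by blast
  have comp: "((\<lambda>t. pulled v p t \<bullet> b) has_real_derivative W' \<bullet> b) (at 0)" for b
    using bounded_linear.has_vector_derivative[OF bounded_linear_inner_left W]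
    by (simp add: has_real_derivative_iff_has_vector_derivative)
  have "((\<lambda>t. \<Sum>b\<in>Basis. (pulled v p t \<bullet> b) *\<^sub>R fD ?c ?c t p b) has_vector_derivative
      (\<Sum>b\<in>Basis. (pulled v p 0 \<bullet> b) *\<^sub>R ?DF b + (W' \<bullet> b) *\<^sub>R fD ?c ?c 0 p b)) (at 0)"
    by (intro has_vector_derivative_sum has_vector_derivative_scaleR comp fD_has_derivative_at_0[OF c])
  moreover have "(\<Sum>b\<in>Basis. (pulled v p 0 \<bullet> b) *\<^sub>R ?DF b + (W' \<bullet> b) *\<^sub>R fD ?c ?c 0 p b) = W' + ?DF (v p)"
    unfolding sum.distrib pulled_0 fD_0[OF c] euclidean_representation linear_euclidean_sum[OF lin, of "v p"] by (rule add.commute)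
  ultimately have "((\<lambda>t. \<Sum>b\<in>Basis. (pulled v p t \<bullet> b) *\<^sub>R fD ?c ?c t p b) has_vector_derivative W' + ?DF (v p)) (at 0)" by simp
  then show ?thesis
  proof (rule has_vector_derivative_cong_open[OF orbit_open[OF c(1), of p], rotated 2])
    show "0 \<in> (\<lambda>t. f t p) -` cdom ?c" using c by (simp add: flow_0)
    fix t assume "t \<in> (\<lambda>t. f t p) -` cdom ?c"
    then have t: "f t p \<in> cdom ?c" by simp
    have "orbit_coord A f v p t = to_chart A ?c (f t p) (push A (f t) p (pulled v p t))"
      unfolding orbit_coord_def push_pulled ..
    also have "\<dots> = fD ?c ?c t p (pulled v p t)"
      unfolding push_flow[OF c(1) c(1) c(2) t] by (simp add: to_chart_self)
    finally have oc: "orbit_coord A f v p t = fD ?c ?c t p (pulled v p t)" .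
    show "(\<Sum>b\<in>Basis. (pulled v p t \<bullet> b) *\<^sub>R fD ?c ?c t p b) = orbit_coord A f v p t"
      unfolding oc by (rule linear_euclidean_sum[OF linear_fD[OF c(1) c(1) c(2) t], symmetric])
  qed
qed

text \<open>\<open>lie_deriv\<close> is a \<open>vector_derivative\<close>, which carries no
  information where no derivative exists. The carrier grants differentiability of
  \<open>orbit_coord\<close>, so for an arbitrary representative it has to be carried over to
  \<open>pulled\<close> by undoing the linearised flow.\<close>

lemma pulled_differentiable:
  assumes v: "orbit_coord A f v p differentiable (at 0)"
  shows "pulled v p differentiable (at 0)"
proof -
  let ?c = "chart_at A p"
  note c = chart_at_in[of p] in_chart_at[of p]
  let ?\<gamma> = "\<lambda>t. (- t, cmap ?c (f t p))"
  have \<gamma>: "?\<gamma> differentiable (at 0)"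
  proof -
    have "((\<lambda>s. cmap ?c (f s p)) has_vector_derivative Fc ?c (cmap ?c (f 0 p))) (at 0)"
      by (rule flow_in_chart[OF c(1)]) (use c in \<open>simp add: flow_0\<close>)
    then have "(\<lambda>s. cmap ?c (f s p)) differentiable (at 0)" unfolding has_vector_derivative_def differentiable_def by blast
    then show ?thesis by (intro differentiable_Pair) (auto intro: differentiable_minus)
  qed
  have g: "(\<lambda>t. fD ?c ?c (- t) (f t p) b) differentiable (at 0)" for b
  proof -
    have z: "?\<gamma> 0 \<in> fdom ?c ?c" using in_fdom[OF c, of 0 ?c] c by (simp add: flow_0)
    have "(\<lambda>z. frechet_derivative (fc ?c ?c) (at z) (0, b)) differentiable (at (?\<gamma> 0))"
      by (rule smooth_on_differentiable[OF smooth_on_partial[OF smooth_fc[OF c(1) c(1)]] z])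
    from differentiable_chain_at[OF \<gamma> this] show ?thesis unfolding fD_def o_def .
  qed
  have "(\<lambda>t. (orbit_coord A f v p t \<bullet> b) *\<^sub>R fD ?c ?c (- t) (f t p) b) differentiable (at 0)" for b
  proof -
    obtain v' where v': "(orbit_coord A f v p has_derivative v') (at 0)" using v unfolding differentiable_def by (rule exE)
    obtain g' where g': "((\<lambda>t. fD ?c ?c (- t) (f t p) b) has_derivative g') (at 0)" using g[of b] unfolding differentiable_def by (rule exE)
    show ?thesis unfolding differentiable_def
      by (rule exI, rule has_derivative_scaleR[OF has_derivative_inner_left[OF v'] g'])
  qed
  then have "(\<lambda>t. \<Sum>b\<in>Basis. (orbit_coord A f v p t \<bullet> b) *\<^sub>R fD ?c ?c (- t) (f t p) b) differentiable (at 0)"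
    by (intro differentiable_sum finite_Basis) simp
  then obtain D where D: "((\<lambda>t. \<Sum>b\<in>Basis. (orbit_coord A f v p t \<bullet> b) *\<^sub>R fD ?c ?c (- t) (f t p) b) has_derivative D) (at 0)"
    unfolding differentiable_def ..
  have "(pulled v p has_derivative D) (at 0)"
  proof (rule has_derivative_cong_open[OF orbit_open[OF c(1), of p], THEN iffD1, rotated 2, OF D])
    show "0 \<in> (\<lambda>t. f t p) -` cdom ?c" using c by (simp add: flow_0)
    fix t assume "t \<in> (\<lambda>t. f t p) -` cdom ?c"
    then have t: "f t p \<in> cdom ?c" by simp
    have t': "f (- t) (f t p) \<in> cdom ?c" using c by (simp add: flow_minus)
    have "to_chart A ?c (f (- t) (f t p)) (pulled v p t) = fD ?c ?c (- t) (f t p) (orbit_coord A f v p t)"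
      unfolding pulled_def orbit_coord_def by (rule push_flow[OF c(1) c(1) t t'])
    then have pl: "pulled v p t = fD ?c ?c (- t) (f t p) (orbit_coord A f v p t)" by (simp add: flow_minus to_chart_self)
    show "(\<Sum>b\<in>Basis. (orbit_coord A f v p t \<bullet> b) *\<^sub>R fD ?c ?c (- t) (f t p) b) = pulled v p t"
      unfolding pl by (rule linear_euclidean_sum[OF linear_fD[OF c(1) c(1) t t'], symmetric])
  qed
  then show ?thesis by (rule differentiableI)
qed

text \<open>The chain rule; it puts the response integrand into the form of a differential applied
  to a push-forward, which the cocycle can handle.\<close>

lemma dderiv_flow:
  assumes \<Phi>: "smooth_fun A \<Phi>"
  shows "dderiv A p u (\<Phi> \<circ> f t) = dderiv A (f t p) (push A (f t) p u) \<Phi>"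
proof -
  let ?c = "chart_at A p" and ?d = "chart_at A (f t p)"
  note c = chart_at_in[of p] in_chart_at[of p] and d = chart_at_in[of "f t p"] in_chart_at[of "f t p"]
  let ?D = "frechet_derivative (\<Phi> \<circ> cinv ?d) (at (cmap ?d (f t p)))"
  have \<Phi>d: "(\<Phi> \<circ> cinv ?d has_derivative ?D) (at (cmap ?d (f t p)))"
    using \<Phi> smooth_on_has_derivative[OF _ cmap_in[OF d]] d unfolding smooth_fun_def by blast
  have eq: "(cmap ?d \<circ> f t \<circ> cinv ?c) (cmap ?c p) = cmap ?d (f t p)" using c by (simp add: cinv_cmap)
  have U: "open (f t -` cdom ?d)" using continuous_on_flow_UNIV open_cdom[OF d(1)] open_vimage by blast
  from diff_chain_at[OF fc_has_derivative[OF c(1) d(1) c(2) d(2)], of "\<Phi> \<circ> cinv ?d" ?D] \<Phi>d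
  have "((\<Phi> \<circ> cinv ?d) \<circ> (cmap ?d \<circ> f t \<circ> cinv ?c) has_derivative ?D \<circ> fD ?c ?d t p) (at (cmap ?c p))"
    unfolding eq by blast
  then have "((\<Phi> \<circ> f t) \<circ> cinv ?c has_derivative ?D \<circ> fD ?c ?d t p) (at (cmap ?c p))"
    by (rule has_derivative_cong_open[OF open_chart_image[OF c(1) U], THEN iffD1, rotated 2])
       (use c d in \<open>auto simp: cinv_cmap\<close>)
  from dderiv_in_chart[OF c this] have "dderiv A p u (\<Phi> \<circ> f t) = ?D (fD ?c ?d t p (to_chart A ?c p u))" by simp
  also have "\<dots> = ?D (to_chart A ?d (f t p) (push A (f t) p u))" unfolding push_flow[OF c(1) d(1) c(2) d(2)] ..
  also have "\<dots> = dderiv A (f t p) (push A (f t) p u) \<Phi>" by (rule dderiv_in_chart[OF d \<Phi>d, symmetric])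
  finally show ?thesis .
qed

lemma dderiv_along_flow:
  assumes \<Phi>: "smooth_fun A \<Phi>"
  shows "((\<lambda>t. \<Phi> (f t p)) has_real_derivative dderiv A (f t p) (F (f t p)) \<Phi>) (at t)"
proof -
  let ?d = "chart_at A (f t p)"
  note d = chart_at_in[of "f t p"] in_chart_at[of "f t p"]
  let ?D = "frechet_derivative (\<Phi> \<circ> cinv ?d) (at (cmap ?d (f t p)))"
  have \<Phi>d: "(\<Phi> \<circ> cinv ?d has_derivative ?D) (at (cmap ?d (f t p)))"
    using \<Phi> smooth_on_has_derivative[OF _ cmap_in[OF d]] d unfolding smooth_fun_def by blast
  from vector_chain_at[OF flow_in_chart[OF d] \<Phi>d]
  have "((\<Phi> \<circ> cinv ?d) \<circ> (\<lambda>s. cmap ?d (f s p)) has_vector_derivative ?D (Fc ?d (cmap ?d (f t p)))) (at t)" .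
  then have "((\<lambda>t. \<Phi> (f t p)) has_vector_derivative ?D (Fc ?d (cmap ?d (f t p)))) (at t)"
    by (rule has_vector_derivative_cong_open[OF orbit_open[OF d(1), of p], rotated 2])
       (use d in \<open>auto simp: cinv_cmap\<close>)
  moreover have "?D (Fc ?d (cmap ?d (f t p))) = dderiv A (f t p) (F (f t p)) \<Phi>"
    unfolding Fc_cmap[OF d] by (rule dderiv_in_chart[OF d \<Phi>d, symmetric])
  ultimately show ?thesis by (simp add: has_real_derivative_iff_has_vector_derivative)
qed

lemma linear_dderiv:
  assumes \<Phi>: "smooth_fun A \<Phi>"
  shows "linear (\<lambda>u. dderiv A p u \<Phi>)"
proof -
  note d = chart_at_in[of p] in_chart_at[of p]
  have "\<Phi> \<circ> cinv (chart_at A p) differentiable (at (cmap (chart_at A p) p))"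
    using \<Phi> smooth_on_differentiable[OF _ cmap_in[OF d]] d unfolding smooth_fun_def by blast
  from linear_frechet_derivative[OF this] show ?thesis unfolding dderiv_def .
qed

end

context chart_cover
begin

lemma lip_dderiv:
  assumes \<Phi>: "smooth_fun A \<Phi>" and p: "p \<in> K"
  shows "locally_lipschitz t0 p (\<lambda>t q. Bl (\<lambda>u. dderiv A q u \<Phi>) o\<^sub>L L q)"
proof -
  let ?c = "chart_at A p"
  note c = chart_at_in[of p] in_chart_at[of p]
  let ?D = "\<lambda>q. frechet_derivative (\<Phi> \<circ> cinv ?c) (at (cmap ?c q))"
  have sm: "smooth_on (crange ?c) (\<Phi> \<circ> cinv ?c)" using \<Phi> c unfolding smooth_fun_def by blast
  have in_c: "\<forall>\<^sub>F (t, q) in nhds (t0, p). q \<in> cdom ?c" by (rule eventually_snd_in[OF open_cdom[OF c(1)] c(2)])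
  have lin: "linear (?D q)" if "q \<in> cdom ?c" for q
    using smooth_on_differentiable[OF sm cmap_in[OF c(1) that]] linear_frechet_derivative by blast
  show ?thesis
  proof (rule locally_lipschitz_cong)
    show "locally_lipschitz t0 p (\<lambda>t q. Bl (?D q) o\<^sub>L Lc ?c q)"
    proof (rule locally_lipschitz_compose[OF locally_lipschitz_Bl lip_Lc[OF c p]])
      show "\<forall>\<^sub>F (t, q) in nhds (t0, p). linear (?D q)" using in_c by eventually_elim (auto intro: lin)
      show "locally_lipschitz t0 p (\<lambda>t q. ?D q b)" for b
        by (rule locally_lipschitz_smooth_static[OF smooth_on_partial[OF sm] open_crange[OF c(1)] c cmap_in[OF c]])
    qed
    show "\<forall>\<^sub>F (t, q) in nhds (t0, p). Bl (?D q) o\<^sub>L Lc ?c q = Bl (\<lambda>u. dderiv A q u \<Phi>) o\<^sub>L L q"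
      using in_c
    proof eventually_elim
      case (elim w)
      obtain t q where [simp]: "w = (t, q)" by (cases w) auto
      have q: "q \<in> cdom ?c" using elim by simp
      have "?D q (Lc ?c q z) = dderiv A q (L q z) \<Phi>" for z
        unfolding L_chart[OF c(1) q, symmetric]
        by (rule dderiv_in_chart[OF c(1) q smooth_on_has_derivative[OF sm cmap_in[OF c(1) q]], symmetric])
      then show ?case by (auto intro!: blinfun_eqI simp: Bl_apply lin[OF q] linear_dderiv[OF \<Phi>])
    qed
  qed
qed

end

section \<open>The shadowing contribution\<close>

text \<open>Nonemptiness of the class is what makes the described number unique.\<close>

lemma pairing_eqI:
  assumes "s \<noteq> {}" "\<And>v \<eta>. (v, \<eta>) \<in> s \<Longrightarrow> avg \<rho> K (\<lambda>p. \<omega> p (v p)) - avg \<rho> K (\<lambda>p. \<eta> p * \<psi> p) = r"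
  shows "pairing \<rho> K s \<omega> \<psi> = r"
  unfolding pairing_def
proof (rule the_equality)
  show "\<forall>(v, \<eta>)\<in>s. r = avg \<rho> K (\<lambda>p. \<omega> p (v p)) - avg \<rho> K (\<lambda>p. \<eta> p * \<psi> p)"
    using assms(2) by auto
  fix r' assume r': "\<forall>(v, \<eta>)\<in>s. r' = avg \<rho> K (\<lambda>p. \<omega> p (v p)) - avg \<rho> K (\<lambda>p. \<eta> p * \<psi> p)"
  obtain v \<eta> where "(v, \<eta>) \<in> s" using assms(1) by auto
  then show "r' = r" using r' assms(2) by force
qed

text \<open>Pairs in the carrier are related exactly when their left-hand sides agree on
  \<open>K\<close>, so the class of one solution is the set of all solutions, and no other class
  solves the equation. Exhibiting a single solution therefore determines the operator.\<close>

lemma shadowing_op_eq: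
  assumes v: "(v, \<eta>) \<in> shadow_carrier A g F f K"
    and eq: "\<And>p. p \<in> K \<Longrightarrow> lie_deriv A f v p + \<eta> p *\<^sub>R F p = X p"
  shows "shadowing_op A g F f K X =
    {(v', \<eta>') \<in> shadow_carrier A g F f K. \<forall>p\<in>K. lie_deriv A f v' p + \<eta>' p *\<^sub>R F p = X p}"
proof -
  let ?R = "shadow_rel A g F f K" and ?C = "shadow_carrier A g F f K"
  let ?S = "{(v', \<eta>') \<in> ?C. \<forall>p\<in>K. lie_deriv A f v' p + \<eta>' p *\<^sub>R F p = X p}"
  have cls: "?R `` {(a, b)} = ?S"
    if "(a, b) \<in> ?C" "\<And>p. p \<in> K \<Longrightarrow> lie_deriv A f a p + b p *\<^sub>R F p = X p" for a b
    using that by (auto simp: shadow_rel_def)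
  show ?thesis
    unfolding shadowing_op_def
  proof (rule the_equality)
    have "?R `` {(v, \<eta>)} = ?S" by (rule cls[OF v eq])
    then have "?S \<in> ?C // ?R" using quotientI[OF v, of ?R] by (elim subst)
    then show "?S \<in> shadow_space A g F f K \<and> (\<forall>(v, \<eta>)\<in>?S. \<forall>p\<in>K. lie_deriv A f v p + \<eta> p *\<^sub>R F p = X p)"
      unfolding shadow_space_def by blast
    fix s assume s: "s \<in> shadow_space A g F f K \<and> (\<forall>(v, \<eta>)\<in>s. \<forall>p\<in>K. lie_deriv A f v p + \<eta> p *\<^sub>R F p = X p)"
    then obtain z where z: "z \<in> ?C" "s = ?R `` {z}" unfolding shadow_space_def by (blast elim: quotientE)
    obtain a b where ab: "z = (a, b)" by (cases z) auto
    have "(a, b) \<in> s" using z by (auto simp: ab shadow_rel_def)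
    then have "lie_deriv A f a p + b p *\<^sub>R F p = X p" if "p \<in> K" for p using s that by fastforce
    then show "s = ?S" using cls[of a b] z unfolding ab by blast
  qed
qed

lemma has_integral_minf_0I:
  assumes "\<And>T. T \<ge> 0 \<Longrightarrow> (\<lambda>t. h (- t)) integrable_on {0..T}"
    and "((\<lambda>T. integral {0..T} (\<lambda>t. h (- t))) \<longlongrightarrow> I) at_top"
  shows "has_integral_minf_0 h I"
  unfolding has_integral_minf_0_def
proof (intro conjI allI impI)
  show "h integrable_on {-T..0}" if "0 \<le> T" for T
    using Henstock_Kurzweil_Integration.integrable_reflect_real[where f = "\<lambda>t. h (- t)" and a = 0 and b = T] assms(1)[OF that] by simp
  have "integral {-T..0} h = integral {0..T} (\<lambda>t. h (- t))" for T
    using Henstock_Kurzweil_Integration.integral_reflect_real[where f = "\<lambda>t. h (- t)" and a = 0 and b = T] by simp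
  then show "((\<lambda>T. integral {-T..0} h) \<longlongrightarrow> I) at_top" using assms(2) by simp
qed

section \<open>The shadowing class of \<open>X\<close> and the three parts of the response\<close>

context hyperbolic_cover
begin

lemma J_pulled: "p \<in> K \<Longrightarrow> J p (pulled v p t) = B (- t) (f t p) (J (f t p) (v (f t p)))"
  using B_J[of "f t p" "-t" "v (f t p)"] f_iff by (simp add: pulled_def flow_minus)

lemma B_0: "B 0 p w = J p (L p w)"
  by (simp add: B_apply push_0 flow_0)

lemma holder_vector_field:
  assumes "smooth_vf A X" "distance_on K dd"
  shows "holder_on K dd (\<lambda>p. J p (X p))"
proof -
  interpret distance_on K dd by fact
  have "\<exists>\<Lambda>\<ge>0. \<forall>t\<in>{-1..1::real}. \<forall>p\<in>K. \<forall>q\<in>K. norm (J p (X p) - J q (X q)) \<le> \<Lambda> * dd p q"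
    by (rule lipschitz_global[OF lip_vector_field[OF assms(1)]])
  then obtain l where l: "\<forall>t\<in>{-1..1::real}. \<forall>p\<in>K. \<forall>q\<in>K. norm (J p (X p) - J q (X q)) \<le> l * dd p q" by (elim exE conjE)
  show ?thesis by (rule holder_on_lipschitz[of _ l]) (use l[rule_format, of 0] in simp)
qed

text \<open>The coordinate derivative along the orbit is the Lie derivative plus the derivative of
  \<open>F\<close>; the Christoffel term completes the latter to \<open>nabla_v F\<close>. Hence
  \<open>nabla_F v\<close> is the sum of \<open>Y\<close> and a Lipschitz operator applied to
  \<open>v\<close>, both Hoelder.\<close>

lemma shadow_carrierI:
  assumes dist: "distance_on K dd"
    and v: "holder_on K dd (\<lambda>p. J p (v p))" and Y: "holder_on K dd (\<lambda>p. J p (Y p))" and \<eta>: "holder_on K dd \<eta>"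
    and W: "\<And>p. p \<in> K \<Longrightarrow> (pulled v p has_vector_derivative Y p) (at 0)"
  shows "(v, \<eta>) \<in> shadow_carrier A g F f K" and "p \<in> K \<Longrightarrow> lie_deriv A f v p = Y p"
proof -
  interpret distance_on K dd by fact
  show "lie_deriv A f v p = Y p" if "p \<in> K" for p
    unfolding lie_deriv_pulled by (rule vector_derivative_at[OF W[OF that]])
  have oc: "(orbit_coord A f v p has_vector_derivative
     Y p + frechet_derivative (Fc (chart_at A p)) (at (cmap (chart_at A p) p)) (v p)) (at 0)" if "p \<in> K" for p
    by (rule orbit_coord_derivative[OF W[OF that]])
  have cov: "cov_deriv A g F f v p = Y p + nablaF p (v p)" if "p \<in> K" for p
    unfolding cov_deriv_def vector_derivative_at[OF oc[OF that]] nablaF_christoffel by simp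
  have "hoelder_vf A K (cov_deriv A g F f v)"
  proof (rule hoelder_vfI[OF dist])
    show "holder_on K dd (\<lambda>p. J p (cov_deriv A g F f v p))"
      by (rule holder_on_cong[OF holder_on_add[OF Y holder_nabla[OF v dist]]]) (simp add: cov blinfun.add_right)
  qed
  moreover have "orbit_coord A f v p differentiable (at 0)" if "p \<in> K" for p
    using oc[OF that] unfolding has_vector_derivative_def by (rule differentiableI)
  ultimately show "(v, \<eta>) \<in> shadow_carrier A g F f K"
    unfolding shadow_carrier_def using hoelder_vfI[OF dist v] hoelder_funI[OF dist \<eta>] by simp
qed

text \<open>The stable part forward in time and the unstable part backward in time converge
  exponentially, the center part by mixing. Forward in time hyperbolicity gives no decay of the
  unstable push-forward, so convergence of its response integral is deduced from the response
  formula by subtraction, which produces the limit \<open>\<delta> - I\<close>.\<close>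

lemma shadowing_contribution:
  assumes X: "smooth_vf A X" and \<Phi>: "smooth_fun A \<Phi>"
    and \<rho>: "sets \<rho> = sets borel" "prob_space \<rho>" "emeasure \<rho> K = 1" "\<And>t. distr \<rho> borel (f t) = \<rho>"
    and mix: "\<And>\<eta>. hoelder_fun A K \<eta> \<Longrightarrow>
      ((\<lambda>T. avg \<rho> K (\<lambda>p. \<eta> p * \<Phi> (f T p))) \<longlongrightarrow> avg \<rho> K \<eta> * avg \<rho> K \<Phi>) at_top"
    and response: "((\<lambda>T. avg \<rho> K (\<lambda>p. integral {0..T} (\<lambda>t. dderiv A p (X p) (\<Phi> \<circ> f t)))) \<longlongrightarrow> \<delta>) at_top"
    and SC: "SC = pairing \<rho> K (shadowing_op A g F f K X) (\<lambda>p v. dderiv A p v \<Phi>) (\<lambda>p. \<Phi> p - avg \<rho> K \<Phi>)"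
  shows "\<exists>I J. has_integral_0_inf (\<lambda>t. avg \<rho> K (\<lambda>p. dderiv A p (PS p (X p) + PC p (X p)) (\<Phi> \<circ> f t))) I \<and>
     has_integral_minf_0 (\<lambda>t. avg \<rho> K (\<lambda>p. dderiv A p (PU p (X p)) (\<Phi> \<circ> f t))) J \<and> SC = I - J \<and>
     has_integral_0_inf (\<lambda>t. avg \<rho> K (\<lambda>p. dderiv A p (PU p (X p)) (\<Phi> \<circ> f t))) (\<delta> - I)"
proof -
  obtain \<Lambda> C \<kappa> where hc: "hyperbolic_cocycle K dd f B (Q PS) (Q PU) (Q PC) Fh \<Lambda> C \<kappa>"
    using cocycle_exists by (elim exE)
  define \<omega> where "\<omega> = (\<lambda>p. Bl (\<lambda>u. dderiv A p u \<Phi>) o\<^sub>L L p)"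
  have \<omega>: "\<omega> p w = dderiv A p (L p w) \<Phi>" for p w
    unfolding \<omega>_def by (simp add: Bl_apply linear_dderiv[OF \<Phi>])
  have \<Phi>c: "continuous_on K \<Phi>"
  proof (rule continuous_at_imp_continuous_on, rule ballI)
    fix p assume "p \<in> K"
    let ?c = "chart_at A p"
    note c = chart_at_in[of p] in_chart_at[of p]
    have "smooth_on (crange ?c) (\<Phi> \<circ> cinv ?c)" using \<Phi> c unfolding smooth_fun_def by blast
    from locally_lipschitz_smooth_static[OF this open_crange[OF c(1)] c cmap_in[OF c], of 0]
    have "locally_lipschitz 0 p (\<lambda>t. \<Phi>)"
      by (rule locally_lipschitz_cong)
         (use eventually_snd_in[OF open_cdom[OF c(1)] c(2), of 0] in eventually_elim, auto simp: cinv_cmap c(1))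
    then show "isCont \<Phi> p" by (rule locally_lipschitz_static_continuous)
  qed
  interpret MC: measured_cocycle K dd f B "Q PS" "Q PU" "Q PC" Fh \<Lambda> C \<kappa> \<rho> \<omega> \<Phi>
  proof (intro measured_cocycle.intro hc invariant_measure.intro measured_cocycle_axioms.intro compact_K \<rho> f_iff continuous_on_flow_UNIV)
    show "continuous_on K \<omega>"
      unfolding \<omega>_def
      by (rule continuous_at_imp_continuous_on) (use locally_lipschitz_static_continuous[OF lip_dderiv[OF \<Phi>, of _ 0]] in blast)
    show "((\<lambda>t. \<Phi> (f t p)) has_real_derivative \<omega> (f t p) (Fh (f t p))) (at t)" if "p \<in> K" for p t
      using dderiv_along_flow[OF \<Phi>, of p t] that f_iff by (simp add: \<omega> Fh_def L_J)
  qed (simp_all add: \<Phi>c B_Fh Fh_nonzero)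
  note dist = MC.distance_on_axioms
  note bap = bounded_bilinear_blinfun_apply
  define x where "x = (\<lambda>p. J p (X p))"
  define xs xu xc where "xs = (\<lambda>p. Q PS p (x p))" and "xu = (\<lambda>p. Q PU p (x p))" and "xc = (\<lambda>p. Q PC p (x p))"
  have Hx: "holder_on K dd x" unfolding x_def by (rule holder_vector_field[OF X dist])
  have H: "holder_on K dd xs" "holder_on K dd xu" "holder_on K dd xc"
    unfolding xs_def xu_def xc_def
    by (rule MC.holder_on_bilinear[OF bap _ Hx], rule MC.holder_Qs MC.holder_Qu MC.holder_Qc)+
  have xP: "xs p = J p (PS p (X p))" "xu p = J p (PU p (X p))" "xc p = J p (PC p (X p))" if "p \<in> K" for p
    using that by (simp_all add: xs_def xu_def xc_def x_def Q_apply linear_P L_J)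
  obtain Mx where Mx: "Mx \<ge> 0" "\<And>p. p \<in> K \<Longrightarrow> norm (x p) \<le> Mx" using MC.holder_on_bounded[OF Hx] by metis
  have dec_s: "norm (B (1 * t) p (xs p)) \<le> (C * Mx) * exp (- \<kappa> * t)" if "p \<in> K" "0 \<le> t" for p t
  proof -
    have "norm ((B t p o\<^sub>L Q PS p) (x p)) \<le> (C * exp (- \<kappa> * t)) * Mx"
      using MC.Qs_decay[OF that] Mx(2)[OF that(1)] MC.C by (intro order_trans[OF norm_blinfun] mult_mono) auto
    then show ?thesis by (simp add: xs_def mult_ac)
  qed
  have dec_u: "norm (B (- 1 * t) p (xu p)) \<le> (C * Mx) * exp (- \<kappa> * t)" if "p \<in> K" "0 \<le> t" for p t
  proof -
    have "norm ((B (- t) p o\<^sub>L Q PU p) (x p)) \<le> (C * exp (- \<kappa> * t)) * Mx"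
      using MC.Qu_decay[OF that] Mx(2)[OF that(1)] MC.C by (intro order_trans[OF norm_blinfun] mult_mono) auto
    then show ?thesis by (simp add: xu_def mult_ac)
  qed
  define vs vu where "vs = MC.transport_integral 1 xs" and "vu = MC.transport_integral (- 1) xu"
  have s1: "(1::real) = 1 \<or> (1::real) = - 1" and s2: "(- 1::real) = 1 \<or> (- 1::real) = - 1" by auto
  have Hvs: "holder_on K dd vs" unfolding vs_def by (rule MC.holder_transport_integral[OF s1 H(1) dec_s])
  have Hvu: "holder_on K dd vu" unfolding vu_def by (rule MC.holder_transport_integral[OF s2 H(2) dec_u])
  have B0v: "B 0 p (vs p) = vs p" "B 0 p (vu p) = vu p" if "p \<in> K" for p
    unfolding vs_def vu_def
    by (rule MC.B_0_transport_integral[OF s1 H(1) dec_s that] MC.B_0_transport_integral[OF s2 H(2) dec_u that]; assumption)+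
  have dvs: "((\<lambda>t. B (- t) (f t p) (vs (f t p))) has_vector_derivative xs p) (at 0)"
    and dvu: "((\<lambda>t. B (- t) (f t p) (vu (f t p))) has_vector_derivative - xu p) (at 0)" if p: "p \<in> K" for p
  proof -
    have "B 0 p (xs p) = xs p" "B 0 p (xu p) = xu p" using p by (simp_all add: xP B_0 L_J)
    moreover have "((\<lambda>t. B (- t) (f t p) (vs (f t p))) has_vector_derivative 1 *\<^sub>R B 0 p (xs p)) (at 0)"
      unfolding vs_def by (rule MC.transport_integral_derivative[OF s1 H(1) dec_s p])
    moreover have "((\<lambda>t. B (- t) (f t p) (vu (f t p))) has_vector_derivative (- 1) *\<^sub>R B 0 p (xu p)) (at 0)"
      unfolding vu_def by (rule MC.transport_integral_derivative[OF s2 H(2) dec_u p])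
    ultimately show "((\<lambda>t. B (- t) (f t p) (vs (f t p))) has_vector_derivative xs p) (at 0)"
      "((\<lambda>t. B (- t) (f t p) (vu (f t p))) has_vector_derivative - xu p) (at 0)" by simp_all
  qed
  \<comment> \<open>\<open>vE\<close> lives in the Banach space; being fixed by
    \<open>B 0 p\<close>, it is the image of the tangent field \<open>v\<close>. The minus sign
    compensates the one that the Lie derivative of \<open>vu\<close> carries.\<close>
  define vE where "vE = (\<lambda>p. vs p - vu p)"
  define v where "v = (\<lambda>p. L p (vE p))"
  have HvE: "holder_on K dd vE" unfolding vE_def by (rule MC.holder_on_diff[OF Hvs Hvu])
  have B0vE: "B 0 p (vE p) = vE p" if "p \<in> K" for p using B0v[OF that] by (simp add: vE_def blinfun.diff_right)
  have Jv: "J p (v p) = vE p" if "p \<in> K" for p using B0vE[OF that] by (simp add: v_def B_0)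
  have dvE: "((\<lambda>t. B (- t) (f t p) (vE (f t p))) has_vector_derivative xs p + xu p) (at 0)" if p: "p \<in> K" for p
    using has_vector_derivative_diff[OF dvs[OF p] dvu[OF p]] by (simp add: vE_def blinfun.diff_right)
  \<comment> \<open>The center bundle is spanned by \<open>F\<close>. The coefficient is determined
    on \<open>K\<close> and arbitrary elsewhere.\<close>
  have "\<forall>p\<in>K. \<exists>k. PC p (X p) = k *\<^sub>R F p" using P_in(3) unfolding span_singleton by blast
  from bchoice[OF this] obtain \<eta> where \<eta>: "\<forall>p\<in>K. PC p (X p) = \<eta> p *\<^sub>R F p" by (rule exE)
  have xc\<eta>: "xc p = \<eta> p *\<^sub>R Fh p" if "p \<in> K" for p using \<eta> that by (simp add: xP Fh_def blinfun.scaleR_right)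
  have H\<eta>: "holder_on K dd \<eta>" by (rule MC.holder_coefficient[OF H(3) xc\<eta>])
  let ?Y = "\<lambda>p. PS p (X p) + PU p (X p)"
  have HvJ: "holder_on K dd (\<lambda>p. J p (v p))" by (rule MC.holder_on_cong[OF HvE]) (simp add: Jv)
  have HY: "holder_on K dd (\<lambda>p. J p (?Y p))"
    by (rule MC.holder_on_cong[OF MC.holder_on_add[OF H(1,2)]]) (simp add: xP blinfun.add_right)
  have pl: "(pulled v p has_vector_derivative ?Y p) (at 0)" if p: "p \<in> K" for p
  proof -
    have "pulled v p = (\<lambda>t. L p (B (- t) (f t p) (vE (f t p))))"
    proof
      show "pulled v p t = L p (B (- t) (f t p) (vE (f t p)))" for t
        using J_pulled[OF p, of v t] Jv[of "f t p"] L_J[OF p, of "pulled v p t"] p f_iff by simp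
    qed
    moreover have "L p (xs p + xu p) = ?Y p" using p by (simp add: xP L_J blinfun.add_right)
    ultimately show ?thesis
      using bounded_linear.has_vector_derivative[OF blinfun.bounded_linear_right dvE[OF p], of "L p"]
      by simp
  qed
  have carrier: "(v, \<eta>) \<in> shadow_carrier A g F f K" by (rule shadow_carrierI(1)[OF dist HvJ HY H\<eta> pl])
  have lie: "lie_deriv A f v p = ?Y p" if "p \<in> K" for p by (rule shadow_carrierI(2)[OF dist HvJ HY H\<eta> pl that])
  have eqX: "lie_deriv A f v p + \<eta> p *\<^sub>R F p = X p" if "p \<in> K" for p
    using \<eta> that P_sum[OF that, of "X p"] by (simp add: lie)
  let ?c = "avg \<rho> K \<Phi>"
  let ?\<psi> = "\<lambda>p. \<Phi> p - ?c"
  have vEc: "continuous_on K vE" and vsc: "continuous_on K vs" and vuc: "continuous_on K vu" and \<eta>c: "continuous_on K \<eta>"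
    using MC.holder_on_continuous HvE Hvs Hvu H\<eta> by blast+
  define r where "r = avg \<rho> K (\<lambda>p. \<omega> p (vE p)) - avg \<rho> K (\<lambda>p. \<eta> p * ?\<psi> p)"
  have cls: "shadowing_op A g F f K X =
    {(v', \<eta>') \<in> shadow_carrier A g F f K. \<forall>p\<in>K. lie_deriv A f v' p + \<eta>' p *\<^sub>R F p = X p}"
    by (rule shadowing_op_eq[OF carrier eqX])
  \<comment> \<open>The pairing has to be evaluated on every member of the class, while the
    half-line integrals are tied to the particular pair of \<open>v\<close> and \<eta>.\<close>
  have "SC = r"
    unfolding SC cls
  proof (rule pairing_eqI)
    show "{(v', \<eta>') \<in> shadow_carrier A g F f K. \<forall>p\<in>K. lie_deriv A f v' p + \<eta>' p *\<^sub>R F p = X p} \<noteq> {}"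
      using carrier eqX by blast
    fix v' \<eta>' assume "(v', \<eta>') \<in> {(v', \<eta>') \<in> shadow_carrier A g F f K. \<forall>p\<in>K. lie_deriv A f v' p + \<eta>' p *\<^sub>R F p = X p}"
    then have hv': "hoelder_vf A K v'" and oc: "\<And>p. p \<in> K \<Longrightarrow> orbit_coord A f v' p differentiable (at 0)"
      and h\<eta>': "hoelder_fun A K \<eta>'" and eq': "\<And>p. p \<in> K \<Longrightarrow> lie_deriv A f v' p + \<eta>' p *\<^sub>R F p = X p"
      unfolding shadow_carrier_def by auto
    have v'c: "continuous_on K (\<lambda>p. J p (v' p))" by (rule hoelder_vf_continuous[OF hv'])
    have \<eta>'c: "continuous_on K \<eta>'" by (rule hoelder_fun_continuous[OF h\<eta>'])
    \<comment> \<open>Both pairs solve the same equation, so the Lie derivative of \<open>w\<close>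
      is \<open>- \<zeta> F\<close>, which is the hypothesis of
      \<open>pairing_difference\<close>.\<close>
    define w \<zeta> where "w = (\<lambda>p. J p (v' p) - vE p)" and "\<zeta> = (\<lambda>p. \<eta>' p - \<eta> p)"
    have "avg \<rho> K (\<lambda>p. \<omega> p (w p)) = avg \<rho> K (\<lambda>p. \<zeta> p * ?\<psi> p)"
    proof (rule MC.pairing_difference)
      show "continuous_on K w" unfolding w_def by (intro continuous_intros v'c vEc)
      show "continuous_on K \<zeta>" unfolding \<zeta>_def by (intro continuous_intros \<eta>c \<eta>'c)
      fix p assume p: "p \<in> K"
      show "B 0 p (w p) = w p" using B0vE[OF p] p by (simp add: w_def blinfun.diff_right B_0 L_J)
      have "(pulled v' p has_vector_derivative lie_deriv A f v' p) (at 0)"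
        unfolding lie_deriv_pulled using pulled_differentiable[OF oc[OF p]] vector_derivative_works by blast
      from bounded_linear.has_vector_derivative[OF blinfun.bounded_linear_right this, of "J p"]
      have "((\<lambda>t. B (- t) (f t p) (J (f t p) (v' (f t p)))) has_vector_derivative J p (lie_deriv A f v' p)) (at 0)"
        unfolding J_pulled[OF p] .
      from has_vector_derivative_diff[OF this dvE[OF p]]
      have "((\<lambda>t. B (- t) (f t p) (w (f t p))) has_vector_derivative J p (lie_deriv A f v' p) - (xs p + xu p)) (at 0)"
        by (simp add: w_def blinfun.diff_right)
      moreover have "J p (lie_deriv A f v' p) - (xs p + xu p) = - \<zeta> p *\<^sub>R Fh p"
      proof -
        have "lie_deriv A f v' p = X p - \<eta>' p *\<^sub>R F p" using eq'[OF p] by (simp add: algebra_simps)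
        also have "X p = PS p (X p) + PU p (X p) + \<eta> p *\<^sub>R F p" using P_sum[OF p, of "X p"] \<eta> p by simp
        finally have lv': "lie_deriv A f v' p = PS p (X p) + PU p (X p) + \<eta> p *\<^sub>R F p - \<eta>' p *\<^sub>R F p" .
        show ?thesis unfolding lv' using p by (simp add: xP Fh_def \<zeta>_def blinfun.bilinear_simps algebra_simps)
      qed
      ultimately show "((\<lambda>t. B (- t) (f t p) (w (f t p))) has_vector_derivative - \<zeta> p *\<^sub>R Fh p) (at 0)" by simp
    qed
    moreover have "avg \<rho> K (\<lambda>p. \<omega> p (w p)) = avg \<rho> K (\<lambda>p. \<omega> p (J p (v' p))) - avg \<rho> K (\<lambda>p. \<omega> p (vE p))"
      unfolding w_def blinfun.diff_right by (rule MC.avg_diff) (intro MC.continuous_on_\<omega> continuous_intros v'c vEc; simp)+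
    moreover have "avg \<rho> K (\<lambda>p. \<zeta> p * ?\<psi> p) = avg \<rho> K (\<lambda>p. \<eta>' p * ?\<psi> p) - avg \<rho> K (\<lambda>p. \<eta> p * ?\<psi> p)"
      unfolding \<zeta>_def left_diff_distrib by (rule MC.avg_diff) (intro continuous_intros \<eta>'c \<eta>c \<Phi>c)+
    moreover have "avg \<rho> K (\<lambda>p. dderiv A p (v' p) \<Phi>) = avg \<rho> K (\<lambda>p. \<omega> p (J p (v' p)))"
      by (rule MC.avg_cong) (simp add: \<omega> L_J)
    ultimately show "avg \<rho> K (\<lambda>p. dderiv A p (v' p) \<Phi>) - avg \<rho> K (\<lambda>p. \<eta>' p * ?\<psi> p) = r"
      unfolding r_def by linarith
  qed
  define I where "I = avg \<rho> K (\<lambda>p. \<omega> p (vs p)) - avg \<rho> K (\<lambda>p. \<eta> p * ?\<psi> p)"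
  define Jv where "Jv = avg \<rho> K (\<lambda>p. \<omega> p (vu p))"
  have "avg \<rho> K (\<lambda>p. \<omega> p (vE p)) = avg \<rho> K (\<lambda>p. \<omega> p (vs p)) - avg \<rho> K (\<lambda>p. \<omega> p (vu p))"
    unfolding vE_def blinfun.diff_right by (rule MC.avg_diff) (intro MC.continuous_on_\<omega> continuous_intros vsc vuc; simp)+
  then have SCI: "SC = I - Jv" using \<open>SC = r\<close> by (simp add: r_def I_def Jv_def)
  have rate: "dderiv A p u (\<Phi> \<circ> f t) = \<omega> (f t p) (B t p (J p u))" if "p \<in> K" for p u t
    using that f_iff by (simp add: dderiv_flow[OF \<Phi>] \<omega> B_J L_J)
  let ?R = "\<lambda>y t. avg \<rho> K (MC.response_rate y t)"
  have xcon: "continuous_on K xs" "continuous_on K xu" "continuous_on K xc" "continuous_on K x"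
    using MC.holder_on_continuous H Hx by blast+
  have int: "?R y integrable_on {0..T}" if "continuous_on K y" for y T
    by (rule MC.avg_fubini(1)[OF MC.continuous_on_response_rate[OF that]])
  have Radd: "?R (\<lambda>p. y p + z p) t = ?R y t + ?R z t" if "continuous_on K y" "continuous_on K z" for y z t
  proof -
    have "MC.response_rate (\<lambda>p. y p + z p) t = (\<lambda>p. MC.response_rate y t p + MC.response_rate z t p)"
      by (simp add: MC.response_rate_def blinfun.add_right fun_eq_iff)
    then show ?thesis using MC.avg_add[OF MC.continuous_on_response_rate_K[OF that(1)] MC.continuous_on_response_rate_K[OF that(2)]] by simp
  qed
  have eq_sc: "avg \<rho> K (\<lambda>p. dderiv A p (PS p (X p) + PC p (X p)) (\<Phi> \<circ> f t)) = ?R xs t + ?R xc t" for t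
  proof -
    have "avg \<rho> K (\<lambda>p. dderiv A p (PS p (X p) + PC p (X p)) (\<Phi> \<circ> f t)) = ?R (\<lambda>p. xs p + xc p) t"
      by (rule MC.avg_cong) (simp add: rate MC.response_rate_def xP blinfun.add_right)
    then show ?thesis by (simp add: Radd xcon)
  qed
  have eq_u: "avg \<rho> K (\<lambda>p. dderiv A p (PU p (X p)) (\<Phi> \<circ> f t)) = ?R xu t" for t
    by (rule MC.avg_cong) (simp add: rate MC.response_rate_def xP)
  have lim_s: "((\<lambda>T. integral {0..T} (?R xs)) \<longlongrightarrow> avg \<rho> K (\<lambda>p. \<omega> p (vs p))) at_top"
    using MC.hyperbolic_response(2)[OF s1 H(1) dec_s] by (simp add: vs_def)
  have xc_R: "?R xc t = ?R (\<lambda>p. \<eta> p *\<^sub>R Fh p) t" for t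
    by (rule MC.avg_cong) (simp add: MC.response_rate_def xc\<eta>)
  have lim_c: "((\<lambda>T. integral {0..T} (?R xc)) \<longlongrightarrow> - avg \<rho> K (\<lambda>p. \<eta> p * ?\<psi> p)) at_top"
    using MC.center_response[OF \<eta>c mix[OF hoelder_funI[OF dist H\<eta>]]] by (simp add: xc_R)
  have sum_sc: "integral {0..T} (\<lambda>t. ?R xs t + ?R xc t) = integral {0..T} (?R xs) + integral {0..T} (?R xc)" for T
    by (rule Henstock_Kurzweil_Integration.integral_add[OF int[OF xcon(1)] int[OF xcon(3)]])
  have lim_sc: "((\<lambda>T. integral {0..T} (\<lambda>t. ?R xs t + ?R xc t)) \<longlongrightarrow> I) at_top"
    unfolding sum_sc using tendsto_add[OF lim_s lim_c] by (simp add: I_def)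
  have A1: "has_integral_0_inf (\<lambda>t. avg \<rho> K (\<lambda>p. dderiv A p (PS p (X p) + PC p (X p)) (\<Phi> \<circ> f t))) I"
    unfolding has_integral_0_inf_def eq_sc using lim_sc integrable_add[OF int[OF xcon(1)] int[OF xcon(3)]] by simp
  have A2: "has_integral_minf_0 (\<lambda>t. avg \<rho> K (\<lambda>p. dderiv A p (PU p (X p)) (\<Phi> \<circ> f t))) Jv"
    unfolding eq_u
  proof (rule has_integral_minf_0I)
    show "(\<lambda>t. ?R xu (- t)) integrable_on {0..T}" for T
      using MC.hyperbolic_response(1)[OF s2 H(2) dec_u, of T] by simp
    show "((\<lambda>T. integral {0..T} (\<lambda>t. ?R xu (- t))) \<longlongrightarrow> Jv) at_top"
      using MC.hyperbolic_response(2)[OF s2 H(2) dec_u] by (simp add: Jv_def vu_def)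
  qed
  have x_sum: "?R x t = (?R xs t + ?R xc t) + ?R xu t" for t
  proof -
    have "?R x t = ?R (\<lambda>p. (xs p + xc p) + xu p) t"
    proof (rule MC.avg_cong)
      fix p assume p: "p \<in> K"
      have "x p = J p (PS p (X p) + PU p (X p) + PC p (X p))" by (simp add: x_def P_sum[OF p])
      then have "x p = (xs p + xc p) + xu p" using p by (simp add: xP blinfun.add_right)
      then show "MC.response_rate x t p = MC.response_rate (\<lambda>p. (xs p + xc p) + xu p) t p"
        by (simp add: MC.response_rate_def)
    qed
    also have "\<dots> = (?R xs t + ?R xc t) + ?R xu t"
      using Radd[OF continuous_on_add[OF xcon(1,3)] xcon(2)] Radd[OF xcon(1,3)] by simp
    finally show ?thesis .
  qed
  have resp: "((\<lambda>T. integral {0..T} (?R x)) \<longlongrightarrow> \<delta>) at_top"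
  proof -
    have "avg \<rho> K (\<lambda>p. integral {0..T} (\<lambda>t. dderiv A p (X p) (\<Phi> \<circ> f t))) = integral {0..T} (?R x)" for T
    proof -
      have "avg \<rho> K (\<lambda>p. integral {0..T} (\<lambda>t. dderiv A p (X p) (\<Phi> \<circ> f t))) = avg \<rho> K (\<lambda>p. integral {0..T} (\<lambda>t. MC.response_rate x t p))"
        by (rule MC.avg_cong) (simp add: rate MC.response_rate_def x_def)
      then show ?thesis using MC.avg_fubini(2)[OF MC.continuous_on_response_rate[OF xcon(4)]] by simp
    qed
    then show ?thesis using response by simp
  qed
  \<comment> \<open>On each bounded interval the unstable part is the total response minus the
    stable and center parts, and both of these have limits.\<close>
  have "integral {0..T} (?R xu) = integral {0..T} (?R x) - integral {0..T} (\<lambda>t. ?R xs t + ?R xc t)" for T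
  proof -
    have "integral {0..T} (?R x) = integral {0..T} (\<lambda>t. (?R xs t + ?R xc t) + ?R xu t)" by (simp add: x_sum)
    also have "\<dots> = integral {0..T} (\<lambda>t. ?R xs t + ?R xc t) + integral {0..T} (?R xu)"
      by (rule Henstock_Kurzweil_Integration.integral_add[OF integrable_add[OF int[OF xcon(1)] int[OF xcon(3)]] int[OF xcon(2)]])
    finally show ?thesis by simp
  qed
  then have "((\<lambda>T. integral {0..T} (?R xu)) \<longlongrightarrow> \<delta> - I) at_top"
    using tendsto_diff[OF resp lim_sc] by simp
  then have A3: "has_integral_0_inf (\<lambda>t. avg \<rho> K (\<lambda>p. dderiv A p (PU p (X p)) (\<Phi> \<circ> f t))) (\<delta> - I)"
    unfolding has_integral_0_inf_def eq_u using int[OF xcon(2)] by simp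
  show ?thesis using A1 A2 A3 SCI by blast
qed

end

text \<open>Each point has a closed coordinate ball inside the range of its own chart; the open
  balls cover \<open>K\<close>, and compactness leaves finitely many of them.\<close>

lemma (in smooth_flow) chart_cover_exists:
  assumes K: "compact K" and inv: "\<And>t p. f t p \<in> K \<longleftrightarrow> p \<in> K"
  shows "\<exists>n ch ctr rad. chart_cover A F f K n ch ctr rad"
proof -
  have "\<forall>p. \<exists>r>0. cball (cmap (chart_at A p) p) r \<subseteq> crange (chart_at A p)"
    using open_crange[OF chart_at_in] cmap_in[OF chart_at_in in_chart_at] open_contains_cball by blast
  then obtain r where r: "\<And>p. r p > 0" "\<And>p. cball (cmap (chart_at A p) p) (r p) \<subseteq> crange (chart_at A p)" by metis
  define U where "U = (\<lambda>p. cdom (chart_at A p) \<inter> cmap (chart_at A p) -` ball (cmap (chart_at A p) p) (r p))"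
  have "open (U p)" for p unfolding U_def by (rule open_chart_preimage[OF chart_at_in open_ball])
  moreover have "p \<in> U p" for p unfolding U_def using r in_chart_at by simp
  ultimately have "\<exists>T\<subseteq>K. finite T \<and> K \<subseteq> (\<Union>p\<in>T. U p)"
  proof -
    assume U: "\<And>p. open (U p)" "\<And>p. p \<in> U p"
    have "K \<subseteq> (\<Union>p\<in>K. U p)" using U(2) by auto
    from compactE_image[OF K U(1) this] show ?thesis by metis
  qed
  then obtain T where T: "T \<subseteq> K" "finite T" "K \<subseteq> (\<Union>p\<in>T. U p)"
    by (elim exE conjE)
  obtain h where h: "bij_betw h {0..<card T} T" using ex_bij_betw_nat_finite[OF T(2)] by blast
  have "chart_cover A F f K (card T) (\<lambda>i. chart_at A (h i)) (\<lambda>i. cmap (chart_at A (h i)) (h i)) (\<lambda>i. r (h i))"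
  proof
    fix p assume "p \<in> K"
    then obtain q where q: "q \<in> T" "p \<in> U q" using T by blast
    then obtain i where "i < card T" "h i = q" using h unfolding bij_betw_def by (metis atLeastLessThan_iff imageE)
    then show "\<exists>i<card T. p \<in> cdom (chart_at A (h i)) \<and> norm (cmap (chart_at A (h i)) p - cmap (chart_at A (h i)) (h i)) < r (h i)"
      using q(2) by (intro exI[of _ i]) (simp add: U_def dist_norm norm_minus_commute)
  qed (use K inv r chart_at_in in auto)
  then show ?thesis by blast
qed

theorem theorem6:
  fixes A :: "('m::{t2_space, second_countable_topology}, 'e::euclidean_space) chart set"
    and g :: "'m \<Rightarrow> 'e \<Rightarrow> 'e \<Rightarrow> real"
    and F X Xs Xu Xc :: "'m \<Rightarrow> 'e"
    and f :: "real \<Rightarrow> 'm \<Rightarrow> 'm"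
    and K U :: "'m set"
    and Vs Vu :: "'m \<Rightarrow> 'e set"
    and \<rho> :: "'m measure"
    and \<Phi> divcu :: "'m \<Rightarrow> real"
    and \<delta>\<rho> SC UC :: real
  assumes manifold: "smooth_atlas A" "riemannian_metric A g"
    and fields: "smooth_vf A F" "smooth_vf A X"
    and flow: "flow_of A F f"
    and attr: "mixing_axiom_A_attractor A g F f K U Vs Vu"
    and phys: "physical_measure A f K U \<rho>"
    and obs: "smooth_fun A \<Phi>"
    and Xs: "Xs = (\<lambda>p. Ps F Vs Vu p (X p))"
    and Xu: "Xu = (\<lambda>p. Pu F Vs Vu p (X p))"
    and Xc: "Xc = (\<lambda>p. Pc F Vs Vu p (X p))"
    and divcu: "cu_divergence A g F f K Vu \<rho> (\<lambda>p. Xc p + Xu p) divcu"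
    and D1: "\<exists>I. has_integral_0_inf (\<lambda>t. avg \<rho> K (\<lambda>p. \<Phi> (f t p) * divcu p)) I"
    and D2: "\<And>\<eta>. hoelder_fun A K \<eta> \<Longrightarrow>
      ((\<lambda>T. avg \<rho> K (\<lambda>p. \<eta> p * \<Phi> (f T p))) \<longlongrightarrow> avg \<rho> K \<eta> * avg \<rho> K \<Phi>) at_top"
    and response: "response_derivative A F X f K \<rho> \<Phi> \<delta>\<rho>"
    and response_formula:
      "((\<lambda>T. avg \<rho> K (\<lambda>p. integral {0..T} (\<lambda>t. dderiv A p (X p) (\<Phi> \<circ> f t)))) \<longlongrightarrow> \<delta>\<rho>) at_top"
    and SC: "SC = pairing \<rho> K (shadowing_op A g F f K X)
                    (\<lambda>p v. dderiv A p v \<Phi>) (\<lambda>p. \<Phi> p - avg \<rho> K \<Phi>)"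
    and UC: "- UC = \<delta>\<rho> - SC"
  shows "(\<exists>I J. has_integral_0_inf (\<lambda>t. avg \<rho> K (\<lambda>p. dderiv A p (Xs p + Xc p) (\<Phi> \<circ> f t))) I \<and>
                has_integral_minf_0 (\<lambda>t. avg \<rho> K (\<lambda>p. dderiv A p (Xu p) (\<Phi> \<circ> f t))) J \<and>
                SC = I - J) \<and>
         has_integral_line (\<lambda>t. avg \<rho> K (\<lambda>p. dderiv A p (Xu p) (\<Phi> \<circ> f t))) (- UC)"
proof -
  interpret smooth_flow A F f using manifold fields flow by unfold_locales
  have at: "compact K" "\<And>t. f t ` K = K" and hyp: "hyperbolic_splitting A g F f K Vs Vu"
    using attr unfolding mixing_axiom_A_attractor_def attractor_def by auto
  have iff: "f t p \<in> K \<longleftrightarrow> p \<in> K" for t p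
  proof
    assume "f t p \<in> K"
    then have "f (- t) (f t p) \<in> f (- t) ` K" by (rule imageI)
    then show "p \<in> K" by (simp add: flow_minus at)
  next
    assume "p \<in> K"
    then show "f t p \<in> K" using at(2)[of t] by blast
  qed
  obtain n ch ctr rad where "chart_cover A F f K n ch ctr rad"
    using chart_cover_exists[OF at(1) iff] by (elim exE)
  then interpret chart_cover A F f K n ch ctr rad .
  interpret hyperbolic_cover A F f K n ch ctr rad g Vs Vu
    using manifold hyp by unfold_locales
  have \<rho>: "sets \<rho> = sets borel" "prob_space \<rho>" "emeasure \<rho> K = 1" "\<And>t. distr \<rho> borel (f t) = \<rho>"
    using phys unfolding physical_measure_def by auto
  have "\<exists>I J. has_integral_0_inf (\<lambda>t. avg \<rho> K (\<lambda>p. dderiv A p (Xs p + Xc p) (\<Phi> \<circ> f t))) I \<and>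
     has_integral_minf_0 (\<lambda>t. avg \<rho> K (\<lambda>p. dderiv A p (Xu p) (\<Phi> \<circ> f t))) J \<and> SC = I - J \<and>
     has_integral_0_inf (\<lambda>t. avg \<rho> K (\<lambda>p. dderiv A p (Xu p) (\<Phi> \<circ> f t))) (\<delta>\<rho> - I)"
    unfolding Xs Xu Xc by (rule shadowing_contribution[OF fields(2) obs \<rho> D2 response_formula SC])
  then   obtain I J where IJ: "has_integral_0_inf (\<lambda>t. avg \<rho> K (\<lambda>p. dderiv A p (Xs p + Xc p) (\<Phi> \<circ> f t))) I"
    "has_integral_minf_0 (\<lambda>t. avg \<rho> K (\<lambda>p. dderiv A p (Xu p) (\<Phi> \<circ> f t))) J" "SC = I - J"
    "has_integral_0_inf (\<lambda>t. avg \<rho> K (\<lambda>p. dderiv A p (Xu p) (\<Phi> \<circ> f t))) (\<delta>\<rho> - I)"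
    by (elim exE conjE)
  \<comment> \<open>The backward integral \<open>J\<close> and the forward integral
    \<open>\<delta>\<rho> - I\<close> add up to \<open>\<delta>\<rho> - SC\<close>, because
    \<open>SC = I - J\<close>.\<close>
  have "has_integral_line (\<lambda>t. avg \<rho> K (\<lambda>p. dderiv A p (Xu p) (\<Phi> \<circ> f t))) (- UC)"
    unfolding has_integral_line_def
    by (rule exI[of _ J], rule exI[of _ "\<delta>\<rho> - I"]) (use IJ UC in auto)
  then show ?thesis using IJ by blast
qed

end
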